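(* Let $J_t=\frac1T\int_0^tS_u\,du$, $t\in[0,T]$, and let $J^n$ be the trapezoidal discretization associated with $J$: $$J^n_t:=\frac{\delta}{T}\sum_{k=1}^{[t/\delta]}S_{t_{k-1}}\Big(1+\frac{r\delta}{2}+\sigma\frac{W_{t_k}-W_{t_{k-1}}}{2}\Big),$$ where $\delta=T/n$ and $t_k=k\delta$. Then, as $n\to\infty$, the processes $n(J-J^n)$ converge stably in law to $\chi$, where $\chi$ is the process defined by $$\chi_t=\frac{\sigma}{2\sqrt3}\int_0^tS_s\,dB'_s,$$ and $B'$ is a standard Brownian motion on an extension $\hat{\mathcal{B}}$ of $\mathcal{B}$, which is independent of $W$.
   Context: $T>0$, and $\sigma$, $r$ are real constants with $\sigma>0$. $(W_t)_{t\in[0,T]}$ is a standard Brownian motion on a stochastic basis $\mathcal{B}=(\Omega,\mathcal{F},(\mathcal{F}_t)_{t\ge0},P)$, where $(\mathcal{F}_t)$ is the standard Brownian filtration. $S$ is the process on $\mathcal{B}$ satisfying $dS_t/S_t=r\,dt+\sigma\,dW_t$, $t\in[0,T]$, with initial value $S_0$, that is, $S_t=S_0\exp\big((r-\sigma^2/2)t+\sigma W_t\big)$. $[\cdot]$ is the integer part. Stable convergence: random variables $X_n$ on $(\Omega,\mathcal{F},P)$ with values in a Polish space $E$ converge stably in law to an $E$-valued $X$ defined on an extension $(\hat\Omega,\hat{\mathcal{F}},\hat P)$ of $(\Omega,\mathcal{F},P)$ if $\mathbb{E}(U\,h(X_n))\to\hat{\mathbb{E}}(U\,h(X))$ for all bounded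 continuous $h:E\to\mathbb{R}$ and all bounded random variables $U$ on $(\Omega,\mathcal{F})$. For processes on $[0,T]$, $E=\mathbb{D}([0,T],\mathbb{R})$, the space of càdlàg functions.
   Formalization: The error n(J−J^n) is taken at the grid time [t/δ]δ instead of t: at t=T/2 and odd n the unsampled error has an extra term tending to S_t/2, so the literal claim fails for S_0≠0. The σ-field F is taken to be F_T, generated by W up to null sets. *)

theory Defs
  imports "HOL-Probability.Probability"
begin

section \<open>The Skorokhod space of cadlag functions on $[0,T]$\<close>

text \<open>Paths are total functions that take the value \<open>undefined\<close> outside $[0,T]$.\<close>

definition cadlag_paths :: "real \<Rightarrow> (real \<Rightarrow> real) set" where
  "cadlag_paths T = {x \<in> extensional {0..T}.
     (\<forall>t\<in>{0..<T}. (x \<longlongrightarrow> x t) (at_right t)) \<and>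
     (\<forall>t\<in>{0<..T}. \<exists>l. (x \<longlongrightarrow> l) (at_left t))}"

definition time_changes :: "real \<Rightarrow> (real \<Rightarrow> real) set" where
  "time_changes T = {\<tau>. strict_mono_on {0..T} \<tau> \<and> \<tau> ` {0..T} = {0..T}}"

definition skorokhod_close ::
    "real \<Rightarrow> real \<Rightarrow> (real \<Rightarrow> real) \<Rightarrow> (real \<Rightarrow> real) \<Rightarrow> bool" where
  "skorokhod_close T e x y \<longleftrightarrow>
     (\<exists>\<tau>\<in>time_changes T. \<forall>t\<in>{0..T}. \<bar>\<tau> t - t\<bar> \<le> e \<and> \<bar>x t - y (\<tau> t)\<bar> \<le> e)"

text \<open>This is the incomplete one of the two usual metrics for Skorokhod's $J_1$ topology; the
  complete one induces the same topology, and only the topology is used.\<close>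

definition skorokhod_dist :: "real \<Rightarrow> (real \<Rightarrow> real) \<Rightarrow> (real \<Rightarrow> real) \<Rightarrow> real" where
  "skorokhod_dist T x y =
     (if x \<in> cadlag_paths T \<and> y \<in> cadlag_paths T then Inf {e. skorokhod_close T e x y} else 0)"

definition skorokhod_topology :: "real \<Rightarrow> (real \<Rightarrow> real) topology" where
  "skorokhod_topology T = Metric_space.mtopology (cadlag_paths T) (skorokhod_dist T)"

lemma time_changes_image: "\<tau> \<in> time_changes T \<Longrightarrow> t \<in> {0..T} \<Longrightarrow> \<tau> t \<in> {0..T}"
  unfolding time_changes_def by blast

lemma time_changes_top:
  assumes "\<tau> \<in> time_changes T" "0 \<le> T"
  shows "\<tau> T = T"
proof -
  have "T \<in> \<tau> ` {0..T}" using assms by (auto simp: time_changes_def)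
  then obtain s where s: "s \<in> {0..T}" "\<tau> s = T" by auto
  have "\<tau> s \<le> \<tau> T"
    using assms s strict_mono_on_leD[of "{0..T}" \<tau> s T] by (auto simp: time_changes_def)
  moreover have "\<tau> T \<in> {0..T}" using time_changes_image assms by auto
  ultimately show ?thesis using s by auto
qed

lemma time_changes_comp:
  assumes "\<tau> \<in> time_changes T" "\<rho> \<in> time_changes T"
  shows "\<rho> \<circ> \<tau> \<in> time_changes T"
proof -
  have "strict_mono_on {0..T} (\<rho> \<circ> \<tau>)"
  proof (rule strict_mono_onI)
    fix r s assume rs: "r \<in> {0..T}" "s \<in> {0..T}" "r < s"
    then have "\<tau> r < \<tau> s"
      using assms(1) strict_mono_onD[of "{0..T}" \<tau> r s] by (auto simp: time_changes_def)
    moreover have "\<tau> r \<in> {0..T}" "\<tau> s \<in> {0..T}"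
      using time_changes_image assms(1) rs by blast+
    ultimately show "(\<rho> \<circ> \<tau>) r < (\<rho> \<circ> \<tau>) s"
      using assms(2) \<open>\<tau> r < \<tau> s\<close> strict_mono_onD[of "{0..T}" \<rho> "\<tau> r" "\<tau> s"]
      by (auto simp: time_changes_def)
  qed
  moreover have "(\<rho> \<circ> \<tau>) ` {0..T} = {0..T}"
    using assms unfolding time_changes_def by (simp only: mem_Collect_eq image_comp[symmetric])
  ultimately show ?thesis by (simp add: time_changes_def)
qed

lemma time_changes_inv:
  assumes "\<tau> \<in> time_changes T"
  shows "inv_into {0..T} \<tau> \<in> time_changes T"
proof -
  let ?i = "inv_into {0..T} \<tau>"
  have sm: "strict_mono_on {0..T} \<tau>" and im: "\<tau> ` {0..T} = {0..T}"
    using assms by (auto simp: time_changes_def)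
  have inj: "inj_on \<tau> {0..T}" using sm by (rule strict_mono_on_imp_inj_on)
  have "bij_betw ?i {0..T} {0..T}"
    using inj im by (intro bij_betw_inv_into) (simp add: bij_betw_def)
  moreover have "strict_mono_on {0..T} ?i"
  proof (rule strict_mono_onI, rule ccontr)
    fix r s assume rs: "r \<in> {0..T}" "s \<in> {0..T}" "r < s" and "\<not> ?i r < ?i s"
    then have le: "?i s \<le> ?i r" by simp
    have mem: "?i r \<in> {0..T}" "?i s \<in> {0..T}"
      using rs im inv_into_into[of _ \<tau> "{0..T}"] by metis+
    have "\<tau> (?i s) \<le> \<tau> (?i r)" using sm mem le by (simp add: strict_mono_on_leD)
    moreover have "\<tau> (?i s) = s" "\<tau> (?i r) = r"
      using rs im f_inv_into_f[of _ \<tau> "{0..T}"] by metis+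
    ultimately show False using rs by simp
  qed
  ultimately show ?thesis by (simp add: time_changes_def bij_betw_def)
qed

lemma cadlag_bounded:
  assumes x: "x \<in> cadlag_paths T" and T: "0 \<le> T"
  obtains C where "\<And>t. t \<in> {0..T} \<Longrightarrow> \<bar>x t\<bar> \<le> C"
proof -
  define P where "P a b \<longleftrightarrow> (\<exists>C. \<forall>u\<in>{a..b} \<inter> {0..T}. \<bar>x u\<bar> \<le> C)" for a b :: real
  have "P 0 T" using T
  proof (induction rule: Bolzano)
    case (trans a b c)
    then obtain C D where C: "\<forall>u\<in>{a..b} \<inter> {0..T}. \<bar>x u\<bar> \<le> C"
      and D: "\<forall>u\<in>{b..c} \<inter> {0..T}. \<bar>x u\<bar> \<le> D" by (auto simp: P_def)
    have "\<bar>x u\<bar> \<le> max C D" if "u \<in> {a..c} \<inter> {0..T}" for u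
      using C D that by (cases "u \<le> b") (auto simp: le_max_iff_disj)
    then show ?case unfolding P_def by blast
  next
    case (local t)
    have right: "\<exists>d>0. \<exists>C. \<forall>u. t < u \<and> u < t + d \<and> u \<le> T \<longrightarrow> \<bar>x u\<bar> \<le> C"
    proof (cases "t < T")
      case True
      then have "(x \<longlongrightarrow> x t) (at_right t)" using x local by (auto simp: cadlag_paths_def)
      then have "\<forall>\<^sub>F u in at_right t. dist (x u) (x t) < 1" by (rule tendstoD) simp
      then obtain b where b: "b > t" "\<And>u. u > t \<Longrightarrow> u < b \<Longrightarrow> dist (x u) (x t) < 1"
        by (auto simp: eventually_at_right_field)
      show ?thesis
      proof (intro exI conjI allI impI)
        show "b - t > 0" using b by simp
        show "\<bar>x u\<bar> \<le> \<bar>x t\<bar> + 1" if "t < u \<and> u < t + (b - t) \<and> u \<le> T" for u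
          using b(2)[of u] that by (auto simp: dist_real_def)
      qed
    qed (use local in \<open>auto intro!: exI[of _ 1]\<close>)
    have left: "\<exists>d>0. \<exists>C. \<forall>u. t - d < u \<and> u < t \<and> 0 \<le> u \<longrightarrow> \<bar>x u\<bar> \<le> C"
    proof (cases "0 < t")
      case True
      then have "t \<in> {0<..T}" using local by auto
      then obtain l where "(x \<longlongrightarrow> l) (at_left t)" using x unfolding cadlag_paths_def by blast
      then have "\<forall>\<^sub>F u in at_left t. dist (x u) l < 1" by (rule tendstoD) simp
      then obtain b where b: "b < t" "\<And>u. u > b \<Longrightarrow> u < t \<Longrightarrow> dist (x u) l < 1"
        by (auto simp: eventually_at_left_field)
      show ?thesis
      proof (intro exI conjI allI impI)
        show "t - b > 0" using b by simp
        show "\<bar>x u\<bar> \<le> \<bar>l\<bar> + 1" if "t - (t - b) < u \<and> u < t \<and> 0 \<le> u" for u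
          using b(2)[of u] that by (auto simp: dist_real_def)
      qed
    qed (use local in \<open>auto intro!: exI[of _ 1]\<close>)
    from right obtain d C where d: "d > 0"
      and C: "\<And>u. t < u \<Longrightarrow> u < t + d \<Longrightarrow> u \<le> T \<Longrightarrow> \<bar>x u\<bar> \<le> C" by blast
    from left obtain d' C' where d': "d' > 0"
      and C': "\<And>u. t - d' < u \<Longrightarrow> u < t \<Longrightarrow> 0 \<le> u \<Longrightarrow> \<bar>x u\<bar> \<le> C'" by blast
    show ?case
    proof (intro exI conjI allI impI)
      show "min d d' > 0" using d d' by simp
      fix a b assume ab: "a \<le> t \<and> t \<le> b \<and> b - a < min d d'"
      have "\<bar>x u\<bar> \<le> max \<bar>x t\<bar> (max C C')" if u: "u \<in> {a..b} \<inter> {0..T}" for u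
      proof -
        consider "u = t" | "t < u" | "u < t" by linarith
        then show ?thesis
        proof cases
          case 2
          then have "\<bar>x u\<bar> \<le> C" using ab u by (intro C) auto
          then show ?thesis by simp
        next
          case 3
          then have "\<bar>x u\<bar> \<le> C'" using ab u by (intro C') auto
          then show ?thesis by simp
        qed simp
      qed
      then show "P a b" unfolding P_def by blast
    qed
  qed
  then obtain C where "\<forall>u\<in>{0..T}. \<bar>x u\<bar> \<le> C" by (auto simp: P_def)
  then show ?thesis using that by blast
qed

lemma skorokhod_close_nonneg: "skorokhod_close T e x y \<Longrightarrow> 0 \<le> T \<Longrightarrow> 0 \<le> e"
  unfolding skorokhod_close_def by (meson abs_ge_zero atLeastAtMost_iff order_refl order_trans)

lemma skorokhod_close_sym:
  assumes "skorokhod_close T e x y"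
  shows "skorokhod_close T e y x"
proof -
  from assms obtain \<tau> where \<tau>: "\<tau> \<in> time_changes T"
    and c: "\<And>t. t \<in> {0..T} \<Longrightarrow> \<bar>\<tau> t - t\<bar> \<le> e \<and> \<bar>x t - y (\<tau> t)\<bar> \<le> e"
    by (auto simp: skorokhod_close_def)
  let ?i = "inv_into {0..T} \<tau>"
  have "\<bar>?i t - t\<bar> \<le> e \<and> \<bar>y t - x (?i t)\<bar> \<le> e" if t: "t \<in> {0..T}" for t
  proof -
    have "t \<in> \<tau> ` {0..T}" using \<tau> t by (simp add: time_changes_def)
    then have "\<tau> (?i t) = t" "?i t \<in> {0..T}" by (rule f_inv_into_f, rule inv_into_into)
    then show ?thesis using c[of "?i t"] by (simp add: abs_minus_commute)
  qed
  then show ?thesis using time_changes_inv[OF \<tau>] unfolding skorokhod_close_def by blast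
qed

lemma skorokhod_close_trans:
  assumes "skorokhod_close T e x y" "skorokhod_close T e' y z"
  shows "skorokhod_close T (e + e') x z"
proof -
  from assms(1) obtain \<tau> where \<tau>: "\<tau> \<in> time_changes T"
    and c: "\<And>t. t \<in> {0..T} \<Longrightarrow> \<bar>\<tau> t - t\<bar> \<le> e \<and> \<bar>x t - y (\<tau> t)\<bar> \<le> e"
    by (auto simp: skorokhod_close_def)
  from assms(2) obtain \<rho> where \<rho>: "\<rho> \<in> time_changes T"
    and c': "\<And>t. t \<in> {0..T} \<Longrightarrow> \<bar>\<rho> t - t\<bar> \<le> e' \<and> \<bar>y t - z (\<rho> t)\<bar> \<le> e'"
    by (auto simp: skorokhod_close_def)
  have "\<bar>(\<rho> \<circ> \<tau>) t - t\<bar> \<le> e + e' \<and> \<bar>x t - z ((\<rho> \<circ> \<tau>) t)\<bar> \<le> e + e'"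
    if t: "t \<in> {0..T}" for t
    using c[OF t] c'[OF time_changes_image[OF \<tau> t]] by auto
  then show ?thesis using time_changes_comp[OF \<tau> \<rho>] unfolding skorokhod_close_def by blast
qed

lemma skorokhod_close_ex:
  assumes "x \<in> cadlag_paths T" "y \<in> cadlag_paths T" "0 \<le> T"
  shows "\<exists>e. skorokhod_close T e x y"
proof -
  obtain C where C: "\<And>t. t \<in> {0..T} \<Longrightarrow> \<bar>x t\<bar> \<le> C" using cadlag_bounded assms by metis
  obtain D where D: "\<And>t. t \<in> {0..T} \<Longrightarrow> \<bar>y t\<bar> \<le> D" using cadlag_bounded assms by metis
  have id: "(\<lambda>t. t) \<in> time_changes T" by (simp add: time_changes_def strict_mono_on_def)
  have "\<bar>t - t\<bar> \<le> C + D \<and> \<bar>x t - y t\<bar> \<le> C + D" if "t \<in> {0..T}" for t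
    using C[OF that] D[OF that] by auto
  then have "skorokhod_close T (C + D) x y"
    unfolding skorokhod_close_def using id by (intro bexI[of _ "\<lambda>t. t"]) auto
  then show ?thesis by blast
qed

lemma skorokhod_close_all_imp_eq:
  assumes x: "x \<in> cadlag_paths T" and y: "y \<in> cadlag_paths T" and T: "0 \<le> T"
    and close: "\<And>e. e > 0 \<Longrightarrow> skorokhod_close T e x y"
  shows "x = y"
proof -
  have eq: "x t = y t" if t: "t \<in> {0..T}" for t
  proof (cases "t = T")
    case True
    have "\<bar>x T - y T\<bar> \<le> e" if e: "e > 0" for e
    proof -
      obtain \<tau> where \<tau>: "\<tau> \<in> time_changes T" "\<forall>t\<in>{0..T}. \<bar>x t - y (\<tau> t)\<bar> \<le> e"
        using close[OF e] unfolding skorokhod_close_def by blast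
      then show ?thesis using T time_changes_top[OF \<tau>(1) T] by (auto dest: bspec[of _ _ T])
    qed
    then show ?thesis using True dense_ge[of 0 "\<bar>x T - y T\<bar>"] by simp
  next
    case False
    then have tT: "t < T" "t \<in> {0..<T}" using t by auto
    have "\<bar>x t - y t\<bar> \<le> e" if e: "e > 0" for e
    proof -
      have "(x \<longlongrightarrow> x t) (at_right t)" "(y \<longlongrightarrow> y t) (at_right t)"
        using x y tT by (auto simp: cadlag_paths_def)
      then have "\<forall>\<^sub>F u in at_right t. dist (x u) (x t) < e / 3"
        "\<forall>\<^sub>F u in at_right t. dist (y u) (y t) < e / 3"
        using tendstoD[of x "x t" "at_right t" "e / 3"] tendstoD[of y "y t" "at_right t" "e / 3"] e
        by fastforce+
      then have "\<forall>\<^sub>F u in at_right t. dist (x u) (x t) < e / 3 \<and> dist (y u) (y t) < e / 3"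
        by (rule eventually_conj)
      then obtain b where b: "b > t"
        and bx: "\<And>u. u > t \<Longrightarrow> u < b \<Longrightarrow> dist (x u) (x t) < e / 3"
        and by': "\<And>u. u > t \<Longrightarrow> u < b \<Longrightarrow> dist (y u) (y t) < e / 3"
        by (auto simp: eventually_at_right_field)
      define c where "c = min b T"
      have c: "t < c" "c \<le> b" "c \<le> T" using b tT by (auto simp: c_def)
      define u where "u = (t + c) / 2"
      define \<epsilon> where "\<epsilon> = min (e / 3) ((c - t) / 4)"
      have "\<epsilon> > 0" using e c by (simp add: \<epsilon>_def)
      moreover have "\<epsilon> \<le> e / 3" "\<epsilon> \<le> (c - t) / 4"
        unfolding \<epsilon>_def by (rule min.cobounded1, rule min.cobounded2)
      ultimately have \<epsilon>: "\<epsilon> > 0" "\<epsilon> \<le> e / 3" "\<epsilon> \<le> (c - t) / 4" .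
      have u: "t < u" "u < b" "u \<in> {0..T}" using c t by (auto simp: u_def field_simps)
      from close[OF \<epsilon>(1)] obtain \<tau>
        where "\<bar>\<tau> u - u\<bar> \<le> \<epsilon>" "\<bar>x u - y (\<tau> u)\<bar> \<le> \<epsilon>"
        using u unfolding skorokhod_close_def by blast
      moreover from this have "t < \<tau> u" "\<tau> u < b"
        using \<epsilon> c by (auto simp: u_def field_simps abs_le_iff)
      ultimately show ?thesis
        using bx[OF u(1,2)] by'[of "\<tau> u"] \<epsilon> unfolding dist_real_def by linarith
    qed
    then show ?thesis using dense_ge[of 0 "\<bar>x t - y t\<bar>"] by simp
  qed
  show ?thesis
  proof
    fix t
    show "x t = y t"
      using eq x y by (cases "t \<in> {0..T}") (auto simp: cadlag_paths_def extensional_def)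
  qed
qed

lemma Metric_space_skorokhod:
  assumes T: "0 \<le> T"
  shows "Metric_space (cadlag_paths T) (skorokhod_dist T)"
proof
  have bdd: "bdd_below {e. skorokhod_close T e x y}" for x y
    using skorokhod_close_nonneg T by (intro bdd_belowI[of _ 0]) auto
  have le: "skorokhod_dist T x y \<le> e"
    if "x \<in> cadlag_paths T" "y \<in> cadlag_paths T" "skorokhod_close T e x y" for x y e
    using that bdd by (auto simp: skorokhod_dist_def intro!: cInf_lower)
  have less: "\<exists>e'<e. skorokhod_close T e' x y"
    if "x \<in> cadlag_paths T" "y \<in> cadlag_paths T" "skorokhod_dist T x y < e" for x y e
    using that skorokhod_close_ex[OF that(1,2) T] bdd
    by (auto simp: skorokhod_dist_def cInf_less_iff)
  show nonneg: "0 \<le> skorokhod_dist T x y" for x y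
    using skorokhod_close_ex[of x T y] skorokhod_close_nonneg T
    by (auto simp: skorokhod_dist_def intro!: cInf_greatest)
  show "skorokhod_dist T x y = skorokhod_dist T y x" for x y
    using skorokhod_close_sym[of T _ x y] skorokhod_close_sym[of T _ y x]
    by (auto simp: skorokhod_dist_def intro!: arg_cong[where f=Inf])
  show "skorokhod_dist T x y = 0 \<longleftrightarrow> x = y"
    if xy: "x \<in> cadlag_paths T" "y \<in> cadlag_paths T" for x y
  proof
    assume 0: "skorokhod_dist T x y = 0"
    show "x = y"
    proof (rule skorokhod_close_all_imp_eq[OF xy T])
      fix e :: real assume "e > 0"
      then obtain e' where "e' < e" "skorokhod_close T e' x y" using less[OF xy] 0 by auto
      then show "skorokhod_close T e x y"
        unfolding skorokhod_close_def by (meson less_imp_le order_trans)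
    qed
  next
    assume "x = y"
    moreover have "skorokhod_close T 0 y y"
      unfolding skorokhod_close_def
      by (rule bexI[of _ "\<lambda>t. t"]) (auto simp: time_changes_def strict_mono_on_def)
    ultimately show "skorokhod_dist T x y = 0" using le[OF xy] nonneg[of x y] by force
  qed
  show "skorokhod_dist T x z \<le> skorokhod_dist T x y + skorokhod_dist T y z"
    if xyz: "x \<in> cadlag_paths T" "y \<in> cadlag_paths T" "z \<in> cadlag_paths T" for x y z
  proof (rule field_le_epsilon)
    fix e :: real assume "e > 0"
    then obtain a b where "a < skorokhod_dist T x y + e / 2" "skorokhod_close T a x y"
      and "b < skorokhod_dist T y z + e / 2" "skorokhod_close T b y z"
      using less[OF xyz(1,2), of "skorokhod_dist T x y + e / 2"]
        less[OF xyz(2,3), of "skorokhod_dist T y z + e / 2"] by auto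
    then show "skorokhod_dist T x z \<le> skorokhod_dist T x y + skorokhod_dist T y z + e"
      using le[OF xyz(1,3) skorokhod_close_trans[of T a x y b z]] by simp
  qed
qed


section \<open>Stochastic bases, extensions and stable convergence\<close>

definition stochastic_basis :: "'a measure \<Rightarrow> (real \<Rightarrow> 'a measure) \<Rightarrow> bool" where
  "stochastic_basis M F \<longleftrightarrow>
     prob_space M \<and> filtration (space M) F \<and> (\<forall>t. subalgebra M (F t))"

text \<open>Objects on the original basis are carried to the extension by composition with
  \<open>\<pi>\<close>. For the usual extensions, $N$ lives on a product and \<open>\<pi>\<close> is the first projection.\<close>

definition basis_extension :: "'a measure \<Rightarrow> (real \<Rightarrow> 'a measure) \<Rightarrow>
    'b measure \<Rightarrow> (real \<Rightarrow> 'b measure) \<Rightarrow> ('b \<Rightarrow> 'a) \<Rightarrow> bool" where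
  "basis_extension M F N G \<pi> \<longleftrightarrow>
     stochastic_basis M F \<and> stochastic_basis N G \<and>
     \<pi> \<in> measurable N M \<and> distr N M \<pi> = M \<and>
     (\<forall>t\<ge>0. \<pi> \<in> measurable (G t) (F t))"

definition borel_of_topology :: "'e topology \<Rightarrow> 'e measure" where
  "borel_of_topology E = sigma (topspace E) {V. openin E V}"

text \<open>Stable convergence in law of $X_n$, defined on $M$, to $Y$, defined on the extension $N$.\<close>

definition converges_stably :: "'a measure \<Rightarrow> 'b measure \<Rightarrow> ('b \<Rightarrow> 'a) \<Rightarrow> 'e topology \<Rightarrow>
    (nat \<Rightarrow> 'a \<Rightarrow> 'e) \<Rightarrow> ('b \<Rightarrow> 'e) \<Rightarrow> bool" where
  "converges_stably M N \<pi> E X Y \<longleftrightarrow>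
     (\<forall>n. X n \<in> measurable M (borel_of_topology E)) \<and>
     Y \<in> measurable N (borel_of_topology E) \<and>
     (\<forall>h U. continuous_map E euclideanreal h \<and> bounded (h ` topspace E) \<and>
            U \<in> borel_measurable M \<and> bounded (U ` space M) \<longrightarrow>
        (\<lambda>n. \<integral>\<omega>. U \<omega> * h (X n \<omega>) \<partial>M)
          \<longlonglongrightarrow> (\<integral>\<omega>. U (\<pi> \<omega>) * h (Y \<omega>) \<partial>N))"


section \<open>Brownian motion and the stochastic integral\<close>

definition brownian_motion ::
    "'a measure \<Rightarrow> (real \<Rightarrow> 'a measure) \<Rightarrow> real \<Rightarrow> (real \<Rightarrow> 'a \<Rightarrow> real) \<Rightarrow> bool" where
  "brownian_motion M F T B \<longleftrightarrow>
     stochastic_basis M F \<and>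
     (AE \<omega> in M. B 0 \<omega> = 0) \<and>
     (\<forall>\<omega>\<in>space M. continuous_on {0..T} (\<lambda>t. B t \<omega>)) \<and>
     (\<forall>t\<in>{0..T}. B t \<in> borel_measurable (F t)) \<and>
     (\<forall>s t. 0 \<le> s \<and> s < t \<and> t \<le> T \<longrightarrow>
        distributed M lborel (\<lambda>\<omega>. B t \<omega> - B s \<omega>) (normal_density 0 (sqrt (t - s))) \<and>
        prob_space.indep_set M (sets (F s))
          (sets (vimage_algebra (space M) (\<lambda>\<omega>. B t \<omega> - B s \<omega>) borel)))"

text \<open>The filtration generated by \<open>W\<close>, augmented by the null sets.\<close>

definition brownian_filtration ::
    "'a measure \<Rightarrow> real \<Rightarrow> (real \<Rightarrow> 'a \<Rightarrow> real) \<Rightarrow> real \<Rightarrow> 'a measure" where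
  "brownian_filtration M T W t = sigma (space M)
     ({W s -` A \<inter> space M | s A. 0 \<le> s \<and> s \<le> t \<and> s \<le> T \<and> A \<in> sets borel} \<union> null_sets M)"

definition independent_processes ::
    "'a measure \<Rightarrow> real \<Rightarrow> (real \<Rightarrow> 'a \<Rightarrow> real) \<Rightarrow> (real \<Rightarrow> 'a \<Rightarrow> real) \<Rightarrow> bool" where
  "independent_processes M T X Y \<longleftrightarrow>
     prob_space.indep_var M
       (\<Pi>\<^sub>M t\<in>{0..T}. borel) (\<lambda>\<omega>. \<lambda>t\<in>{0..T}. X t \<omega>)
       (\<Pi>\<^sub>M t\<in>{0..T}. borel) (\<lambda>\<omega>. \<lambda>t\<in>{0..T}. Y t \<omega>)"

text \<open>The data $(k, s, \xi)$ stand for the simple process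
  $\sum_{i<k} \xi_i 1_{(s_i, s_{i+1}]}$.\<close>

definition simple_process ::
    "'a measure \<Rightarrow> (real \<Rightarrow> 'a measure) \<Rightarrow> real \<Rightarrow> nat \<Rightarrow> (nat \<Rightarrow> real) \<Rightarrow> (nat \<Rightarrow> 'a \<Rightarrow> real) \<Rightarrow> bool" where
  "simple_process M F T k s \<xi> \<longleftrightarrow>
     s 0 = 0 \<and> s k = T \<and> (\<forall>i<k. s i \<le> s (Suc i)) \<and>
     (\<forall>i<k. \<xi> i \<in> borel_measurable (F (s i)) \<and> bounded (\<xi> i ` space M))"

definition simple_value ::
    "nat \<Rightarrow> (nat \<Rightarrow> real) \<Rightarrow> (nat \<Rightarrow> 'a \<Rightarrow> real) \<Rightarrow> real \<Rightarrow> 'a \<Rightarrow> real" where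
  "simple_value k s \<xi> t \<omega> = (\<Sum>i<k. \<xi> i \<omega> * indicator {s i<..s (Suc i)} t)"

definition simple_integral :: "(real \<Rightarrow> 'a \<Rightarrow> real) \<Rightarrow>
    nat \<Rightarrow> (nat \<Rightarrow> real) \<Rightarrow> (nat \<Rightarrow> 'a \<Rightarrow> real) \<Rightarrow> real \<Rightarrow> 'a \<Rightarrow> real" where
  "simple_integral B k s \<xi> t \<omega> =
     (\<Sum>i<k. \<xi> i \<omega> * (B (min (s (Suc i)) t) \<omega> - B (min (s i) t) \<omega>))"

text \<open>\<open>ito_integral M F T B H I\<close> says that $I$ is a continuous version of the Ito integral
  process $I_t = \int_0^t H_s\,dB_s$, $t \in [0,T]$, for an adapted integrand with
  $E\int_0^T H_s^2\,ds < \infty$: the $L^2$ limit of the integrals of simple processes that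
  approximate $H$ in $L^2(dt \otimes P)$. It determines $I$ up to indistinguishability.\<close>

definition ito_integral :: "'a measure \<Rightarrow> (real \<Rightarrow> 'a measure) \<Rightarrow> real \<Rightarrow>
    (real \<Rightarrow> 'a \<Rightarrow> real) \<Rightarrow> (real \<Rightarrow> 'a \<Rightarrow> real) \<Rightarrow> (real \<Rightarrow> 'a \<Rightarrow> real) \<Rightarrow> bool" where
  "ito_integral M F T B H I \<longleftrightarrow>
     (\<lambda>(t, \<omega>). H t \<omega>) \<in> borel_measurable (restrict_space lborel {0..T} \<Otimes>\<^sub>M M) \<and>
     (\<forall>t\<in>{0..T}. H t \<in> borel_measurable (F t)) \<and>
     (\<integral>\<^sup>+\<omega>. (\<integral>\<^sup>+t\<in>{0..T}. ennreal ((H t \<omega>)\<^sup>2) \<partial>lborel) \<partial>M) < \<infinity> \<and>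
     (\<forall>t\<in>{0..T}. I t \<in> borel_measurable M) \<and>
     (\<forall>\<omega>\<in>space M. continuous_on {0..T} (\<lambda>t. I t \<omega>)) \<and>
     (\<exists>k s \<xi>. (\<forall>m. simple_process M F T (k m) (s m) (\<xi> m)) \<and>
        (\<lambda>m. \<integral>\<^sup>+\<omega>. (\<integral>\<^sup>+t\<in>{0..T}.
            ennreal ((H t \<omega> - simple_value (k m) (s m) (\<xi> m) t \<omega>)\<^sup>2) \<partial>lborel) \<partial>M)
          \<longlonglongrightarrow> 0 \<and>
        (\<forall>t\<in>{0..T}.
          (\<lambda>m. \<integral>\<^sup>+\<omega>. ennreal ((I t \<omega> - simple_integral B (k m) (s m) (\<xi> m) t \<omega>)\<^sup>2) \<partial>M)
            \<longlonglongrightarrow> 0))"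


section \<open>The time average of the stock price and its trapezoidal discretization\<close>

definition stock :: "real \<Rightarrow> real \<Rightarrow> real \<Rightarrow> (real \<Rightarrow> 'a \<Rightarrow> real) \<Rightarrow> real \<Rightarrow> 'a \<Rightarrow> real" where
  "stock S0 r \<sigma> W t \<omega> = S0 * exp ((r - \<sigma>\<^sup>2 / 2) * t + \<sigma> * W t \<omega>)"

definition average :: "real \<Rightarrow> (real \<Rightarrow> 'a \<Rightarrow> real) \<Rightarrow> real \<Rightarrow> 'a \<Rightarrow> real" where
  "average T S t \<omega> = 1 / T * (LBINT u:{0..t}. S u \<omega>)"

definition trapezoidal_average :: "real \<Rightarrow> real \<Rightarrow> real \<Rightarrow> (real \<Rightarrow> 'a \<Rightarrow> real) \<Rightarrow>
    (real \<Rightarrow> 'a \<Rightarrow> real) \<Rightarrow> nat \<Rightarrow> real \<Rightarrow> 'a \<Rightarrow> real" where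
  "trapezoidal_average T r \<sigma> W S n t \<omega> =
     (let \<delta> = T / n; tt = (\<lambda>k. real k * \<delta>) in
        \<delta> / T * (\<Sum>k = 1..nat \<lfloor>t / \<delta>\<rfloor>. S (tt (k - 1)) \<omega> *
          (1 + r * \<delta> / 2 + \<sigma> * ((W (tt k) \<omega> - W (tt (k - 1)) \<omega>) / 2))))"

text \<open>The process $t \mapsto X_{[t/\delta]\delta}$ with $\delta = T/n$. The discretization error
  $n (J - J^n)$ has to be observed on the grid in this way: $J^n$ is constant between grid points,
  and $J$ is not, so that at $t = T/2$ and odd $n$ the unsampled $n (J_t - J^n_t)$ contains the
  additional term $\delta^{-1} \int_{[t/\delta]\delta}^t S_u\,du$, which tends to $S_t / 2$.
  At grid points, in particular at $T$, nothing changes.\<close>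

definition grid_sampled :: "real \<Rightarrow> nat \<Rightarrow> (real \<Rightarrow> 'a \<Rightarrow> real) \<Rightarrow> real \<Rightarrow> 'a \<Rightarrow> real" where
  "grid_sampled T n X t \<omega> = (let \<delta> = T / n in X (of_int \<lfloor>t / \<delta>\<rfloor> * \<delta>) \<omega>)"

text \<open>$(N, G, \pi)$ is an extension of the basis of \<open>W\<close>, carrying a Brownian motion $B$
  independent of \<open>W\<close>, and $I = \int S\,dB$.\<close>

definition limit_data :: "'a measure \<Rightarrow> real \<Rightarrow> (real \<Rightarrow> 'a \<Rightarrow> real) \<Rightarrow> (real \<Rightarrow> 'a \<Rightarrow> real) \<Rightarrow>
    'b measure \<Rightarrow> (real \<Rightarrow> 'b measure) \<Rightarrow> ('b \<Rightarrow> 'a) \<Rightarrow>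
    (real \<Rightarrow> 'b \<Rightarrow> real) \<Rightarrow> (real \<Rightarrow> 'b \<Rightarrow> real) \<Rightarrow> bool" where
  "limit_data M T W S N G \<pi> B I \<longleftrightarrow>
     basis_extension M (brownian_filtration M T W) N G \<pi> \<and>
     brownian_motion N G T B \<and>
     independent_processes N T (\<lambda>t \<omega>. W t (\<pi> \<omega>)) B \<and>
     ito_integral N G T B (\<lambda>t \<omega>. S t (\<pi> \<omega>)) I"

end

theory Submission
  imports Defs
begin

text \<open>On a grid cell $[s, t]$ of length $\<delta>$, the difference between the exact average of $S$ and the
  trapezoidal value is $S_s (\<sigma> \<zeta> + \<rho> + d)$. Here \<open>\<zeta>\<close> is the mean of $W$ over the cell minus
  $(W_s + W_t) / 2$, \<open>\<rho>\<close> is a centred second order remainder of the exponential, and $d$ is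
  deterministic of order \<open>\<delta>\<^sup>2\<close>. The remainders \<open>\<rho>\<close> are martingale differences with second moment of
  order \<open>\<delta>\<^sup>2\<close>, so the maximal inequality makes their sums negligible uniformly on the grid. The bridge
  functionals \<open>\<zeta>\<close> are normal with variance $\<delta> / 12$, independent of each other and of all the values
  of $W$ on the grid. Hence no central limit theorem is needed: jointly with $W$ on the grid, the main
  part of the error has exactly the law of the Riemann sums of $\<sigma> / (2 \<surd>3) \<integral> S\,dB'$ for an
  independent Brownian motion $B'$, and these converge to the Ito integral uniformly in probability.
  This gives the convergence for Lipschitz test functions, weighted with indicators of events that
  depend on finitely many values of $W$. Inf-convolution extends it to bounded continuous test
  functions, a Dynkin argument to all events, and uniform approximation by simple functions to all
  bounded weights. The extension is the product of the basis with itself, and the Ito integral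
  on it is the almost surely uniform limit of integrals of grid processes.\<close>

section \<open>Grid points and step paths\<close>

definition grid_index :: "real \<Rightarrow> nat \<Rightarrow> real \<Rightarrow> nat" where
  "grid_index T n t = nat \<lfloor>t / (T / real n)\<rfloor>"

definition grid_point :: "real \<Rightarrow> nat \<Rightarrow> nat \<Rightarrow> real" where
  "grid_point T n j = real j * (T / real n)"

definition step_path :: "real \<Rightarrow> nat \<Rightarrow> (nat \<Rightarrow> real) \<Rightarrow> real \<Rightarrow> real" where
  "step_path T n x = (\<lambda>t\<in>{0..T}. x (grid_index T n t))"

lemma grid_index_le:
  assumes "0 < T" "t \<in> {0..T}"
  shows "grid_index T n t \<le> n"
proof (cases "n = 0")
  case False
  then have "t / (T / real n) \<le> real n" using assms by (simp add: field_simps)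
  then show ?thesis unfolding grid_index_def by linarith
qed (simp add: grid_index_def)

lemma grid_point_index:
  assumes "0 < T" "0 \<le> t"
  shows "grid_point T n (grid_index T n t) = of_int \<lfloor>t / (T / real n)\<rfloor> * (T / real n)"
  using assms by (simp add: grid_point_def grid_index_def)

lemma grid_point_mem: "0 < T \<Longrightarrow> j \<le> n \<Longrightarrow> grid_point T n j \<in> {0..T}"
  by (cases "n = 0") (auto simp: grid_point_def field_simps)

lemma grid_point_mono: "0 < T \<Longrightarrow> i \<le> j \<Longrightarrow> grid_point T n i \<le> grid_point T n j"
  by (auto simp: grid_point_def intro!: mult_right_mono divide_right_mono)

lemma grid_point_strict_mono: "0 < T \<Longrightarrow> 0 < n \<Longrightarrow> i < j \<Longrightarrow> grid_point T n i < grid_point T n j"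
  by (auto simp: grid_point_def intro!: divide_strict_right_mono)

lemma grid_point_0 [simp]: "grid_point T n 0 = 0"
  by (simp add: grid_point_def)

lemma grid_point_n: "0 < n \<Longrightarrow> grid_point T n n = T"
  by (simp add: grid_point_def)

lemma grid_point_Suc: "grid_point T n (Suc j) = grid_point T n j + T / real n"
  by (simp add: grid_point_def distrib_right add.commute add_divide_distrib)

lemma grid_point_index_bounds:
  assumes "0 < T" "0 \<le> t" "0 < n"
  shows "grid_point T n (grid_index T n t) \<le> t" "t < grid_point T n (grid_index T n t) + T / real n"
proof -
  have "of_int \<lfloor>t / (T / real n)\<rfloor> \<le> t / (T / real n)" "t / (T / real n) < of_int \<lfloor>t / (T / real n)\<rfloor> + 1"
    by linarith+
  then show "grid_point T n (grid_index T n t) \<le> t" "t < grid_point T n (grid_index T n t) + T / real n"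
    unfolding grid_point_index[OF assms(1,2)] using assms
    by (simp_all only: pos_le_divide_eq[of "T / real n"] pos_divide_less_eq[of "T / real n"] distrib_right mult_1
      zero_less_divide_iff of_nat_0_less_iff simp_thms)
qed

lemma grid_index_grid_point: "0 < T \<Longrightarrow> 0 < n \<Longrightarrow> grid_index T n (grid_point T n j) = j"
  by (simp add: grid_point_def grid_index_def)

lemma grid_point_index_tendsto:
  assumes "0 < T" "0 \<le> t"
  shows "(\<lambda>n. grid_point T n (grid_index T n t)) \<longlonglongrightarrow> t"
proof (rule tendsto_sandwich[where f="\<lambda>n. t - T / real n" and h="\<lambda>_. t"])
  show "\<forall>\<^sub>F n in sequentially. t - T / real n \<le> grid_point T n (grid_index T n t)"
    using eventually_gt_at_top[of "0::nat"]
  proof eventually_elim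
    case (elim n)
    show ?case using grid_point_index_bounds(2)[OF assms elim] by simp
  qed
  show "\<forall>\<^sub>F n in sequentially. grid_point T n (grid_index T n t) \<le> t"
    using eventually_gt_at_top[of "0::nat"]
    by eventually_elim (rule grid_point_index_bounds(1)[OF assms])
  have "(\<lambda>n. t - T * (1 / real n)) \<longlonglongrightarrow> t - T * 0"
    by (intro tendsto_intros lim_1_over_n)
  then show "(\<lambda>n. t - T / real n) \<longlonglongrightarrow> t" by simp
qed simp

lemma step_path_cadlag:
  assumes T: "0 < T"
  shows "step_path T n x \<in> cadlag_paths T"
proof (cases "n = 0")
  case True
  then have "step_path T n x = (\<lambda>t\<in>{0..T}. x 0)"
    by (simp add: step_path_def grid_index_def)
  moreover have "((\<lambda>t\<in>{0..T}. x 0) \<longlongrightarrow> x 0) (at_right t)" if "t \<in> {0..<T}" for t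
    by (rule tendsto_eventually) (use that in \<open>auto simp: eventually_at_right_field intro!: exI[of _ T]\<close>)
  moreover have "((\<lambda>t\<in>{0..T}. x 0) \<longlongrightarrow> x 0) (at_left t)" if "t \<in> {0<..T}" for t
    by (rule tendsto_eventually) (use that in \<open>auto simp: eventually_at_left_field intro!: exI[of _ 0]\<close>)
  ultimately show ?thesis unfolding cadlag_paths_def by fastforce
next
  case False
  define \<delta> where "\<delta> = T / real n"
  have \<delta>: "\<delta> > 0" using T False by (simp add: \<delta>_def)
  show ?thesis unfolding cadlag_paths_def mem_Collect_eq
  proof (intro conjI ballI)
    fix t assume t: "t \<in> {0..<T}"
    define c where "c = (of_int \<lfloor>t / \<delta>\<rfloor> + 1) * \<delta>"
    have "t / \<delta> < of_int \<lfloor>t / \<delta>\<rfloor> + 1" by linarith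
    then have c: "t < c" using \<delta> by (simp add: c_def field_simps)
    have "step_path T n x u = step_path T n x t" if "t < u" "u < min c T" for u
    proof -
      have "t / \<delta> < u / \<delta>" using that \<delta> by (simp add: divide_strict_right_mono)
      moreover have "u / \<delta> < of_int \<lfloor>t / \<delta>\<rfloor> + 1"
        using that \<delta> unfolding c_def by (simp add: field_simps)
      ultimately have "\<lfloor>u / \<delta>\<rfloor> = \<lfloor>t / \<delta>\<rfloor>" by linarith
      then show ?thesis using that t by (simp add: step_path_def grid_index_def \<delta>_def)
    qed
    then show "(step_path T n x \<longlongrightarrow> step_path T n x t) (at_right t)"
      using c t by (intro tendsto_eventually) (auto simp: eventually_at_right_field intro!: exI[of _ "min c T"])
  next
    fix t assume t: "t \<in> {0<..T}"
    define m where "m = \<lceil>t / \<delta>\<rceil> - 1"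
    define c where "c = of_int m * \<delta>"
    have "of_int m < t / \<delta>" unfolding m_def by linarith
    then have c: "c < t" using \<delta> by (simp add: c_def field_simps)
    have "step_path T n x u = x (nat m)" if "max c 0 < u" "u < t" for u
    proof -
      have "u / \<delta> < t / \<delta>" using that \<delta> by (simp add: divide_strict_right_mono)
      moreover have "of_int m < u / \<delta>"
        using that \<delta> unfolding c_def by (simp add: field_simps)
      ultimately have "\<lfloor>u / \<delta>\<rfloor> = m" unfolding m_def by linarith
      then show ?thesis using that t by (simp add: step_path_def grid_index_def \<delta>_def)
    qed
    then have "(step_path T n x \<longlongrightarrow> x (nat m)) (at_left t)"
      using c t by (intro tendsto_eventually) (auto simp: eventually_at_left_field intro!: exI[of _ "max c 0"])
    then show "\<exists>l. (step_path T n x \<longlongrightarrow> l) (at_left t)" by blast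
  qed (simp add: step_path_def)
qed

lemma continuous_cadlag:
  assumes "continuous_on {0..T} f"
  shows "(\<lambda>t\<in>{0..T}. f t) \<in> cadlag_paths T"
  unfolding cadlag_paths_def mem_Collect_eq
proof (intro conjI ballI)
  have lim: "(f \<longlongrightarrow> f t) (at t within {0..T})" if "t \<in> {0..T}" for t
    using assms that by (auto simp: continuous_on_def)
  fix t assume t: "t \<in> {0..<T}"
  have "(f \<longlongrightarrow> f t) (at_right t)"
  proof -
    have "at t within {t..T} = at_right t" using t by (simp add: at_within_Icc_at_right)
    moreover have "(f \<longlongrightarrow> f t) (at t within {t..T})"
      by (rule tendsto_within_subset[OF lim]) (use t in auto)
    ultimately show ?thesis by simp
  qed
  moreover have "\<forall>\<^sub>F u in at_right t. f u = restrict f {0..T} u"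
    using t by (auto simp: eventually_at_right_field intro!: exI[of _ T])
  ultimately have "(restrict f {0..T} \<longlongrightarrow> f t) (at_right t)" by (rule Lim_transform_eventually)
  then show "((\<lambda>t\<in>{0..T}. f t) \<longlongrightarrow> (\<lambda>t\<in>{0..T}. f t) t) (at_right t)" using t by simp
next
  have lim: "(f \<longlongrightarrow> f t) (at t within {0..T})" if "t \<in> {0..T}" for t
    using assms that by (auto simp: continuous_on_def)
  fix t assume t: "t \<in> {0<..T}"
  have "(f \<longlongrightarrow> f t) (at_left t)"
  proof -
    have "at t within {0..t} = at_left t" using t by (simp add: at_within_Icc_at_left)
    moreover have "(f \<longlongrightarrow> f t) (at t within {0..t})"
      by (rule tendsto_within_subset[OF lim]) (use t in auto)
    ultimately show ?thesis by simp
  qed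
  moreover have "\<forall>\<^sub>F u in at_left t. f u = restrict f {0..T} u"
    using t by (auto simp: eventually_at_left_field intro!: exI[of _ 0])
  ultimately have "(restrict f {0..T} \<longlongrightarrow> f t) (at_left t)" by (rule Lim_transform_eventually)
  then show "\<exists>l. ((\<lambda>t\<in>{0..T}. f t) \<longlongrightarrow> l) (at_left t)" by blast
qed simp

lemma skorokhod_dist_le_sup:
  assumes "x \<in> cadlag_paths T" "y \<in> cadlag_paths T" "0 \<le> T"
    and "0 \<le> e" "\<And>t. t \<in> {0..T} \<Longrightarrow> \<bar>x t - y t\<bar> \<le> e"
  shows "skorokhod_dist T x y \<le> e"
proof -
  have "skorokhod_close T e x y" unfolding skorokhod_close_def
    using assms by (intro bexI[of _ "\<lambda>t. t"]) (auto simp: time_changes_def strict_mono_on_def)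
  moreover have "bdd_below {e. skorokhod_close T e x y}"
    using skorokhod_close_nonneg assms(3) by (intro bdd_belowI[of _ 0]) auto
  ultimately show ?thesis using assms by (auto simp: skorokhod_dist_def intro!: cInf_lower)
qed

lemma topspace_skorokhod [simp]: "0 \<le> T \<Longrightarrow> topspace (skorokhod_topology T) = cadlag_paths T"
  using Metric_space.topspace_mtopology[OF Metric_space_skorokhod[of T]]
  by (simp add: skorokhod_topology_def)

lemma space_borel_of_topology [simp]: "space (borel_of_topology E) = topspace E"
  by (simp add: borel_of_topology_def space_measure_of_conv)

lemma sets_borel_of_topology: "sets (borel_of_topology E) = sigma_sets (topspace E) {V. openin E V}"
  unfolding borel_of_topology_def
  by (rule sets_measure_of) (auto dest: openin_subset)

lemma measurable_borel_of_topologyI: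
  assumes "\<And>\<omega>. \<omega> \<in> space Q \<Longrightarrow> X \<omega> \<in> topspace E"
    and "\<And>V. openin E V \<Longrightarrow> X -` V \<inter> space Q \<in> sets Q"
  shows "X \<in> measurable Q (borel_of_topology E)"
  unfolding borel_of_topology_def
  by (rule measurable_measure_of) (use assms in \<open>auto dest: openin_subset\<close>)

lemma continuous_map_measurable_borel_of_topology:
  assumes "continuous_map E euclideanreal h"
  shows "h \<in> borel_measurable (borel_of_topology E)"
proof (rule borel_measurableI)
  fix V :: "real set" assume "open V"
  then have "openin E {x \<in> topspace E. h x \<in> V}"
    by (intro openin_continuous_map_preimage[OF assms]) simp
  moreover have "h -` V \<inter> space (borel_of_topology E) = {x \<in> topspace E. h x \<in> V}" by auto
  ultimately show "h -` V \<inter> space (borel_of_topology E) \<in> sets (borel_of_topology E)"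
    unfolding sets_borel_of_topology by (auto intro: sigma_sets.Basic)
qed

lemma step_path_measurable:
  assumes T: "0 < T" and x: "\<And>j. j \<le> n \<Longrightarrow> x j \<in> borel_measurable Q"
  shows "(\<lambda>\<omega>. step_path T n (\<lambda>j. x j \<omega>)) \<in> measurable Q (borel_of_topology (skorokhod_topology T))"
proof (rule measurable_borel_of_topologyI)
  fix V assume V: "openin (skorokhod_topology T) V"
  interpret S: Metric_space "cadlag_paths T" "skorokhod_dist T"
    using T by (intro Metric_space_skorokhod) simp
  define U where "U = {z :: nat \<Rightarrow> real. step_path T n z \<in> V}"
  have "open U"
  proof (subst open_subopen, intro ballI)
    fix z assume z: "z \<in> U"
    then obtain r where r: "r > 0" "S.mball (step_path T n z) r \<subseteq> V"
      using V unfolding U_def skorokhod_topology_def S.openin_mtopology by blast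
    define O' where "O' = (\<Inter>j\<le>n. (\<lambda>y. y j) -` {z j - r/2 <..< z j + r/2})"
    have "open O'" unfolding O'_def
      by (intro open_INT finite_atMost ballI open_vimage continuous_on_product_coordinates open_greaterThanLessThan)
    moreover have "z \<in> O'" using r by (simp add: O'_def)
    moreover have "O' \<subseteq> U"
    proof
      fix y assume y: "y \<in> O'"
      have "skorokhod_dist T (step_path T n z) (step_path T n y) \<le> r/2"
      proof (rule skorokhod_dist_le_sup)
        fix t assume t: "t \<in> {0..T}"
        have "y (grid_index T n t) \<in> {z (grid_index T n t) - r/2 <..< z (grid_index T n t) + r/2}"
          using y grid_index_le[OF T t] unfolding O'_def by blast
        then have "\<bar>z (grid_index T n t) - y (grid_index T n t)\<bar> \<le> r/2"
          by (simp add: abs_le_iff del: divide_le_eq_numeral1 le_divide_eq_numeral1)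
        then show "\<bar>step_path T n z t - step_path T n y t\<bar> \<le> r/2"
          using t by (simp add: step_path_def)
      qed (use T r step_path_cadlag in auto)
      then have "step_path T n y \<in> S.mball (step_path T n z) r"
        using r step_path_cadlag[OF T] by auto
      then show "y \<in> U" using r by (auto simp: U_def)
    qed
    ultimately show "\<exists>O''. open O'' \<and> z \<in> O'' \<and> O'' \<subseteq> U" by blast
  qed
  moreover define x' where "x' = (\<lambda>\<omega> j. x (min j n) \<omega>)"
  have "x' \<in> borel_measurable Q" unfolding x'_def
    by (rule measurable_coordinatewise_then_product) (simp add: x)
  ultimately have "x' -` U \<inter> space Q \<in> sets Q" by (simp add: measurable_sets)
  moreover have "step_path T n (x' \<omega>) = step_path T n (\<lambda>j. x j \<omega>)" for \<omega>
    using grid_index_le[OF T] by (auto simp: step_path_def x'_def min_absorb1)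
  then have "x' -` U \<inter> space Q = (\<lambda>\<omega>. step_path T n (\<lambda>j. x j \<omega>)) -` V \<inter> space Q"
    unfolding U_def by auto
  ultimately show "(\<lambda>\<omega>. step_path T n (\<lambda>j. x j \<omega>)) -` V \<inter> space Q \<in> sets Q" by simp
qed (simp add: T less_imp_le step_path_cadlag)

lemma uniform_grid_approx:
  fixes f :: "real \<Rightarrow> real"
  assumes T: "0 < T" and f: "continuous_on {0..T} f" and e: "0 < e"
  shows "\<forall>\<^sub>F n in sequentially. \<forall>t\<in>{0..T}. \<bar>f t - f (grid_point T n (grid_index T n t))\<bar> < e"
proof -
  have "uniformly_continuous_on {0..T} f" by (rule compact_uniformly_continuous) (use f in auto)
  then obtain d where d: "d > 0"
    "\<And>s t. s \<in> {0..T} \<Longrightarrow> t \<in> {0..T} \<Longrightarrow> dist s t < d \<Longrightarrow> dist (f s) (f t) < e"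
    using e unfolding uniformly_continuous_on_def by metis
  have "(\<lambda>n. T * (1 / real n)) \<longlonglongrightarrow> T * 0" by (intro tendsto_intros lim_1_over_n)
  then have "\<forall>\<^sub>F n in sequentially. T * (1 / real n) < d" using d order_tendstoD(2)[of _ 0] by simp
  then show ?thesis using eventually_gt_at_top[of 0]
  proof eventually_elim
    case (elim n)
    show ?case
    proof
      fix t assume t: "t \<in> {0..T}"
      have "dist t (grid_point T n (grid_index T n t)) < d"
        using grid_point_index_bounds[of T t n] T t elim by (auto simp: dist_real_def)
      then show "\<bar>f t - f (grid_point T n (grid_index T n t))\<bar> < e"
        using d(2)[OF t grid_point_mem[OF T grid_index_le[OF T t]]] by (simp add: dist_real_def)
    qed
  qed
qed

lemma continuous_path_measurable:
  assumes T: "0 < T" and Y: "\<And>t. t \<in> {0..T} \<Longrightarrow> Y t \<in> borel_measurable Q"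
    and cont: "\<And>\<omega>. \<omega> \<in> space Q \<Longrightarrow> continuous_on {0..T} (\<lambda>t. Y t \<omega>)"
  shows "(\<lambda>\<omega>. \<lambda>t\<in>{0..T}. Y t \<omega>) \<in> measurable Q (borel_of_topology (skorokhod_topology T))"
proof (rule measurable_borel_of_topologyI)
  fix V assume V: "openin (skorokhod_topology T) V"
  interpret S: Metric_space "cadlag_paths T" "skorokhod_dist T"
    using T by (intro Metric_space_skorokhod) simp
  define P where "P n \<omega> = step_path T n (\<lambda>j. Y (grid_point T n j) \<omega>)" for n \<omega>
  define P' where "P' \<omega> = (\<lambda>t\<in>{0..T}. Y t \<omega>)" for \<omega>
  have P'_cad: "P' \<omega> \<in> cadlag_paths T" if "\<omega> \<in> space Q" for \<omega>
    unfolding P'_def by (rule continuous_cadlag[OF cont[OF that]])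
  have P_cad: "P n \<omega> \<in> cadlag_paths T" for n \<omega> unfolding P_def by (rule step_path_cadlag[OF T])
  have conv: "\<forall>\<^sub>F n in sequentially. skorokhod_dist T (P' \<omega>) (P n \<omega>) < e" if \<omega>: "\<omega> \<in> space Q" and "e > 0" for \<omega> e
  proof -
    have "\<forall>\<^sub>F n in sequentially. \<forall>t\<in>{0..T}. \<bar>Y t \<omega> - Y (grid_point T n (grid_index T n t)) \<omega>\<bar> < e / 2"
      by (rule uniform_grid_approx[OF T cont[OF \<omega>]]) (use \<open>e > 0\<close> in simp)
    then show ?thesis
    proof eventually_elim
    case (elim n)
    have "skorokhod_dist T (P' \<omega>) (P n \<omega>) \<le> e / 2"
      by (rule skorokhod_dist_le_sup)
        (use elim \<open>e > 0\<close> T P'_cad[OF \<omega>] P_cad in \<open>auto simp: P_def P'_def step_path_def less_imp_le\<close>)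
    then show ?case using \<open>e > 0\<close> by simp
    qed
  qed
  define Wk where "Wk k = \<Union>{S.mball x (1 / real (Suc k)) | x. S.mball x (2 / real (Suc k)) \<subseteq> V}" for k
  have Wk: "openin (skorokhod_topology T) (Wk k)" for k
    unfolding Wk_def skorokhod_topology_def by (intro openin_Union) auto
  have meas: "P n \<in> measurable Q (borel_of_topology (skorokhod_topology T))" for n
    unfolding P_def by (rule step_path_measurable[OF T]) (auto intro!: Y grid_point_mem T simp del: atLeastAtMost_iff)
  have set: "P n -` Wk k \<inter> space Q \<in> sets Q" for n k
    by (rule measurable_sets[OF meas]) (use Wk in \<open>auto simp: sets_borel_of_topology\<close>)
  have "P' \<omega> \<in> V \<longleftrightarrow> (\<exists>k N. \<forall>n\<ge>N. P n \<omega> \<in> Wk k)" if \<omega>: "\<omega> \<in> space Q" for \<omega>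
  proof
    assume "P' \<omega> \<in> V"
    then obtain r where r: "r > 0" "S.mball (P' \<omega>) r \<subseteq> V"
      using V unfolding skorokhod_topology_def S.openin_mtopology by blast
    obtain k where k: "inverse (real (Suc k)) < r / 2" using reals_Archimedean[of "r/2"] r by auto
    have "S.mball (P' \<omega>) (2 / real (Suc k)) \<subseteq> V"
    proof -
      have "2 / real (Suc k) < r" using k by (simp add: field_simps)
      then show ?thesis using r(2) by auto
    qed
    moreover obtain N where "\<forall>n\<ge>N. skorokhod_dist T (P' \<omega>) (P n \<omega>) < 1 / real (Suc k)"
      using conv[OF \<omega>, of "1 / real (Suc k)"] by (auto simp: eventually_sequentially)
    ultimately show "\<exists>k N. \<forall>n\<ge>N. P n \<omega> \<in> Wk k"
      unfolding Wk_def using P_cad P'_cad[OF \<omega>]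
      by (intro exI[of _ k] exI[of _ N] allI impI UnionI[of "S.mball (P' \<omega>) (1 / real (Suc k))"]) auto
  next
    assume "\<exists>k N. \<forall>n\<ge>N. P n \<omega> \<in> Wk k"
    then obtain k N where N: "\<forall>n\<ge>N. P n \<omega> \<in> Wk k" by blast
    have "\<forall>\<^sub>F n in sequentially. skorokhod_dist T (P' \<omega>) (P n \<omega>) < 1 / real (Suc k)"
      by (rule conv[OF \<omega>]) simp
    with eventually_ge_at_top[of N] have "\<forall>\<^sub>F n in sequentially. N \<le> n \<and> skorokhod_dist T (P' \<omega>) (P n \<omega>) < 1 / real (Suc k)"
      by eventually_elim simp
    then obtain n where n: "n \<ge> N" "skorokhod_dist T (P' \<omega>) (P n \<omega>) < 1 / real (Suc k)"
      by (auto simp: eventually_sequentially)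
    then obtain x where x: "P n \<omega> \<in> S.mball x (1 / real (Suc k))" "S.mball x (2 / real (Suc k)) \<subseteq> V"
      using N unfolding Wk_def by blast
    have "skorokhod_dist T x (P' \<omega>) \<le> skorokhod_dist T x (P n \<omega>) + skorokhod_dist T (P' \<omega>) (P n \<omega>)"
      using S.triangle[of x "P n \<omega>" "P' \<omega>"] x P_cad P'_cad[OF \<omega>] S.commute by simp
    also have "\<dots> < 2 / real (Suc k)" using x n by auto
    finally show "P' \<omega> \<in> V" using x P'_cad[OF \<omega>] by auto
  qed
  then have eq: "P' -` V \<inter> space Q = {\<omega> \<in> space Q. \<exists>k N. \<forall>n\<ge>N. P n \<omega> \<in> Wk k}" by auto
  have [measurable]: "Measurable.pred Q (\<lambda>\<omega>. P n \<omega> \<in> Wk k)" for n k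
  proof -
    have "{\<omega> \<in> space Q. P n \<omega> \<in> Wk k} = P n -` Wk k \<inter> space Q" by auto
    then show ?thesis using set[of n k] by (simp add: pred_def)
  qed
  have "P' -` V \<inter> space Q \<in> sets Q" unfolding eq by measurable
  moreover have "P' = (\<lambda>\<omega>. \<lambda>t\<in>{0..T}. Y t \<omega>)" by (simp add: P'_def fun_eq_iff)
  ultimately show "(\<lambda>\<omega>. \<lambda>t\<in>{0..T}. Y t \<omega>) -` V \<inter> space Q \<in> sets Q" by simp
next
  fix \<omega> assume "\<omega> \<in> space Q"
  then show "(\<lambda>t\<in>{0..T}. Y t \<omega>) \<in> topspace (skorokhod_topology T)"
    using T continuous_cadlag[OF cont] by simp
qed

section \<open>Lipschitz test functions\<close>

context Metric_space
begin

text \<open>The inf-convolutions of $h$ with multiples of the distance are Lipschitz and increase to $h$.\<close>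

definition lip_approx :: "('a \<Rightarrow> real) \<Rightarrow> nat \<Rightarrow> 'a \<Rightarrow> real" where
  "lip_approx h k x = (INF y\<in>M. h y + real k * d x y)"

lemma lip_approx_bdd:
  assumes "\<And>y. y \<in> M \<Longrightarrow> \<bar>h y\<bar> \<le> C"
  shows "bdd_below ((\<lambda>y. h y + real k * d x y) ` M)"
proof (rule bdd_belowI2)
  fix y assume "y \<in> M"
  have "0 \<le> real k * d x y" by simp
  then show "- C \<le> h y + real k * d x y" using assms[OF \<open>y \<in> M\<close>] by linarith
qed

lemma lip_approx_le:
  assumes C: "\<And>y. y \<in> M \<Longrightarrow> \<bar>h y\<bar> \<le> C" and x: "x \<in> M"
  shows "lip_approx h k x \<le> h x"
proof -
  have "lip_approx h k x \<le> h x + real k * d x x"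
    unfolding lip_approx_def by (rule cINF_lower[OF lip_approx_bdd[of h, OF C] x])
  then show ?thesis using x by simp
qed

lemma lip_approx_ge:
  assumes C: "\<And>y. y \<in> M \<Longrightarrow> \<bar>h y\<bar> \<le> C" and x: "x \<in> M"
  shows "- C \<le> lip_approx h k x"
  unfolding lip_approx_def
proof (rule cINF_greatest)
  fix y assume "y \<in> M"
  have "0 \<le> real k * d x y" by simp
  then show "- C \<le> h y + real k * d x y" using C[OF \<open>y \<in> M\<close>] by linarith
qed (use x in auto)

lemma lip_approx_lipschitz:
  assumes C: "\<And>y. y \<in> M \<Longrightarrow> \<bar>h y\<bar> \<le> C" and x: "x \<in> M" "x' \<in> M"
  shows "\<bar>lip_approx h k x - lip_approx h k x'\<bar> \<le> real k * d x x'"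
proof -
  have "lip_approx h k x \<le> lip_approx h k x' + real k * d x x'" if x: "x \<in> M" "x' \<in> M" for x x'
  proof -
    have "lip_approx h k x - real k * d x x' \<le> lip_approx h k x'"
      unfolding lip_approx_def[of h k x']
    proof (rule cINF_greatest)
      fix y assume y: "y \<in> M"
      have "lip_approx h k x \<le> h y + real k * d x y"
        unfolding lip_approx_def by (rule cINF_lower[OF lip_approx_bdd[of h, OF C] y])
      moreover have "real k * d x y \<le> real k * (d x x' + d x' y)"
        by (intro mult_left_mono triangle x y) auto
      ultimately show "lip_approx h k x - real k * d x x' \<le> h y + real k * d x' y"
        by (simp add: distrib_left)
    qed (use x in auto)
    then show ?thesis by simp
  qed
  from this[OF x] this[OF x(2,1)] show ?thesis using commute[of x x'] by simp
qed

lemma lip_approx_tendsto: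
  assumes C: "\<And>y. y \<in> M \<Longrightarrow> \<bar>h y\<bar> \<le> C" and x: "x \<in> M"
    and h: "continuous_map mtopology euclideanreal h"
  shows "(\<lambda>k. lip_approx h k x) \<longlonglongrightarrow> h x"
proof (rule LIMSEQ_I)
  fix e :: real assume e: "e > 0"
  have "openin mtopology {y \<in> M. h y \<in> {h x - e/2 <..}}"
    using openin_continuous_map_preimage[OF h, of "{h x - e/2 <..}"] by (simp add: topspace_mtopology)
  then obtain r where r: "r > 0" "mball x r \<subseteq> {y \<in> M. h y \<in> {h x - e/2 <..}}"
    unfolding openin_mtopology using x e by force
  obtain k0 where k0: "2 * C / r < real k0" using reals_Archimedean2 by blast
  have "norm (lip_approx h k x - h x) < e" if k: "k \<ge> k0" for k
  proof -
    have "h x - e/2 \<le> lip_approx h k x" unfolding lip_approx_def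
    proof (rule cINF_greatest)
      fix y assume y: "y \<in> M"
      show "h x - e/2 \<le> h y + real k * d x y"
      proof (cases "d x y < r")
        case True
        then have "h y > h x - e/2" using r x y by auto
        moreover have "0 \<le> real k * d x y" by simp
        ultimately show ?thesis by linarith
      next
        case False
        have "2 * C < real k0 * r" using k0 r by (simp add: field_simps)
        also have "\<dots> \<le> real k * d x y" using k False r by (intro mult_mono) auto
        finally show ?thesis using C[OF x] C[OF y] e by linarith
      qed
    qed (use x in auto)
    moreover have "lip_approx h k x \<le> h x" by (rule lip_approx_le[OF C x])
    ultimately show ?thesis using e by simp
  qed
  then show "\<exists>k0. \<forall>k\<ge>k0. norm (lip_approx h k x - h x) < e" by blast
qed

lemma lipschitz_continuous_map:
  fixes g :: "'a \<Rightarrow> real"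
  assumes "\<And>x y. x \<in> M \<Longrightarrow> y \<in> M \<Longrightarrow> \<bar>g x - g y\<bar> \<le> L * d x y"
  shows "continuous_map mtopology euclideanreal g"
proof -
  have "\<bar>g x - g y\<bar> \<le> (\<bar>L\<bar> + 1) * d x y" if "x \<in> M" "y \<in> M" for x y
    by (rule order_trans[OF assms[OF that]]) (simp add: mult_right_mono)
  then have "Lipschitz_continuous_map (metric (M, d)) euclidean_metric g"
    unfolding Lipschitz_continuous_map_def
    by (auto simp: dist_real_def Metric_space_axioms)
  then have "continuous_map (mtopology_of (metric (M, d))) (mtopology_of euclidean_metric) g"
    by (rule Lipschitz_continuous_imp_continuous_map)
  then show ?thesis by (simp add: Metric_space_axioms mtopology_of_def)
qed

lemma stable_limit_from_lipschitz:
  fixes X :: "nat \<Rightarrow> 'b \<Rightarrow> 'a" and Y :: "'c \<Rightarrow> 'a"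
  assumes X: "\<And>n. X n \<in> measurable Q (borel_of_topology mtopology)"
    and Y: "Y \<in> measurable R (borel_of_topology mtopology)"
    and u: "integrable Q u" "\<And>\<omega>. \<omega> \<in> space Q \<Longrightarrow> 0 \<le> (u \<omega> :: real)"
    and v: "integrable R v" "\<And>\<omega>. \<omega> \<in> space R \<Longrightarrow> 0 \<le> (v \<omega> :: real)"
    and lip: "\<And>g C L. (\<And>x. x \<in> M \<Longrightarrow> \<bar>g x\<bar> \<le> C) \<Longrightarrow>
        (\<And>x y. x \<in> M \<Longrightarrow> y \<in> M \<Longrightarrow> \<bar>g x - g y\<bar> \<le> L * d x y) \<Longrightarrow>
        (\<lambda>n. \<integral>\<omega>. u \<omega> * g (X n \<omega>) \<partial>Q) \<longlonglongrightarrow> (\<integral>\<omega>. v \<omega> * g (Y \<omega>) \<partial>R)"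
    and h: "continuous_map mtopology euclideanreal h" "\<And>x. x \<in> M \<Longrightarrow> \<bar>h x\<bar> \<le> C"
  shows "(\<lambda>n. \<integral>\<omega>. u \<omega> * h (X n \<omega>) \<partial>Q) \<longlonglongrightarrow> (\<integral>\<omega>. v \<omega> * h (Y \<omega>) \<partial>R)"
proof -
  have XM: "X n \<omega> \<in> M" if "\<omega> \<in> space Q" for n \<omega>
    using measurable_space[OF X that] by simp
  have YM: "Y \<omega> \<in> M" if "\<omega> \<in> space R" for \<omega>
    using measurable_space[OF Y that] by simp
  have intX: "integrable Q (\<lambda>\<omega>. u \<omega> * g (X n \<omega>))" if "continuous_map mtopology euclideanreal g" "\<And>x. x \<in> M \<Longrightarrow> \<bar>g x\<bar> \<le> C" for g n
  proof -
    have [measurable]: "(\<lambda>\<omega>. g (X n \<omega>)) \<in> borel_measurable Q"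
      using measurable_compose[OF X continuous_map_measurable_borel_of_topology[OF that(1)]] .
    have [measurable]: "u \<in> borel_measurable Q" using u by auto
    show ?thesis
    proof (rule Bochner_Integration.integrable_bound[where f="\<lambda>\<omega>. C * u \<omega>"])
      show "AE \<omega> in Q. norm (u \<omega> * g (X n \<omega>)) \<le> norm (C * u \<omega>)"
      proof (rule AE_I2)
        fix \<omega> assume \<omega>: "\<omega> \<in> space Q"
        have "\<bar>g (X n \<omega>)\<bar> \<le> \<bar>C\<bar>" using that(2)[OF XM[OF \<omega>]] by (rule order_trans) simp
        then show "norm (u \<omega> * g (X n \<omega>)) \<le> norm (C * u \<omega>)"
          by (simp add: abs_mult mult.commute[of "\<bar>C\<bar>"] mult_left_mono)
      qed
    qed (use u in auto)
  qed
  have measY: "(\<lambda>\<omega>. g (Y \<omega>)) \<in> borel_measurable R" if "continuous_map mtopology euclideanreal g" for g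
    using measurable_compose[OF Y continuous_map_measurable_borel_of_topology[OF that(1)]] .
  have lower: "\<forall>\<^sub>F n in sequentially. (\<integral>\<omega>. v \<omega> * h (Y \<omega>) \<partial>R) - e < (\<integral>\<omega>. u \<omega> * h (X n \<omega>) \<partial>Q)"
    if h: "continuous_map mtopology euclideanreal h" "\<And>x. x \<in> M \<Longrightarrow> \<bar>h x\<bar> \<le> C" and e: "e > 0" for h :: "'a \<Rightarrow> real" and e
  proof -
    have hk_bd: "\<bar>lip_approx h k x\<bar> \<le> C" if "x \<in> M" for k x
      using lip_approx_le[of h, OF h(2) that, of k] lip_approx_ge[of h, OF h(2) that, of k] h(2)[OF that]
      by linarith
    have hk_cont: "continuous_map mtopology euclideanreal (lip_approx h k)" for k
      by (rule lipschitz_continuous_map[of _ "real k"]) (rule lip_approx_lipschitz[of h, OF h(2)])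
    have "(\<lambda>k. \<integral>\<omega>. v \<omega> * lip_approx h k (Y \<omega>) \<partial>R) \<longlonglongrightarrow> (\<integral>\<omega>. v \<omega> * h (Y \<omega>) \<partial>R)"
    proof (rule integral_dominated_convergence[where w="\<lambda>\<omega>. C * v \<omega>"])
      have [measurable]: "v \<in> borel_measurable R" using v by auto
      note [measurable] = measY[OF h(1)] measY[OF hk_cont]
      show "(\<lambda>\<omega>. v \<omega> * h (Y \<omega>)) \<in> borel_measurable R" by measurable
      show "(\<lambda>\<omega>. v \<omega> * lip_approx h k (Y \<omega>)) \<in> borel_measurable R" for k by measurable
      show "AE \<omega> in R. (\<lambda>k. v \<omega> * lip_approx h k (Y \<omega>)) \<longlonglongrightarrow> v \<omega> * h (Y \<omega>)"
        by (intro AE_I2 tendsto_intros lip_approx_tendsto[of h, OF h(2) _ h(1)] YM)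
      show "AE \<omega> in R. norm (v \<omega> * lip_approx h k (Y \<omega>)) \<le> C * v \<omega>" for k
        by (rule AE_I2) (simp add: abs_mult v hk_bd YM mult.commute[of "v _"] mult_right_mono)
    qed (use v in auto)
    then have "\<forall>\<^sub>F k in sequentially. (\<integral>\<omega>. v \<omega> * h (Y \<omega>) \<partial>R) - e < (\<integral>\<omega>. v \<omega> * lip_approx h k (Y \<omega>) \<partial>R)"
      by (rule order_tendstoD) (use e in simp)
    then obtain k where k: "(\<integral>\<omega>. v \<omega> * h (Y \<omega>) \<partial>R) - e < (\<integral>\<omega>. v \<omega> * lip_approx h k (Y \<omega>) \<partial>R)"
      by (auto simp: eventually_sequentially)
    have "(\<lambda>n. \<integral>\<omega>. u \<omega> * lip_approx h k (X n \<omega>) \<partial>Q) \<longlonglongrightarrow> (\<integral>\<omega>. v \<omega> * lip_approx h k (Y \<omega>) \<partial>R)"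
      by (rule lip[OF hk_bd lip_approx_lipschitz[of h, OF h(2)]])
    then have "\<forall>\<^sub>F n in sequentially. (\<integral>\<omega>. v \<omega> * h (Y \<omega>) \<partial>R) - e < (\<integral>\<omega>. u \<omega> * lip_approx h k (X n \<omega>) \<partial>Q)"
      using k by (rule order_tendstoD)
    then show ?thesis
    proof eventually_elim
      case (elim n)
      have "(\<integral>\<omega>. u \<omega> * lip_approx h k (X n \<omega>) \<partial>Q) \<le> (\<integral>\<omega>. u \<omega> * h (X n \<omega>) \<partial>Q)"
        by (intro integral_mono intX hk_cont hk_bd h mult_left_mono lip_approx_le[of h C, OF h(2)] XM u)
      then show ?case using elim by simp
    qed
  qed
  have cm: "continuous_map mtopology euclideanreal (\<lambda>x. - h x)"
    using h(1) by (rule continuous_map_minus)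
  show ?thesis
  proof (rule LIMSEQ_I)
    fix e :: real assume e: "e > 0"
    have "\<forall>\<^sub>F n in sequentially. (\<integral>\<omega>. v \<omega> * h (Y \<omega>) \<partial>R) - e < (\<integral>\<omega>. u \<omega> * h (X n \<omega>) \<partial>Q)"
      by (rule lower[OF h(1) _ e]) (rule h(2))
    moreover have "\<forall>\<^sub>F n in sequentially. (\<integral>\<omega>. v \<omega> * - h (Y \<omega>) \<partial>R) - e < (\<integral>\<omega>. u \<omega> * - h (X n \<omega>) \<partial>Q)"
      by (rule lower[OF cm _ e]) (simp add: h(2))
    ultimately have "\<forall>\<^sub>F n in sequentially. norm ((\<integral>\<omega>. u \<omega> * h (X n \<omega>) \<partial>Q) - (\<integral>\<omega>. v \<omega> * h (Y \<omega>) \<partial>R)) < e"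
      by eventually_elim (simp add: abs_less_iff)
    then show "\<exists>N. \<forall>n\<ge>N. norm ((\<integral>\<omega>. u \<omega> * h (X n \<omega>) \<partial>Q) - (\<integral>\<omega>. v \<omega> * h (Y \<omega>) \<partial>R)) < e"
      by (simp add: eventually_sequentially)
  qed
qed

end

section \<open>Normal increments\<close>

lemma integrable_mult_of_squares:
  fixes f g :: "'a \<Rightarrow> real"
  assumes [measurable]: "f \<in> borel_measurable M" "g \<in> borel_measurable M"
    and "integrable M (\<lambda>x. (f x)\<^sup>2)" "integrable M (\<lambda>x. (g x)\<^sup>2)"
  shows "integrable M (\<lambda>x. f x * g x)"
proof (rule Bochner_Integration.integrable_bound[where f="\<lambda>x. (f x)\<^sup>2 + (g x)\<^sup>2"])
  show "AE x in M. norm (f x * g x) \<le> norm ((f x)\<^sup>2 + (g x)\<^sup>2)"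
  proof (rule AE_I2)
    fix x
    have "0 \<le> (\<bar>f x\<bar> - \<bar>g x\<bar>)\<^sup>2" "0 \<le> (f x)\<^sup>2" "0 \<le> (g x)\<^sup>2" by simp_all
    then have "2 * (\<bar>f x\<bar> * \<bar>g x\<bar>) \<le> (f x)\<^sup>2 + (g x)\<^sup>2"
      by (simp add: power2_diff)
    moreover have "0 \<le> \<bar>f x\<bar> * \<bar>g x\<bar>" by simp
    ultimately show "norm (f x * g x) \<le> norm ((f x)\<^sup>2 + (g x)\<^sup>2)"
      unfolding real_norm_def abs_mult by linarith
  qed
qed (use assms in auto)

lemma normal_density_exp:
  assumes "0 < s"
  shows "normal_density 0 s x * exp (c * x) = exp (c\<^sup>2 * s\<^sup>2 / 2) * normal_density (c * s\<^sup>2) s x"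
proof -
  have "c * x - x\<^sup>2 / (2 * s\<^sup>2) = c\<^sup>2 * s\<^sup>2 / 2 - (x - c * s\<^sup>2)\<^sup>2 / (2 * s\<^sup>2)"
    using assms by (simp add: field_simps power2_eq_square)
  then have "exp (- (x\<^sup>2 / (2 * s\<^sup>2))) * exp (c * x) = exp (c\<^sup>2 * s\<^sup>2 / 2) * exp (- ((x - c * s\<^sup>2)\<^sup>2 / (2 * s\<^sup>2)))"
    by (simp add: exp_add[symmetric])
  then show ?thesis by (simp add: normal_density_def)
qed

context prob_space
begin

lemma normal_moments:
  assumes X: "distributed M lborel X (normal_density 0 s)" and s: "0 < s"
  shows "integrable M X" "expectation X = 0"
    and "integrable M (\<lambda>x. (X x)\<^sup>2)" "expectation (\<lambda>x. (X x)\<^sup>2) = s\<^sup>2"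
    and "integrable M (\<lambda>x. exp (c * X x))" "expectation (\<lambda>x. exp (c * X x)) = exp (c\<^sup>2 * s\<^sup>2 / 2)"
    and "integrable M (\<lambda>x. X x * exp (c * X x))"
      "expectation (\<lambda>x. X x * exp (c * X x)) = c * s\<^sup>2 * exp (c\<^sup>2 * s\<^sup>2 / 2)"
proof -
  note i = distributed_integrable[OF X, THEN iffD1] and e = distributed_integral[OF X, symmetric]
  show "integrable M X" using i[of "\<lambda>x. x"] integrable_normal_moment_nz_1[OF s] by simp
  show "expectation X = 0" using e[of "\<lambda>x. x"] integral_normal_moment_nz_1[OF s, of 0] by simp
  show "integrable M (\<lambda>x. (X x)\<^sup>2)" using i[of "\<lambda>x. x\<^sup>2"] integrable_normal_moment[OF s, of 0 2] by simp
  show "expectation (\<lambda>x. (X x)\<^sup>2) = s\<^sup>2"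
    using e[of "\<lambda>x. x\<^sup>2"] integral_normal_moment_even[OF s, of 0 1] by simp
  show "integrable M (\<lambda>x. exp (c * X x))"
    by (rule i) (use s in \<open>simp_all add: normal_density_exp\<close>)
  show "expectation (\<lambda>x. exp (c * X x)) = exp (c\<^sup>2 * s\<^sup>2 / 2)"
    by (subst e) (use s in \<open>simp_all add: normal_density_exp\<close>)
  have *: "normal_density 0 s x * (x * exp (c * x)) = exp (c\<^sup>2 * s\<^sup>2 / 2) * (normal_density (c * s\<^sup>2) s x * x)" for x
    using normal_density_exp[OF s, of x c] by (simp add: ac_simps)
  show "integrable M (\<lambda>x. X x * exp (c * X x))"
    by (rule i) (use s integrable_normal_moment_nz_1[OF s] in \<open>simp_all add: *\<close>)
  show "expectation (\<lambda>x. X x * exp (c * X x)) = c * s\<^sup>2 * exp (c\<^sup>2 * s\<^sup>2 / 2)"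
    by (subst e) (use s integral_normal_moment_nz_1[OF s] in \<open>simp_all add: *\<close>)
qed

lemma normal_char:
  assumes X: "distributed M lborel X (normal_density 0 s)" and s: "0 < s"
  shows "(\<integral>x. iexp (c * X x) \<partial>M) = of_real (exp (- (c\<^sup>2 * s\<^sup>2 / 2)))"
proof -
  have [measurable]: "X \<in> borel_measurable M" using distributed_measurable[OF X] by simp
  have Z: "distributed M lborel (\<lambda>x. X x / s) std_normal_density"
    using normal_density_affine[OF X s, of "1 / s" 0] s by simp
  have "(\<integral>x. iexp (c * X x) \<partial>M) = char (distr M borel (\<lambda>x. X x / s)) (c * s)"
    unfolding char_def by (subst integral_distr) (use s in auto)
  also have "distr M borel (\<lambda>x. X x / s) = std_normal_distribution"
    using distributed_distr_eq_density[OF Z] by (simp cong: distr_cong)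
  finally show ?thesis by (simp add: char_std_normal_distribution power_mult_distrib)
qed

lemma weighted_char_unique:
  fixes V X :: "'a \<Rightarrow> real" and \<mu> :: "real measure"
  assumes V[measurable]: "integrable M V" and V0: "\<And>x. x \<in> space M \<Longrightarrow> 0 \<le> V x"
    and X[measurable]: "X \<in> borel_measurable M" and \<mu>: "real_distribution \<mu>"
    and char: "\<And>a. (\<integral>x. of_real (V x) * iexp (a * X x) \<partial>M) = of_real (\<integral>x. V x \<partial>M) * char \<mu> a"
    and A[measurable]: "A \<in> sets borel"
  shows "(\<integral>x. V x * indicator A (X x) \<partial>M) = (\<integral>x. V x \<partial>M) * measure \<mu> A"
proof (cases "(\<integral>x. V x \<partial>M) = 0")
  case True
  then have "AE x in M. V x = 0"
    using integral_nonneg_eq_0_iff_AE[OF V] V0 by (auto intro: AE_I2)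
  then have "(\<integral>x. V x * indicator A (X x) \<partial>M) = (\<integral>x. 0 \<partial>M)"
    by (intro integral_cong_AE) (use V in auto)
  then show ?thesis using True by simp
next
  case False
  define c where "c = (\<integral>x. V x \<partial>M)"
  have "0 \<le> c" unfolding c_def by (rule Bochner_Integration.integral_nonneg) (rule V0)
  then have c: "c > 0" using False by (simp add: c_def)
  have [measurable]: "V \<in> borel_measurable M" using V by auto
  define D where "D = density M (\<lambda>x. ennreal (V x / c))"
  have nn: "AE x in M. 0 \<le> V x / c" using V0 c by (intro AE_I2) simp
  have "emeasure D (space D) = (\<integral>\<^sup>+x. ennreal (V x / c) \<partial>M)"
    unfolding D_def by (subst emeasure_density) (auto intro!: nn_integral_cong)
  also have "\<dots> = ennreal (\<integral>x. V x / c \<partial>M)"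
    by (rule nn_integral_eq_integral) (use V nn in auto)
  also have "\<dots> = 1" using c by (simp add: c_def[symmetric])
  finally interpret D: prob_space D by (rule prob_spaceI)
  have [measurable]: "X \<in> borel_measurable D" by (simp add: D_def)
  have "distr D borel X = \<mu>"
  proof (rule Levy_uniqueness)
    show "real_distribution (distr D borel X)" by (rule D.real_distribution_distr) simp
    show "char (distr D borel X) = char \<mu>"
    proof
      fix a
      have "char (distr D borel X) a = (\<integral>x. iexp (a * X x) \<partial>D)"
        unfolding char_def by (subst integral_distr) auto
      also have "\<dots> = (\<integral>x. (V x / c) *\<^sub>R iexp (a * X x) \<partial>M)"
        unfolding D_def by (rule integral_density) (use nn in auto)
      also have "\<dots> = (\<integral>x. of_real (V x) * iexp (a * X x) / of_real c \<partial>M)"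
        by (intro Bochner_Integration.integral_cong) (auto simp: scaleR_conv_of_real)
      also have "\<dots> = char \<mu> a" using c char[of a] by (simp add: c_def[symmetric])
      finally show "char (distr D borel X) a = char \<mu> a" .
    qed
  qed (rule \<mu>)
  then have "measure \<mu> A = measure (distr D borel X) A" by simp
  also have "\<dots> = measure D (X -` A \<inter> space D)" by (rule measure_distr) simp_all
  also have "\<dots> = (\<integral>x. indicator (X -` A \<inter> space M) x \<partial>D)"
    by (simp add: D_def)
  also have "\<dots> = (\<integral>x. (V x / c) *\<^sub>R indicator (X -` A \<inter> space M) x \<partial>M)"
    unfolding D_def by (rule integral_density) (use nn in auto)
  also have "\<dots> = (\<integral>x. V x * indicator A (X x) / c \<partial>M)"
    by (intro Bochner_Integration.integral_cong) (auto simp: indicator_def)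
  finally show ?thesis using c by (simp add: c_def[symmetric] field_simps)
qed

lemma maximal_inequality:
  fixes Z :: "nat \<Rightarrow> 'a \<Rightarrow> real" and F :: "nat \<Rightarrow> 'a measure"
  assumes sub: "\<And>j. j \<le> n \<Longrightarrow> subalgebra M (F j)"
    and adapted: "\<And>i j. i \<le> j \<Longrightarrow> j \<le> n \<Longrightarrow> Z i \<in> borel_measurable (F j)"
    and sq: "\<And>j. j \<le> n \<Longrightarrow> integrable M (\<lambda>x. (Z j x)\<^sup>2)"
    and orth: "\<And>j A. j \<le> n \<Longrightarrow> A \<in> sets (F j) \<Longrightarrow> (\<integral>x. indicator A x * Z j x * (Z n x - Z j x) \<partial>M) = 0"
    and l: "0 < l"
  shows "prob {x \<in> space M. \<exists>j\<le>n. l \<le> \<bar>Z j x\<bar>} \<le> expectation (\<lambda>x. (Z n x)\<^sup>2) / l\<^sup>2"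
proof -
  have Zm[measurable]: "Z j \<in> borel_measurable M" if "j \<le> n" for j
    using adapted[of j j] that measurable_from_subalg[OF sub[OF that]] by auto
  define A where "A j = {x \<in> space M. l \<le> \<bar>Z j x\<bar> \<and> (\<forall>i<j. \<bar>Z i x\<bar> < l)}" for j
  have AF: "A j \<in> sets (F j)" if "j \<le> n" for j
  proof -
    have sp: "space (F j) = space M" using sub[OF that] by (simp add: subalgebra_def)
    have [measurable]: "Z i \<in> borel_measurable (F j)" if "i \<le> j" for i
      using adapted[OF that \<open>j \<le> n\<close>] .
    have "A j = {x \<in> space (F j). l \<le> \<bar>Z j x\<bar>} \<inter> (\<Inter>i<j. {x \<in> space (F j). \<bar>Z i x\<bar> < l}) \<inter> space (F j)"
      by (auto simp: A_def sp)
    also have "\<dots> \<in> sets (F j)"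
    proof (cases "j = 0")
      case False
      then show ?thesis by (intro sets.Int sets.finite_INT) auto
    next
      case True
      have "{x \<in> space (F j). l \<le> \<bar>Z j x\<bar>} \<in> sets (F j)" by measurable
      moreover have "{x \<in> space (F j). l \<le> \<bar>Z j x\<bar>} \<inter> (\<Inter>i<j. {x \<in> space (F j). \<bar>Z i x\<bar> < l}) \<inter> space (F j)
          = {x \<in> space (F j). l \<le> \<bar>Z j x\<bar>}" using True by auto
      ultimately show ?thesis by simp
    qed
    finally show ?thesis .
  qed
  have AM[measurable]: "A j \<in> sets M" if "j \<le> n" for j
    using AF[OF that] sub[OF that] by (auto simp: subalgebra_def)
  have disj: "disjoint_family_on A {..n}"
    unfolding disjoint_family_on_def A_def by (auto, metis linorder_neqE_nat not_less)
  have un: "{x \<in> space M. \<exists>j\<le>n. l \<le> \<bar>Z j x\<bar>} = (\<Union>j\<le>n. A j)"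
  proof (intro set_eqI iffI)
    fix x assume "x \<in> {x \<in> space M. \<exists>j\<le>n. l \<le> \<bar>Z j x\<bar>}"
    then obtain j where j: "x \<in> space M" "j \<le> n" "l \<le> \<bar>Z j x\<bar>" by auto
    define k where "k = (LEAST j. l \<le> \<bar>Z j x\<bar>)"
    have "l \<le> \<bar>Z k x\<bar>" unfolding k_def by (rule LeastI) (rule j)
    moreover have "k \<le> j" unfolding k_def by (rule Least_le) (rule j)
    moreover have "\<bar>Z i x\<bar> < l" if "i < k" for i
      using not_less_Least that unfolding k_def by (metis not_less)
    ultimately show "x \<in> (\<Union>j\<le>n. A j)" using j unfolding A_def by (intro UN_I[of k]) auto
  qed (auto simp: A_def)
  have step: "l\<^sup>2 * prob (A j) \<le> (\<integral>x. indicator (A j) x * (Z n x)\<^sup>2 \<partial>M)" if j: "j \<le> n" for j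
  proof -
    have iZ: "integrable M (\<lambda>x. Z j x * Z n x)"
      by (rule integrable_mult_of_squares) (use j in \<open>auto intro!: sq\<close>)
    have i2: "integrable M (\<lambda>x. (Z n x - Z j x)\<^sup>2)"
    proof -
      have "integrable M (\<lambda>x. (Z n x)\<^sup>2 + (Z j x)\<^sup>2 - 2 * (Z j x * Z n x))"
        using sq[OF j] sq[of n] iZ by simp
      then show ?thesis by (simp add: power2_diff ac_simps)
    qed
    have i3: "integrable M (\<lambda>x. indicator (A j) x * Z j x * (Z n x - Z j x))"
    proof -
      have "integrable M (\<lambda>x. indicator (A j) x *\<^sub>R (Z j x * Z n x - (Z j x)\<^sup>2))"
        using j by (intro integrable_mult_indicator AM Bochner_Integration.integrable_diff iZ sq)
      then show ?thesis by (simp add: algebra_simps power2_eq_square)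
    qed
    have iA: "integrable M (\<lambda>x. indicator (A j) x * (f x :: real))" if "integrable M f" for f
      using integrable_mult_indicator[OF AM[OF j] that] by simp
    have "l\<^sup>2 * prob (A j) = (\<integral>x. indicator (A j) x * l\<^sup>2 \<partial>M)" using j by simp
    also have "\<dots> \<le> (\<integral>x. indicator (A j) x * (Z j x)\<^sup>2 \<partial>M)"
    proof (rule integral_mono)
      show "integrable M (\<lambda>x. indicator (A j) x * l\<^sup>2)" by (rule iA) simp
      show "integrable M (\<lambda>x. indicator (A j) x * (Z j x)\<^sup>2)" by (rule iA[OF sq[OF j]])
      fix x
      show "indicator (A j) x * l\<^sup>2 \<le> indicator (A j) x * (Z j x)\<^sup>2"
        using l by (auto simp: A_def indicator_def abs_le_square_iff[symmetric])
    qed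
    also have "\<dots> \<le> (\<integral>x. indicator (A j) x * (Z j x)\<^sup>2 \<partial>M) + (\<integral>x. indicator (A j) x * (Z n x - Z j x)\<^sup>2 \<partial>M)"
      by (simp add: integral_nonneg_AE)
    also have "\<dots> = (\<integral>x. indicator (A j) x * (Z j x)\<^sup>2 + indicator (A j) x * (Z n x - Z j x)\<^sup>2 \<partial>M)"
      by (intro Bochner_Integration.integral_add[symmetric] iA sq j i2)
    also have "\<dots> = (\<integral>x. (indicator (A j) x * (Z j x)\<^sup>2 + indicator (A j) x * (Z n x - Z j x)\<^sup>2)
        + 2 * (indicator (A j) x * Z j x * (Z n x - Z j x)) \<partial>M)"
      using orth[OF j AF[OF j]] i3 iA[OF sq[OF j]] iA[OF i2] by simp
    also have "\<dots> = (\<integral>x. indicator (A j) x * (Z n x)\<^sup>2 \<partial>M)"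
      by (intro Bochner_Integration.integral_cong) (auto simp: power2_eq_square algebra_simps)
    finally show ?thesis .
  qed
  have "l\<^sup>2 * prob {x \<in> space M. \<exists>j\<le>n. l \<le> \<bar>Z j x\<bar>} = (\<Sum>j\<le>n. l\<^sup>2 * prob (A j))"
    unfolding un by (subst finite_measure_finite_Union[OF _ _ disj]) (auto simp: sum_distrib_left)
  also have "\<dots> \<le> (\<Sum>j\<le>n. \<integral>x. indicator (A j) x * (Z n x)\<^sup>2 \<partial>M)"
    by (intro sum_mono step) simp
  also have "\<dots> = (\<integral>x. (\<Sum>j\<le>n. indicator (A j) x * (Z n x)\<^sup>2) \<partial>M)"
    by (rule Bochner_Integration.integral_sum[symmetric])
      (use integrable_mult_indicator[OF AM sq[of n]] in auto)
  also have "\<dots> \<le> expectation (\<lambda>x. (Z n x)\<^sup>2)"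
  proof (rule integral_mono)
    show "integrable M (\<lambda>x. \<Sum>j\<le>n. indicator (A j) x * (Z n x)\<^sup>2)"
      by (rule Bochner_Integration.integrable_sum)
        (use integrable_mult_indicator[OF AM sq[of n]] in auto)
    fix x
    have "(\<Sum>j\<le>n. indicator (A j) x * (Z n x)\<^sup>2) = indicator (\<Union>j\<le>n. A j) x * (Z n x)\<^sup>2"
      using disj by (simp add: sum_distrib_right[symmetric] indicator_UN_disjoint)
    also have "\<dots> \<le> (Z n x)\<^sup>2" by (simp add: indicator_def)
    finally show "(\<Sum>j\<le>n. indicator (A j) x * (Z n x)\<^sup>2) \<le> (Z n x)\<^sup>2" .
  qed (use sq in auto)
  finally show ?thesis using l by (simp add: field_simps)
qed

end

section \<open>Brownian motion\<close>

locale brownian =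
  fixes M :: "'a measure" and F :: "real \<Rightarrow> 'a measure" and T :: real and B :: "real \<Rightarrow> 'a \<Rightarrow> real"
  assumes bm: "brownian_motion M F T B" and T_pos: "0 < T"

sublocale brownian \<subseteq> prob_space M
  using bm by (simp add: brownian_motion_def stochastic_basis_def)

context brownian
begin

lemma subalgebra_F: "subalgebra M (F t)"
  using bm by (simp add: brownian_motion_def stochastic_basis_def)

lemma space_F: "space (F t) = space M"
  using subalgebra_F[of t] by (simp add: subalgebra_def)

lemma sets_F_mono: "s \<le> t \<Longrightarrow> sets (F s) \<subseteq> sets (F t)"
  using bm by (auto simp: brownian_motion_def stochastic_basis_def filtration_def)

lemma sets_F: "A \<in> sets (F t) \<Longrightarrow> A \<in> sets M"
  using subalgebra_F[of t] by (auto simp: subalgebra_def)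

lemma measurable_F_mono: "X \<in> measurable (F s) N \<Longrightarrow> s \<le> t \<Longrightarrow> X \<in> measurable (F t) N"
  using sets_F_mono[of s t] by (auto simp: measurable_def space_F)

lemma measurable_F: "X \<in> measurable (F s) N \<Longrightarrow> X \<in> measurable M N"
  using measurable_from_subalg[OF subalgebra_F] .

lemma B_F: "0 \<le> s \<Longrightarrow> s \<le> t \<Longrightarrow> s \<le> T \<Longrightarrow> B s \<in> borel_measurable (F t)"
  using bm by (intro measurable_F_mono[of "B s" s _ t]) (auto simp: brownian_motion_def)

lemma B_M: "0 \<le> s \<Longrightarrow> s \<le> T \<Longrightarrow> B s \<in> borel_measurable M"
  using B_F[of s s] by (auto intro: measurable_F)

lemma B_cont: "\<omega> \<in> space M \<Longrightarrow> continuous_on {0..T} (\<lambda>t. B t \<omega>)"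
  using bm by (simp add: brownian_motion_def)

lemma B_0: "AE \<omega> in M. B 0 \<omega> = 0"
  using bm by (simp add: brownian_motion_def)

lemma increment_distributed:
  "0 \<le> s \<Longrightarrow> s < t \<Longrightarrow> t \<le> T \<Longrightarrow> distributed M lborel (\<lambda>\<omega>. B t \<omega> - B s \<omega>) (normal_density 0 (sqrt (t - s)))"
  using bm by (simp add: brownian_motion_def)

lemma increment_indep:
  assumes "0 \<le> s" "s < t" "t \<le> T" and V: "V \<in> measurable (F s) L"
    and f[measurable]: "f \<in> measurable borel L'"
  shows "indep_var L V L' (\<lambda>\<omega>. f (B t \<omega> - B s \<omega>))"
proof -
  have [measurable]: "B s \<in> borel_measurable M" "B t \<in> borel_measurable M"
    using assms by (auto intro: B_M)
  have ind: "indep_set (sets (F s)) (sets (vimage_algebra (space M) (\<lambda>\<omega>. B t \<omega> - B s \<omega>) borel))"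
    using bm assms by (simp add: brownian_motion_def)
  have 1: "sigma_sets (space M) {V -` A \<inter> space M |A. A \<in> sets L} \<subseteq> sets (F s)"
    by (rule sets.sigma_sets_subset[of _ "F s", unfolded space_F])
      (use measurable_sets[OF V] in \<open>auto simp: space_F\<close>)
  have "(\<lambda>\<omega>. f (B t \<omega> - B s \<omega>)) -` A \<inter> space M \<in> {(\<lambda>\<omega>. B t \<omega> - B s \<omega>) -` A \<inter> space M |A. A \<in> sets borel}"
    if "A \<in> sets L'" for A
    using measurable_sets[OF f that] by (intro CollectI exI[of _ "f -` A"]) auto
  then have 2: "sigma_sets (space M) {(\<lambda>\<omega>. f (B t \<omega> - B s \<omega>)) -` A \<inter> space M |A. A \<in> sets L'}
      \<subseteq> sets (vimage_algebra (space M) (\<lambda>\<omega>. B t \<omega> - B s \<omega>) borel)"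
    unfolding sets_vimage_algebra by (intro sigma_sets_subseteq) auto
  show ?thesis unfolding indep_var_eq
  proof (intro conjI)
    show "V \<in> measurable M L" using V by (rule measurable_F)
    show "indep_set (sigma_sets (space M) {V -` A \<inter> space M |A. A \<in> sets L})
     (sigma_sets (space M) {(\<lambda>\<omega>. f (B t \<omega> - B s \<omega>)) -` A \<inter> space M |A. A \<in> sets L'})"
      using ind 1 2 unfolding indep_sets2_eq by blast
  qed simp
qed

lemma increment_integral:
  fixes V :: "'a \<Rightarrow> 'c::{banach, second_countable_topology, real_normed_field}" and f :: "real \<Rightarrow> 'c"
  assumes st: "0 \<le> s" "s < t" "t \<le> T" and V: "V \<in> borel_measurable (F s)" "integrable M V"
    and f: "f \<in> borel_measurable borel" "integrable M (\<lambda>\<omega>. f (B t \<omega> - B s \<omega>))"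
  shows "integrable M (\<lambda>\<omega>. V \<omega> * f (B t \<omega> - B s \<omega>))"
    and "(\<integral>\<omega>. V \<omega> * f (B t \<omega> - B s \<omega>) \<partial>M) = (\<integral>\<omega>. V \<omega> \<partial>M) * (\<integral>\<omega>. f (B t \<omega> - B s \<omega>) \<partial>M)"
proof -
  note * = increment_indep[OF st V(1) f(1)]
  show "integrable M (\<lambda>\<omega>. V \<omega> * f (B t \<omega> - B s \<omega>))" by (rule indep_var_integrable[OF * V(2) f(2)])
  show "(\<integral>\<omega>. V \<omega> * f (B t \<omega> - B s \<omega>) \<partial>M) = (\<integral>\<omega>. V \<omega> \<partial>M) * (\<integral>\<omega>. f (B t \<omega> - B s \<omega>) \<partial>M)"
    by (rule indep_var_lebesgue_integral[OF * V(2) f(2)])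
qed

lemma increment_moments:
  assumes "0 \<le> s" "s \<le> t" "t \<le> T"
  shows "integrable M (\<lambda>\<omega>. B t \<omega> - B s \<omega>)" "expectation (\<lambda>\<omega>. B t \<omega> - B s \<omega>) = 0"
    "integrable M (\<lambda>\<omega>. (B t \<omega> - B s \<omega>)\<^sup>2)" "expectation (\<lambda>\<omega>. (B t \<omega> - B s \<omega>)\<^sup>2) = t - s"
    "integrable M (\<lambda>\<omega>. exp (c * (B t \<omega> - B s \<omega>)))"
    "expectation (\<lambda>\<omega>. exp (c * (B t \<omega> - B s \<omega>))) = exp (c\<^sup>2 * (t - s) / 2)"
    "integrable M (\<lambda>\<omega>. (B t \<omega> - B s \<omega>) * exp (c * (B t \<omega> - B s \<omega>)))"
    "expectation (\<lambda>\<omega>. (B t \<omega> - B s \<omega>) * exp (c * (B t \<omega> - B s \<omega>))) = c * (t - s) * exp (c\<^sup>2 * (t - s) / 2)"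
proof -
  show "integrable M (\<lambda>\<omega>. B t \<omega> - B s \<omega>)" "expectation (\<lambda>\<omega>. B t \<omega> - B s \<omega>) = 0"
    "integrable M (\<lambda>\<omega>. (B t \<omega> - B s \<omega>)\<^sup>2)" "expectation (\<lambda>\<omega>. (B t \<omega> - B s \<omega>)\<^sup>2) = t - s"
    using normal_moments(1-4)[OF increment_distributed[of s t]] assms prob_space
    by (cases "s = t"; simp)+
  show "integrable M (\<lambda>\<omega>. exp (c * (B t \<omega> - B s \<omega>)))"
    "expectation (\<lambda>\<omega>. exp (c * (B t \<omega> - B s \<omega>))) = exp (c\<^sup>2 * (t - s) / 2)"
    "integrable M (\<lambda>\<omega>. (B t \<omega> - B s \<omega>) * exp (c * (B t \<omega> - B s \<omega>)))"
    "expectation (\<lambda>\<omega>. (B t \<omega> - B s \<omega>) * exp (c * (B t \<omega> - B s \<omega>))) = c * (t - s) * exp (c\<^sup>2 * (t - s) / 2)"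
    using normal_moments(5-8)[OF increment_distributed[of s t], of c] assms prob_space
    by (cases "s = t"; simp)+
qed

lemma increment_mult:
  fixes V :: "'a \<Rightarrow> real"
  assumes "0 \<le> s" "s \<le> t" "t \<le> T" and V: "V \<in> borel_measurable (F s)" "integrable M V"
  shows "integrable M (\<lambda>\<omega>. V \<omega> * (B t \<omega> - B s \<omega>))" "(\<integral>\<omega>. V \<omega> * (B t \<omega> - B s \<omega>) \<partial>M) = 0"
    "integrable M (\<lambda>\<omega>. V \<omega> * (B t \<omega> - B s \<omega>)\<^sup>2)" "(\<integral>\<omega>. V \<omega> * (B t \<omega> - B s \<omega>)\<^sup>2 \<partial>M) = expectation V * (t - s)"
proof -
  have "integrable M (\<lambda>\<omega>. V \<omega> * (B t \<omega> - B s \<omega>)) \<and> (\<integral>\<omega>. V \<omega> * (B t \<omega> - B s \<omega>) \<partial>M) = 0 \<and>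
    integrable M (\<lambda>\<omega>. V \<omega> * (B t \<omega> - B s \<omega>)\<^sup>2) \<and> (\<integral>\<omega>. V \<omega> * (B t \<omega> - B s \<omega>)\<^sup>2 \<partial>M) = expectation V * (t - s)"
  proof (cases "s = t")
    case False
    then have "s < t" using assms by simp
    note * = increment_integral[OF assms(1) this assms(3) V]
    note m = increment_moments[OF assms(1-3)]
    show ?thesis using *[of "\<lambda>x. x"] *[of "\<lambda>x. x\<^sup>2"] m by simp
  qed simp
  then show "integrable M (\<lambda>\<omega>. V \<omega> * (B t \<omega> - B s \<omega>))" "(\<integral>\<omega>. V \<omega> * (B t \<omega> - B s \<omega>) \<partial>M) = 0"
    "integrable M (\<lambda>\<omega>. V \<omega> * (B t \<omega> - B s \<omega>)\<^sup>2)" "(\<integral>\<omega>. V \<omega> * (B t \<omega> - B s \<omega>)\<^sup>2 \<partial>M) = expectation V * (t - s)"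
    by auto
qed

end

section \<open>Riemann sums\<close>

lemma integral_partition:
  fixes f :: "real \<Rightarrow> real"
  assumes "\<And>j. j < m \<Longrightarrow> p j \<le> p (Suc j)" and "continuous_on {p 0..p m} f"
  shows "integral {p 0..p m} f = (\<Sum>j<m. integral {p j..p (Suc j)} f)"
  using assms
proof (induction m)
  case (Suc m)
  have mono: "p 0 \<le> p m"
    using Suc.prems(1) by (intro lift_Suc_mono_le[of "\<lambda>j. p (min j (Suc m))" 0 m, simplified]) (auto simp: min_def le_Suc_eq)
  have "continuous_on {p 0..p m} f"
    by (rule continuous_on_subset[OF Suc.prems(2)]) (use Suc.prems(1)[of m] in auto)
  then have "integral {p 0..p m} f = (\<Sum>j<m. integral {p j..p (Suc j)} f)"
    by (intro Suc.IH) (auto intro: Suc.prems)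
  moreover have "integral {p 0..p m} f + integral {p m..p (Suc m)} f = integral {p 0..p (Suc m)} f"
    by (rule Henstock_Kurzweil_Integration.integral_combine)
      (use mono Suc.prems in \<open>auto intro!: integrable_continuous_interval\<close>)
  ultimately show ?case by simp
qed simp

definition riemann_sum :: "real \<Rightarrow> real \<Rightarrow> nat \<Rightarrow> (real \<Rightarrow> real) \<Rightarrow> real" where
  "riemann_sum a b m f = (\<Sum>j<m. f (a + real (Suc j) * ((b - a) / real m))) / real m"

lemma riemann_sum_tendsto:
  fixes f :: "real \<Rightarrow> real"
  assumes ab: "a < b" and f: "continuous_on {a..b} f"
  shows "(\<lambda>m. riemann_sum a b m f) \<longlonglongrightarrow> integral {a..b} f / (b - a)"
proof (rule LIMSEQ_I)
  fix r :: real assume r: "0 < r"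
  have "uniformly_continuous_on {a..b} f" by (rule compact_uniformly_continuous) (use f in auto)
  then obtain d where d: "d > 0"
    "\<And>s t. s \<in> {a..b} \<Longrightarrow> t \<in> {a..b} \<Longrightarrow> dist s t < d \<Longrightarrow> dist (f s) (f t) < r / 2"
    using r unfolding uniformly_continuous_on_def by (metis half_gt_zero)
  have "(\<lambda>m. (b - a) * (1 / real m)) \<longlonglongrightarrow> (b - a) * 0" by (intro tendsto_intros lim_1_over_n)
  then have "\<forall>\<^sub>F m in sequentially. (b - a) * (1 / real m) < d" using d order_tendstoD(2)[of _ 0] by simp
  then have "\<forall>\<^sub>F m in sequentially. norm (riemann_sum a b m f - integral {a..b} f / (b - a)) < r"
    using eventually_gt_at_top[of 0]
  proof eventually_elim
    case (elim m)
    define h where "h = (b - a) / real m"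
    define p where "p j = a + real j * h" for j
    have h: "0 < h" "h < d" "h * real m = b - a" using elim ab by (auto simp: h_def)
    have p0: "p 0 = a" and pm: "p m = b" using elim by (auto simp: p_def h_def)
    have psuc: "p (Suc j) = p j + h" for j by (simp add: p_def algebra_simps)
    have pmem: "p j \<in> {a..b}" if "j \<le> m" for j
    proof -
      have "real j * h \<le> real m * h" using that h by (intro mult_right_mono) auto
      then show ?thesis using h by (auto simp: p_def ac_simps)
    qed
    have "integral {a..b} f = (\<Sum>j<m. integral {p j..p (Suc j)} f)"
      using integral_partition[of m p f] f h by (simp add: p0 pm psuc)
    then have "integral {a..b} f - h * (\<Sum>j<m. f (p (Suc j))) = (\<Sum>j<m. integral {p j..p (Suc j)} f - h * f (p (Suc j)))"
      by (simp add: sum_subtractf sum_distrib_left)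
    also have "\<dots> = (\<Sum>j<m. integral {p j..p (Suc j)} (\<lambda>u. f u - f (p (Suc j))))"
    proof (intro sum.cong refl)
      fix j assume j: "j \<in> {..<m}"
      have "{p j..p (Suc j)} \<subseteq> {a..b}" using pmem[of j] pmem[of "Suc j"] j by auto
      then have "f integrable_on {p j..p (Suc j)}"
        by (intro integrable_continuous_interval continuous_on_subset[OF f])
      then show "integral {p j..p (Suc j)} f - h * f (p (Suc j)) = integral {p j..p (Suc j)} (\<lambda>u. f u - f (p (Suc j)))"
        using h by (subst Henstock_Kurzweil_Integration.integral_diff) (auto simp: psuc)
    qed
    also have "\<bar>\<dots>\<bar> \<le> (\<Sum>j<m. r / 2 * h)"
    proof (rule order_trans[OF sum_abs], rule sum_mono)
      fix j assume j: "j \<in> {..<m}"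
      have sub: "{p j..p (Suc j)} \<subseteq> {a..b}" using pmem[of j] pmem[of "Suc j"] j by auto
      have "norm (integral {p j..p (Suc j)} (\<lambda>u. f u - f (p (Suc j)))) \<le> r / 2 * (p (Suc j) - p j)"
      proof (rule integral_bound)
        show "continuous_on {p j..p (Suc j)} (\<lambda>u. f u - f (p (Suc j)))"
          by (intro continuous_intros continuous_on_subset[OF f sub])
        fix u assume u: "u \<in> {p j..p (Suc j)}"
        have "dist (f u) (f (p (Suc j))) < r / 2"
          using u sub j pmem[of "Suc j"] h psuc[of j] by (intro d) (auto simp: dist_real_def)
        then show "norm (f u - f (p (Suc j))) \<le> r / 2" by (simp add: dist_real_def)
      qed (use psuc h in auto)
      then show "\<bar>integral {p j..p (Suc j)} (\<lambda>u. f u - f (p (Suc j)))\<bar> \<le> r / 2 * h" by (simp add: psuc)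
    qed
    also have "\<dots> = r / 2 * (b - a)" using h by (simp add: ac_simps)
    finally have *: "\<bar>integral {a..b} f - h * (\<Sum>j<m. f (p (Suc j)))\<bar> \<le> r / 2 * (b - a)" .
    have "riemann_sum a b m f = h * (\<Sum>j<m. f (p (Suc j))) / (b - a)"
      using ab by (simp add: riemann_sum_def p_def h_def)
    then have "norm (riemann_sum a b m f - integral {a..b} f / (b - a)) =
        \<bar>integral {a..b} f - h * (\<Sum>j<m. f (p (Suc j)))\<bar> / (b - a)"
      using ab by (simp add: diff_divide_distrib[symmetric] abs_minus_commute)
    also have "\<dots> \<le> r / 2" using * ab by (simp add: divide_le_eq)
    finally show ?case using r by simp
  qed
  then show "\<exists>m0. \<forall>m\<ge>m0. norm (riemann_sum a b m f - integral {a..b} f / (b - a)) < r"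
    by (simp add: eventually_sequentially)
qed

lemma riemann_sum_point_mem:
  assumes "a < b" "j < m"
  shows "a + real (Suc j) * ((b - a) / real m) \<in> {a<..b}"
proof -
  have m: "0 < real m" using assms by simp
  have "real (Suc j) * ((b - a) / real m) \<le> real m * ((b - a) / real m)"
    using assms by (intro mult_right_mono) auto
  moreover have "0 < real (Suc j) * ((b - a) / real m)" using assms by simp
  ultimately show ?thesis using m by (simp del: of_nat_Suc)
qed

lemma riemann_sum_measurable:
  fixes X :: "real \<Rightarrow> 'a \<Rightarrow> real"
  assumes ab: "a < b" and X: "\<And>u. u \<in> {a..b} \<Longrightarrow> X u \<in> borel_measurable Q"
  shows "(\<lambda>\<omega>. riemann_sum a b m (\<lambda>u. X u \<omega>)) \<in> borel_measurable Q"
  unfolding riemann_sum_def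
proof (intro borel_measurable_divide borel_measurable_const borel_measurable_sum X)
  fix j assume "j \<in> {..<m}"
  then have "a + real (Suc j) * ((b - a) / real m) \<in> {a<..b}" by (intro riemann_sum_point_mem ab) simp
  then show "a + real (Suc j) * ((b - a) / real m) \<in> {a..b}" by (simp only: greaterThanAtMost_iff atLeastAtMost_iff less_imp_le simp_thms)
qed

lemma integral_measurable:
  fixes X :: "real \<Rightarrow> 'a \<Rightarrow> real"
  assumes ab: "a \<le> b" and X: "\<And>u. u \<in> {a..b} \<Longrightarrow> X u \<in> borel_measurable Q"
    and cont: "\<And>\<omega>. \<omega> \<in> space Q \<Longrightarrow> continuous_on {a..b} (\<lambda>u. X u \<omega>)"
  shows "(\<lambda>\<omega>. integral {a..b} (\<lambda>u. X u \<omega>)) \<in> borel_measurable Q"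
proof (cases "a = b")
  case False
  then have ab: "a < b" using ab by simp
  have "(\<lambda>\<omega>. integral {a..b} (\<lambda>u. X u \<omega>) / (b - a)) \<in> borel_measurable Q"
  proof (rule borel_measurable_LIMSEQ_real)
    show "(\<lambda>m. riemann_sum a b m (\<lambda>u. X u \<omega>)) \<longlonglongrightarrow> integral {a..b} (\<lambda>u. X u \<omega>) / (b - a)" if "\<omega> \<in> space Q" for \<omega>
      by (rule riemann_sum_tendsto[OF ab cont[OF that]])
    show "(\<lambda>\<omega>. riemann_sum a b m (\<lambda>u. X u \<omega>)) \<in> borel_measurable Q" for m
      by (rule riemann_sum_measurable[OF ab X])
  qed
  then have "(\<lambda>\<omega>. (b - a) * (integral {a..b} (\<lambda>u. X u \<omega>) / (b - a))) \<in> borel_measurable Q" by measurable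
  then show ?thesis using ab by simp
qed simp

lemma sum_squares_arith: "(\<Sum>i<m. (\<alpha> - \<beta> * real i)\<^sup>2) =
    real m * \<alpha>\<^sup>2 - \<alpha> * \<beta> * real m * (real m - 1) + \<beta>\<^sup>2 * real m * (real m - 1) * (2 * real m - 1) / 6"
  by (induction m) (simp_all add: power2_eq_square field_simps)

lemma sum_by_parts_increments:
  fixes x :: "nat \<Rightarrow> real"
  shows "(\<Sum>i<m. (real m - real i) * (x (Suc i) - x i)) = (\<Sum>j<m. x (Suc j)) - real m * x 0"
proof (induction m)
  case (Suc m)
  have "(\<Sum>i<Suc m. (real (Suc m) - real i) * (x (Suc i) - x i))
      = (\<Sum>i<m. (real m - real i) * (x (Suc i) - x i)) + (\<Sum>i<Suc m. x (Suc i) - x i)"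
    by (simp add: sum.distrib[symmetric] algebra_simps)
  also have "(\<Sum>i<Suc m. x (Suc i) - x i) = x (Suc m) - x 0" by (rule sum_lessThan_telescope)
  finally show ?case using Suc by (simp add: algebra_simps)
qed simp

section \<open>The bridge functional\<close>

abbreviation normal_law :: "real \<Rightarrow> real measure" where
  "normal_law v \<equiv> density lborel (normal_density 0 (sqrt v))"

lemma real_distribution_normal_law: "0 < v \<Longrightarrow> real_distribution (normal_law v)"
  by (simp add: real_distribution_def real_distribution_axioms_def prob_space_normal_density)

lemma char_normal_law:
  assumes "0 < v"
  shows "char (normal_law v) c = of_real (exp (- (c\<^sup>2 * v / 2)))"
proof -
  interpret prob_space "normal_law v" using assms by (intro prob_space_normal_density) simp
  have "distributed (normal_law v) lborel (\<lambda>x. x) (normal_density 0 (sqrt v))"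
    unfolding distributed_def by (auto simp: distr_id2)
  then show ?thesis using normal_char[of "\<lambda>x. x" "sqrt v" c] assms by (simp add: char_def)
qed

context brownian
begin

definition bridge :: "real \<Rightarrow> real \<Rightarrow> 'a \<Rightarrow> real" where
  "bridge s t \<omega> = integral {s..t} (\<lambda>u. B u \<omega>) / (t - s) - (B s \<omega> + B t \<omega>) / 2"

lemma bridge_measurable:
  assumes "0 \<le> s" "s < t" "t \<le> T"
  shows "bridge s t \<in> borel_measurable (F t)"
proof -
  have [measurable]: "B s \<in> borel_measurable (F t)" "B t \<in> borel_measurable (F t)" using assms by (auto intro: B_F)
  have [measurable]: "(\<lambda>\<omega>. integral {s..t} (\<lambda>u. B u \<omega>)) \<in> borel_measurable (F t)"
  proof (rule integral_measurable)
    show "continuous_on {s..t} (\<lambda>u. B u \<omega>)" if "\<omega> \<in> space (F t)" for \<omega>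
      using B_cont[of \<omega>] that assms by (auto simp: space_F intro: continuous_on_subset)
  qed (use assms in \<open>auto intro: B_F\<close>)
  show ?thesis unfolding bridge_def by measurable
qed

lemma char_increments:
  fixes V :: "'a \<Rightarrow> complex"
  assumes p: "0 \<le> p 0" "p m \<le> T" "\<And>i. i < m \<Longrightarrow> p i < p (Suc i)"
    and V: "V \<in> borel_measurable (F (p 0))" "integrable M V"
  shows "integrable M (\<lambda>\<omega>. V \<omega> * iexp (\<Sum>i<m. c i * (B (p (Suc i)) \<omega> - B (p i) \<omega>)))
    \<and> (\<integral>\<omega>. V \<omega> * iexp (\<Sum>i<m. c i * (B (p (Suc i)) \<omega> - B (p i) \<omega>)) \<partial>M)
      = (\<integral>\<omega>. V \<omega> \<partial>M) * of_real (exp (- (\<Sum>i<m. (c i)\<^sup>2 * (p (Suc i) - p i)) / 2))"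
  using p
proof (induction m)
  case (Suc m)
  have mono: "p i \<le> p j" if "i \<le> j" "j \<le> Suc m" for i j
    using that
  proof (induction j rule: dec_induct)
    case (step k)
    then show ?case using Suc.prems(3)[of k] by simp
  qed simp
  have pm: "0 \<le> p m" "p m < p (Suc m)" "p (Suc m) \<le> T" using Suc.prems mono[of 0 m] by auto
  define V' where "V' \<omega> = V \<omega> * iexp (\<Sum>i<m. c i * (B (p (Suc i)) \<omega> - B (p i) \<omega>))" for \<omega>
  have IH: "integrable M V'"
    "(\<integral>\<omega>. V' \<omega> \<partial>M) = (\<integral>\<omega>. V \<omega> \<partial>M) * of_real (exp (- (\<Sum>i<m. (c i)\<^sup>2 * (p (Suc i) - p i)) / 2))"
    using Suc.IH Suc.prems pm unfolding V'_def by auto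
  have [measurable]: "V \<in> borel_measurable (F (p m))"
    by (rule measurable_F_mono[OF V(1)]) (rule mono, auto)
  have "(\<lambda>\<omega>. c i * (B (p (Suc i)) \<omega> - B (p i) \<omega>)) \<in> borel_measurable (F (p m))" if "i < m" for i
  proof -
    have "0 \<le> p i" "p i \<le> p m" "p (Suc i) \<le> p m" "p i \<le> p (Suc i)" using mono[of 0 i] mono[of i m] mono[of "Suc i" m] mono[of i "Suc i"] that Suc.prems(1) by auto
    then have [measurable]: "B (p (Suc i)) \<in> borel_measurable (F (p m))" "B (p i) \<in> borel_measurable (F (p m))"
      using pm by (auto intro!: B_F)
    show ?thesis by measurable
  qed
  then have [measurable]: "(\<lambda>\<omega>. \<Sum>i<m. c i * (B (p (Suc i)) \<omega> - B (p i) \<omega>)) \<in> borel_measurable (F (p m))"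
    by (intro borel_measurable_sum) auto
  have V': "V' \<in> borel_measurable (F (p m))" unfolding V'_def by measurable
  have [measurable]: "B (p m) \<in> borel_measurable M" "B (p (Suc m)) \<in> borel_measurable M" using pm by (auto intro: B_M)
  have ii: "integrable M (\<lambda>\<omega>. iexp (c m * (B (p (Suc m)) \<omega> - B (p m) \<omega>)))"
    by (rule integrable_const_bound[where B=1]) auto
  note st = increment_integral[OF pm V' IH(1), where f="\<lambda>x. iexp (c m * x)", OF _ ii]
  have ch: "(\<integral>\<omega>. iexp (c m * (B (p (Suc m)) \<omega> - B (p m) \<omega>)) \<partial>M) = of_real (exp (- ((c m)\<^sup>2 * (p (Suc m) - p m)) / 2))"
    using normal_char[OF increment_distributed[OF pm], of "c m"] pm by simp
  have eq: "V \<omega> * iexp (\<Sum>i<Suc m. c i * (B (p (Suc i)) \<omega> - B (p i) \<omega>)) = V' \<omega> * iexp (c m * (B (p (Suc m)) \<omega> - B (p m) \<omega>))" for \<omega>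
    by (simp add: V'_def distrib_left exp_add)
  show ?case unfolding eq
  proof (intro conjI)
    show "integrable M (\<lambda>\<omega>. V' \<omega> * iexp (c m * (B (p (Suc m)) \<omega> - B (p m) \<omega>)))" by (rule st(1)) measurable
    have "(\<integral>\<omega>. V' \<omega> * iexp (c m * (B (p (Suc m)) \<omega> - B (p m) \<omega>)) \<partial>M)
        = (\<integral>\<omega>. V' \<omega> \<partial>M) * (\<integral>\<omega>. iexp (c m * (B (p (Suc m)) \<omega> - B (p m) \<omega>)) \<partial>M)"
      by (rule st(2)) measurable
    also have "\<dots> = (\<integral>\<omega>. V \<omega> \<partial>M) * of_real (exp (- (\<Sum>i<m. (c i)\<^sup>2 * (p (Suc i) - p i)) / 2)
        * exp (- ((c m)\<^sup>2 * (p (Suc m) - p m)) / 2))"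
      unfolding ch IH(2) by simp
    also have "exp (- (\<Sum>i<m. (c i)\<^sup>2 * (p (Suc i) - p i)) / 2) * exp (- ((c m)\<^sup>2 * (p (Suc m) - p m)) / 2)
        = exp (- (\<Sum>i<Suc m. (c i)\<^sup>2 * (p (Suc i) - p i)) / 2)"
      by (simp add: exp_add[symmetric] add_divide_distrib)
    finally show "(\<integral>\<omega>. V' \<omega> * iexp (c m * (B (p (Suc m)) \<omega> - B (p m) \<omega>)) \<partial>M)
        = (\<integral>\<omega>. V \<omega> \<partial>M) * of_real (exp (- (\<Sum>i<Suc m. (c i)\<^sup>2 * (p (Suc i) - p i)) / 2))" .
  qed
qed (use V in simp)

lemma char_increment_bridge:
  assumes st: "0 \<le> s" "s < t" "t \<le> T" and D: "D \<in> sets (F s)"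
  shows "(\<integral>\<omega>. of_real (indicator D \<omega>) * iexp (a * (B t \<omega> - B s \<omega>) + b * bridge s t \<omega>) \<partial>M)
    = of_real (prob D) * of_real (exp (- ((a\<^sup>2 + b\<^sup>2 / 12) * (t - s) / 2)))"
proof -
  define h where "h m = (t - s) / real m" for m
  define p where "p m j = s + real j * h m" for m j
  define c where "c m i = (a + b / 2) - (b / real m) * real i" for m i
  define Y where "Y m \<omega> = a * (B t \<omega> - B s \<omega>) + b * (riemann_sum s t m (\<lambda>u. B u \<omega>) - (B s \<omega> + B t \<omega>) / 2)" for m \<omega>
  have DM[measurable]: "D \<in> sets M" using D by (rule sets_F)
  have Ym: "Y m \<omega> = (\<Sum>i<m. c m i * (B (p m (Suc i)) \<omega> - B (p m i) \<omega>))" if m: "0 < m" for m \<omega>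
  proof -
    have pm: "p m m = t" "p m 0 = s" using m by (auto simp: p_def h_def)
    have "(\<Sum>i<m. (real m - real i) * (B (p m (Suc i)) \<omega> - B (p m i) \<omega>)) = (\<Sum>j<m. B (p m (Suc j)) \<omega>) - real m * B s \<omega>"
      using sum_by_parts_increments[of m "\<lambda>i. B (p m i) \<omega>"] by (simp add: pm)
    also have "(\<Sum>j<m. B (p m (Suc j)) \<omega>) = real m * riemann_sum s t m (\<lambda>u. B u \<omega>)"
      using m by (simp add: riemann_sum_def p_def h_def)
    finally have 1: "(\<Sum>i<m. (real m - real i) * (B (p m (Suc i)) \<omega> - B (p m i) \<omega>)) = real m * riemann_sum s t m (\<lambda>u. B u \<omega>) - real m * B s \<omega>" .
    have 2: "(\<Sum>i<m. B (p m (Suc i)) \<omega> - B (p m i) \<omega>) = B t \<omega> - B s \<omega>"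
      using sum_lessThan_telescope[of "\<lambda>i. B (p m i) \<omega>" m] by (simp add: pm)
    have "c m i * x = (a - b / 2) * x + (b / real m) * ((real m - real i) * x)" for i x
      using m by (simp add: c_def field_simps)
    then have "(\<Sum>i<m. c m i * (B (p m (Suc i)) \<omega> - B (p m i) \<omega>)) = (a - b / 2) * (B t \<omega> - B s \<omega>)
      + (b / real m) * (real m * riemann_sum s t m (\<lambda>u. B u \<omega>) - real m * B s \<omega>)"
      by (simp only: sum.distrib sum_distrib_left[symmetric] 1 2)
    also have "(b / real m) * (real m * riemann_sum s t m (\<lambda>u. B u \<omega>) - real m * B s \<omega>) = b * (riemann_sum s t m (\<lambda>u. B u \<omega>) - B s \<omega>)"
      using m by (simp add: right_diff_distrib)
    finally show ?thesis by (simp add: Y_def algebra_simps add_divide_distrib)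
  qed
  have bm: "bridge s t \<in> borel_measurable M" by (rule measurable_F[OF bridge_measurable[OF st]])
  have [measurable]: "B s \<in> borel_measurable M" "B t \<in> borel_measurable M" using st by (auto intro: B_M)
  have "(\<lambda>m. \<integral>\<omega>. of_real (indicator D \<omega>) * iexp (Y m \<omega>) \<partial>M) \<longlonglongrightarrow>
      (\<integral>\<omega>. of_real (indicator D \<omega>) * iexp (a * (B t \<omega> - B s \<omega>) + b * bridge s t \<omega>) \<partial>M)"
  proof (rule integral_dominated_convergence[where w="\<lambda>_. 1"])
    have [measurable]: "(\<lambda>\<omega>. riemann_sum s t m (\<lambda>u. B u \<omega>)) \<in> borel_measurable M" for m
      by (rule riemann_sum_measurable[OF st(2) B_M]) (use st in auto)
    show "(\<lambda>\<omega>. complex_of_real (indicat_real D \<omega>) * iexp (Y m \<omega>)) \<in> borel_measurable M" for m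
      unfolding Y_def by measurable
    show "(\<lambda>\<omega>. complex_of_real (indicat_real D \<omega>) * iexp (a * (B t \<omega> - B s \<omega>) + b * bridge s t \<omega>)) \<in> borel_measurable M"
      using bm by measurable
    show "AE \<omega> in M. (\<lambda>m. complex_of_real (indicat_real D \<omega>) * iexp (Y m \<omega>)) \<longlonglongrightarrow>
        complex_of_real (indicat_real D \<omega>) * iexp (a * (B t \<omega> - B s \<omega>) + b * bridge s t \<omega>)"
    proof (rule AE_I2)
      fix \<omega> assume "\<omega> \<in> space M"
      then have "continuous_on {s..t} (\<lambda>u. B u \<omega>)"
        using B_cont[of \<omega>] st by (auto intro: continuous_on_subset)
      then show "(\<lambda>m. complex_of_real (indicat_real D \<omega>) * iexp (Y m \<omega>)) \<longlonglongrightarrow>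
        complex_of_real (indicat_real D \<omega>) * iexp (a * (B t \<omega> - B s \<omega>) + b * bridge s t \<omega>)"
        unfolding Y_def bridge_def by (intro tendsto_intros riemann_sum_tendsto st)
    qed
  qed (auto simp: norm_mult indicator_def)
  moreover have "(\<lambda>m. \<integral>\<omega>. of_real (indicator D \<omega>) * iexp (Y m \<omega>) \<partial>M) \<longlonglongrightarrow>
      of_real (prob D) * of_real (exp (- ((a\<^sup>2 + b\<^sup>2 / 12) * (t - s) / 2)))"
  proof (rule Lim_transform_eventually)
    define v where "v m = (\<Sum>i<m. (c m i)\<^sup>2 * h m)" for m
    have v: "v m = (t - s) * ((a + b / 2)\<^sup>2 - (a + b / 2) * b * (1 - 1 / real m) + b\<^sup>2 * (1 - 1 / real m) * (2 - 1 / real m) / 6)"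
      if "0 < m" for m
    proof -
      have "v m = (\<Sum>i<m. (c m i)\<^sup>2) * h m" by (simp add: v_def sum_distrib_right)
      also have "(\<Sum>i<m. (c m i)\<^sup>2) = real m * (a + b / 2)\<^sup>2 - (a + b / 2) * (b / real m) * real m * (real m - 1)
          + (b / real m)\<^sup>2 * real m * (real m - 1) * (2 * real m - 1) / 6"
        unfolding c_def by (rule sum_squares_arith)
      also have "\<dots> * h m = (t - s) * ((a + b / 2)\<^sup>2 - (a + b / 2) * b * ((real m - 1) / real m) + b\<^sup>2 * ((real m - 1) / real m) * ((2 * real m - 1) / real m) / 6)"
        using that by (simp add: h_def power2_eq_square field_simps)
      also have "(real m - 1) / real m = 1 - 1 / real m" using that by (simp add: field_simps)
      also have "(2 * real m - 1) / real m = 2 - 1 / real m" using that by (simp add: field_simps)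
      finally show ?thesis .
    qed
    have "(\<lambda>m. (t - s) * ((a + b / 2)\<^sup>2 - (a + b / 2) * b * (1 - 1 / real m) + b\<^sup>2 * (1 - 1 / real m) * (2 - 1 / real m) / 6))
      \<longlonglongrightarrow> (t - s) * ((a + b / 2)\<^sup>2 - (a + b / 2) * b * (1 - 0) + b\<^sup>2 * (1 - 0) * (2 - 0) / 6)"
      by (intro tendsto_intros lim_1_over_n) auto
    also have "(t - s) * ((a + b / 2)\<^sup>2 - (a + b / 2) * b * (1 - 0) + b\<^sup>2 * (1 - 0) * (2 - 0) / 6) = (a\<^sup>2 + b\<^sup>2 / 12) * (t - s)"
      by (simp add: power2_eq_square field_simps)
    finally have "v \<longlonglongrightarrow> (a\<^sup>2 + b\<^sup>2 / 12) * (t - s)"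
      by (rule Lim_transform_eventually) (use eventually_gt_at_top[of 0] in \<open>eventually_elim, simp add: v\<close>)
    then show "(\<lambda>m. of_real (prob D) * of_real (exp (- (v m / 2)))) \<longlonglongrightarrow>
      of_real (prob D) * complex_of_real (exp (- ((a\<^sup>2 + b\<^sup>2 / 12) * (t - s) / 2)))"
      by (intro tendsto_intros) simp_all
    have lim: "(\<integral>\<omega>. of_real (indicator D \<omega>) * iexp (Y m \<omega>) \<partial>M) = of_real (prob D) * of_real (exp (- (v m / 2)))" if m: "0 < m" for m
    proof -
      have "h m > 0" using st m by (simp add: h_def)
      then have p: "p m 0 = s" "p m m = t" "p m i < p m (Suc i)" "p m (Suc i) - p m i = h m" for i
      proof -
        have "real m * h m = t - s" using m by (simp add: h_def)
        then show "p m 0 = s" "p m m = t" "p m i < p m (Suc i)" "p m (Suc i) - p m i = h m"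
          using \<open>h m > 0\<close> by (simp_all add: p_def distrib_right)
      qed
      have "(\<lambda>\<omega>. complex_of_real (indicator D \<omega>)) \<in> borel_measurable (F (p m 0))"
        using D unfolding p by measurable
      moreover have "integrable M (\<lambda>\<omega>. complex_of_real (indicator D \<omega>))"
        by (rule integrable_const_bound[where B=1]) (auto simp: indicator_def)
      ultimately have "(\<integral>\<omega>. of_real (indicator D \<omega>) * iexp (\<Sum>i<m. c m i * (B (p m (Suc i)) \<omega> - B (p m i) \<omega>)) \<partial>M)
        = (\<integral>\<omega>. of_real (indicator D \<omega>) \<partial>M) * of_real (exp (- (\<Sum>i<m. (c m i)\<^sup>2 * (p m (Suc i) - p m i)) / 2))"
        using char_increments[of "p m" m "\<lambda>\<omega>. of_real (indicator D \<omega>)" "c m"] st p by auto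
      then show ?thesis by (simp add: Ym[OF m] p v_def)
    qed
    show "\<forall>\<^sub>F m in sequentially. of_real (prob D) * of_real (exp (- (v m / 2))) = (\<integral>\<omega>. of_real (indicator D \<omega>) * iexp (Y m \<omega>) \<partial>M)"
      using eventually_gt_at_top[of "0::nat"]
    proof eventually_elim
      case (elim m)
      show ?case using lim[OF elim] by simp
    qed
  qed
  ultimately show ?thesis by (rule LIMSEQ_unique)
qed

lemma bridge_law:
  assumes st: "0 \<le> s" "s < t" "t \<le> T" and D: "D \<in> sets (F s)"
    and A[measurable]: "A \<in> sets borel" "C \<in> sets borel"
  shows "prob {\<omega> \<in> D. B t \<omega> - B s \<omega> \<in> A \<and> sqrt 12 * bridge s t \<omega> \<in> C}
    = prob D * (measure (normal_law (t - s)) A * measure (normal_law (t - s)) C)"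
proof -
  define X where "X \<omega> = B t \<omega> - B s \<omega>" for \<omega>
  define U where "U \<omega> = sqrt 12 * bridge s t \<omega>" for \<omega>
  define g where "g c = exp (- (c\<^sup>2 * (t - s) / 2))" for c :: real
  have DM[measurable]: "D \<in> sets M" using D by (rule sets_F)
  have [measurable]: "B s \<in> borel_measurable M" "B t \<in> borel_measurable M" "bridge s t \<in> borel_measurable M"
    using st by (auto intro: B_M measurable_F[OF bridge_measurable])
  have [measurable]: "X \<in> borel_measurable M" "U \<in> borel_measurable M" unfolding X_def U_def by measurable
  have rd: "real_distribution (normal_law (t - s))" using st by (intro real_distribution_normal_law) simp
  have ch: "char (normal_law (t - s)) c = of_real (g c)" for c
    using char_normal_law[of "t - s" c] st by (simp add: g_def)
  have E: "(\<integral>\<omega>. of_real (indicator D \<omega>) * iexp (a * X \<omega> + b * U \<omega>) \<partial>M) = of_real (prob D * g a * g b)" for a b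
    using char_increment_bridge[OF st D, of a "b * sqrt 12"]
    by (simp add: X_def U_def g_def mult.assoc power_mult_distrib exp_add[symmetric] add_divide_distrib distrib_right)
  have intr: "integrable M (\<lambda>\<omega>. indicator D \<omega> * f \<omega>)" if [measurable]: "f \<in> borel_measurable M" and "\<And>\<omega>. \<bar>f \<omega>\<bar> \<le> 2" for f :: "'a \<Rightarrow> real"
    by (rule integrable_const_bound[where B=2]) (use that(2) in \<open>auto simp: abs_mult indicator_def\<close>)
  define e where "e a b \<omega> = complex_of_real (indicator D \<omega>) * iexp (a * X \<omega> + b * U \<omega>)" for a b \<omega>
  have ie: "integrable M (e a b)" for a b
    unfolding e_def by (rule integrable_const_bound[where B=1]) (auto simp: norm_mult indicator_def)
  have Ee: "(\<integral>\<omega>. e a b \<omega> \<partial>M) = of_real (prob D * g a * g b)" for a b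
    using E[of a b] by (simp add: e_def)
  have split: "e a b \<omega> = complex_of_real (indicator D \<omega>) * (iexp (a * X \<omega>) * iexp (b * U \<omega>))" for a b \<omega>
    by (simp add: e_def distrib_left exp_add)
  have cosE: "(\<integral>\<omega>. of_real (indicator D \<omega> * (1 + cos (b * U \<omega>))) * iexp (a * X \<omega>) \<partial>M) = of_real (prob D * g a * (1 + g b))" for a b
  proof -
    have "of_real (indicator D \<omega> * (1 + cos (b * U \<omega>))) * iexp (a * X \<omega>)
      = e a 0 \<omega> + (e a b \<omega> + e a (- b) \<omega>) / 2" for \<omega>
    proof -
      have c: "complex_of_real (cos (b * U \<omega>)) = (iexp (b * U \<omega>) + iexp (- b * U \<omega>)) / 2"
        by (simp add: cos_of_real[symmetric] cos_exp_eq)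
      show ?thesis unfolding split of_real_mult of_real_add c of_real_1 by (simp add: distrib_left distrib_right)
    qed
    then have "(\<integral>\<omega>. of_real (indicator D \<omega> * (1 + cos (b * U \<omega>))) * iexp (a * X \<omega>) \<partial>M) =
      (\<integral>\<omega>. e a 0 \<omega> + (e a b \<omega> + e a (- b) \<omega>) / 2 \<partial>M)" by presburger
    also have "\<dots> = of_real (prob D * g a * g 0) + (of_real (prob D * g a * g b) + of_real (prob D * g a * g (- b))) / 2"
      using ie Ee by simp
    also have "\<dots> = of_real (prob D * g a * (1 + g b))" by (simp add: g_def distrib_left)
    finally show ?thesis .
  qed
  have sinE: "(\<integral>\<omega>. of_real (indicator D \<omega> * (1 + sin (b * U \<omega>))) * iexp (a * X \<omega>) \<partial>M) = of_real (prob D * g a)" for a b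
  proof -
    have "of_real (indicator D \<omega> * (1 + sin (b * U \<omega>))) * iexp (a * X \<omega>)
      = e a 0 \<omega> + (e a b \<omega> - e a (- b) \<omega>) / (2 * \<i>)" for \<omega>
    proof -
      have c: "complex_of_real (sin (b * U \<omega>)) = (iexp (b * U \<omega>) - iexp (- b * U \<omega>)) / (2 * \<i>)"
        by (simp add: sin_of_real[symmetric] sin_exp_eq)
      show ?thesis unfolding split of_real_mult of_real_add c of_real_1
        by (simp add: distrib_left distrib_right left_diff_distrib right_diff_distrib diff_divide_distrib mult_ac)
    qed
    then have "(\<integral>\<omega>. of_real (indicator D \<omega> * (1 + sin (b * U \<omega>))) * iexp (a * X \<omega>) \<partial>M) =
      (\<integral>\<omega>. e a 0 \<omega> + (e a b \<omega> - e a (- b) \<omega>) / (2 * \<i>) \<partial>M)" by presburger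
    also have "\<dots> = of_real (prob D * g a * g 0) + (of_real (prob D * g a * g b) - of_real (prob D * g a * g (- b))) / (2 * \<i>)"
      using ie Ee by simp
    also have "\<dots> = of_real (prob D * g a)" by (simp add: g_def)
    finally show ?thesis .
  qed
  define \<nu> where "\<nu> = measure (normal_law (t - s))"
  have to_real: "(\<integral>\<omega>. f \<omega> \<partial>M) = y" if "(\<integral>\<omega>. of_real (f \<omega>) * iexp (0 * X \<omega>) \<partial>M) = of_real y" for f :: "'a \<Rightarrow> real" and y
    using that by (simp add: of_real_eq_iff)
  have cos0: "(\<integral>\<omega>. indicator D \<omega> * (1 + cos (b * U \<omega>)) \<partial>M) = prob D * (1 + g b)" for b
    by (rule to_real, unfold cosE) (simp add: g_def)
  have sin0: "(\<integral>\<omega>. indicator D \<omega> * (1 + sin (b * U \<omega>)) \<partial>M) = prob D" for b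
    by (rule to_real, unfold sinE) (simp add: g_def)
  have bd: "\<bar>1 + cos x\<bar> \<le> 2" "\<bar>1 + sin x\<bar> \<le> 2" "0 \<le> 1 + cos x" "0 \<le> 1 + sin x" for x :: real
    using cos_le_one[of x] sin_le_one[of x] cos_ge_minus_one[of x] sin_ge_minus_one[of x] by linarith+
  have cosA: "(\<integral>\<omega>. indicator D \<omega> * (1 + cos (b * U \<omega>)) * indicator A (X \<omega>) \<partial>M) = prob D * (1 + g b) * \<nu> A" for b
    unfolding \<nu>_def cos0[symmetric]
  proof (rule weighted_char_unique[OF intr _ _ rd _ A(1)])
    show "(\<integral>\<omega>. of_real (indicator D \<omega> * (1 + cos (b * U \<omega>))) * iexp (a * X \<omega>) \<partial>M) =
      of_real (\<integral>\<omega>. indicator D \<omega> * (1 + cos (b * U \<omega>)) \<partial>M) * char (normal_law (t - s)) a" for a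
      unfolding cosE cos0 ch by simp
  qed (use bd in simp_all)
  have sinA: "(\<integral>\<omega>. indicator D \<omega> * (1 + sin (b * U \<omega>)) * indicator A (X \<omega>) \<partial>M) = prob D * \<nu> A" for b
  proof -
    have "(\<integral>\<omega>. indicator D \<omega> * (1 + sin (b * U \<omega>)) * indicator A (X \<omega>) \<partial>M)
        = (\<integral>\<omega>. indicator D \<omega> * (1 + sin (b * U \<omega>)) \<partial>M) * measure (normal_law (t - s)) A"
    proof (rule weighted_char_unique[OF intr _ _ rd _ A(1)])
      show "(\<integral>\<omega>. of_real (indicator D \<omega> * (1 + sin (b * U \<omega>))) * iexp (a * X \<omega>) \<partial>M) =
        of_real (\<integral>\<omega>. indicator D \<omega> * (1 + sin (b * U \<omega>)) \<partial>M) * char (normal_law (t - s)) a" for a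
        unfolding sinE sin0 ch by simp
    qed (use bd in simp_all)
    then show ?thesis by (simp only: sin0 \<nu>_def)
  qed
  define V where "V \<omega> = indicator D \<omega> * (indicator A (X \<omega>) :: real)" for \<omega>
  have [measurable]: "V \<in> borel_measurable M" unfolding V_def by measurable
  have iV: "integrable M (\<lambda>\<omega>. V \<omega> * f \<omega>)" if [measurable]: "f \<in> borel_measurable M" and "\<And>\<omega>. \<bar>f \<omega>\<bar> \<le> 1" for f :: "'a \<Rightarrow> real"
    by (rule integrable_const_bound[where B=1]) (use that(2) in \<open>auto simp: abs_mult V_def indicator_def\<close>)
  have iV1: "integrable M V" using iV[of "\<lambda>_. 1"] by simp
  have V1: "(\<integral>\<omega>. V \<omega> \<partial>M) = prob D * \<nu> A"
    using sinA[of 0] by (simp add: V_def)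
  have Vcos: "(\<integral>\<omega>. V \<omega> * cos (b * U \<omega>) \<partial>M) = prob D * \<nu> A * g b" for b
  proof -
    have "(\<integral>\<omega>. V \<omega> + V \<omega> * cos (b * U \<omega>) \<partial>M) = prob D * (1 + g b) * \<nu> A"
      unfolding cosA[symmetric, of b] by (intro Bochner_Integration.integral_cong refl) (simp add: V_def algebra_simps)
    then show ?thesis using iV1 iV[of "\<lambda>\<omega>. cos (b * U \<omega>)"] V1 by (simp add: algebra_simps)
  qed
  have Vsin: "(\<integral>\<omega>. V \<omega> * sin (b * U \<omega>) \<partial>M) = 0" for b
  proof -
    have "(\<integral>\<omega>. V \<omega> + V \<omega> * sin (b * U \<omega>) \<partial>M) = prob D * \<nu> A"
      unfolding sinA[symmetric, of b] by (intro Bochner_Integration.integral_cong refl) (simp add: V_def algebra_simps)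
    then show ?thesis using iV1 iV[of "\<lambda>\<omega>. sin (b * U \<omega>)"] V1 by (simp add: algebra_simps)
  qed
  have "(\<integral>\<omega>. V \<omega> * indicator C (U \<omega>) \<partial>M) = (\<integral>\<omega>. V \<omega> \<partial>M) * measure (normal_law (t - s)) C"
  proof (rule weighted_char_unique[OF iV1 _ _ rd _ A(2)])
    fix b
    have "of_real (V \<omega>) * iexp (b * U \<omega>) = of_real (V \<omega> * cos (b * U \<omega>)) + \<i> * of_real (V \<omega> * sin (b * U \<omega>))" for \<omega>
      by (simp add: exp_Euler cos_of_real[symmetric] sin_of_real[symmetric] distrib_left)
    then have "(\<integral>\<omega>. of_real (V \<omega>) * iexp (b * U \<omega>) \<partial>M) = (\<integral>\<omega>. of_real (V \<omega> * cos (b * U \<omega>)) + \<i> * of_real (V \<omega> * sin (b * U \<omega>)) \<partial>M)"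
      by presburger
    also have "\<dots> = (\<integral>\<omega>. of_real (V \<omega> * cos (b * U \<omega>)) \<partial>M) + (\<integral>\<omega>. \<i> * of_real (V \<omega> * sin (b * U \<omega>)) \<partial>M)"
      by (intro Bochner_Integration.integral_add integrable_mult_right integrable_of_real iV) auto
    also have "(\<integral>\<omega>. complex_of_real (V \<omega> * cos (b * U \<omega>)) \<partial>M) = of_real (prob D * \<nu> A * g b)"
      by (simp only: integral_complex_of_real Vcos)
    also have "(\<integral>\<omega>. \<i> * complex_of_real (V \<omega> * sin (b * U \<omega>)) \<partial>M) = 0"
      by (simp only: integral_mult_right_zero integral_complex_of_real Vsin of_real_0 mult_zero_right)
    finally show "(\<integral>\<omega>. of_real (V \<omega>) * iexp (b * U \<omega>) \<partial>M) = of_real (\<integral>\<omega>. V \<omega> \<partial>M) * char (normal_law (t - s)) b"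
      by (simp add: V1 ch)
  qed (auto simp: V_def)
  moreover have "(\<integral>\<omega>. V \<omega> * indicator C (U \<omega>) \<partial>M) = (\<integral>\<omega>. indicator {\<omega> \<in> D. X \<omega> \<in> A \<and> U \<omega> \<in> C} \<omega> \<partial>M)"
    by (intro Bochner_Integration.integral_cong refl) (auto simp: V_def indicator_def)
  moreover have "(\<integral>\<omega>. indicator {\<omega> \<in> D. X \<omega> \<in> A \<and> U \<omega> \<in> C} \<omega> \<partial>M) = prob {\<omega> \<in> D. X \<omega> \<in> A \<and> U \<omega> \<in> C}"
  proof -
    have "{\<omega> \<in> D. X \<omega> \<in> A \<and> U \<omega> \<in> C} = D \<inter> {\<omega> \<in> space M. X \<omega> \<in> A \<and> U \<omega> \<in> C}"
      using sets.sets_into_space[OF DM] by auto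
    then have "{\<omega> \<in> D. X \<omega> \<in> A \<and> U \<omega> \<in> C} \<in> sets M" by simp
    then show ?thesis by simp
  qed
  ultimately show ?thesis by (simp add: V1 \<nu>_def X_def U_def)
qed

end

lemma measure_collect_prod_emeasure:
  assumes "finite I" "\<And>i. i \<in> I \<Longrightarrow> prob_space (L i)"
  shows "(\<Prod>i\<in>I. emeasure (L i) (A i)) = ennreal (\<Prod>i\<in>I. measure (L i) (A i))"
  using assms
  by (simp add: prod_ennreal prob_space.finite_measure finite_measure.emeasure_eq_measure cong: prod.cong)

lemma distr_PiM_eqI:
  fixes f :: "'a \<Rightarrow> 'i \<Rightarrow> real"
  assumes Q: "prob_space Q" and I: "finite I" and L: "\<And>i. i \<in> I \<Longrightarrow> real_distribution (L i)"
    and f: "\<And>i. i \<in> I \<Longrightarrow> (\<lambda>\<omega>. f \<omega> i) \<in> borel_measurable Q"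
    and eq: "\<And>A. (\<And>i. i \<in> I \<Longrightarrow> A i \<in> sets borel) \<Longrightarrow>
      measure Q {\<omega> \<in> space Q. \<forall>i\<in>I. f \<omega> i \<in> A i} = (\<Prod>i\<in>I. measure (L i) (A i))"
  shows "distr Q (\<Pi>\<^sub>M i\<in>I. borel) (\<lambda>\<omega>. \<lambda>i\<in>I. f \<omega> i) = (\<Pi>\<^sub>M i\<in>I. L i)"
proof -
  define L' where "L' i = (if i \<in> I then L i else return borel 0)" for i
  have L': "prob_space (L' i)" "sets (L' i) = sets borel" "space (L' i) = UNIV" for i
    using L[of i] real_distribution.space_eq_univ[OF L, of i]
    by (auto simp: L'_def real_distribution_def real_distribution_axioms_def prob_space_return)
  interpret Q: prob_space Q by (rule Q)
  interpret product_prob_space L' UNIV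
    unfolding product_prob_space_def product_prob_space_axioms_def product_sigma_finite_def
    using L' prob_space_imp_sigma_finite by blast
  have "distr Q (\<Pi>\<^sub>M i\<in>I. borel) (\<lambda>\<omega>. \<lambda>i\<in>I. f \<omega> i) = (\<Pi>\<^sub>M i\<in>I. L' i)"
  proof (rule PiM_eqI[OF I])
    show "sets (distr Q (\<Pi>\<^sub>M i\<in>I. borel) (\<lambda>\<omega>. \<lambda>i\<in>I. f \<omega> i)) = sets (\<Pi>\<^sub>M i\<in>I. L' i)"
      by (simp add: L' cong: sets_PiM_cong)
    fix A assume "\<And>i. i \<in> I \<Longrightarrow> A i \<in> sets (L' i)"
    then have A: "\<And>i. i \<in> I \<Longrightarrow> A i \<in> sets borel" by (simp add: L')
    have "emeasure (distr Q (\<Pi>\<^sub>M i\<in>I. borel) (\<lambda>\<omega>. \<lambda>i\<in>I. f \<omega> i)) (Pi\<^sub>E I A)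
        = emeasure Q ((\<lambda>\<omega>. \<lambda>i\<in>I. f \<omega> i) -` Pi\<^sub>E I A \<inter> space Q)"
      using f I A by (intro emeasure_distr measurable_restrict sets_PiM_I_finite) auto
    also have "(\<lambda>\<omega>. \<lambda>i\<in>I. f \<omega> i) -` Pi\<^sub>E I A \<inter> space Q = {\<omega> \<in> space Q. \<forall>i\<in>I. f \<omega> i \<in> A i}"
      by (auto simp: PiE_iff)
    also have "emeasure Q \<dots> = ennreal (\<Prod>i\<in>I. measure (L i) (A i))"
      using eq[OF A] by (simp add: Q.emeasure_eq_measure)
    also have "\<dots> = (\<Prod>i\<in>I. emeasure (L i) (A i))"
      using L by (intro measure_collect_prod_emeasure[OF I, symmetric]) (simp add: real_distribution_def)
    also have "\<dots> = (\<Prod>i\<in>I. emeasure (L' i) (A i))" by (intro prod.cong refl) (simp add: L'_def)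
    finally show "emeasure (distr Q (\<Pi>\<^sub>M i\<in>I. borel) (\<lambda>\<omega>. \<lambda>i\<in>I. f \<omega> i)) (Pi\<^sub>E I A) = (\<Prod>i\<in>I. emeasure (L' i) (A i))" .
  qed
  also have "\<dots> = (\<Pi>\<^sub>M i\<in>I. L i)" by (intro PiM_cong refl) (simp add: L'_def)
  finally show ?thesis .
qed

lemma ball_Plus: "(\<forall>i\<in>A <+> B. P i) \<longleftrightarrow> (\<forall>a\<in>A. P (Inl a)) \<and> (\<forall>b\<in>B. P (Inr b))"
  by auto

abbreviation grid_labels :: "nat \<Rightarrow> (nat + nat) set" where
  "grid_labels n \<equiv> {..<n} <+> {..<n}"

context brownian
begin

definition grid_increment :: "nat \<Rightarrow> nat \<Rightarrow> 'a \<Rightarrow> real" where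
  "grid_increment n k \<omega> = B (grid_point T n (Suc k)) \<omega> - B (grid_point T n k) \<omega>"

definition grid_bridge :: "nat \<Rightarrow> nat \<Rightarrow> 'a \<Rightarrow> real" where
  "grid_bridge n k \<omega> = bridge (grid_point T n k) (grid_point T n (Suc k)) \<omega>"

lemma grid_interval:
  assumes "k < n"
  shows "0 \<le> grid_point T n k" "grid_point T n k < grid_point T n (Suc k)" "grid_point T n (Suc k) \<le> T"
    "grid_point T n (Suc k) - grid_point T n k = T / real n"
proof -
  show "0 \<le> grid_point T n k" using grid_point_mem[OF T_pos, of k n] assms by simp
  show "grid_point T n k < grid_point T n (Suc k)" by (rule grid_point_strict_mono) (use T_pos assms in auto)
  show "grid_point T n (Suc k) \<le> T" using grid_point_mem[OF T_pos, of "Suc k" n] assms by simp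
  show "grid_point T n (Suc k) - grid_point T n k = T / real n" by (simp add: grid_point_Suc)
qed

lemma grid_B_F: "j \<le> n \<Longrightarrow> grid_point T n j \<le> t \<Longrightarrow> B (grid_point T n j) \<in> borel_measurable (F t)"
  using grid_point_mem[OF T_pos, of j n] by (intro B_F) auto

lemma grid_B_M: "j \<le> n \<Longrightarrow> B (grid_point T n j) \<in> borel_measurable M"
  by (rule measurable_F[OF grid_B_F]) auto

lemma grid_increment_F: "k < n \<Longrightarrow> grid_point T n (Suc k) \<le> t \<Longrightarrow> grid_increment n k \<in> borel_measurable (F t)"
  using grid_interval[of k n] unfolding grid_increment_def
  by (intro borel_measurable_diff grid_B_F) auto

lemma grid_bridge_F: "k < n \<Longrightarrow> grid_point T n (Suc k) \<le> t \<Longrightarrow> grid_bridge n k \<in> borel_measurable (F t)"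
  using grid_interval[of k n] unfolding grid_bridge_def
  by (intro measurable_F_mono[OF bridge_measurable]) auto

lemma grid_increment_M: "k < n \<Longrightarrow> grid_increment n k \<in> borel_measurable M"
  by (rule measurable_F[OF grid_increment_F]) auto

lemma grid_bridge_M: "k < n \<Longrightarrow> grid_bridge n k \<in> borel_measurable M"
  by (rule measurable_F[OF grid_bridge_F]) auto

lemma grid_law_box:
  assumes A: "\<And>k. k < n \<Longrightarrow> A k \<in> sets borel" "\<And>k. k < n \<Longrightarrow> C k \<in> sets borel" and m: "m \<le> n"
  shows "prob {\<omega> \<in> space M. \<forall>k<m. grid_increment n k \<omega> \<in> A k \<and> sqrt 12 * grid_bridge n k \<omega> \<in> C k}
    = (\<Prod>k<m. measure (normal_law (T / real n)) (A k) * measure (normal_law (T / real n)) (C k))"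
  using m
proof (induction m)
  case 0
  then show ?case by (simp add: prob_space)
next
  case (Suc m)
  define D where "D = {\<omega> \<in> space M. \<forall>k<m. grid_increment n k \<omega> \<in> A k \<and> sqrt 12 * grid_bridge n k \<omega> \<in> C k}"
  have mn: "m < n" using Suc by simp
  note gi = grid_interval[OF mn]
  have D: "D \<in> sets (F (grid_point T n m))"
  proof -
    have "{\<omega> \<in> space (F (grid_point T n m)). \<forall>k\<in>{..<m}. grid_increment n k \<omega> \<in> A k \<and> sqrt 12 * grid_bridge n k \<omega> \<in> C k} \<in> sets (F (grid_point T n m))"
    proof (rule sets.sets_Collect_finite_All[OF _ finite_lessThan])
      fix k assume "k \<in> {..<m}"
      then have k: "k < n" "grid_point T n (Suc k) \<le> grid_point T n m" using mn T_pos by (auto intro: grid_point_mono)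
      note [measurable] = grid_increment_F[OF k] grid_bridge_F[OF k] A(1)[OF k(1)] A(2)[OF k(1)]
      show "{\<omega> \<in> space (F (grid_point T n m)). grid_increment n k \<omega> \<in> A k \<and> sqrt 12 * grid_bridge n k \<omega> \<in> C k}
          \<in> sets (F (grid_point T n m))" by measurable
    qed
    moreover have "D = {\<omega> \<in> space (F (grid_point T n m)). \<forall>k\<in>{..<m}. grid_increment n k \<omega> \<in> A k \<and> sqrt 12 * grid_bridge n k \<omega> \<in> C k}"
      by (auto simp: D_def space_F)
    ultimately show ?thesis by (simp only:)
  qed
  have "{\<omega> \<in> space M. \<forall>k<Suc m. grid_increment n k \<omega> \<in> A k \<and> sqrt 12 * grid_bridge n k \<omega> \<in> C k} =
     {\<omega> \<in> D. B (grid_point T n (Suc m)) \<omega> - B (grid_point T n m) \<omega> \<in> A m \<and>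
       sqrt 12 * bridge (grid_point T n m) (grid_point T n (Suc m)) \<omega> \<in> C m}"
    by (auto simp: D_def less_Suc_eq grid_increment_def grid_bridge_def)
  also have "prob \<dots> = prob D * (measure (normal_law (T / real n)) (A m) * measure (normal_law (T / real n)) (C m))"
    using bridge_law[OF gi(1-3) D A(1)[OF mn] A(2)[OF mn]] by (simp add: gi(4))
  also have "prob D = (\<Prod>k<m. measure (normal_law (T / real n)) (A k) * measure (normal_law (T / real n)) (C k))"
    unfolding D_def using Suc by simp
  finally show ?case by simp
qed

lemma grid_law_increments:
  assumes A: "\<And>k. k < n \<Longrightarrow> A k \<in> sets borel" and n: "0 < n"
  shows "prob {\<omega> \<in> space M. \<forall>k<n. grid_increment n k \<omega> \<in> A k} = (\<Prod>k<n. measure (normal_law (T / real n)) (A k))"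
proof -
  interpret nl: real_distribution "normal_law (T / real n)"
    using n T_pos by (intro real_distribution_normal_law) simp
  show ?thesis
    using grid_law_box[of n A "\<lambda>_. UNIV" n] A nl.prob_space[unfolded nl.space_eq_univ] by simp
qed

lemma grid_law:
  assumes n: "0 < n"
  shows "distr M (\<Pi>\<^sub>M i\<in>grid_labels n. borel)
      (\<lambda>\<omega>. \<lambda>i\<in>grid_labels n. case_sum (\<lambda>k. grid_increment n k \<omega>) (\<lambda>k. sqrt 12 * grid_bridge n k \<omega>) i)
    = (\<Pi>\<^sub>M i\<in>grid_labels n. normal_law (T / real n))"
proof (rule distr_PiM_eqI)
  show "real_distribution (normal_law (T / real n))"
    using n T_pos by (intro real_distribution_normal_law) simp
  show "(\<lambda>\<omega>. case_sum (\<lambda>k. grid_increment n k \<omega>) (\<lambda>k. sqrt 12 * grid_bridge n k \<omega>) i) \<in> borel_measurable M"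
    if "i \<in> grid_labels n" for i
    using that by (cases i) (auto intro: grid_increment_M borel_measurable_times grid_bridge_M)
  fix A :: "nat + nat \<Rightarrow> real set" assume "\<And>i. i \<in> grid_labels n \<Longrightarrow> A i \<in> sets borel"
  then have "\<And>k. k < n \<Longrightarrow> A (Inl k) \<in> sets borel" "\<And>k. k < n \<Longrightarrow> A (Inr k) \<in> sets borel" by auto
  note * = grid_law_box[OF this order_refl]
  have "{\<omega> \<in> space M. \<forall>i\<in>grid_labels n. case_sum (\<lambda>k. grid_increment n k \<omega>) (\<lambda>k. sqrt 12 * grid_bridge n k \<omega>) i \<in> A i}
      = {\<omega> \<in> space M. \<forall>k<n. grid_increment n k \<omega> \<in> A (Inl k) \<and> sqrt 12 * grid_bridge n k \<omega> \<in> A (Inr k)}"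
    by (auto simp: ball_Plus)
  then show "prob {\<omega> \<in> space M. \<forall>i\<in>grid_labels n. case_sum (\<lambda>k. grid_increment n k \<omega>) (\<lambda>k. sqrt 12 * grid_bridge n k \<omega>) i \<in> A i}
    = (\<Prod>i\<in>grid_labels n. measure (normal_law (T / real n)) (A i))"
    by (simp add: * prod.Plus prod.distrib)
qed (simp_all add: prob_space_axioms)

end

text \<open>By \<open>grid_law\<close> this is also the joint law of the increments and the rescaled bridge functionals
  of a single Brownian motion.\<close>

lemma grid_law_independent:
  assumes X: "brownian M F T W" and Y: "brownian N G T B"
    and pi: "\<pi> \<in> measurable N M" "distr N M \<pi> = M"
    and ind: "independent_processes N T (\<lambda>t \<omega>. W t (\<pi> \<omega>)) B" and n: "0 < n"
  shows "distr N (\<Pi>\<^sub>M i\<in>grid_labels n. borel)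
      (\<lambda>\<omega>. \<lambda>i\<in>grid_labels n. case_sum (\<lambda>k. brownian.grid_increment T W n k (\<pi> \<omega>)) (\<lambda>k. brownian.grid_increment T B n k \<omega>) i)
    = (\<Pi>\<^sub>M i\<in>grid_labels n. normal_law (T / real n))"
proof -
  interpret X: brownian M F T W by (rule X)
  interpret Y: brownian N G T B by (rule Y)
  show ?thesis
  proof (rule distr_PiM_eqI)
    show "real_distribution (normal_law (T / real n))"
      using n X.T_pos by (intro real_distribution_normal_law) simp
    show "(\<lambda>\<omega>. case_sum (\<lambda>k. X.grid_increment n k (\<pi> \<omega>)) (\<lambda>k. Y.grid_increment n k \<omega>) i) \<in> borel_measurable N"
      if "i \<in> grid_labels n" for i
      using that by (cases i) (auto intro: Y.grid_increment_M measurable_compose[OF pi(1) X.grid_increment_M])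
    fix A :: "nat + nat \<Rightarrow> real set" assume A: "\<And>i. i \<in> grid_labels n \<Longrightarrow> A i \<in> sets borel"
    then have A1: "\<And>k. k < n \<Longrightarrow> A (Inl k) \<in> sets borel" and A2: "\<And>k. k < n \<Longrightarrow> A (Inr k) \<in> sets borel" by auto
    define E where "E A' = {f \<in> space (\<Pi>\<^sub>M t\<in>{0..T}. borel). \<forall>k\<in>{..<n}. f (grid_point T n (Suc k)) - f (grid_point T n k) \<in> A' k}" for A' :: "nat \<Rightarrow> real set"
    have E: "E A' \<in> sets (\<Pi>\<^sub>M t\<in>{0..T}. borel)" if A': "\<And>k. k < n \<Longrightarrow> A' k \<in> sets borel" for A'
      unfolding E_def
    proof (rule sets.sets_Collect_finite_All[OF _ finite_lessThan])
      fix k assume "k \<in> {..<n}"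
      then have k: "k < n" by simp
      have comp: "(\<lambda>f. f (grid_point T n j)) \<in> borel_measurable (\<Pi>\<^sub>M t\<in>{0..T}. borel :: real measure)" if "j \<le> n" for j
        by (rule measurable_component_singleton) (rule grid_point_mem[OF X.T_pos that])
      note [measurable] = A'[OF k]
      have [measurable]: "(\<lambda>f. f (grid_point T n (Suc k)) - f (grid_point T n k)) \<in> borel_measurable (\<Pi>\<^sub>M t\<in>{0..T}. borel :: real measure)"
        using comp[of k] comp[of "Suc k"] k by (intro borel_measurable_diff) auto
      then show "{f \<in> space (\<Pi>\<^sub>M t\<in>{0..T}. borel). f (grid_point T n (Suc k)) - f (grid_point T n k) \<in> A' k} \<in> sets (\<Pi>\<^sub>M t\<in>{0..T}. borel)"
        by measurable
    qed
    have mem: "grid_point T n (Suc k) \<in> {0..T}" "grid_point T n k \<in> {0..T}" if "k < n" for k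
      using that by (intro grid_point_mem X.T_pos; simp)+
    let ?X = "\<lambda>\<omega>. \<lambda>t\<in>{0..T}. W t (\<pi> \<omega>)" and ?Y = "\<lambda>\<omega>. \<lambda>t\<in>{0..T}. B t \<omega>"
    have XE: "?X -` E A' \<inter> space N = \<pi> -` {\<omega> \<in> space M. \<forall>k<n. X.grid_increment n k \<omega> \<in> A' k} \<inter> space N" for A'
      using measurable_space[OF pi(1)] mem by (auto simp: E_def space_PiM X.grid_increment_def)
    have YE: "?Y -` E A' \<inter> space N = {\<omega> \<in> space N. \<forall>k<n. Y.grid_increment n k \<omega> \<in> A' k}" for A'
      using mem by (auto simp: E_def space_PiM Y.grid_increment_def)
    have ms: "{\<omega> \<in> space M. \<forall>k<n. X.grid_increment n k \<omega> \<in> A (Inl k)} \<in> sets M"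
    proof -
      have "{\<omega> \<in> space M. \<forall>k\<in>{..<n}. X.grid_increment n k \<omega> \<in> A (Inl k)} \<in> sets M"
      proof (rule sets.sets_Collect_finite_All[OF _ finite_lessThan])
        fix k assume "k \<in> {..<n}"
        then show "{\<omega> \<in> space M. X.grid_increment n k \<omega> \<in> A (Inl k)} \<in> sets M"
          using measurable_sets[OF X.grid_increment_M[of k n] A1[of k]] by (simp add: vimage_def Int_def conj_commute)
      qed
      then show ?thesis unfolding Ball_def lessThan_iff .
    qed
    have "{\<omega> \<in> space N. \<forall>i\<in>grid_labels n. case_sum (\<lambda>k. X.grid_increment n k (\<pi> \<omega>)) (\<lambda>k. Y.grid_increment n k \<omega>) i \<in> A i}
        = (?X -` E (\<lambda>k. A (Inl k)) \<inter> space N) \<inter> (?Y -` E (\<lambda>k. A (Inr k)) \<inter> space N)"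
      unfolding XE YE using measurable_space[OF pi(1)] by (auto simp: ball_Plus)
    also have "Y.prob \<dots> = Y.prob (?X -` E (\<lambda>k. A (Inl k)) \<inter> space N) * Y.prob (?Y -` E (\<lambda>k. A (Inr k)) \<inter> space N)"
    proof -
      have "Y.indep_set
        (sigma_sets (space N) {?X -` A \<inter> space N | A. A \<in> sets (\<Pi>\<^sub>M t\<in>{0..T}. borel)})
        (sigma_sets (space N) {?Y -` A \<inter> space N | A. A \<in> sets (\<Pi>\<^sub>M t\<in>{0..T}. borel)})"
        using ind by (simp add: independent_processes_def Y.indep_var_eq)
      then show ?thesis
        by (rule Y.indep_setD) (use E[OF A1] E[OF A2] in \<open>auto intro!: sigma_sets.Basic\<close>)
    qed
    also have "Y.prob (?X -` E (\<lambda>k. A (Inl k)) \<inter> space N) = X.prob {\<omega> \<in> space M. \<forall>k<n. X.grid_increment n k \<omega> \<in> A (Inl k)}"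
      unfolding XE by (subst measure_distr[OF pi(1) ms, symmetric]) (simp add: pi(2))
    also have "\<dots> = (\<Prod>k<n. measure (normal_law (T / real n)) (A (Inl k)))"
      by (rule X.grid_law_increments[OF A1 n])
    also have "Y.prob (?Y -` E (\<lambda>k. A (Inr k)) \<inter> space N) = (\<Prod>k<n. measure (normal_law (T / real n)) (A (Inr k)))"
      unfolding YE by (rule Y.grid_law_increments[OF A2 n])
    finally show "Y.prob {\<omega> \<in> space N. \<forall>i\<in>grid_labels n. case_sum (\<lambda>k. X.grid_increment n k (\<pi> \<omega>)) (\<lambda>k. Y.grid_increment n k \<omega>) i \<in> A i}
      = (\<Prod>i\<in>grid_labels n. measure (normal_law (T / real n)) (A i))"
      by (simp add: prod.Plus)
  qed (simp_all add: Y.prob_space_axioms)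
qed

section \<open>Elementary integrals\<close>

lemma square_integrable_sum:
  fixes f :: "'i \<Rightarrow> 'a \<Rightarrow> real"
  assumes "finite I" "\<And>i. i \<in> I \<Longrightarrow> f i \<in> borel_measurable M" "\<And>i. i \<in> I \<Longrightarrow> integrable M (\<lambda>x. (f i x)\<^sup>2)"
  shows "integrable M (\<lambda>x. (\<Sum>i\<in>I. f i x)\<^sup>2)"
  using assms
proof (induction I rule: finite_induct)
  case (insert i I)
  have IH: "integrable M (\<lambda>x. (\<Sum>i\<in>I. f i x)\<^sup>2)" using insert by auto
  have "integrable M (\<lambda>x. f i x * (\<Sum>i\<in>I. f i x))"
    by (rule integrable_mult_of_squares) (use insert IH in auto)
  then have "integrable M (\<lambda>x. (f i x)\<^sup>2 + (\<Sum>i\<in>I. f i x)\<^sup>2 + 2 * (f i x * (\<Sum>i\<in>I. f i x)))"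
    using IH insert by (intro Bochner_Integration.integrable_add integrable_mult_right) auto
  then show ?case using insert by (simp add: power2_sum ac_simps)
qed simp

lemma square_integrable_diff:
  fixes f g :: "'a \<Rightarrow> real"
  assumes "f \<in> borel_measurable M" "g \<in> borel_measurable M" "integrable M (\<lambda>x. (f x)\<^sup>2)" "integrable M (\<lambda>x. (g x)\<^sup>2)"
  shows "integrable M (\<lambda>x. (f x - g x)\<^sup>2)"
proof -
  have "integrable M (\<lambda>x. (f x)\<^sup>2 + (g x)\<^sup>2 - 2 * (f x * g x))"
    using assms integrable_mult_of_squares[OF assms]
    by (intro Bochner_Integration.integrable_add Bochner_Integration.integrable_diff integrable_mult_right)
  then show ?thesis by (simp add: power2_diff ac_simps)
qed

lemma integrable_bounded_mult:
  fixes f g :: "'a \<Rightarrow> real"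
  assumes [measurable]: "f \<in> borel_measurable M" and "bounded (f ` space M)" and g: "integrable M g"
  shows "integrable M (\<lambda>x. f x * g x)"
proof -
  obtain C where C: "\<And>x. x \<in> space M \<Longrightarrow> \<bar>f x\<bar> \<le> C" using assms(2) by (auto simp: bounded_iff)
  have [measurable]: "g \<in> borel_measurable M" using g by auto
  show ?thesis
  proof (rule Bochner_Integration.integrable_bound[where f="\<lambda>x. C * g x"])
    show "AE x in M. norm (f x * g x) \<le> norm (C * g x)"
    proof (rule AE_I2)
      fix x assume "x \<in> space M"
      then have "\<bar>f x\<bar> \<le> \<bar>C\<bar>" using C[of x] by simp
      then show "norm (f x * g x) \<le> norm (C * g x)" by (simp add: abs_mult mult_right_mono)
    qed
  qed (use g in auto)
qed

lemma bounded_mult_image: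
  fixes f g :: "'a \<Rightarrow> real"
  assumes "bounded (f ` S)" "bounded (g ` S)"
  shows "bounded ((\<lambda>x. f x * g x) ` S)"
proof -
  obtain C D where "\<And>x. x \<in> S \<Longrightarrow> \<bar>f x\<bar> \<le> C" "\<And>x. x \<in> S \<Longrightarrow> \<bar>g x\<bar> \<le> D"
    using assms by (auto simp: bounded_iff)
  then have "\<bar>f x * g x\<bar> \<le> C * D" if "x \<in> S" for x
    using that unfolding abs_mult by (intro mult_mono) (auto intro: order_trans[OF abs_ge_zero])
  then show ?thesis by (auto simp: bounded_iff)
qed

definition sq_norm :: "'a measure \<Rightarrow> real \<Rightarrow> (real \<Rightarrow> 'a \<Rightarrow> real) \<Rightarrow> ennreal" where
  "sq_norm M T f = (\<integral>\<^sup>+\<omega>. (\<integral>\<^sup>+t\<in>{0..T}. ennreal ((f t \<omega>)\<^sup>2) \<partial>lborel) \<partial>M)"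

abbreviation time_product :: "'a measure \<Rightarrow> real \<Rightarrow> (real \<times> 'a) measure" where
  "time_product M T \<equiv> restrict_space lborel {0..T} \<Otimes>\<^sub>M M"

lemma sq_norm_inner:
  assumes f: "(\<lambda>(t, \<omega>). f t \<omega>) \<in> borel_measurable (time_product M T)"
  shows "(\<lambda>\<omega>. \<integral>\<^sup>+t\<in>{0..T}. ennreal ((f t \<omega>)\<^sup>2) \<partial>lborel) \<in> borel_measurable M"
    and "\<And>\<omega>. \<omega> \<in> space M \<Longrightarrow> (\<lambda>t. f t \<omega>) \<in> borel_measurable (restrict_space lborel {0..T})"
proof -
  interpret L: sigma_finite_measure "restrict_space lborel {0..T::real}"
    by (rule sigma_finite_measure_restrict_space) (auto intro: sigma_finite_lborel)
  have "(\<lambda>(\<omega>, t). f t \<omega>) \<in> borel_measurable (M \<Otimes>\<^sub>M restrict_space lborel {0..T})"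
    using measurable_compose[OF measurable_pair_swap' f] by (simp add: split_beta comp_def)
  then have "(\<lambda>(\<omega>, t). ennreal ((f t \<omega>)\<^sup>2)) \<in> borel_measurable (M \<Otimes>\<^sub>M restrict_space lborel {0..T})"
    by (simp add: split_beta)
  then have "(\<lambda>\<omega>. \<integral>\<^sup>+t. ennreal ((f t \<omega>)\<^sup>2) \<partial>restrict_space lborel {0..T}) \<in> borel_measurable M"
    by (rule L.borel_measurable_nn_integral)
  then show "(\<lambda>\<omega>. \<integral>\<^sup>+t\<in>{0..T}. ennreal ((f t \<omega>)\<^sup>2) \<partial>lborel) \<in> borel_measurable M"
    by (simp add: nn_integral_restrict_space)
  show "(\<lambda>t. f t \<omega>) \<in> borel_measurable (restrict_space lborel {0..T})" if "\<omega> \<in> space M" for \<omega>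
    using measurable_compose[OF measurable_Pair2'[OF that] f] by simp
qed

lemma sq_norm_add_le:
  assumes f: "(\<lambda>(t, \<omega>). f t \<omega>) \<in> borel_measurable (time_product M T)"
    and g: "(\<lambda>(t, \<omega>). g t \<omega>) \<in> borel_measurable (time_product M T)"
  shows "sq_norm M T (\<lambda>t \<omega>. f t \<omega> + g t \<omega>) \<le> 2 * sq_norm M T f + 2 * sq_norm M T g"
proof -
  let ?L = "restrict_space lborel {0..T}"
  have sq: "ennreal ((x + y)\<^sup>2) \<le> 2 * ennreal (x\<^sup>2) + 2 * ennreal (y\<^sup>2)" for x y :: real
  proof -
    have "0 \<le> (x - y)\<^sup>2" by simp
    then have "(x + y)\<^sup>2 \<le> 2 * x\<^sup>2 + 2 * y\<^sup>2" by (simp add: power2_sum power2_diff)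
    then have "ennreal ((x + y)\<^sup>2) \<le> ennreal (2 * x\<^sup>2 + 2 * y\<^sup>2)" by (rule ennreal_leI)
    then show ?thesis by (simp add: ennreal_plus ennreal_mult)
  qed
  have "sq_norm M T (\<lambda>t \<omega>. f t \<omega> + g t \<omega>) \<le>
      (\<integral>\<^sup>+\<omega>. 2 * (\<integral>\<^sup>+t\<in>{0..T}. ennreal ((f t \<omega>)\<^sup>2) \<partial>lborel) + 2 * (\<integral>\<^sup>+t\<in>{0..T}. ennreal ((g t \<omega>)\<^sup>2) \<partial>lborel) \<partial>M)"
    unfolding sq_norm_def
  proof (rule nn_integral_mono)
    fix \<omega> assume \<omega>: "\<omega> \<in> space M"
    note [measurable] = sq_norm_inner(2)[OF f \<omega>] sq_norm_inner(2)[OF g \<omega>]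
    have "(\<integral>\<^sup>+t. ennreal ((f t \<omega> + g t \<omega>)\<^sup>2) \<partial>?L) \<le> (\<integral>\<^sup>+t. 2 * ennreal ((f t \<omega>)\<^sup>2) + 2 * ennreal ((g t \<omega>)\<^sup>2) \<partial>?L)"
      by (intro nn_integral_mono sq)
    also have "\<dots> = 2 * (\<integral>\<^sup>+t. ennreal ((f t \<omega>)\<^sup>2) \<partial>?L) + 2 * (\<integral>\<^sup>+t. ennreal ((g t \<omega>)\<^sup>2) \<partial>?L)"
      by (simp add: nn_integral_add nn_integral_cmult)
    finally show "(\<integral>\<^sup>+t\<in>{0..T}. ennreal ((f t \<omega> + g t \<omega>)\<^sup>2) \<partial>lborel)
      \<le> 2 * (\<integral>\<^sup>+t\<in>{0..T}. ennreal ((f t \<omega>)\<^sup>2) \<partial>lborel) + 2 * (\<integral>\<^sup>+t\<in>{0..T}. ennreal ((g t \<omega>)\<^sup>2) \<partial>lborel)"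
      by (simp add: nn_integral_restrict_space)
  qed
  also have "\<dots> = 2 * sq_norm M T f + 2 * sq_norm M T g"
    using sq_norm_inner(1)[OF f] sq_norm_inner(1)[OF g]
    by (simp add: sq_norm_def nn_integral_add nn_integral_cmult)
  finally show ?thesis .
qed

lemma sq_norm_diff_le:
  assumes f: "(\<lambda>(t, \<omega>). f t \<omega>) \<in> borel_measurable (time_product M T)"
    and g: "(\<lambda>(t, \<omega>). g t \<omega>) \<in> borel_measurable (time_product M T)"
  shows "sq_norm M T (\<lambda>t \<omega>. f t \<omega> - g t \<omega>) \<le> 2 * sq_norm M T f + 2 * sq_norm M T g"
proof -
  have "(\<lambda>(t, \<omega>). - g t \<omega>) \<in> borel_measurable (time_product M T)"
    using borel_measurable_uminus[OF g] by (simp add: split_beta)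
  from sq_norm_add_le[OF f this] show ?thesis by (simp add: sq_norm_def)
qed

context brownian
begin

definition elementary :: "'i set \<Rightarrow> ('i \<Rightarrow> real) \<Rightarrow> ('i \<Rightarrow> real) \<Rightarrow> ('i \<Rightarrow> 'a \<Rightarrow> real) \<Rightarrow> bool" where
  "elementary I a b \<xi> \<longleftrightarrow> finite I \<and> (\<forall>i\<in>I. 0 \<le> a i \<and> a i \<le> b i \<and> b i \<le> T \<and>
     \<xi> i \<in> borel_measurable (F (a i)) \<and> bounded (\<xi> i ` space M))"

definition elem_int :: "'i set \<Rightarrow> ('i \<Rightarrow> real) \<Rightarrow> ('i \<Rightarrow> real) \<Rightarrow> ('i \<Rightarrow> 'a \<Rightarrow> real) \<Rightarrow> real \<Rightarrow> 'a \<Rightarrow> real" where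
  "elem_int I a b \<xi> t \<omega> = (\<Sum>i\<in>I. \<xi> i \<omega> * (B (min (b i) t) \<omega> - B (min (a i) t) \<omega>))"

definition elem_val :: "'i set \<Rightarrow> ('i \<Rightarrow> real) \<Rightarrow> ('i \<Rightarrow> real) \<Rightarrow> ('i \<Rightarrow> 'a \<Rightarrow> real) \<Rightarrow> real \<Rightarrow> 'a \<Rightarrow> real" where
  "elem_val I a b \<xi> t \<omega> = (\<Sum>i\<in>I. \<xi> i \<omega> * indicator {a i<..b i} t)"

lemma elem_int_cont:
  assumes "elementary I a b \<xi>" "\<omega> \<in> space M"
  shows "continuous_on {0..T} (\<lambda>t. elem_int I a b \<xi> t \<omega>)"
  unfolding elem_int_def
proof (intro continuous_on_sum continuous_on_mult continuous_on_const continuous_on_diff)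
  have *: "continuous_on {0..T} (\<lambda>t. B (min c t) \<omega>)" if "0 \<le> c" for c
    by (rule continuous_on_compose2[OF B_cont[OF assms(2)]])
      (use that in \<open>auto intro!: continuous_intros\<close>)
  fix i assume "i \<in> I"
  then show "continuous_on {0..T} (\<lambda>t. B (min (b i) t) \<omega>)" "continuous_on {0..T} (\<lambda>t. B (min (a i) t) \<omega>)"
    using assms by (auto intro!: * simp: elementary_def)
qed

lemma elem_int_F:
  assumes el: "elementary I a b \<xi>" and tu: "0 \<le> t" "t \<le> u"
  shows "elem_int I a b \<xi> t \<in> borel_measurable (F u)"
  unfolding elem_int_def
proof (intro borel_measurable_sum)
  fix i assume i: "i \<in> I"
  then have *: "0 \<le> a i" "a i \<le> b i" "b i \<le> T" "\<xi> i \<in> borel_measurable (F (a i))"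
    using el by (auto simp: elementary_def)
  show "(\<lambda>\<omega>. \<xi> i \<omega> * (B (min (b i) t) \<omega> - B (min (a i) t) \<omega>)) \<in> borel_measurable (F u)"
  proof (cases "t \<le> a i")
    case True
    then have "min (b i) t = t" "min (a i) t = t" using *(2) by auto
    then show ?thesis by simp
  next
    case False
    then have "\<xi> i \<in> borel_measurable (F u)" using tu by (intro measurable_F_mono[OF *(4)]) simp
    moreover have "B (min (b i) t) \<in> borel_measurable (F u)" "B (min (a i) t) \<in> borel_measurable (F u)"
      using *(1-3) tu by (intro B_F; simp)+
    ultimately show ?thesis by (intro borel_measurable_times borel_measurable_diff)
  qed
qed

lemma elem_int_M: "elementary I a b \<xi> \<Longrightarrow> 0 \<le> t \<Longrightarrow> elem_int I a b \<xi> t \<in> borel_measurable M"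
  by (rule measurable_F[OF elem_int_F]) auto

lemma bounded_increment_square_integrable:
  assumes \<xi>: "\<xi> \<in> borel_measurable M" "bounded (\<xi> ` space M)" and st: "0 \<le> s" "s \<le> t" "t \<le> T"
  shows "integrable M (\<lambda>\<omega>. (\<xi> \<omega> * (B t \<omega> - B s \<omega>))\<^sup>2)"
proof -
  have "integrable M (\<lambda>\<omega>. (\<xi> \<omega> * \<xi> \<omega>) * (B t \<omega> - B s \<omega>)\<^sup>2)"
    by (rule integrable_bounded_mult)
      (use \<xi> increment_moments(3)[OF st] bounded_mult_image[OF \<xi>(2) \<xi>(2)] in auto)
  then show ?thesis by (simp add: power2_eq_square ac_simps)
qed

lemma elem_int_square_integrable:
  assumes el: "elementary I a b \<xi>" and t: "0 \<le> t"
  shows "integrable M (\<lambda>\<omega>. (elem_int I a b \<xi> t \<omega>)\<^sup>2)"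
  unfolding elem_int_def
proof (rule square_integrable_sum)
  fix i assume i: "i \<in> I"
  then have *: "0 \<le> a i" "a i \<le> b i" "b i \<le> T" "\<xi> i \<in> borel_measurable (F (a i))" "bounded (\<xi> i ` space M)"
    using el by (auto simp: elementary_def)
  have [measurable]: "\<xi> i \<in> borel_measurable M" using *(4) by (rule measurable_F)
  have [measurable]: "B (min (b i) t) \<in> borel_measurable M" "B (min (a i) t) \<in> borel_measurable M"
    using * t by (intro B_M; simp)+
  show "(\<lambda>\<omega>. \<xi> i \<omega> * (B (min (b i) t) \<omega> - B (min (a i) t) \<omega>)) \<in> borel_measurable M" by measurable
  show "integrable M (\<lambda>\<omega>. (\<xi> i \<omega> * (B (min (b i) t) \<omega> - B (min (a i) t) \<omega>))\<^sup>2)"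
    by (rule bounded_increment_square_integrable) (use * t in auto)
qed (use el in \<open>simp add: elementary_def\<close>)

lemma elem_int_martingale:
  assumes el: "elementary I a b \<xi>" and st: "0 \<le> s" "s \<le> t" "t \<le> T"
    and V: "V \<in> borel_measurable (F s)" "integrable M (\<lambda>\<omega>. (V \<omega>)\<^sup>2)"
  shows "(\<integral>\<omega>. V \<omega> * (elem_int I a b \<xi> t \<omega> - elem_int I a b \<xi> s \<omega>) \<partial>M) = 0"
proof -
  define u v where "u i = max (a i) s" and "v i = max (u i) (min (b i) t)" for i
  have VM: "V \<in> borel_measurable M" using V(1) by (rule measurable_F)
  have summand: "\<xi> i \<omega> * (B (min (b i) t) \<omega> - B (min (a i) t) \<omega>) - \<xi> i \<omega> * (B (min (b i) s) \<omega> - B (min (a i) s) \<omega>)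
      = \<xi> i \<omega> * (B (v i) \<omega> - B (u i) \<omega>)" if "i \<in> I" for i \<omega>
  proof -
    have "a i \<le> b i" using el that by (auto simp: elementary_def)
    then have "B (min (b i) t) \<omega> - B (min (a i) t) \<omega> - (B (min (b i) s) \<omega> - B (min (a i) s) \<omega>) = B (v i) \<omega> - B (u i) \<omega>"
    proof -
      consider "t \<le> a i" | "b i \<le> s" | "s \<le> a i" "a i \<le> t" | "a i \<le> s" "s \<le> b i" by linarith
      then show ?thesis
      proof cases
        case 1
        then have "s \<le> a i" "s \<le> b i" "t \<le> b i" using st \<open>a i \<le> b i\<close> by linarith+
        with 1 show ?thesis by (simp add: u_def v_def min_absorb1 min_absorb2 max_absorb1 max_absorb2)
      next
        case 2
        then have "a i \<le> s" "a i \<le> t" "b i \<le> t" using st \<open>a i \<le> b i\<close> by linarith+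
        with 2 show ?thesis by (simp add: u_def v_def min_absorb1 min_absorb2 max_absorb1 max_absorb2)
      next
        case 3
        then have "s \<le> b i" "a i \<le> min (b i) t" using \<open>a i \<le> b i\<close> by simp_all
        with 3 show ?thesis by (simp add: u_def v_def min_absorb1 min_absorb2 max_absorb1 max_absorb2)
      next
        case 4
        then have "a i \<le> t" "s \<le> min (b i) t" using st by simp_all
        with 4 show ?thesis by (simp add: u_def v_def min_absorb1 min_absorb2 max_absorb1 max_absorb2)
      qed
    qed
    then show ?thesis by (simp only: right_diff_distrib[symmetric])
  qed
  have each: "integrable M (\<lambda>\<omega>. V \<omega> * \<xi> i \<omega> * (B (v i) \<omega> - B (u i) \<omega>)) \<and> (\<integral>\<omega>. V \<omega> * \<xi> i \<omega> * (B (v i) \<omega> - B (u i) \<omega>) \<partial>M) = 0"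
    if i: "i \<in> I" for i
  proof -
    have *: "0 \<le> a i" "a i \<le> b i" "b i \<le> T" "\<xi> i \<in> borel_measurable (F (a i))" "bounded (\<xi> i ` space M)"
      using el i by (auto simp: elementary_def)
    have uv: "0 \<le> u i" "u i \<le> v i" "v i \<le> T" "a i \<le> u i" "s \<le> u i" using * st by (auto simp: u_def v_def)
    have m: "(\<lambda>\<omega>. V \<omega> * \<xi> i \<omega>) \<in> borel_measurable (F (u i))"
      using measurable_F_mono[OF V(1) uv(5)] measurable_F_mono[OF *(4) uv(4)] by simp
    have "integrable M V" using square_integrable_imp_integrable[OF VM V(2)] .
    then have "integrable M (\<lambda>\<omega>. \<xi> i \<omega> * V \<omega>)"
      by (intro integrable_bounded_mult measurable_F[OF *(4)] *(5))
    then have "integrable M (\<lambda>\<omega>. V \<omega> * \<xi> i \<omega>)" by (simp add: mult.commute)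
    from increment_mult(1,2)[OF uv(1-3) m this] show ?thesis by simp
  qed
  have "(\<integral>\<omega>. V \<omega> * (elem_int I a b \<xi> t \<omega> - elem_int I a b \<xi> s \<omega>) \<partial>M) = (\<integral>\<omega>. (\<Sum>i\<in>I. V \<omega> * \<xi> i \<omega> * (B (v i) \<omega> - B (u i) \<omega>)) \<partial>M)"
  proof (intro Bochner_Integration.integral_cong refl)
    fix \<omega>
    have "elem_int I a b \<xi> t \<omega> - elem_int I a b \<xi> s \<omega> = (\<Sum>i\<in>I. \<xi> i \<omega> * (B (v i) \<omega> - B (u i) \<omega>))"
      unfolding elem_int_def sum_subtractf[symmetric] by (intro sum.cong refl summand)
    then show "V \<omega> * (elem_int I a b \<xi> t \<omega> - elem_int I a b \<xi> s \<omega>) = (\<Sum>i\<in>I. V \<omega> * \<xi> i \<omega> * (B (v i) \<omega> - B (u i) \<omega>))"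
      by (simp add: sum_distrib_left mult.assoc)
  qed
  also have "\<dots> = (\<Sum>i\<in>I. \<integral>\<omega>. V \<omega> * \<xi> i \<omega> * (B (v i) \<omega> - B (u i) \<omega>) \<partial>M)"
    by (rule Bochner_Integration.integral_sum) (use each in blast)
  also have "\<dots> = 0" using each by simp
  finally show ?thesis .
qed

lemma increment_product_aux:
  assumes \<xi>: "\<xi> \<in> borel_measurable (F a)" "bounded (\<xi> ` space M)"
    and \<eta>: "\<eta> \<in> borel_measurable (F a')" "bounded (\<eta> ` space M)"
    and ab: "0 \<le> a" "a \<le> b" "b \<le> T" "a \<le> a'" "a' \<le> b'" "b' \<le> T"
  shows "(\<integral>\<omega>. (\<xi> \<omega> * (B b \<omega> - B a \<omega>)) * (\<eta> \<omega> * (B b' \<omega> - B a' \<omega>)) \<partial>M) = expectation (\<lambda>\<omega>. \<xi> \<omega> * \<eta> \<omega>) * max 0 (min b b' - a')"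
proof -
  define V where "V \<omega> = \<xi> \<omega> * \<eta> \<omega>" for \<omega>
  have V: "V \<in> borel_measurable (F a')" unfolding V_def
    using measurable_F_mono[OF \<xi>(1) ab(4)] \<eta>(1) by simp
  have VM: "V \<in> borel_measurable M" using V by (rule measurable_F)
  have Vb: "bounded (V ` space M)" unfolding V_def by (rule bounded_mult_image[OF \<xi>(2) \<eta>(2)])
  have iV: "integrable M V" using integrable_bounded_mult[OF VM Vb, of "\<lambda>_. 1"] by simp
  have iVB: "integrable M (\<lambda>\<omega>. V \<omega> * (B t \<omega> - B s \<omega>))" if "0 \<le> s" "s \<le> t" "t \<le> T" for s t
    by (rule integrable_bounded_mult[OF VM Vb increment_moments(1)[OF that]])
  have orth: "integrable M (\<lambda>\<omega>. V \<omega> * (B t \<omega> - B s \<omega>) * (B t' \<omega> - B s' \<omega>)) \<and> (\<integral>\<omega>. V \<omega> * (B t \<omega> - B s \<omega>) * (B t' \<omega> - B s' \<omega>) \<partial>M) = 0"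
    if "0 \<le> s" "s \<le> t" "t \<le> s'" "s' \<le> t'" "t' \<le> T" "a' \<le> s'" for s t s' t'
  proof -
    have m: "(\<lambda>\<omega>. V \<omega> * (B t \<omega> - B s \<omega>)) \<in> borel_measurable (F s')"
      using measurable_F_mono[OF V, of s'] B_F[of t s'] B_F[of s s'] that by simp
    show ?thesis using increment_mult(1,2)[of s' t', OF _ _ _ m iVB] that by auto
  qed
  show ?thesis
  proof (cases "b \<le> a'")
    case True
    then have "max 0 (min b b' - a') = 0" by auto
    moreover have "(\<integral>\<omega>. (\<xi> \<omega> * (B b \<omega> - B a \<omega>)) * (\<eta> \<omega> * (B b' \<omega> - B a' \<omega>)) \<partial>M) = (\<integral>\<omega>. V \<omega> * (B b \<omega> - B a \<omega>) * (B b' \<omega> - B a' \<omega>) \<partial>M)"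
      by (simp add: V_def ac_simps)
    ultimately show ?thesis using orth[of a b a' b'] ab True by simp
  next
    case False
    define c where "c = min b b'"
    have c: "a' \<le> c" "c \<le> b" "c \<le> b'" "c \<le> T" using False ab by (auto simp: c_def)
    have a': "0 \<le> a'" using ab by simp
    have z: "(B b \<omega> - B c \<omega>) * (B b' \<omega> - B c \<omega>) = 0" for \<omega> by (auto simp: c_def min_def)
    have "(\<xi> \<omega> * (B b \<omega> - B a \<omega>)) * (\<eta> \<omega> * (B b' \<omega> - B a' \<omega>)) =
        V \<omega> * (B a' \<omega> - B a \<omega>) * (B b' \<omega> - B a' \<omega>) + V \<omega> * (B c \<omega> - B a' \<omega>)\<^sup>2
        + V \<omega> * (B c \<omega> - B a' \<omega>) * (B b \<omega> - B c \<omega>) + V \<omega> * (B c \<omega> - B a' \<omega>) * (B b' \<omega> - B c \<omega>)" for \<omega>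
    proof -
      have "(B b \<omega> - B a \<omega>) * (B b' \<omega> - B a' \<omega>) = (B a' \<omega> - B a \<omega>) * (B b' \<omega> - B a' \<omega>) + (B c \<omega> - B a' \<omega>)\<^sup>2
        + (B c \<omega> - B a' \<omega>) * (B b \<omega> - B c \<omega>) + (B c \<omega> - B a' \<omega>) * (B b' \<omega> - B c \<omega>) + (B b \<omega> - B c \<omega>) * (B b' \<omega> - B c \<omega>)"
        by (simp add: power2_eq_square algebra_simps)
      then have "V \<omega> * ((B b \<omega> - B a \<omega>) * (B b' \<omega> - B a' \<omega>)) = V \<omega> * ((B a' \<omega> - B a \<omega>) * (B b' \<omega> - B a' \<omega>) + (B c \<omega> - B a' \<omega>)\<^sup>2
        + (B c \<omega> - B a' \<omega>) * (B b \<omega> - B c \<omega>) + (B c \<omega> - B a' \<omega>) * (B b' \<omega> - B c \<omega>))" by (simp only: z add_0_right)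
      then show ?thesis by (simp only: V_def distrib_left mult.assoc mult.left_commute mult.commute)
    qed
    then have "(\<integral>\<omega>. (\<xi> \<omega> * (B b \<omega> - B a \<omega>)) * (\<eta> \<omega> * (B b' \<omega> - B a' \<omega>)) \<partial>M) =
      (\<integral>\<omega>. V \<omega> * (B a' \<omega> - B a \<omega>) * (B b' \<omega> - B a' \<omega>) + V \<omega> * (B c \<omega> - B a' \<omega>)\<^sup>2
        + V \<omega> * (B c \<omega> - B a' \<omega>) * (B b \<omega> - B c \<omega>) + V \<omega> * (B c \<omega> - B a' \<omega>) * (B b' \<omega> - B c \<omega>) \<partial>M)"
      by presburger
    also have "\<dots> = expectation V * (c - a')"
      using orth[of a a' a' b'] orth[of a' c c b] orth[of a' c c b'] increment_mult(3,4)[OF a' c(1) c(4) V iV] ab c a' by simp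
    also have "expectation V = expectation (\<lambda>\<omega>. \<xi> \<omega> * \<eta> \<omega>)" by (simp add: V_def[abs_def])
    also have "c - a' = max 0 (min b b' - a')" using c by (simp add: c_def)
    finally show ?thesis .
  qed
qed

lemma increment_product:
  assumes \<xi>: "\<xi> \<in> borel_measurable (F a)" "bounded (\<xi> ` space M)"
    and \<eta>: "\<eta> \<in> borel_measurable (F a')" "bounded (\<eta> ` space M)"
    and ab: "0 \<le> a" "a \<le> b" "b \<le> T" "0 \<le> a'" "a' \<le> b'" "b' \<le> T"
  shows "(\<integral>\<omega>. (\<xi> \<omega> * (B b \<omega> - B a \<omega>)) * (\<eta> \<omega> * (B b' \<omega> - B a' \<omega>)) \<partial>M)
    = expectation (\<lambda>\<omega>. \<xi> \<omega> * \<eta> \<omega>) * max 0 (min b b' - max a a')"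
proof (cases "a \<le> a'")
  case True
  then show ?thesis using increment_product_aux[OF \<xi> \<eta>] ab by (simp add: max_def)
next
  case False
  then show ?thesis using increment_product_aux[OF \<eta> \<xi>, of b' b] ab
    by (simp add: max_def min.commute mult.commute)
qed

lemma elem_isometry:
  assumes el: "elementary I a b \<xi>"
  shows "ennreal (expectation (\<lambda>\<omega>. (elem_int I a b \<xi> T \<omega>)\<^sup>2)) = sq_norm M T (elem_val I a b \<xi>)"
proof -
  have fin: "finite I" using el by (simp add: elementary_def)
  have *: "0 \<le> a i" "a i \<le> b i" "b i \<le> T" "\<xi> i \<in> borel_measurable (F (a i))" "bounded (\<xi> i ` space M)" if "i \<in> I" for i
    using el that by (auto simp: elementary_def)
  have \<xi>M: "\<xi> i \<in> borel_measurable M" if "i \<in> I" for i using *(4)[OF that] by (rule measurable_F)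
  define len where "len i j = max 0 (min (b i) (b j) - max (a i) (a j))" for i j
  define q where "q \<omega> = (\<Sum>i\<in>I. \<Sum>j\<in>I. \<xi> i \<omega> * \<xi> j \<omega> * len i j)" for \<omega>
  have i\<xi>: "integrable M (\<lambda>\<omega>. \<xi> i \<omega> * \<xi> j \<omega>)" if "i \<in> I" "j \<in> I" for i j
    using integrable_bounded_mult[OF \<xi>M[OF that(1)] *(5)[OF that(1)]
        integrable_bounded_mult[OF \<xi>M[OF that(2)] *(5)[OF that(2)], of "\<lambda>_. 1"]] by simp
  have iq: "integrable M q" unfolding q_def
    by (intro Bochner_Integration.integrable_sum integrable_mult_left i\<xi>)
  have "expectation (\<lambda>\<omega>. (elem_int I a b \<xi> T \<omega>)\<^sup>2) =
      (\<integral>\<omega>. (\<Sum>i\<in>I. \<Sum>j\<in>I. (\<xi> i \<omega> * (B (b i) \<omega> - B (a i) \<omega>)) * (\<xi> j \<omega> * (B (b j) \<omega> - B (a j) \<omega>))) \<partial>M)"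
  proof (intro Bochner_Integration.integral_cong refl)
    fix \<omega>
    have "elem_int I a b \<xi> T \<omega> = (\<Sum>i\<in>I. \<xi> i \<omega> * (B (b i) \<omega> - B (a i) \<omega>))"
      unfolding elem_int_def
    proof (intro sum.cong refl)
      fix i assume "i \<in> I"
      then have "min (b i) T = b i" "min (a i) T = a i" using *[of i] by auto
      then show "\<xi> i \<omega> * (B (min (b i) T) \<omega> - B (min (a i) T) \<omega>) = \<xi> i \<omega> * (B (b i) \<omega> - B (a i) \<omega>)" by simp
    qed
    then show "(elem_int I a b \<xi> T \<omega>)\<^sup>2 = (\<Sum>i\<in>I. \<Sum>j\<in>I. (\<xi> i \<omega> * (B (b i) \<omega> - B (a i) \<omega>)) * (\<xi> j \<omega> * (B (b j) \<omega> - B (a j) \<omega>)))"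
      by (simp add: power2_eq_square sum_product)
  qed
  also have "\<dots> = (\<Sum>i\<in>I. \<Sum>j\<in>I. \<integral>\<omega>. (\<xi> i \<omega> * (B (b i) \<omega> - B (a i) \<omega>)) * (\<xi> j \<omega> * (B (b j) \<omega> - B (a j) \<omega>)) \<partial>M)"
  proof -
    have "integrable M (\<lambda>\<omega>. (\<xi> i \<omega> * (B (b i) \<omega> - B (a i) \<omega>)) * (\<xi> j \<omega> * (B (b j) \<omega> - B (a j) \<omega>)))" if "i \<in> I" "j \<in> I" for i j
    proof (rule integrable_mult_of_squares)
      show "(\<lambda>\<omega>. \<xi> i \<omega> * (B (b i) \<omega> - B (a i) \<omega>)) \<in> borel_measurable M" "(\<lambda>\<omega>. \<xi> j \<omega> * (B (b j) \<omega> - B (a j) \<omega>)) \<in> borel_measurable M"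
        using * that by (auto intro!: borel_measurable_times \<xi>M borel_measurable_diff B_M intro: order_trans)
    qed (use * that in \<open>auto intro!: bounded_increment_square_integrable \<xi>M\<close>)
    then show ?thesis by (simp add: Bochner_Integration.integral_sum)
  qed
  also have "\<dots> = (\<Sum>i\<in>I. \<Sum>j\<in>I. expectation (\<lambda>\<omega>. \<xi> i \<omega> * \<xi> j \<omega>) * len i j)"
    unfolding len_def by (intro sum.cong refl increment_product *)
  also have "\<dots> = expectation q"
    unfolding q_def using i\<xi> by (simp add: Bochner_Integration.integral_sum)
  finally have E: "expectation (\<lambda>\<omega>. (elem_int I a b \<xi> T \<omega>)\<^sup>2) = expectation q" .
  have inner: "(\<integral>\<^sup>+t\<in>{0..T}. ennreal ((elem_val I a b \<xi> t \<omega>)\<^sup>2) \<partial>lborel) = ennreal (q \<omega>) \<and> 0 \<le> q \<omega>" for \<omega>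
  proof -
    have sq: "(elem_val I a b \<xi> t \<omega>)\<^sup>2 = (\<Sum>i\<in>I. \<Sum>j\<in>I. \<xi> i \<omega> * \<xi> j \<omega> * indicator {max (a i) (a j)<..min (b i) (b j)} t)" for t
      unfolding elem_val_def power2_eq_square sum_product
      by (intro sum.cong refl) (auto simp: indicator_def)
    have hb: "has_bochner_integral lborel (\<lambda>t. (elem_val I a b \<xi> t \<omega>)\<^sup>2) (q \<omega>)"
      unfolding sq q_def
    proof (intro has_bochner_integral_sum has_bochner_integral_mult_right)
      fix i j
      show "has_bochner_integral lborel (indicator {max (a i) (a j)<..min (b i) (b j)} :: real \<Rightarrow> real) (len i j)"
        using has_bochner_integral_real_indicator[of "{max (a i) (a j)<..min (b i) (b j)}" lborel]
        by (cases "max (a i) (a j) \<le> min (b i) (b j)") (auto simp: len_def max_absorb1 max_absorb2 not_le)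
    qed
    have "(\<integral>\<^sup>+t\<in>{0..T}. ennreal ((elem_val I a b \<xi> t \<omega>)\<^sup>2) \<partial>lborel) = (\<integral>\<^sup>+t. ennreal ((elem_val I a b \<xi> t \<omega>)\<^sup>2) \<partial>lborel)"
    proof (intro nn_integral_cong)
      fix t
      show "ennreal ((elem_val I a b \<xi> t \<omega>)\<^sup>2) * indicator {0..T} t = ennreal ((elem_val I a b \<xi> t \<omega>)\<^sup>2)"
      proof (cases "t \<in> {0..T}")
        case False
        then have "elem_val I a b \<xi> t \<omega> = 0" unfolding elem_val_def
        proof (intro sum.neutral ballI)
          fix i assume "i \<in> I"
          then have "t \<notin> {a i<..b i}" using *(1,3)[of i] False by auto
          then show "\<xi> i \<omega> * indicator {a i<..b i} t = 0" by simp
        qed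
        then show ?thesis by simp
      qed simp
    qed
    also have "\<dots> = ennreal (q \<omega>)"
      using nn_integral_eq_integral[of lborel "\<lambda>t. (elem_val I a b \<xi> t \<omega>)\<^sup>2"] hb
      by (simp add: has_bochner_integral_iff)
    finally have "(\<integral>\<^sup>+t\<in>{0..T}. ennreal ((elem_val I a b \<xi> t \<omega>)\<^sup>2) \<partial>lborel) = ennreal (q \<omega>)" .
    moreover have hq: "(\<integral>t. (elem_val I a b \<xi> t \<omega>)\<^sup>2 \<partial>lborel) = q \<omega>" using hb by (rule has_bochner_integral_integral_eq)
    have "0 \<le> q \<omega>" unfolding hq[symmetric] by (rule Bochner_Integration.integral_nonneg) simp
    ultimately show ?thesis by simp
  qed
  have "sq_norm M T (elem_val I a b \<xi>) = (\<integral>\<^sup>+\<omega>. ennreal (q \<omega>) \<partial>M)"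
    unfolding sq_norm_def using inner by simp
  also have "\<dots> = ennreal (expectation q)"
    using inner by (intro nn_integral_eq_integral iq) auto
  finally show ?thesis using E by simp
qed

lemma elem_maximal:
  fixes p :: "nat \<Rightarrow> real"
  assumes el: "elementary I a b \<xi>" and p: "\<And>i j. i \<le> j \<Longrightarrow> j \<le> n \<Longrightarrow> p i \<le> p j" "0 \<le> p 0" "p n = T" and l: "0 < l"
  shows "emeasure M {\<omega> \<in> space M. \<exists>j\<le>n. l \<le> \<bar>elem_int I a b \<xi> (p j) \<omega>\<bar>} \<le> ennreal (1 / l\<^sup>2) * sq_norm M T (elem_val I a b \<xi>)"
proof -
  have p0: "0 \<le> p j" "p j \<le> T" if "j \<le> n" for j
    using p(1)[of 0 j, OF _ that] p(1)[of j n, OF that] p(2,3) by simp_all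
  have "prob {\<omega> \<in> space M. \<exists>j\<le>n. l \<le> \<bar>elem_int I a b \<xi> (p j) \<omega>\<bar>} \<le> expectation (\<lambda>\<omega>. (elem_int I a b \<xi> (p n) \<omega>)\<^sup>2) / l\<^sup>2"
  proof (rule maximal_inequality[where F="\<lambda>j. F (p j)"])
    fix j A assume j: "j \<le> n" and A: "A \<in> sets (F (p j))"
    have Z: "elem_int I a b \<xi> (p j) \<in> borel_measurable (F (p j))" by (rule elem_int_F[OF el p0(1)[OF j]]) simp
    have V: "(\<lambda>\<omega>. indicator A \<omega> * elem_int I a b \<xi> (p j) \<omega>) \<in> borel_measurable (F (p j))"
      using A Z by measurable
    have "integrable M (\<lambda>\<omega>. indicator A \<omega> *\<^sub>R (elem_int I a b \<xi> (p j) \<omega>)\<^sup>2)"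
      by (intro integrable_mult_indicator sets_F[OF A] elem_int_square_integrable[OF el p0(1)[OF j]])
    moreover have "(indicator A \<omega> * elem_int I a b \<xi> (p j) \<omega>)\<^sup>2 = indicator A \<omega> *\<^sub>R (elem_int I a b \<xi> (p j) \<omega>)\<^sup>2" for \<omega>
      by (simp add: indicator_def)
    ultimately have V2: "integrable M (\<lambda>\<omega>. (indicator A \<omega> * elem_int I a b \<xi> (p j) \<omega>)\<^sup>2)" by simp
    show "(\<integral>\<omega>. indicator A \<omega> * elem_int I a b \<xi> (p j) \<omega> * (elem_int I a b \<xi> (p n) \<omega> - elem_int I a b \<xi> (p j) \<omega>) \<partial>M) = 0"
      by (rule elem_int_martingale[OF el _ _ _ V V2]) (use p0 p j in auto)
  qed (use p p0 el l in \<open>auto intro!: subalgebra_F elem_int_F elem_int_square_integrable\<close>)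
  then have "emeasure M {\<omega> \<in> space M. \<exists>j\<le>n. l \<le> \<bar>elem_int I a b \<xi> (p j) \<omega>\<bar>} \<le> ennreal ((1 / l\<^sup>2) * expectation (\<lambda>\<omega>. (elem_int I a b \<xi> T \<omega>)\<^sup>2))"
    by (simp add: emeasure_eq_measure p ennreal_leI)
  also have "\<dots> = ennreal (1 / l\<^sup>2) * sq_norm M T (elem_val I a b \<xi>)"
    unfolding elem_isometry[OF el, symmetric] by (rule ennreal_mult) auto
  finally show ?thesis .
qed

lemma elem_int_L2_le:
  assumes el: "elementary I a b \<xi>" and t: "0 \<le> t" "t \<le> T"
  shows "(\<integral>\<^sup>+\<omega>. ennreal ((elem_int I a b \<xi> t \<omega>)\<^sup>2) \<partial>M) \<le> sq_norm M T (elem_val I a b \<xi>)"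
proof -
  define Z where "Z t = elem_int I a b \<xi> t" for t
  have m: "Z t \<in> borel_measurable M" "Z T \<in> borel_measurable M" "integrable M (\<lambda>\<omega>. (Z t \<omega>)\<^sup>2)" "integrable M (\<lambda>\<omega>. (Z T \<omega>)\<^sup>2)"
    unfolding Z_def using t by (auto intro!: elem_int_M elem_int_square_integrable el)
  have d: "(\<lambda>\<omega>. Z T \<omega> - Z t \<omega>) \<in> borel_measurable M" "integrable M (\<lambda>\<omega>. (Z T \<omega> - Z t \<omega>)\<^sup>2)"
    using m by (auto intro: square_integrable_diff)
  have 0: "(\<integral>\<omega>. Z t \<omega> * (Z T \<omega> - Z t \<omega>) \<partial>M) = 0"
    unfolding Z_def by (rule elem_int_martingale[OF el]) (use t m(3) in \<open>auto intro!: elem_int_F el simp: Z_def\<close>)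
  have i: "integrable M (\<lambda>\<omega>. Z t \<omega> * (Z T \<omega> - Z t \<omega>))"
    by (rule integrable_mult_of_squares[OF m(1) d(1) m(3) d(2)])
  have "expectation (\<lambda>\<omega>. (Z t \<omega>)\<^sup>2) \<le> expectation (\<lambda>\<omega>. (Z t \<omega>)\<^sup>2) + expectation (\<lambda>\<omega>. (Z T \<omega> - Z t \<omega>)\<^sup>2)"
    by simp
  also have "\<dots> = (\<integral>\<omega>. (Z t \<omega>)\<^sup>2 + (Z T \<omega> - Z t \<omega>)\<^sup>2 + 2 * (Z t \<omega> * (Z T \<omega> - Z t \<omega>)) \<partial>M)"
    using m d i 0 by simp
  also have "\<dots> = expectation (\<lambda>\<omega>. (Z T \<omega>)\<^sup>2)"
    by (intro Bochner_Integration.integral_cong refl) (simp add: power2_eq_square algebra_simps)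
  finally have "ennreal (expectation (\<lambda>\<omega>. (Z t \<omega>)\<^sup>2)) \<le> ennreal (expectation (\<lambda>\<omega>. (Z T \<omega>)\<^sup>2))" by (rule ennreal_leI)
  then show ?thesis using elem_isometry[OF el] m(3) by (simp add: Z_def nn_integral_eq_integral)
qed

lemma elem_val_measurable:
  assumes "elementary I a b \<xi>"
  shows "(\<lambda>(t, \<omega>). elem_val I a b \<xi> t \<omega>) \<in> borel_measurable (time_product M T)"
proof -
  have [measurable]: "\<xi> i \<in> borel_measurable M" if "i \<in> I" for i
    using assms that by (auto simp: elementary_def intro: measurable_F)
  have [measurable]: "(\<lambda>t. indicator {a i<..b i} t :: real) \<in> borel_measurable (restrict_space lborel {0..T})" for i
    by (rule measurable_restrict_space1) simp
  show ?thesis unfolding elem_val_def split_beta by measurable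
qed

lemma elementary_diff:
  assumes e1: "elementary I a b \<xi>" and e2: "elementary J c d \<eta>"
  shows "elementary (I <+> J) (case_sum a c) (case_sum b d) (case_sum \<xi> (\<lambda>j \<omega>. - \<eta> j \<omega>))"
    and "elem_int (I <+> J) (case_sum a c) (case_sum b d) (case_sum \<xi> (\<lambda>j \<omega>. - \<eta> j \<omega>)) t \<omega> = elem_int I a b \<xi> t \<omega> - elem_int J c d \<eta> t \<omega>"
    and "elem_val (I <+> J) (case_sum a c) (case_sum b d) (case_sum \<xi> (\<lambda>j \<omega>. - \<eta> j \<omega>)) t \<omega> = elem_val I a b \<xi> t \<omega> - elem_val J c d \<eta> t \<omega>"
proof -
  have fin: "finite I" "finite J" using assms by (auto simp: elementary_def)
  have "bounded ((\<lambda>\<omega>. - \<eta> j \<omega>) ` space M)" if "bounded (\<eta> j ` space M)" for j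
    using that by (auto simp: bounded_iff)
  then show "elementary (I <+> J) (case_sum a c) (case_sum b d) (case_sum \<xi> (\<lambda>j \<omega>. - \<eta> j \<omega>))"
    using assms unfolding elementary_def ball_Plus by auto
  show "elem_int (I <+> J) (case_sum a c) (case_sum b d) (case_sum \<xi> (\<lambda>j \<omega>. - \<eta> j \<omega>)) t \<omega> = elem_int I a b \<xi> t \<omega> - elem_int J c d \<eta> t \<omega>"
    unfolding elem_int_def
    by (simp only: sum.Plus[OF fin] comp_def sum.case mult_minus_left sum_negf add_uminus_conv_diff)
  show "elem_val (I <+> J) (case_sum a c) (case_sum b d) (case_sum \<xi> (\<lambda>j \<omega>. - \<eta> j \<omega>)) t \<omega> = elem_val I a b \<xi> t \<omega> - elem_val J c d \<eta> t \<omega>"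
    unfolding elem_val_def
    by (simp only: sum.Plus[OF fin] comp_def sum.case mult_minus_left sum_negf add_uminus_conv_diff)
qed

lemma simple_process_elementary:
  assumes "simple_process M F T k s \<xi>"
  shows "elementary {..<k} s (\<lambda>i. s (Suc i)) \<xi>"
proof -
  have s: "s 0 = 0" "s k = T" "\<And>i. i < k \<Longrightarrow> s i \<le> s (Suc i)"
    and \<xi>: "\<And>i. i < k \<Longrightarrow> \<xi> i \<in> borel_measurable (F (s i)) \<and> bounded (\<xi> i ` space M)"
    using assms by (auto simp: simple_process_def)
  have mono: "s i \<le> s j" if "i \<le> j" "j \<le> k" for i j
    using that
  proof (induction j rule: dec_induct)
    case (step j)
    then show ?case using s(3)[of j] by simp
  qed simp
  have "0 \<le> s i \<and> s (Suc i) \<le> T" if "i < k" for i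
    using mono[of 0 i] mono[of "Suc i" k] s that by simp
  then show ?thesis using s \<xi> by (simp add: elementary_def)
qed

lemma grid_elementary:
  assumes c: "\<And>k. k < n \<Longrightarrow> c k \<in> borel_measurable (F (grid_point T n k))" "\<And>k. k < n \<Longrightarrow> bounded (c k ` space M)"
  shows "elementary {..<n} (grid_point T n) (\<lambda>k. grid_point T n (Suc k)) c"
  using grid_interval c by (simp add: elementary_def less_imp_le)

lemma grid_elem_int:
  assumes j: "j \<le> n"
  shows "elem_int {..<n} (grid_point T n) (\<lambda>k. grid_point T n (Suc k)) c (grid_point T n j) \<omega>
    = (\<Sum>k<j. c k \<omega> * grid_increment n k \<omega>)"
proof -
  have "(\<Sum>k<n. c k \<omega> * (B (min (grid_point T n (Suc k)) (grid_point T n j)) \<omega> - B (min (grid_point T n k) (grid_point T n j)) \<omega>))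
    = (\<Sum>k<j. c k \<omega> * grid_increment n k \<omega>)"
  proof (rule sum.mono_neutral_cong_right)
    show "\<forall>k\<in>{..<n} - {..<j}. c k \<omega> * (B (min (grid_point T n (Suc k)) (grid_point T n j)) \<omega> - B (min (grid_point T n k) (grid_point T n j)) \<omega>) = 0"
    proof
      fix k assume "k \<in> {..<n} - {..<j}"
      then have "grid_point T n j \<le> grid_point T n k" "grid_point T n j \<le> grid_point T n (Suc k)"
        by (auto intro!: grid_point_mono T_pos)
      then show "c k \<omega> * (B (min (grid_point T n (Suc k)) (grid_point T n j)) \<omega> - B (min (grid_point T n k) (grid_point T n j)) \<omega>) = 0"
        by (simp add: min_absorb2)
    qed
    fix k assume "k \<in> {..<j}"
    then have "grid_point T n k \<le> grid_point T n j" "grid_point T n (Suc k) \<le> grid_point T n j"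
      by (auto intro!: grid_point_mono T_pos)
    then show "c k \<omega> * (B (min (grid_point T n (Suc k)) (grid_point T n j)) \<omega> - B (min (grid_point T n k) (grid_point T n j)) \<omega>) = c k \<omega> * grid_increment n k \<omega>"
      by (simp add: min_absorb1 grid_increment_def)
  qed (use j in auto)
  then show ?thesis by (simp add: elem_int_def)
qed

lemma ito_grid_approx:
  assumes ito: "ito_integral M F T B H I" and n: "0 < n" and l: "0 < l"
    and c: "\<And>k. k < n \<Longrightarrow> c k \<in> borel_measurable (F (grid_point T n k))" "\<And>k. k < n \<Longrightarrow> bounded (c k ` space M)"
  shows "emeasure M {\<omega> \<in> space M. \<exists>j\<le>n. 2 * l \<le> \<bar>I (grid_point T n j) \<omega> - (\<Sum>k<j. c k \<omega> * grid_increment n k \<omega>)\<bar>}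
    \<le> ennreal (2 / l\<^sup>2) * sq_norm M T (\<lambda>t \<omega>. H t \<omega> - elem_val {..<n} (grid_point T n) (\<lambda>k. grid_point T n (Suc k)) c t \<omega>)"
proof -
  from ito have Hm: "(\<lambda>(t, \<omega>). H t \<omega>) \<in> borel_measurable (time_product M T)"
    and IM: "\<And>t. t \<in> {0..T} \<Longrightarrow> I t \<in> borel_measurable M"
    unfolding ito_integral_def by auto
  from ito obtain K s \<xi> where sp': "\<forall>m. simple_process M F T (K m) (s m) (\<xi> m)"
    and conv: "(\<lambda>m. \<integral>\<^sup>+\<omega>. (\<integral>\<^sup>+t\<in>{0..T}. ennreal ((H t \<omega> - simple_value (K m) (s m) (\<xi> m) t \<omega>)\<^sup>2) \<partial>lborel) \<partial>M) \<longlonglongrightarrow> 0"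
    and convI: "\<forall>t\<in>{0..T}. (\<lambda>m. \<integral>\<^sup>+\<omega>. ennreal ((I t \<omega> - simple_integral B (K m) (s m) (\<xi> m) t \<omega>)\<^sup>2) \<partial>M) \<longlonglongrightarrow> 0"
    unfolding ito_integral_def by (elim conjE exE)
  have sp: "simple_process M F T (K m) (s m) (\<xi> m)" for m using sp' by simp
  define p where "p = grid_point T n"
  have pmem: "p j \<in> {0..T}" if "j \<le> n" for j unfolding p_def by (rule grid_point_mem[OF T_pos that])
  define h where "h = elem_val {..<n} (grid_point T n) (\<lambda>k. grid_point T n (Suc k)) c"
  define R where "R j \<omega> = (\<Sum>k<j. c k \<omega> * grid_increment n k \<omega>)" for j \<omega>
  define v where "v m = elem_val {..<K m} (s m) (\<lambda>i. s m (Suc i)) (\<xi> m)" for m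
  define Z where "Z m = elem_int {..<K m} (s m) (\<lambda>i. s m (Suc i)) (\<xi> m)" for m
  have elc: "elementary {..<n} (grid_point T n) (\<lambda>k. grid_point T n (Suc k)) c" by (rule grid_elementary) (rule c; assumption)+
  have els: "elementary {..<K m} (s m) (\<lambda>i. s m (Suc i)) (\<xi> m)" for m by (rule simple_process_elementary[OF sp])
  have sv: "simple_value (K m) (s m) (\<xi> m) t \<omega> = v m t \<omega>" for m t \<omega> by (simp only: simple_value_def v_def elem_val_def)
  have si: "simple_integral B (K m) (s m) (\<xi> m) t \<omega> = Z m t \<omega>" for m t \<omega> by (simp only: simple_integral_def Z_def elem_int_def)
  have conv: "(\<lambda>m. sq_norm M T (\<lambda>t \<omega>. H t \<omega> - v m t \<omega>)) \<longlonglongrightarrow> 0" using conv by (simp add: sq_norm_def sv)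
  have convI: "(\<lambda>m. \<integral>\<^sup>+\<omega>. ennreal ((I t \<omega> - Z m t \<omega>)\<^sup>2) \<partial>M) \<longlonglongrightarrow> 0" if "t \<in> {0..T}" for t using bspec[OF convI that] by (simp add: si)
  have hm: "(\<lambda>(t, \<omega>). h t \<omega>) \<in> borel_measurable (time_product M T)" unfolding h_def by (rule elem_val_measurable[OF elc])
  have vm: "(\<lambda>(t, \<omega>). v m t \<omega>) \<in> borel_measurable (time_product M T)" for m unfolding v_def by (rule elem_val_measurable[OF els])
  have d1: "(\<lambda>(t, \<omega>). H t \<omega> - v m t \<omega>) \<in> borel_measurable (time_product M T)" for m
    using borel_measurable_diff[OF Hm vm[of m]] by (simp add: split_beta)
  have d2: "(\<lambda>(t, \<omega>). H t \<omega> - h t \<omega>) \<in> borel_measurable (time_product M T)"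
    using borel_measurable_diff[OF Hm hm] by (simp add: split_beta)
  define e where "e m = (\<Sum>j\<le>n. ennreal (1 / l\<^sup>2) * (\<integral>\<^sup>+\<omega>. ennreal ((I (p j) \<omega> - Z m (p j) \<omega>)\<^sup>2) \<partial>M))" for m
  have cM: "c k \<in> borel_measurable M" if "k < n" for k by (rule measurable_F[OF c(1)[OF that]])
  have RM: "R j \<in> borel_measurable M" if "j \<le> n" for j
    unfolding R_def using that cM grid_increment_M[of _ n]
    by (intro borel_measurable_sum borel_measurable_times) auto
  have ZM: "Z m (p j) \<in> borel_measurable M" if "j \<le> n" for j m
    unfolding Z_def by (rule elem_int_M[OF els]) (use pmem[OF that] in simp)
  have bound: "emeasure M {\<omega> \<in> space M. \<exists>j\<le>n. 2 * l \<le> \<bar>I (p j) \<omega> - R j \<omega>\<bar>}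
    \<le> e m + ennreal (1 / l\<^sup>2) * (2 * sq_norm M T (\<lambda>t \<omega>. H t \<omega> - h t \<omega>) + 2 * sq_norm M T (\<lambda>t \<omega>. H t \<omega> - v m t \<omega>))" for m
  proof -
    have meas1: "{\<omega> \<in> space M. l \<le> \<bar>I (p j) \<omega> - Z m (p j) \<omega>\<bar>} \<in> sets M" if "j \<le> n" for j
    proof -
      note [measurable] = IM[OF pmem[OF that]] ZM[OF that, of m]
      show ?thesis by measurable
    qed
    have meas2: "{\<omega> \<in> space M. \<exists>j\<le>n. l \<le> \<bar>Z m (p j) \<omega> - R j \<omega>\<bar>} \<in> sets M"
    proof -
      have "{\<omega> \<in> space M. \<exists>j\<in>{..n}. l \<le> \<bar>Z m (p j) \<omega> - R j \<omega>\<bar>} \<in> sets M"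
      proof (rule sets.sets_Collect_finite_Ex[OF _ finite_atMost])
        fix j assume "j \<in> {..n}"
        then have j: "j \<le> n" by simp
        note [measurable] = RM[OF j] ZM[OF j, of m]
        show "{\<omega> \<in> space M. l \<le> \<bar>Z m (p j) \<omega> - R j \<omega>\<bar>} \<in> sets M" by measurable
      qed
      then show ?thesis unfolding Bex_def atMost_iff .
    qed
    have "emeasure M {\<omega> \<in> space M. \<exists>j\<le>n. 2 * l \<le> \<bar>I (p j) \<omega> - R j \<omega>\<bar>} \<le>
      emeasure M ((\<Union>j\<le>n. {\<omega> \<in> space M. l \<le> \<bar>I (p j) \<omega> - Z m (p j) \<omega>\<bar>}) \<union> {\<omega> \<in> space M. \<exists>j\<le>n. l \<le> \<bar>Z m (p j) \<omega> - R j \<omega>\<bar>})"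
    proof (rule emeasure_mono)
      show "{\<omega> \<in> space M. \<exists>j\<le>n. 2 * l \<le> \<bar>I (p j) \<omega> - R j \<omega>\<bar>} \<subseteq>
        (\<Union>j\<le>n. {\<omega> \<in> space M. l \<le> \<bar>I (p j) \<omega> - Z m (p j) \<omega>\<bar>}) \<union> {\<omega> \<in> space M. \<exists>j\<le>n. l \<le> \<bar>Z m (p j) \<omega> - R j \<omega>\<bar>}"
      proof
        fix \<omega> assume "\<omega> \<in> {\<omega> \<in> space M. \<exists>j\<le>n. 2 * l \<le> \<bar>I (p j) \<omega> - R j \<omega>\<bar>}"
        then obtain j where j: "\<omega> \<in> space M" "j \<le> n" "2 * l \<le> \<bar>I (p j) \<omega> - R j \<omega>\<bar>" by auto
        then have "l \<le> \<bar>I (p j) \<omega> - Z m (p j) \<omega>\<bar> \<or> l \<le> \<bar>Z m (p j) \<omega> - R j \<omega>\<bar>" by linarith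
        then show "\<omega> \<in> (\<Union>j\<le>n. {\<omega> \<in> space M. l \<le> \<bar>I (p j) \<omega> - Z m (p j) \<omega>\<bar>}) \<union> {\<omega> \<in> space M. \<exists>j\<le>n. l \<le> \<bar>Z m (p j) \<omega> - R j \<omega>\<bar>}"
          using j by blast
      qed
      show "(\<Union>j\<le>n. {\<omega> \<in> space M. l \<le> \<bar>I (p j) \<omega> - Z m (p j) \<omega>\<bar>}) \<union> {\<omega> \<in> space M. \<exists>j\<le>n. l \<le> \<bar>Z m (p j) \<omega> - R j \<omega>\<bar>} \<in> sets M"
        by (intro sets.Un sets.finite_UN finite_atMost meas1 meas2) simp
    qed
    also have "\<dots> \<le> emeasure M (\<Union>j\<le>n. {\<omega> \<in> space M. l \<le> \<bar>I (p j) \<omega> - Z m (p j) \<omega>\<bar>}) + emeasure M {\<omega> \<in> space M. \<exists>j\<le>n. l \<le> \<bar>Z m (p j) \<omega> - R j \<omega>\<bar>}"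
      by (intro emeasure_subadditive sets.finite_UN finite_atMost meas1 meas2) simp
    also have "emeasure M (\<Union>j\<le>n. {\<omega> \<in> space M. l \<le> \<bar>I (p j) \<omega> - Z m (p j) \<omega>\<bar>}) \<le> (\<Sum>j\<le>n. emeasure M {\<omega> \<in> space M. l \<le> \<bar>I (p j) \<omega> - Z m (p j) \<omega>\<bar>})"
      by (rule emeasure_subadditive_finite) (use meas1 in auto)
    also have "\<dots> \<le> e m" unfolding e_def
    proof (rule sum_mono)
      fix j assume "j \<in> {..n}"
      then have j: "j \<le> n" by simp
      note [measurable] = IM[OF pmem[OF j]] ZM[OF j, of m]
      have "emeasure M {\<omega> \<in> space M. l \<le> \<bar>I (p j) \<omega> - Z m (p j) \<omega>\<bar>}
          \<le> emeasure M ({\<omega> \<in> space M. 1 \<le> ennreal (1 / l\<^sup>2) * ennreal ((I (p j) \<omega> - Z m (p j) \<omega>)\<^sup>2)})"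
      proof (rule emeasure_mono)
        show "{\<omega> \<in> space M. l \<le> \<bar>I (p j) \<omega> - Z m (p j) \<omega>\<bar>} \<subseteq> {\<omega> \<in> space M. 1 \<le> ennreal (1 / l\<^sup>2) * ennreal ((I (p j) \<omega> - Z m (p j) \<omega>)\<^sup>2)}"
        proof safe
          fix \<omega> assume "l \<le> \<bar>I (p j) \<omega> - Z m (p j) \<omega>\<bar>"
          then have "l\<^sup>2 \<le> (I (p j) \<omega> - Z m (p j) \<omega>)\<^sup>2" using l by (simp add: abs_le_square_iff[symmetric])
          then have "1 \<le> 1 / l\<^sup>2 * (I (p j) \<omega> - Z m (p j) \<omega>)\<^sup>2" using l by simp
          then have "ennreal 1 \<le> ennreal (1 / l\<^sup>2 * (I (p j) \<omega> - Z m (p j) \<omega>)\<^sup>2)" by (rule ennreal_leI)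
          also have "\<dots> = ennreal (1 / l\<^sup>2) * ennreal ((I (p j) \<omega> - Z m (p j) \<omega>)\<^sup>2)" by (rule ennreal_mult) auto
          finally show "1 \<le> ennreal (1 / l\<^sup>2) * ennreal ((I (p j) \<omega> - Z m (p j) \<omega>)\<^sup>2)" by simp
        qed
      qed measurable
      also have "\<dots> \<le> ennreal (1 / l\<^sup>2) * (\<integral>\<^sup>+\<omega>. ennreal ((I (p j) \<omega> - Z m (p j) \<omega>)\<^sup>2) \<partial>M)"
        using nn_integral_Markov_inequality[where u="\<lambda>\<omega>. ennreal ((I (p j) \<omega> - Z m (p j) \<omega>)\<^sup>2)" and A="space M" and M=M and c="ennreal (1 / l\<^sup>2)"]
        by (simp cong: nn_integral_cong)
      finally show "emeasure M {\<omega> \<in> space M. l \<le> \<bar>I (p j) \<omega> - Z m (p j) \<omega>\<bar>}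
        \<le> ennreal (1 / l\<^sup>2) * (\<integral>\<^sup>+\<omega>. ennreal ((I (p j) \<omega> - Z m (p j) \<omega>)\<^sup>2) \<partial>M)" .
    qed
    also have "emeasure M {\<omega> \<in> space M. \<exists>j\<le>n. l \<le> \<bar>Z m (p j) \<omega> - R j \<omega>\<bar>} \<le>
        ennreal (1 / l\<^sup>2) * sq_norm M T (\<lambda>t \<omega>. v m t \<omega> - h t \<omega>)"
    proof -
      note el = elementary_diff[OF els[of m] elc]
      have "emeasure M {\<omega> \<in> space M. \<exists>j\<le>n. l \<le> \<bar>elem_int ({..<K m} <+> {..<n}) (case_sum (s m) (grid_point T n))
          (case_sum (\<lambda>i. s m (Suc i)) (\<lambda>k. grid_point T n (Suc k))) (case_sum (\<xi> m) (\<lambda>j \<omega>. - c j \<omega>)) (p j) \<omega>\<bar>} \<le>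
        ennreal (1 / l\<^sup>2) * sq_norm M T (elem_val ({..<K m} <+> {..<n}) (case_sum (s m) (grid_point T n))
          (case_sum (\<lambda>i. s m (Suc i)) (\<lambda>k. grid_point T n (Suc k))) (case_sum (\<xi> m) (\<lambda>j \<omega>. - c j \<omega>)))"
        by (rule elem_maximal[OF el(1) _ _ _ l]) (use n T_pos in \<open>auto simp: p_def grid_point_n intro!: grid_point_mono\<close>)
      moreover have "elem_val ({..<K m} <+> {..<n}) (case_sum (s m) (grid_point T n))
          (case_sum (\<lambda>i. s m (Suc i)) (\<lambda>k. grid_point T n (Suc k))) (case_sum (\<xi> m) (\<lambda>j \<omega>. - c j \<omega>)) = (\<lambda>t \<omega>. v m t \<omega> - h t \<omega>)"
        by (intro ext) (simp only: el(3) v_def h_def)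
      moreover have "elem_int ({..<K m} <+> {..<n}) (case_sum (s m) (grid_point T n))
          (case_sum (\<lambda>i. s m (Suc i)) (\<lambda>k. grid_point T n (Suc k))) (case_sum (\<xi> m) (\<lambda>j \<omega>. - c j \<omega>)) (p j) \<omega> = Z m (p j) \<omega> - R j \<omega>"
        if "j \<le> n" for j \<omega>
        unfolding el(2) Z_def R_def p_def grid_elem_int[OF that] ..
      then have "{\<omega> \<in> space M. \<exists>j\<le>n. l \<le> \<bar>elem_int ({..<K m} <+> {..<n}) (case_sum (s m) (grid_point T n))
          (case_sum (\<lambda>i. s m (Suc i)) (\<lambda>k. grid_point T n (Suc k))) (case_sum (\<xi> m) (\<lambda>j \<omega>. - c j \<omega>)) (p j) \<omega>\<bar>}
        = {\<omega> \<in> space M. \<exists>j\<le>n. l \<le> \<bar>Z m (p j) \<omega> - R j \<omega>\<bar>}" by (intro Collect_cong conj_cong ex_cong1) auto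
      ultimately show ?thesis by simp
    qed
    also have "(\<lambda>t \<omega>. v m t \<omega> - h t \<omega>) = (\<lambda>t \<omega>. (H t \<omega> - h t \<omega>) - (H t \<omega> - v m t \<omega>))" by simp
    also have "sq_norm M T \<dots> \<le> 2 * sq_norm M T (\<lambda>t \<omega>. H t \<omega> - h t \<omega>) + 2 * sq_norm M T (\<lambda>t \<omega>. H t \<omega> - v m t \<omega>)"
      by (rule sq_norm_diff_le[OF d2 d1])
    finally show ?thesis by (simp add: add_mono mult_left_mono)
  qed
  have "(\<lambda>m. e m + ennreal (1 / l\<^sup>2) * (2 * sq_norm M T (\<lambda>t \<omega>. H t \<omega> - h t \<omega>) + 2 * sq_norm M T (\<lambda>t \<omega>. H t \<omega> - v m t \<omega>)))
    \<longlonglongrightarrow> (\<Sum>j\<le>n. ennreal (1 / l\<^sup>2) * 0) + ennreal (1 / l\<^sup>2) * (2 * sq_norm M T (\<lambda>t \<omega>. H t \<omega> - h t \<omega>) + 2 * 0)"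
    unfolding e_def
    by (intro tendsto_add tendsto_sum ennreal_tendsto_cmult convI conv tendsto_const) (use pmem in auto)
  then have "emeasure M {\<omega> \<in> space M. \<exists>j\<le>n. 2 * l \<le> \<bar>I (p j) \<omega> - R j \<omega>\<bar>} \<le>
    (\<Sum>j\<le>n. ennreal (1 / l\<^sup>2) * 0) + ennreal (1 / l\<^sup>2) * (2 * sq_norm M T (\<lambda>t \<omega>. H t \<omega> - h t \<omega>) + 2 * 0)"
    by (rule LIMSEQ_le_const) (use bound in blast)
  also have "\<dots> = ennreal (2 / l\<^sup>2) * sq_norm M T (\<lambda>t \<omega>. H t \<omega> - h t \<omega>)"
  proof -
    have "ennreal (2 / l\<^sup>2) = ennreal (1 / l\<^sup>2) * 2"
      using ennreal_mult[of "1 / l\<^sup>2" 2] by simp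
    then show ?thesis by (simp add: mult.assoc)
  qed
  finally show ?thesis by (simp add: p_def R_def h_def)
qed

end

section \<open>The remainder of the discretization error\<close>

lemma exp_minus_one_le: "\<bar>exp x - 1\<bar> \<le> \<bar>x\<bar> * exp \<bar>x\<bar>" for x :: real
proof -
  have "exp x * (1 - x) \<le> exp x * exp (- x)" using exp_ge_add_one_self[of "- x"] by (intro mult_left_mono) auto
  then have 1: "exp x - 1 \<le> x * exp x" by (simp add: algebra_simps exp_minus_inverse)
  show ?thesis
  proof (cases "0 \<le> x")
    case False
    then have "\<bar>exp x - 1\<bar> = 1 - exp x" by simp
    also have "\<dots> \<le> \<bar>x\<bar> * 1" using exp_ge_add_one_self[of x] False by linarith
    also have "\<dots> \<le> \<bar>x\<bar> * exp \<bar>x\<bar>" by (intro mult_left_mono) auto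
    finally show ?thesis .
  qed (use 1 in simp)
qed

lemma exp_minus_one_minus_le:
  fixes x :: real
  shows "0 \<le> exp x - 1 - x" "exp x - 1 - x \<le> x\<^sup>2 * exp \<bar>x\<bar>"
proof -
  show "0 \<le> exp x - 1 - x" using exp_ge_add_one_self[of x] by linarith
  have "exp x * (1 - x) \<le> exp x * exp (- x)" using exp_ge_add_one_self[of "- x"] by (intro mult_left_mono) auto
  then have "exp x - 1 - x \<le> x * (exp x - 1)" by (simp add: algebra_simps exp_minus_inverse)
  also have "\<dots> \<le> \<bar>x\<bar> * \<bar>exp x - 1\<bar>" unfolding abs_mult[symmetric] by simp
  also have "\<dots> \<le> \<bar>x\<bar> * (\<bar>x\<bar> * exp \<bar>x\<bar>)" by (intro mult_left_mono exp_minus_one_le) simp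
  finally show "exp x - 1 - x \<le> x\<^sup>2 * exp \<bar>x\<bar>" by (simp add: power2_eq_square)
qed

lemma (in prob_space) prob_le_of_eventually:
  assumes "E \<in> events" "\<And>m. E' m \<in> events" "\<And>m. 0 < m \<Longrightarrow> prob (E' m) \<le> q"
    and ev: "\<And>\<omega>. \<omega> \<in> E \<Longrightarrow> \<forall>\<^sub>F m in sequentially. \<omega> \<in> E' m"
  shows "prob E \<le> q"
proof -
  define G where "G k = (\<Inter>m\<in>{Suc k..}. E' m)" for k
  have G: "G k \<in> events" for k unfolding G_def using assms(2) by (intro sets.countable_INT') auto
  have "incseq G" unfolding G_def incseq_def by force
  then have "(\<lambda>k. prob (G k)) \<longlonglongrightarrow> prob (\<Union>k. G k)" using G by (intro finite_Lim_measure_incseq) auto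
  moreover have "prob (G k) \<le> q" for k
  proof -
    have "prob (G k) \<le> prob (E' (Suc k))" unfolding G_def using assms(2) by (intro finite_measure_mono) auto
    then show ?thesis using assms(3)[of "Suc k"] by simp
  qed
  ultimately have "prob (\<Union>k. G k) \<le> q" by (intro LIMSEQ_le_const2) auto
  moreover have "E \<subseteq> (\<Union>k. G k)"
  proof
    fix \<omega> assume "\<omega> \<in> E"
    then obtain k where "\<forall>m\<ge>k. \<omega> \<in> E' m" using ev by (auto simp: eventually_sequentially)
    then show "\<omega> \<in> (\<Union>k. G k)" unfolding G_def by (intro UN_I[of k]) auto
  qed
  then have "prob E \<le> prob (\<Union>k. G k)" using G by (intro finite_measure_mono) auto
  ultimately show ?thesis by simp
qed

lemma (in prob_space) maximal_inequality_differences: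
  fixes X :: "nat \<Rightarrow> 'a \<Rightarrow> real" and F :: "nat \<Rightarrow> 'a measure"
  assumes sub: "\<And>j. j \<le> n \<Longrightarrow> subalgebra M (F j)"
    and mono: "\<And>i j. i \<le> j \<Longrightarrow> j \<le> n \<Longrightarrow> sets (F i) \<subseteq> sets (F j)"
    and X: "\<And>k. k < n \<Longrightarrow> X k \<in> borel_measurable (F (Suc k))"
    and sq: "\<And>k. k < n \<Longrightarrow> integrable M (\<lambda>x. (X k x)\<^sup>2)"
    and orth: "\<And>k V. k < n \<Longrightarrow> V \<in> borel_measurable (F k) \<Longrightarrow> integrable M (\<lambda>x. (V x)\<^sup>2) \<Longrightarrow> (\<integral>x. V x * X k x \<partial>M) = 0"
    and l: "0 < l"
  shows "prob {x \<in> space M. \<exists>j\<le>n. l \<le> \<bar>\<Sum>k<j. X k x\<bar>} \<le> (\<Sum>k<n. expectation (\<lambda>x. (X k x)\<^sup>2)) / l\<^sup>2"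
proof -
  have sp: "space (F j) = space M" if "j \<le> n" for j using sub[OF that] by (simp add: subalgebra_def)
  have XF: "X k \<in> borel_measurable (F j)" if "k < j" "j \<le> n" for k j
    using X[of k] mono[of "Suc k" j] that by (auto simp: measurable_def sp)
  have XM: "X k \<in> borel_measurable M" if "k < n" for k
    using measurable_from_subalg[OF sub X[OF that]] that by simp
  define Z where "Z j x = (\<Sum>k<j. X k x)" for j x
  have ZF: "Z i \<in> borel_measurable (F j)" if "i \<le> j" "j \<le> n" for i j
    unfolding Z_def using that XF by (intro borel_measurable_sum) auto
  have ZM: "Z j \<in> borel_measurable M" if "j \<le> n" for j
    using measurable_from_subalg[OF sub ZF[OF order_refl that]] that by simp
  have Z2: "integrable M (\<lambda>x. (Z j x)\<^sup>2)" if "j \<le> n" for j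
    unfolding Z_def using that XM sq by (intro square_integrable_sum) auto
  have "prob {x \<in> space M. \<exists>j\<le>n. l \<le> \<bar>Z j x\<bar>} \<le> expectation (\<lambda>x. (Z n x)\<^sup>2) / l\<^sup>2"
  proof (rule maximal_inequality[where F=F])
    fix j A assume j: "j \<le> n" and A: "A \<in> sets (F j)"
    have AM: "A \<in> events" using A sub[OF j] by (auto simp: subalgebra_def)
    define V where "V x = indicator A x * Z j x" for x
    have VF: "V \<in> borel_measurable (F k)" if "j \<le> k" "k \<le> n" for k
      unfolding V_def using ZF[OF that] A mono[OF that] by (intro borel_measurable_times borel_measurable_indicator) auto
    have "integrable M (\<lambda>x. indicator A x *\<^sub>R (Z j x)\<^sup>2)" by (intro integrable_mult_indicator AM Z2 j)
    moreover have "(V x)\<^sup>2 = indicator A x *\<^sub>R (Z j x)\<^sup>2" for x by (simp add: V_def indicator_def)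
    ultimately have V2: "integrable M (\<lambda>x. (V x)\<^sup>2)" by simp
    have VM: "V \<in> borel_measurable M" using measurable_from_subalg[OF sub VF] j by simp
    have "(\<integral>x. indicator A x * Z j x * (Z n x - Z j x) \<partial>M) = (\<integral>x. (\<Sum>k\<in>{j..<n}. V x * X k x) \<partial>M)"
    proof (intro Bochner_Integration.integral_cong refl)
      fix x
      have "Z n x - Z j x = (\<Sum>k\<in>{j..<n}. X k x)"
        unfolding Z_def using j sum_diff[of "{..<n}" "{..<j}" "\<lambda>k. X k x"]
        by (simp add: lessThan_minus_lessThan)
      then show "indicator A x * Z j x * (Z n x - Z j x) = (\<Sum>k\<in>{j..<n}. V x * X k x)"
        by (simp add: V_def sum_distrib_left)
    qed
    also have "\<dots> = (\<Sum>k\<in>{j..<n}. \<integral>x. V x * X k x \<partial>M)"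
      by (intro Bochner_Integration.integral_sum integrable_mult_of_squares) (use VM V2 XM sq in auto)
    also have "\<dots> = 0" using orth[OF _ VF V2] by (intro sum.neutral) auto
    finally show "(\<integral>x. indicator A x * Z j x * (Z n x - Z j x) \<partial>M) = 0" .
  qed (use sub ZF Z2 l in auto)
  moreover have "expectation (\<lambda>x. (Z j x)\<^sup>2) = (\<Sum>k<j. expectation (\<lambda>x. (X k x)\<^sup>2))" if "j \<le> n" for j
    using that
  proof (induction j)
    case (Suc j)
    then have j: "j < n" "j \<le> n" by auto
    have "expectation (\<lambda>x. (Z (Suc j) x)\<^sup>2) = expectation (\<lambda>x. (Z j x)\<^sup>2 + (X j x)\<^sup>2 + 2 * (Z j x * X j x))"
      by (simp add: Z_def power2_sum ac_simps)
    also have "\<dots> = expectation (\<lambda>x. (Z j x)\<^sup>2) + expectation (\<lambda>x. (X j x)\<^sup>2)"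
      using Z2[OF j(2)] sq[OF j(1)] integrable_mult_of_squares[OF ZM[OF j(2)] XM[OF j(1)] Z2[OF j(2)] sq[OF j(1)]]
        orth[OF j(1) ZF[OF order_refl j(2)] Z2[OF j(2)]] by simp
    finally show ?case using Suc j by simp
  qed (simp add: Z_def)
  ultimately show ?thesis by (simp add: Z_def)
qed

context brownian
begin

definition exp_remainder :: "real \<Rightarrow> real \<Rightarrow> real \<Rightarrow> real \<Rightarrow> 'a \<Rightarrow> real" where
  "exp_remainder r \<sigma> s u \<omega> = exp ((r - \<sigma>\<^sup>2 / 2) * (u - s) + \<sigma> * (B u \<omega> - B s \<omega>)) - exp (r * (u - s)) - \<sigma> * (B u \<omega> - B s \<omega>)"

definition exp_const :: "real \<Rightarrow> real \<Rightarrow> real" where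
  "exp_const r \<sigma> = exp (2 * \<bar>r\<bar> * T) * (\<sigma>^4 * exp (\<sigma>\<^sup>2 * T) + \<sigma>\<^sup>2 * r\<^sup>2 * T)"

lemma exp_const_nonneg: "0 \<le> exp_const r \<sigma>"
  using T_pos by (simp add: exp_const_def)

lemma exp_remainder_moments:
  assumes su: "0 \<le> s" "s \<le> u" "u \<le> T"
  shows "exp_remainder r \<sigma> s u \<in> borel_measurable (F u)"
    and "V \<in> borel_measurable (F s) \<Longrightarrow> integrable M V \<Longrightarrow> integrable M (\<lambda>\<omega>. V \<omega> * exp_remainder r \<sigma> s u \<omega>)"
    and "V \<in> borel_measurable (F s) \<Longrightarrow> integrable M V \<Longrightarrow> (\<integral>\<omega>. V \<omega> * exp_remainder r \<sigma> s u \<omega> \<partial>M) = 0"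
    and "integrable M (\<lambda>\<omega>. (exp_remainder r \<sigma> s u \<omega>)\<^sup>2)"
    and "expectation (\<lambda>\<omega>. (exp_remainder r \<sigma> s u \<omega>)\<^sup>2) \<le> exp_const r \<sigma> * (u - s)\<^sup>2"
proof -
  define \<tau> where "\<tau> = u - s"
  have \<tau>: "0 \<le> \<tau>" "\<tau> \<le> T" using su by (auto simp: \<tau>_def)
  define \<alpha> \<beta> where "\<alpha> = exp ((r - \<sigma>\<^sup>2 / 2) * \<tau>)" and "\<beta> = exp (r * \<tau>)"
  define x where "x \<omega> = B u \<omega> - B s \<omega>" for \<omega>
  have eq: "exp_remainder r \<sigma> s u \<omega> = \<alpha> * exp (\<sigma> * x \<omega>) - \<beta> - \<sigma> * x \<omega>" for \<omega>
    by (simp add: exp_remainder_def \<alpha>_def \<beta>_def x_def \<tau>_def exp_add)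
  have [measurable]: "B u \<in> borel_measurable (F u)" "B s \<in> borel_measurable (F u)" using su by (auto intro!: B_F)
  show "exp_remainder r \<sigma> s u \<in> borel_measurable (F u)"
    unfolding exp_remainder_def by measurable
  note m = increment_moments[OF su, folded x_def \<tau>_def]
  have "(r - \<sigma>\<^sup>2 / 2) * \<tau> + \<sigma>\<^sup>2 * \<tau> / 2 = r * \<tau>" by (simp add: left_diff_distrib)
  then have \<alpha>\<beta>: "\<alpha> * exp (\<sigma>\<^sup>2 * \<tau> / 2) = \<beta>" by (simp only: \<alpha>_def \<beta>_def exp_add[symmetric])
  have i: "integrable M (\<lambda>\<omega>. \<alpha> * exp (\<sigma> * x \<omega>) - \<beta> - \<sigma> * x \<omega>)"
    using m(1) m(5)[of \<sigma>] by (intro Bochner_Integration.integrable_diff integrable_mult_right) auto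
  have e0: "expectation (\<lambda>\<omega>. \<alpha> * exp (\<sigma> * x \<omega>) - \<beta> - \<sigma> * x \<omega>) = 0"
    using m(1,2) m(5,6)[of \<sigma>] \<alpha>\<beta> prob_space by simp
  have "integrable M (\<lambda>\<omega>. V \<omega> * exp_remainder r \<sigma> s u \<omega>) \<and> (\<integral>\<omega>. V \<omega> * exp_remainder r \<sigma> s u \<omega> \<partial>M) = 0"
    if V: "V \<in> borel_measurable (F s)" "integrable M V" for V
  proof (cases "s = u")
    case True
    then show ?thesis by (simp add: exp_remainder_def)
  next
    case False
    then have "s < u" using su by simp
    from increment_integral[OF su(1) this su(3) V, of "\<lambda>y. \<alpha> * exp (\<sigma> * y) - \<beta> - \<sigma> * y"] i e0
    show ?thesis by (simp add: eq x_def)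
  qed
  then show "V \<in> borel_measurable (F s) \<Longrightarrow> integrable M V \<Longrightarrow> integrable M (\<lambda>\<omega>. V \<omega> * exp_remainder r \<sigma> s u \<omega>)"
    "V \<in> borel_measurable (F s) \<Longrightarrow> integrable M V \<Longrightarrow> (\<integral>\<omega>. V \<omega> * exp_remainder r \<sigma> s u \<omega> \<partial>M) = 0" by auto
  define E where "E = exp (\<sigma>\<^sup>2 * \<tau> / 2)"
  have E: "exp ((2 * \<sigma>)\<^sup>2 * \<tau> / 2) = E ^ 4" "exp (\<sigma>\<^sup>2 * \<tau>) = E\<^sup>2" "\<beta> = \<alpha> * E"
    using \<alpha>\<beta> by (simp_all add: E_def exp_of_nat_mult[symmetric] power_mult_distrib)
  have sq: "(exp_remainder r \<sigma> s u \<omega>)\<^sup>2 = \<alpha>\<^sup>2 * exp ((2 * \<sigma>) * x \<omega>) + \<beta>\<^sup>2 + \<sigma>\<^sup>2 * (x \<omega>)\<^sup>2 - 2 * \<alpha> * \<beta> * exp (\<sigma> * x \<omega>)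
      - 2 * \<alpha> * \<sigma> * (x \<omega> * exp (\<sigma> * x \<omega>)) + 2 * \<beta> * \<sigma> * x \<omega>" for \<omega>
  proof -
    have "exp ((2 * \<sigma>) * x \<omega>) = (exp (\<sigma> * x \<omega>))\<^sup>2" by (simp add: power2_eq_square exp_add[symmetric])
    then show ?thesis by (simp add: eq power2_eq_square algebra_simps)
  qed
  note ints = m(1) m(3) m(5)[of \<sigma>] m(5)[of "2 * \<sigma>"] m(7)[of \<sigma>]
  show "integrable M (\<lambda>\<omega>. (exp_remainder r \<sigma> s u \<omega>)\<^sup>2)" unfolding sq
    by (intro Bochner_Integration.integrable_add Bochner_Integration.integrable_diff integrable_mult_right ints) simp
  have "expectation (\<lambda>\<omega>. (exp_remainder r \<sigma> s u \<omega>)\<^sup>2) = \<alpha>\<^sup>2 * exp ((2 * \<sigma>)\<^sup>2 * \<tau> / 2) + \<beta>\<^sup>2 + \<sigma>\<^sup>2 * \<tau> - 2 * \<alpha> * \<beta> * exp (\<sigma>\<^sup>2 * \<tau> / 2)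
      - 2 * \<alpha> * \<sigma> * (\<sigma> * \<tau> * exp (\<sigma>\<^sup>2 * \<tau> / 2)) + 2 * \<beta> * \<sigma> * 0"
    unfolding sq using ints m(2,4) m(6)[of \<sigma>] m(6)[of "2 * \<sigma>"] m(8)[of \<sigma>] prob_space by simp
  also have "\<alpha>\<^sup>2 * exp ((2 * \<sigma>)\<^sup>2 * \<tau> / 2) = \<beta>\<^sup>2 * exp (\<sigma>\<^sup>2 * \<tau>)"
    unfolding E by (simp add: power2_eq_square power4_eq_xxxx ac_simps)
  also have "2 * \<alpha> * \<beta> * exp (\<sigma>\<^sup>2 * \<tau> / 2) = 2 * \<beta>\<^sup>2"
    unfolding E E_def[symmetric] by (simp add: power2_eq_square ac_simps)
  also have "2 * \<alpha> * \<sigma> * (\<sigma> * \<tau> * exp (\<sigma>\<^sup>2 * \<tau> / 2)) = 2 * \<sigma>\<^sup>2 * \<tau> * \<beta>"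
    unfolding E E_def[symmetric] by (simp add: power2_eq_square ac_simps)
  also have "\<beta>\<^sup>2 * exp (\<sigma>\<^sup>2 * \<tau>) + \<beta>\<^sup>2 + \<sigma>\<^sup>2 * \<tau> - 2 * \<beta>\<^sup>2 - 2 * \<sigma>\<^sup>2 * \<tau> * \<beta> + 2 * \<beta> * \<sigma> * 0
     = \<beta>\<^sup>2 * (exp (\<sigma>\<^sup>2 * \<tau>) - 1 - \<sigma>\<^sup>2 * \<tau>) + \<sigma>\<^sup>2 * \<tau> * (exp (r * \<tau>) - 1)\<^sup>2"
  proof -
    have "exp (r * \<tau>) = \<beta>" by (simp add: \<beta>_def)
    then show ?thesis by (simp add: power2_eq_square algebra_simps)
  qed
  also have "\<dots> \<le> exp (2 * \<bar>r\<bar> * T) * ((\<sigma>\<^sup>2 * \<tau>)\<^sup>2 * exp (\<sigma>\<^sup>2 * T)) + \<sigma>\<^sup>2 * \<tau> * (r\<^sup>2 * \<tau>\<^sup>2 * exp (2 * \<bar>r\<bar> * T))"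
  proof (intro add_mono mult_mono mult_left_mono)
    have "r * \<tau> \<le> \<bar>r\<bar> * T" using \<tau> by (intro mult_mono) auto
    then show "\<beta>\<^sup>2 \<le> exp (2 * \<bar>r\<bar> * T)" by (simp add: \<beta>_def power2_eq_square exp_add[symmetric] mult.commute[of \<tau>])
    have "exp (\<sigma>\<^sup>2 * \<tau>) - 1 - \<sigma>\<^sup>2 * \<tau> \<le> (\<sigma>\<^sup>2 * \<tau>)\<^sup>2 * exp \<bar>\<sigma>\<^sup>2 * \<tau>\<bar>" by (rule exp_minus_one_minus_le)
    also have "\<dots> \<le> (\<sigma>\<^sup>2 * \<tau>)\<^sup>2 * exp (\<sigma>\<^sup>2 * T)" using \<tau> by (intro mult_left_mono) (auto intro: mult_left_mono)
    finally show "exp (\<sigma>\<^sup>2 * \<tau>) - 1 - \<sigma>\<^sup>2 * \<tau> \<le> (\<sigma>\<^sup>2 * \<tau>)\<^sup>2 * exp (\<sigma>\<^sup>2 * T)" .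
    have "(exp (r * \<tau>) - 1)\<^sup>2 = \<bar>exp (r * \<tau>) - 1\<bar>\<^sup>2" by simp
    also have "\<dots> \<le> (\<bar>r * \<tau>\<bar> * exp \<bar>r * \<tau>\<bar>)\<^sup>2" by (intro power_mono exp_minus_one_le) simp
    also have "\<dots> = (r\<^sup>2 * \<tau>\<^sup>2) * exp (2 * \<bar>r * \<tau>\<bar>)"
    proof -
      have "(exp \<bar>r * \<tau>\<bar>)\<^sup>2 = exp (2 * \<bar>r * \<tau>\<bar>)" by (simp add: power2_eq_square exp_add[symmetric])
      then show ?thesis by (simp only: power_mult_distrib power2_abs)
    qed
    also have "\<dots> \<le> (r\<^sup>2 * \<tau>\<^sup>2) * exp (2 * \<bar>r\<bar> * T)" using \<tau>
      by (intro mult_left_mono) (auto simp: abs_mult intro: mult_left_mono)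
    finally show "(exp (r * \<tau>) - 1)\<^sup>2 \<le> r\<^sup>2 * \<tau>\<^sup>2 * exp (2 * \<bar>r\<bar> * T)" .
  qed (use \<tau> exp_minus_one_minus_le in auto)
  also have "\<dots> = exp (2 * \<bar>r\<bar> * T) * (\<sigma>^4 * exp (\<sigma>\<^sup>2 * T) + \<sigma>\<^sup>2 * r\<^sup>2 * \<tau>) * \<tau>\<^sup>2"
    by (simp add: power2_eq_square power4_eq_xxxx algebra_simps)
  also have "\<dots> \<le> exp (2 * \<bar>r\<bar> * T) * (\<sigma>^4 * exp (\<sigma>\<^sup>2 * T) + \<sigma>\<^sup>2 * r\<^sup>2 * T) * \<tau>\<^sup>2"
    using \<tau> by (intro mult_right_mono mult_left_mono add_left_mono) auto
  finally show "expectation (\<lambda>\<omega>. (exp_remainder r \<sigma> s u \<omega>)\<^sup>2) \<le> exp_const r \<sigma> * (u - s)\<^sup>2"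
    by (simp add: exp_const_def \<tau>_def)
qed

lemma exp_remainder_cont:
  assumes "0 \<le> s" "t \<le> T" "\<omega> \<in> space M"
  shows "continuous_on {s..t} (\<lambda>u. exp_remainder r \<sigma> s u \<omega>)"
proof -
  have "continuous_on {s..t} (\<lambda>u. B u \<omega>)" by (rule continuous_on_subset[OF B_cont[OF assms(3)]]) (use assms in auto)
  then show ?thesis unfolding exp_remainder_def by (intro continuous_intros)
qed

lemma riemann_remainder_moments:
  fixes r \<sigma> :: real
  assumes st: "0 \<le> s" "s < t" "t \<le> T" and m: "0 < m"
    and c: "c \<in> borel_measurable (F s)" "\<And>\<omega>. \<omega> \<in> space M \<Longrightarrow> \<bar>c \<omega>\<bar> \<le> K"
  defines "\<rho> \<equiv> (\<lambda>\<omega>. c \<omega> * riemann_sum s t m (\<lambda>u. exp_remainder r \<sigma> s u \<omega>))"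
  shows "\<rho> \<in> borel_measurable (F t)"
    and "V \<in> borel_measurable (F s) \<Longrightarrow> integrable M (\<lambda>\<omega>. (V \<omega>)\<^sup>2) \<Longrightarrow> (\<integral>\<omega>. V \<omega> * \<rho> \<omega> \<partial>M) = 0"
    and "integrable M (\<lambda>\<omega>. (\<rho> \<omega>)\<^sup>2)"
    and "expectation (\<lambda>\<omega>. (\<rho> \<omega>)\<^sup>2) \<le> K\<^sup>2 * exp_const r \<sigma> * (t - s)\<^sup>2"
proof -
  define u where "u j = s + real (Suc j) * ((t - s) / real m)" for j
  have u: "s \<le> u j" "u j \<le> t" "0 \<le> u j" "u j \<le> T" if "j < m" for j
    using riemann_sum_point_mem[OF st(2) that] st unfolding u_def
    by (simp_all only: greaterThanAtMost_iff) linarith+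
  have \<rho>: "\<rho> \<omega> = (\<Sum>j<m. c \<omega> * exp_remainder r \<sigma> s (u j) \<omega>) / real m" for \<omega>
    by (simp add: \<rho>_def riemann_sum_def u_def sum_distrib_left)
  note mom = exp_remainder_moments[OF st(1), where r=r and \<sigma>=\<sigma>]
  have eF: "exp_remainder r \<sigma> s (u j) \<in> borel_measurable (F t)" if "j < m" for j
    using measurable_F_mono[OF mom(1) u(2)] u that by simp
  have cF: "c \<in> borel_measurable (F t)" using measurable_F_mono[OF c(1)] st by simp
  show \<rho>F: "\<rho> \<in> borel_measurable (F t)" unfolding \<rho>[abs_def]
    by (intro borel_measurable_divide borel_measurable_sum borel_measurable_times) (use eF cF in auto)
  have cM: "c \<in> borel_measurable M" by (rule measurable_F[OF c(1)])
  have cb: "bounded (c ` space M)" using c(2) by (auto simp: bounded_iff)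
  show "(\<integral>\<omega>. V \<omega> * \<rho> \<omega> \<partial>M) = 0" if V: "V \<in> borel_measurable (F s)" "integrable M (\<lambda>\<omega>. (V \<omega>)\<^sup>2)" for V
  proof -
    have VM: "V \<in> borel_measurable M" by (rule measurable_F[OF V(1)])
    have "integrable M (\<lambda>\<omega>. V \<omega> * c \<omega>)"
    proof (rule integrable_mult_of_squares[OF VM cM V(2)])
      have "(c \<omega>)\<^sup>2 \<le> K\<^sup>2" if "\<omega> \<in> space M" for \<omega>
        using c(2)[OF that] by (metis abs_ge_zero power2_abs power_mono)
      then show "integrable M (\<lambda>\<omega>. (c \<omega>)\<^sup>2)"
        by (intro integrable_const_bound[where B="K\<^sup>2"]) (use cM in auto)
    qed
    note Vc = _ this
    have VcF: "(\<lambda>\<omega>. V \<omega> * c \<omega>) \<in> borel_measurable (F s)" using V(1) c(1) by simp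
    have "(\<integral>\<omega>. V \<omega> * \<rho> \<omega> \<partial>M) = (\<integral>\<omega>. (\<Sum>j<m. V \<omega> * c \<omega> * exp_remainder r \<sigma> s (u j) \<omega>) / real m \<partial>M)"
      by (simp add: \<rho> sum_distrib_left mult.assoc)
    also have "\<dots> = (\<Sum>j<m. \<integral>\<omega>. V \<omega> * c \<omega> * exp_remainder r \<sigma> s (u j) \<omega> \<partial>M) / real m"
      by (subst integral_divide_zero, subst Bochner_Integration.integral_sum)
        (use mom(2)[OF u(1) u(4) VcF Vc(2)] in auto)
    also have "\<dots> = 0" using mom(3)[OF u(1) u(4) VcF Vc(2)] by simp
    finally show ?thesis .
  qed
  have i1: "integrable M (\<lambda>\<omega>. (exp_remainder r \<sigma> s (u j) \<omega>)\<^sup>2)" if "j < m" for j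
    using mom(4)[OF u(1) u(4)] that by simp
  have bound: "(\<rho> \<omega>)\<^sup>2 \<le> (\<Sum>j<m. K\<^sup>2 * (exp_remainder r \<sigma> s (u j) \<omega>)\<^sup>2) / real m" if "\<omega> \<in> space M" for \<omega>
  proof -
    have "(\<Sum>j<m. 1 * (c \<omega> * exp_remainder r \<sigma> s (u j) \<omega>))\<^sup>2 \<le> (\<Sum>j<m. 1\<^sup>2) * (\<Sum>j<m. (c \<omega> * exp_remainder r \<sigma> s (u j) \<omega>)\<^sup>2)"
      by (rule Cauchy_Schwarz_ineq_sum)
    then have "(\<rho> \<omega>)\<^sup>2 \<le> (real m * (\<Sum>j<m. (c \<omega> * exp_remainder r \<sigma> s (u j) \<omega>)\<^sup>2)) / (real m)\<^sup>2"
      by (simp add: \<rho> power_divide divide_right_mono)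
    also have "\<dots> = (\<Sum>j<m. (c \<omega> * exp_remainder r \<sigma> s (u j) \<omega>)\<^sup>2) / real m" using m by (simp add: power2_eq_square)
    also have "\<dots> \<le> (\<Sum>j<m. K\<^sup>2 * (exp_remainder r \<sigma> s (u j) \<omega>)\<^sup>2) / real m"
    proof (intro divide_right_mono sum_mono)
      have "(c \<omega>)\<^sup>2 \<le> K\<^sup>2" using c(2)[OF that] by (metis abs_ge_zero power2_abs power_mono)
      then show "(c \<omega> * exp_remainder r \<sigma> s (u j) \<omega>)\<^sup>2 \<le> K\<^sup>2 * (exp_remainder r \<sigma> s (u j) \<omega>)\<^sup>2" for j
        by (simp add: power_mult_distrib mult_right_mono)
    qed simp
    finally show ?thesis .
  qed
  have i2: "integrable M (\<lambda>\<omega>. (\<Sum>j<m. K\<^sup>2 * (exp_remainder r \<sigma> s (u j) \<omega>)\<^sup>2) / real m)"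
    by (intro integrable_divide Bochner_Integration.integrable_sum integrable_mult_right i1) simp
  show i3: "integrable M (\<lambda>\<omega>. (\<rho> \<omega>)\<^sup>2)"
  proof (rule Bochner_Integration.integrable_bound[OF i2])
    show "(\<lambda>\<omega>. (\<rho> \<omega>)\<^sup>2) \<in> borel_measurable M" using measurable_F[OF \<rho>F] by simp
    show "AE \<omega> in M. norm ((\<rho> \<omega>)\<^sup>2) \<le> norm ((\<Sum>j<m. K\<^sup>2 * (exp_remainder r \<sigma> s (u j) \<omega>)\<^sup>2) / real m)"
    proof (rule AE_I2)
      fix \<omega> assume "\<omega> \<in> space M"
      have "norm ((\<rho> \<omega>)\<^sup>2) = (\<rho> \<omega>)\<^sup>2" by simp
      also note bound[OF \<open>\<omega> \<in> space M\<close>]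
      also note abs_ge_self
      finally show "norm ((\<rho> \<omega>)\<^sup>2) \<le> norm ((\<Sum>j<m. K\<^sup>2 * (exp_remainder r \<sigma> s (u j) \<omega>)\<^sup>2) / real m)" by simp
    qed
  qed
  have "expectation (\<lambda>\<omega>. (\<rho> \<omega>)\<^sup>2) \<le> expectation (\<lambda>\<omega>. (\<Sum>j<m. K\<^sup>2 * (exp_remainder r \<sigma> s (u j) \<omega>)\<^sup>2) / real m)"
    by (rule integral_mono[OF i3 i2 bound])
  also have "\<dots> = (\<Sum>j<m. K\<^sup>2 * expectation (\<lambda>\<omega>. (exp_remainder r \<sigma> s (u j) \<omega>)\<^sup>2)) / real m"
    by (subst integral_divide_zero, subst Bochner_Integration.integral_sum) (use i1 in auto)
  also have "\<dots> \<le> (\<Sum>j<m. K\<^sup>2 * (exp_const r \<sigma> * (t - s)\<^sup>2)) / real m"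
  proof (intro divide_right_mono sum_mono mult_left_mono)
    fix j assume "j \<in> {..<m}"
    then have j: "j < m" by simp
    have "expectation (\<lambda>\<omega>. (exp_remainder r \<sigma> s (u j) \<omega>)\<^sup>2) \<le> exp_const r \<sigma> * (u j - s)\<^sup>2"
      using mom(5)[OF u(1) u(4)] j by simp
    also have "\<dots> \<le> exp_const r \<sigma> * (t - s)\<^sup>2"
      using u[OF j] by (intro mult_left_mono power_mono exp_const_nonneg) auto
    finally show "expectation (\<lambda>\<omega>. (exp_remainder r \<sigma> s (u j) \<omega>)\<^sup>2) \<le> exp_const r \<sigma> * (t - s)\<^sup>2" .
  qed auto
  also have "\<dots> = K\<^sup>2 * exp_const r \<sigma> * (t - s)\<^sup>2" using m by simp
  finally show "expectation (\<lambda>\<omega>. (\<rho> \<omega>)\<^sup>2) \<le> K\<^sup>2 * exp_const r \<sigma> * (t - s)\<^sup>2" .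
qed

definition mean_remainder :: "real \<Rightarrow> real \<Rightarrow> real \<Rightarrow> real \<Rightarrow> 'a \<Rightarrow> real" where
  "mean_remainder r \<sigma> s t \<omega> = integral {s..t} (\<lambda>u. exp_remainder r \<sigma> s u \<omega>) / (t - s)"

lemma mean_remainder_maximal:
  assumes n: "0 < n" and l: "0 < l"
    and c: "\<And>k. k < n \<Longrightarrow> c k \<in> borel_measurable (F (grid_point T n k))" "\<And>k \<omega>. k < n \<Longrightarrow> \<omega> \<in> space M \<Longrightarrow> \<bar>c k \<omega>\<bar> \<le> K"
  shows "prob {\<omega> \<in> space M. \<exists>j\<le>n. l < \<bar>\<Sum>k<j. c k \<omega> * mean_remainder r \<sigma> (grid_point T n k) (grid_point T n (Suc k)) \<omega>\<bar>}
    \<le> K\<^sup>2 * exp_const r \<sigma> * T\<^sup>2 / (real n * l\<^sup>2)"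
proof -
  define \<rho> where "\<rho> m k \<omega> = c k \<omega> * riemann_sum (grid_point T n k) (grid_point T n (Suc k)) m (\<lambda>u. exp_remainder r \<sigma> (grid_point T n k) u \<omega>)" for m k \<omega>
  note gi = grid_interval[of _ n]
  have \<rho>: "\<rho> m k \<in> borel_measurable (F (grid_point T n (Suc k)))"
    "V \<in> borel_measurable (F (grid_point T n k)) \<Longrightarrow> integrable M (\<lambda>\<omega>. (V \<omega>)\<^sup>2) \<Longrightarrow> (\<integral>\<omega>. V \<omega> * \<rho> m k \<omega> \<partial>M) = 0"
    "integrable M (\<lambda>\<omega>. (\<rho> m k \<omega>)\<^sup>2)"
    "expectation (\<lambda>\<omega>. (\<rho> m k \<omega>)\<^sup>2) \<le> K\<^sup>2 * exp_const r \<sigma> * (T / real n)\<^sup>2"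
    if "k < n" "0 < m" for k m V
  proof -
    note rm = riemann_remainder_moments[OF gi(1-3)[OF that(1)] that(2) c(1)[OF that(1)] c(2)[OF that(1)], where r=r and \<sigma>=\<sigma>]
    show "\<rho> m k \<in> borel_measurable (F (grid_point T n (Suc k)))" unfolding \<rho>_def by (rule rm(1))
    show "V \<in> borel_measurable (F (grid_point T n k)) \<Longrightarrow> integrable M (\<lambda>\<omega>. (V \<omega>)\<^sup>2) \<Longrightarrow> (\<integral>\<omega>. V \<omega> * \<rho> m k \<omega> \<partial>M) = 0"
      unfolding \<rho>_def by (rule rm(2))
    show "integrable M (\<lambda>\<omega>. (\<rho> m k \<omega>)\<^sup>2)" unfolding \<rho>_def by (rule rm(3))
    show "expectation (\<lambda>\<omega>. (\<rho> m k \<omega>)\<^sup>2) \<le> K\<^sup>2 * exp_const r \<sigma> * (T / real n)\<^sup>2"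
      unfolding \<rho>_def gi(4)[OF that(1), symmetric] by (rule rm(4))
  qed
  have \<rho>M: "\<rho> m k \<in> borel_measurable M" if "k < n" "0 < m" for k m
    by (rule measurable_F[OF \<rho>(1)[OF that]])
  have lim: "(\<lambda>m. \<Sum>k<j. \<rho> m k \<omega>) \<longlonglongrightarrow> (\<Sum>k<j. c k \<omega> * mean_remainder r \<sigma> (grid_point T n k) (grid_point T n (Suc k)) \<omega>)"
    if "j \<le> n" "\<omega> \<in> space M" for j \<omega>
    unfolding \<rho>_def mean_remainder_def
    by (intro tendsto_sum tendsto_mult tendsto_const riemann_sum_tendsto exp_remainder_cont)
      (use that gi in \<open>auto simp: less_le_trans\<close>)
  have Zmeas: "(\<lambda>\<omega>. \<Sum>k<j. c k \<omega> * mean_remainder r \<sigma> (grid_point T n k) (grid_point T n (Suc k)) \<omega>) \<in> borel_measurable M" if "j \<le> n" for j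
  proof (rule borel_measurable_LIMSEQ_real[where u="\<lambda>m \<omega>. \<Sum>k<j. \<rho> (Suc m) k \<omega>"])
    show "(\<lambda>\<omega>. \<Sum>k<j. \<rho> (Suc m) k \<omega>) \<in> borel_measurable M" for m
      using that \<rho>M by (intro borel_measurable_sum) auto
    show "(\<lambda>m. \<Sum>k<j. \<rho> (Suc m) k \<omega>) \<longlonglongrightarrow> (\<Sum>k<j. c k \<omega> * mean_remainder r \<sigma> (grid_point T n k) (grid_point T n (Suc k)) \<omega>)" if "\<omega> \<in> space M" for \<omega>
      using lim[OF \<open>j \<le> n\<close> that] by (rule LIMSEQ_Suc)
  qed
  have meas_ex: "{\<omega> \<in> space M. \<exists>j\<le>n. l < \<bar>Z j \<omega>\<bar>} \<in> sets M" if "\<And>j. j \<le> n \<Longrightarrow> Z j \<in> borel_measurable M" for Z :: "nat \<Rightarrow> 'a \<Rightarrow> real"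
  proof -
    have "{\<omega> \<in> space M. \<exists>j\<in>{..n}. l < \<bar>Z j \<omega>\<bar>} \<in> sets M"
    proof (rule sets.sets_Collect_finite_Ex[OF _ finite_atMost])
      fix j assume "j \<in> {..n}"
      then have [measurable]: "Z j \<in> borel_measurable M" by (intro that) simp
      show "{\<omega> \<in> space M. l < \<bar>Z j \<omega>\<bar>} \<in> sets M" by measurable
    qed
    then show ?thesis unfolding Bex_def atMost_iff .
  qed
  define E' where "E' m = (if m = 0 then {} else {\<omega> \<in> space M. \<exists>j\<le>n. l < \<bar>\<Sum>k<j. \<rho> m k \<omega>\<bar>})" for m
  show ?thesis
  proof (rule prob_le_of_eventually[where E'=E'])
    show "E' m \<in> events" for m unfolding E'_def using \<rho>M
      by (auto intro!: meas_ex borel_measurable_sum)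
    show "{\<omega> \<in> space M. \<exists>j\<le>n. l < \<bar>\<Sum>k<j. c k \<omega> * mean_remainder r \<sigma> (grid_point T n k) (grid_point T n (Suc k)) \<omega>\<bar>} \<in> events"
      by (rule meas_ex[OF Zmeas])
    show "prob (E' m) \<le> K\<^sup>2 * exp_const r \<sigma> * T\<^sup>2 / (real n * l\<^sup>2)" if m: "0 < m" for m
    proof -
      have "prob (E' m) \<le> prob {\<omega> \<in> space M. \<exists>j\<le>n. l \<le> \<bar>\<Sum>k<j. \<rho> m k \<omega>\<bar>}"
      proof (rule finite_measure_mono)
        have "{\<omega> \<in> space M. \<exists>j\<in>{..n}. l \<le> \<bar>\<Sum>k<j. \<rho> m k \<omega>\<bar>} \<in> sets M"
        proof (rule sets.sets_Collect_finite_Ex[OF _ finite_atMost])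
          fix j assume "j \<in> {..n}"
          then have [measurable]: "(\<lambda>\<omega>. \<Sum>k<j. \<rho> m k \<omega>) \<in> borel_measurable M" using \<rho>M m by (intro borel_measurable_sum) auto
          show "{\<omega> \<in> space M. l \<le> \<bar>\<Sum>k<j. \<rho> m k \<omega>\<bar>} \<in> sets M" by measurable
        qed
        then show "{\<omega> \<in> space M. \<exists>j\<le>n. l \<le> \<bar>\<Sum>k<j. \<rho> m k \<omega>\<bar>} \<in> sets M" unfolding Bex_def atMost_iff .
      qed (auto simp: E'_def intro: less_imp_le)
      also have "\<dots> \<le> (\<Sum>k<n. expectation (\<lambda>\<omega>. (\<rho> m k \<omega>)\<^sup>2)) / l\<^sup>2"
      proof (rule maximal_inequality_differences[where F="\<lambda>j. F (grid_point T n j)"])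
        show "sets (F (grid_point T n i)) \<subseteq> sets (F (grid_point T n j))" if "i \<le> j" for i j
          by (rule sets_F_mono[OF grid_point_mono[OF T_pos that]])
      qed (simp_all add: subalgebra_F \<rho> m l)
      also have "\<dots> \<le> (\<Sum>k<n. K\<^sup>2 * exp_const r \<sigma> * (T / real n)\<^sup>2) / l\<^sup>2"
        by (intro divide_right_mono sum_mono \<rho>) (use m in auto)
      also have "\<dots> = K\<^sup>2 * exp_const r \<sigma> * T\<^sup>2 / (real n * l\<^sup>2)" using n by (simp add: power2_eq_square)
      finally show ?thesis .
    qed
    fix \<omega> assume "\<omega> \<in> {\<omega> \<in> space M. \<exists>j\<le>n. l < \<bar>\<Sum>k<j. c k \<omega> * mean_remainder r \<sigma> (grid_point T n k) (grid_point T n (Suc k)) \<omega>\<bar>}"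
    then obtain j where j: "\<omega> \<in> space M" "j \<le> n" "l < \<bar>\<Sum>k<j. c k \<omega> * mean_remainder r \<sigma> (grid_point T n k) (grid_point T n (Suc k)) \<omega>\<bar>" by auto
    have "\<forall>\<^sub>F m in sequentially. l < \<bar>\<Sum>k<j. \<rho> m k \<omega>\<bar>"
      by (rule order_tendstoD(1)[OF tendsto_rabs[OF lim[OF j(2,1)]] j(3)])
    then show "\<forall>\<^sub>F m in sequentially. \<omega> \<in> E' m"
      using eventually_gt_at_top[of 0] by eventually_elim (use j in \<open>auto simp: E'_def\<close>)
  qed
qed

end

section \<open>Approximation of continuous integrands\<close>

definition clamp_abs :: "real \<Rightarrow> real \<Rightarrow> real" where
  "clamp_abs K x = max (- K) (min K x)"

lemma clamp_abs_le: "0 \<le> K \<Longrightarrow> \<bar>clamp_abs K x\<bar> \<le> K"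
  by (auto simp: clamp_abs_def)

lemma clamp_abs_eq: "\<bar>x\<bar> \<le> K \<Longrightarrow> clamp_abs K x = x"
  by (auto simp: clamp_abs_def)

lemma clamp_abs_measurable [measurable]: "clamp_abs K \<in> borel_measurable borel"
  unfolding clamp_abs_def[abs_def] by measurable

lemma continuous_on_clamp_abs [continuous_intros]:
  "continuous_on A f \<Longrightarrow> continuous_on A (\<lambda>x. clamp_abs K (f x))"
  unfolding clamp_abs_def by (intro continuous_intros)

lemma clamp_abs_diff_mono:
  assumes "0 \<le> K" "K \<le> K'"
  shows "\<bar>x - clamp_abs K' x\<bar> \<le> \<bar>x - clamp_abs K x\<bar>"
  using assms by (auto simp: clamp_abs_def)

lemma clamp_abs_diff_le: "0 \<le> K \<Longrightarrow> \<bar>x - clamp_abs K x\<bar> \<le> \<bar>x\<bar>"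
  by (auto simp: clamp_abs_def)

lemma sq_norm_mono:
  assumes "\<And>t \<omega>. t \<in> {0..T} \<Longrightarrow> \<omega> \<in> space M \<Longrightarrow> \<bar>f t \<omega>\<bar> \<le> \<bar>g t \<omega>\<bar>"
  shows "sq_norm M T f \<le> sq_norm M T g"
  unfolding sq_norm_def
proof (intro nn_integral_mono)
  fix \<omega> t assume "\<omega> \<in> space M"
  then show "ennreal ((f t \<omega>)\<^sup>2) * indicator {0..T} t \<le> ennreal ((g t \<omega>)\<^sup>2) * indicator {0..T} t"
    using assms[of t \<omega>] by (auto simp: indicator_def abs_le_square_iff intro!: ennreal_leI)
qed

lemma sq_norm_tendsto_0:
  fixes f :: "nat \<Rightarrow> real \<Rightarrow> 'a \<Rightarrow> real"
  assumes f: "\<And>n. (\<lambda>(t, \<omega>). f n t \<omega>) \<in> borel_measurable (time_product M T)"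
    and w: "(\<lambda>(t, \<omega>). w t \<omega>) \<in> borel_measurable (time_product M T)" "sq_norm M T w < \<infinity>"
    and bd: "\<And>n t \<omega>. t \<in> {0..T} \<Longrightarrow> \<omega> \<in> space M \<Longrightarrow> \<bar>f n t \<omega>\<bar> \<le> \<bar>w t \<omega>\<bar>"
    and lim: "\<And>t \<omega>. t \<in> {0<..T} \<Longrightarrow> \<omega> \<in> space M \<Longrightarrow> (\<lambda>n. f n t \<omega>) \<longlonglongrightarrow> 0"
  shows "(\<lambda>n. sq_norm M T (f n)) \<longlonglongrightarrow> 0"
proof -
  let ?G = "\<lambda>g \<omega>. \<integral>\<^sup>+t\<in>{0..T}. ennreal ((g t \<omega>)\<^sup>2) \<partial>lborel"
  have le: "?G (f n) \<omega> \<le> ?G w \<omega>" if "\<omega> \<in> space M" for n \<omega>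
  proof (intro nn_integral_mono)
    fix t
    show "ennreal ((f n t \<omega>)\<^sup>2) * indicator {0..T} t \<le> ennreal ((w t \<omega>)\<^sup>2) * indicator {0..T} t"
      using bd[of t \<omega> n] that by (auto simp: indicator_def abs_le_square_iff intro!: ennreal_leI)
  qed
  have fin: "AE \<omega> in M. ?G w \<omega> < \<infinity>"
    using nn_integral_PInf_AE[OF sq_norm_inner(1)[OF w(1)]] w(2)
    by (simp add: sq_norm_def less_top top.not_eq_extremum)
  have "(\<lambda>n. \<integral>\<^sup>+\<omega>. ?G (f n) \<omega> \<partial>M) \<longlonglongrightarrow> (\<integral>\<^sup>+\<omega>. 0 \<partial>M)"
  proof (rule nn_integral_dominated_convergence[where w="?G w"])
    show "AE \<omega> in M. (\<lambda>n. ?G (f n) \<omega>) \<longlonglongrightarrow> 0"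
      using fin AE_space
    proof eventually_elim
      case (elim \<omega>)
      have "(\<lambda>n. \<integral>\<^sup>+t. ennreal ((f n t \<omega>)\<^sup>2) \<partial>restrict_space lborel {0..T}) \<longlonglongrightarrow> (\<integral>\<^sup>+t. 0 \<partial>restrict_space lborel {0..T})"
      proof (rule nn_integral_dominated_convergence[where w="\<lambda>t. ennreal ((w t \<omega>)\<^sup>2)"])
        show "(\<lambda>t. ennreal ((f n t \<omega>)\<^sup>2)) \<in> borel_measurable (restrict_space lborel {0..T})" for n
          using sq_norm_inner(2)[OF f[of n] elim(2)] by measurable
        show "(\<lambda>t. ennreal ((w t \<omega>)\<^sup>2)) \<in> borel_measurable (restrict_space lborel {0..T})"
          using sq_norm_inner(2)[OF w(1) elim(2)] by measurable
        show "AE t in restrict_space lborel {0..T}. ennreal ((f n t \<omega>)\<^sup>2) \<le> ennreal ((w t \<omega>)\<^sup>2)" for n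
          by (rule AE_I2) (use bd elim in \<open>auto simp: space_restrict_space abs_le_square_iff intro!: ennreal_leI\<close>)
        show "(\<integral>\<^sup>+t. ennreal ((w t \<omega>)\<^sup>2) \<partial>restrict_space lborel {0..T}) < \<infinity>"
          using elim by (simp add: nn_integral_restrict_space)
        have "AE t in lborel. t \<noteq> (0::real)" by (rule AE_lborel_singleton)
        then have "AE t in restrict_space lborel {0..T}. t \<noteq> (0::real)"
          by (auto simp: AE_restrict_space_iff)
        then show "AE t in restrict_space lborel {0..T}. (\<lambda>n. ennreal ((f n t \<omega>)\<^sup>2)) \<longlonglongrightarrow> 0"
          using AE_space
        proof eventually_elim
          case (elim t)
          then have t: "t \<in> {0<..T}" by (auto simp: space_restrict_space)
          have "(\<lambda>n. ennreal ((f n t \<omega>)\<^sup>2)) \<longlonglongrightarrow> ennreal (0\<^sup>2)"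
            by (intro tendsto_ennrealI tendsto_power lim t \<open>\<omega> \<in> space M\<close>)
          then show ?case by simp
        qed
      qed simp
      then show ?case by (simp add: nn_integral_restrict_space)
    qed
    show "(\<integral>\<^sup>+\<omega>. ?G w \<omega> \<partial>M) < \<infinity>" using w(2) by (simp add: sq_norm_def)
  qed (use sq_norm_inner(1)[OF f] sq_norm_inner(1)[OF w(1)] le in \<open>auto intro: AE_I2\<close>)
  then show ?thesis by (simp add: sq_norm_def)
qed

lemma left_grid_point:
  assumes T: "0 < T" and n: "0 < n" and t: "t \<in> {0<..T}"
  obtains k where "k < n" "grid_point T n k < t" "t \<le> grid_point T n (Suc k)"
proof -
  define P where "P j \<longleftrightarrow> t \<le> grid_point T n j" for j
  define m where "m = (LEAST j. P j)"
  have Pn: "P n" using t n by (simp add: P_def grid_point_n)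
  then have Pm: "P m" unfolding m_def by (rule LeastI)
  have mn: "m \<le> n" unfolding m_def by (rule Least_le[of P, OF Pn])
  have "m \<noteq> 0"
  proof
    assume "m = 0"
    then show False using Pm t by (simp add: P_def)
  qed
  then obtain k where k: "m = Suc k" by (cases m) auto
  have "\<not> P k" using not_less_Least[of k P] k by (simp add: m_def)
  then show ?thesis using that[of k] Pm mn k by (simp add: P_def not_le)
qed

context brownian
begin

lemma grid_elem_val:
  assumes k: "k < n" "grid_point T n k < t" "t \<le> grid_point T n (Suc k)"
  shows "elem_val {..<n} (grid_point T n) (\<lambda>k. grid_point T n (Suc k)) c t \<omega> = c k \<omega>"
proof -
  have "(\<Sum>i<n. c i \<omega> * indicator {grid_point T n i<..grid_point T n (Suc i)} t) = (\<Sum>i\<in>{k}. c i \<omega>)"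
  proof (rule sum.mono_neutral_cong_right)
    show "\<forall>i\<in>{..<n} - {k}. c i \<omega> * indicator {grid_point T n i<..grid_point T n (Suc i)} t = 0"
    proof
      fix i assume "i \<in> {..<n} - {k}"
      then consider "Suc i \<le> k" | "Suc k \<le> i" by fastforce
      then have "t \<notin> {grid_point T n i<..grid_point T n (Suc i)}"
      proof cases
        case 1
        then show ?thesis using grid_point_mono[OF T_pos 1, of n] k by simp
      next
        case 2
        then show ?thesis using grid_point_mono[OF T_pos 2, of n] k by simp
      qed
      then show "c i \<omega> * indicator {grid_point T n i<..grid_point T n (Suc i)} t = 0" by simp
    qed
  qed (use k in auto)
  then show ?thesis by (simp add: elem_val_def)
qed

lemma clamp_grid_L2:
  assumes Hm: "(\<lambda>(t, \<omega>). H t \<omega>) \<in> borel_measurable (time_product M T)"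
    and HF: "\<And>t. t \<in> {0..T} \<Longrightarrow> H t \<in> borel_measurable (F t)"
    and Hfin: "sq_norm M T H < \<infinity>"
    and Hcont: "\<And>\<omega>. \<omega> \<in> space M \<Longrightarrow> continuous_on {0..T} (\<lambda>t. H t \<omega>)" and e: "0 < e"
  shows "\<exists>K0\<ge>0. \<forall>K\<ge>K0. \<forall>\<^sub>F n in sequentially.
    sq_norm M T (\<lambda>t \<omega>. H t \<omega> - elem_val {..<n} (grid_point T n) (\<lambda>k. grid_point T n (Suc k)) (\<lambda>k \<omega>. clamp_abs K (H (grid_point T n k) \<omega>)) t \<omega>) < ennreal e"
proof -
  have mc: "(\<lambda>(t, \<omega>). clamp_abs K (H t \<omega>)) \<in> borel_measurable (time_product M T)" for K
    using measurable_compose[OF Hm clamp_abs_measurable[of K]] by (simp add: split_beta)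
  have md: "(\<lambda>(t, \<omega>). H t \<omega> - clamp_abs K (H t \<omega>)) \<in> borel_measurable (time_product M T)" for K
    using borel_measurable_diff[OF Hm mc[of K]] by (simp add: split_beta)
  have "(\<lambda>n. sq_norm M T (\<lambda>t \<omega>. H t \<omega> - clamp_abs (real n) (H t \<omega>))) \<longlonglongrightarrow> 0"
  proof (rule sq_norm_tendsto_0[OF md Hm Hfin])
    show "(\<lambda>n. H t \<omega> - clamp_abs (real n) (H t \<omega>)) \<longlonglongrightarrow> 0" for t \<omega>
    proof (rule tendsto_eventually)
      obtain n0 where "\<bar>H t \<omega>\<bar> \<le> real n0" using real_arch_simple by blast
      then have "H t \<omega> - clamp_abs (real n) (H t \<omega>) = 0" if "n0 \<le> n" for n
        using that clamp_abs_eq[of "H t \<omega>" "real n"] by simp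
      then show "\<forall>\<^sub>F n in sequentially. H t \<omega> - clamp_abs (real n) (H t \<omega>) = 0"
        by (auto simp: eventually_sequentially)
    qed
  qed (auto intro: clamp_abs_diff_le)
  then have "\<forall>\<^sub>F n in sequentially. sq_norm M T (\<lambda>t \<omega>. H t \<omega> - clamp_abs (real n) (H t \<omega>)) < ennreal (e / 4)"
    by (rule order_tendstoD) (use e in simp)
  then obtain n0 where n0: "sq_norm M T (\<lambda>t \<omega>. H t \<omega> - clamp_abs (real n0) (H t \<omega>)) < ennreal (e / 4)"
    by (auto simp: eventually_sequentially)
  have "\<forall>\<^sub>F n in sequentially. sq_norm M T (\<lambda>t \<omega>. H t \<omega> - elem_val {..<n} (grid_point T n) (\<lambda>k. grid_point T n (Suc k)) (\<lambda>k \<omega>. clamp_abs K (H (grid_point T n k) \<omega>)) t \<omega>) < ennreal e"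
    if K: "real n0 \<le> K" for K
  proof -
    have K0: "0 \<le> K" using K by simp
    define h where "h n = elem_val {..<n} (grid_point T n) (\<lambda>k. grid_point T n (Suc k)) (\<lambda>k \<omega>. clamp_abs K (H (grid_point T n k) \<omega>))" for n
    have 1: "sq_norm M T (\<lambda>t \<omega>. H t \<omega> - clamp_abs K (H t \<omega>)) < ennreal (e / 4)"
      by (rule le_less_trans[OF sq_norm_mono n0]) (use clamp_abs_diff_mono[of "real n0" K] K in auto)
    have el: "elementary {..<n} (grid_point T n) (\<lambda>k. grid_point T n (Suc k)) (\<lambda>k \<omega>. clamp_abs K (H (grid_point T n k) \<omega>))" for n
    proof (rule grid_elementary)
      fix k assume k: "k < n"
      have "H (grid_point T n k) \<in> borel_measurable (F (grid_point T n k))"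
        by (rule HF[OF grid_point_mem[OF T_pos]]) (use k in simp)
      then show "(\<lambda>\<omega>. clamp_abs K (H (grid_point T n k) \<omega>)) \<in> borel_measurable (F (grid_point T n k))" by measurable
      show "bounded ((\<lambda>\<omega>. clamp_abs K (H (grid_point T n k) \<omega>)) ` space M)"
        using clamp_abs_le[OF K0] by (auto simp: bounded_iff)
    qed
    have mh: "(\<lambda>(t, \<omega>). h n t \<omega>) \<in> borel_measurable (time_product M T)" for n
      unfolding h_def by (rule elem_val_measurable[OF el])
    have mdh: "(\<lambda>(t, \<omega>). clamp_abs K (H t \<omega>) - h n t \<omega>) \<in> borel_measurable (time_product M T)" for n
      using borel_measurable_diff[OF mc mh[of n]] by (simp add: split_beta)
    have hval: "h n t \<omega> = 0 \<or> (\<exists>k<n. h n t \<omega> = clamp_abs K (H (grid_point T n k) \<omega>))" if "t \<in> {0..T}" for n t \<omega>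
    proof (cases "t = 0 \<or> n = 0")
      case True
      have "indicator {grid_point T n i<..grid_point T n (Suc i)} t = (0::real)" if "i < n" for i
        using True that grid_interval(1)[OF that] by auto
      then show ?thesis by (auto simp: h_def elem_val_def)
    next
      case False
      then have "0 < n" "t \<in> {0<..T}" using that by auto
      then obtain k where "k < n" "grid_point T n k < t" "t \<le> grid_point T n (Suc k)"
        using left_grid_point[OF T_pos] by metis
      then show ?thesis using grid_elem_val unfolding h_def by blast
    qed
    have "(\<lambda>n. sq_norm M T (\<lambda>t \<omega>. clamp_abs K (H t \<omega>) - h n t \<omega>)) \<longlonglongrightarrow> 0"
    proof (rule sq_norm_tendsto_0[OF mdh, where w="\<lambda>_ _. 2 * K"])
      show "sq_norm M T (\<lambda>_ _. 2 * K) < \<infinity>"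
        using T_pos by (simp add: sq_norm_def nn_integral_cmult emeasure_space_1 ennreal_mult_less_top)
      fix n t \<omega> assume t: "t \<in> {0..T}"
      have "\<bar>h n t \<omega>\<bar> \<le> K" using hval[OF t, of n \<omega>] clamp_abs_le[OF K0] K0 by auto
      then show "\<bar>clamp_abs K (H t \<omega>) - h n t \<omega>\<bar> \<le> \<bar>2 * K\<bar>" using clamp_abs_le[OF K0, of "H t \<omega>"] by linarith
    next
      fix t \<omega> assume t: "t \<in> {0<..T}" and \<omega>: "\<omega> \<in> space M"
      have cont: "continuous_on {0..T} (\<lambda>t. clamp_abs K (H t \<omega>))" by (intro continuous_intros Hcont \<omega>)
      show "(\<lambda>n. clamp_abs K (H t \<omega>) - h n t \<omega>) \<longlonglongrightarrow> 0"
      proof (rule LIMSEQ_I)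
        fix d :: real assume d: "0 < d"
        have "uniformly_continuous_on {0..T} (\<lambda>t. clamp_abs K (H t \<omega>))"
          by (rule compact_uniformly_continuous[OF cont]) simp
        then obtain q where q: "q > 0" "\<And>s t. s \<in> {0..T} \<Longrightarrow> t \<in> {0..T} \<Longrightarrow> dist s t < q \<Longrightarrow>
            dist (clamp_abs K (H s \<omega>)) (clamp_abs K (H t \<omega>)) < d"
          using d unfolding uniformly_continuous_on_def by metis
        have "(\<lambda>n. T * (1 / real n)) \<longlonglongrightarrow> T * 0" by (intro tendsto_intros lim_1_over_n)
        then have "\<forall>\<^sub>F n in sequentially. T * (1 / real n) < q" using q order_tendstoD(2)[of _ 0] by simp
        then have "\<forall>\<^sub>F n in sequentially. norm (clamp_abs K (H t \<omega>) - h n t \<omega> - 0) < d"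
          using eventually_gt_at_top[of 0]
        proof eventually_elim
          case (elim n)
          obtain k where k: "k < n" "grid_point T n k < t" "t \<le> grid_point T n (Suc k)"
            using left_grid_point[OF T_pos elim(2) t] by metis
          have "h n t \<omega> = clamp_abs K (H (grid_point T n k) \<omega>)" unfolding h_def by (rule grid_elem_val[OF k])
          moreover have "dist t (grid_point T n k) < q"
            using k elim grid_point_Suc[of T n k] by (simp add: dist_real_def)
          moreover have "grid_point T n k \<in> {0..T}" by (rule grid_point_mem[OF T_pos]) (use k in simp)
          ultimately show ?case using q(2)[of t "grid_point T n k"] t by (simp add: dist_real_def)
        qed
        then show "\<exists>n0. \<forall>n\<ge>n0. norm (clamp_abs K (H t \<omega>) - h n t \<omega> - 0) < d" by (simp add: eventually_sequentially)
      qed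
    qed simp
    then have "\<forall>\<^sub>F n in sequentially. sq_norm M T (\<lambda>t \<omega>. clamp_abs K (H t \<omega>) - h n t \<omega>) < ennreal (e / 4)"
      by (rule order_tendstoD) (use e in simp)
    then show ?thesis
    proof eventually_elim
      case (elim n)
      have "sq_norm M T (\<lambda>t \<omega>. H t \<omega> - h n t \<omega>) = sq_norm M T (\<lambda>t \<omega>. (H t \<omega> - clamp_abs K (H t \<omega>)) + (clamp_abs K (H t \<omega>) - h n t \<omega>))"
        by simp
      also have "\<dots> \<le> 2 * sq_norm M T (\<lambda>t \<omega>. H t \<omega> - clamp_abs K (H t \<omega>)) + 2 * sq_norm M T (\<lambda>t \<omega>. clamp_abs K (H t \<omega>) - h n t \<omega>)"
        by (rule sq_norm_add_le[OF md mdh])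
      also have "\<dots> < 2 * ennreal (e / 4) + 2 * ennreal (e / 4)"
        using 1 elim by (intro add_strict_mono ennreal_mult_strict_left_mono) auto
      also have "\<dots> = ennreal e"
      proof -
        have "2 * ennreal (e / 4) = ennreal (e / 2)" using e ennreal_mult[of 2 "e / 4"] by simp
        then show ?thesis using e by (simp add: ennreal_plus[symmetric] del: ennreal_plus)
      qed
      finally show ?case by (simp add: h_def)
    qed
  qed
  then show ?thesis by (intro exI[of _ "real n0"]) auto
qed

end

lemma measurable_lipschitz_skorokhod:
  assumes T: "0 < T" and lip: "\<And>x y. x \<in> cadlag_paths T \<Longrightarrow> y \<in> cadlag_paths T \<Longrightarrow> \<bar>g x - g y\<bar> \<le> L * skorokhod_dist T x y"
  shows "g \<in> borel_measurable (borel_of_topology (skorokhod_topology T))"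
proof (rule continuous_map_measurable_borel_of_topology)
  interpret Metric_space "cadlag_paths T" "skorokhod_dist T"
    using T by (intro Metric_space_skorokhod) simp
  show "continuous_map (skorokhod_topology T) euclideanreal g"
    unfolding skorokhod_topology_def by (rule lipschitz_continuous_map[OF lip])
qed

lemma step_path_expectation_close:
  assumes T: "0 < T" and Q: "prob_space Q"
    and x: "\<And>j. j \<le> n \<Longrightarrow> x j \<in> borel_measurable Q" and y: "\<And>j. j \<le> n \<Longrightarrow> y j \<in> borel_measurable Q"
    and u: "u \<in> borel_measurable Q" "\<And>\<omega>. \<omega> \<in> space Q \<Longrightarrow> 0 \<le> u \<omega> \<and> u \<omega> \<le> 1"
    and g: "\<And>x. x \<in> cadlag_paths T \<Longrightarrow> \<bar>g x\<bar> \<le> C"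
    and lip: "\<And>x y. x \<in> cadlag_paths T \<Longrightarrow> y \<in> cadlag_paths T \<Longrightarrow> \<bar>g x - g y\<bar> \<le> L * skorokhod_dist T x y"
    and L: "0 \<le> L" and e: "0 \<le> e"
    and close: "measure Q {\<omega> \<in> space Q. \<exists>j\<le>n. e < \<bar>x j \<omega> - y j \<omega>\<bar>} \<le> \<eta>"
  shows "\<bar>(\<integral>\<omega>. u \<omega> * g (step_path T n (\<lambda>j. x j \<omega>)) \<partial>Q) - (\<integral>\<omega>. u \<omega> * g (step_path T n (\<lambda>j. y j \<omega>)) \<partial>Q)\<bar> \<le> L * e + 2 * C * \<eta>"
proof -
  interpret Q: prob_space Q by (rule Q)
  have gm: "g \<in> borel_measurable (borel_of_topology (skorokhod_topology T))"
    by (rule measurable_lipschitz_skorokhod[OF T lip])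
  note [measurable] = u(1) measurable_compose[OF step_path_measurable[where n=n, OF T x] gm]
    measurable_compose[OF step_path_measurable[where n=n, OF T y] gm]
  have C: "0 \<le> C" using g[OF step_path_cadlag[OF T, of n "\<lambda>_. 0"]] by simp
  define bad where "bad = {\<omega> \<in> space Q. \<exists>j\<le>n. e < \<bar>x j \<omega> - y j \<omega>\<bar>}"
  have bad: "bad \<in> sets Q"
  proof -
    have "{\<omega> \<in> space Q. \<exists>j\<in>{..n}. e < \<bar>x j \<omega> - y j \<omega>\<bar>} \<in> sets Q"
    proof (rule sets.sets_Collect_finite_Ex[OF _ finite_atMost])
      fix j assume "j \<in> {..n}"
      then have j: "j \<le> n" by simp
      note [measurable] = x[OF j] y[OF j]
      show "{\<omega> \<in> space Q. e < \<bar>x j \<omega> - y j \<omega>\<bar>} \<in> sets Q" by measurable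
    qed
    then show ?thesis unfolding bad_def Bex_def atMost_iff .
  qed
  let ?x = "\<lambda>\<omega>. step_path T n (\<lambda>j. x j \<omega>)" and ?y = "\<lambda>\<omega>. step_path T n (\<lambda>j. y j \<omega>)"
  have cad: "?x \<omega> \<in> cadlag_paths T" "?y \<omega> \<in> cadlag_paths T" for \<omega> by (rule step_path_cadlag[OF T])+
  have ub: "\<bar>u \<omega> * z\<bar> \<le> \<bar>z\<bar>" if "\<omega> \<in> space Q" for \<omega> z
    using u(2)[OF that] mult_right_mono[of "\<bar>u \<omega>\<bar>" 1 "\<bar>z\<bar>"] by (simp add: abs_mult)
  have int: "integrable Q (\<lambda>\<omega>. u \<omega> * g (z \<omega>))" if "(\<lambda>\<omega>. g (z \<omega>)) \<in> borel_measurable Q" "\<And>\<omega>. z \<omega> \<in> cadlag_paths T" for z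
  proof (rule Q.integrable_const_bound[where B=C])
    show "AE \<omega> in Q. norm (u \<omega> * g (z \<omega>)) \<le> C"
      by (rule AE_I2) (use order_trans[OF ub g[OF that(2)]] in simp)
  qed (use that in measurable)
  have i: "integrable Q (\<lambda>\<omega>. u \<omega> * g (?x \<omega>))" "integrable Q (\<lambda>\<omega>. u \<omega> * g (?y \<omega>))"
    by (rule int; measurable?; rule cad)+
  have "\<bar>(\<integral>\<omega>. u \<omega> * g (?x \<omega>) \<partial>Q) - (\<integral>\<omega>. u \<omega> * g (?y \<omega>) \<partial>Q)\<bar> = \<bar>\<integral>\<omega>. u \<omega> * g (?x \<omega>) - u \<omega> * g (?y \<omega>) \<partial>Q\<bar>"
    using i by simp
  also have "\<dots> \<le> (\<integral>\<omega>. \<bar>u \<omega> * g (?x \<omega>) - u \<omega> * g (?y \<omega>)\<bar> \<partial>Q)" by (rule integral_abs_bound)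
  also have "\<dots> \<le> (\<integral>\<omega>. L * e + 2 * C * indicator bad \<omega> \<partial>Q)"
  proof (rule integral_mono)
    show "integrable Q (\<lambda>\<omega>. \<bar>u \<omega> * g (?x \<omega>) - u \<omega> * g (?y \<omega>)\<bar>)" using i by (intro integrable_abs Bochner_Integration.integrable_diff)
    show "integrable Q (\<lambda>\<omega>. L * e + 2 * C * indicator bad \<omega>)"
      by (intro Bochner_Integration.integrable_add integrable_mult_right integrable_real_indicator bad)
        (simp_all add: Q.emeasure_eq_measure)
    fix \<omega> assume \<omega>: "\<omega> \<in> space Q"
    have "\<bar>u \<omega> * g (?x \<omega>) - u \<omega> * g (?y \<omega>)\<bar> = \<bar>u \<omega> * (g (?x \<omega>) - g (?y \<omega>))\<bar>" by (simp add: right_diff_distrib)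
    also have "\<dots> \<le> \<bar>g (?x \<omega>) - g (?y \<omega>)\<bar>" by (rule ub[OF \<omega>])
    also have "\<dots> \<le> L * e + 2 * C * indicator bad \<omega>"
    proof (cases "\<omega> \<in> bad")
      case True
      then show ?thesis using g[OF cad(1), of \<omega>] g[OF cad(2), of \<omega>] L e C by (simp add: add_increasing)
    next
      case False
      have "\<bar>g (?x \<omega>) - g (?y \<omega>)\<bar> \<le> L * skorokhod_dist T (?x \<omega>) (?y \<omega>)" by (rule lip[OF cad])
      also have "\<dots> \<le> L * e"
      proof (intro mult_left_mono skorokhod_dist_le_sup cad e L)
        fix t assume t: "t \<in> {0..T}"
        then show "\<bar>?x \<omega> t - ?y \<omega> t\<bar> \<le> e"
          using False \<omega> grid_index_le[OF T t, of n] by (auto simp: bad_def step_path_def not_less)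
      qed (use T in simp)
      finally show ?thesis using False by simp
    qed
    finally show "\<bar>u \<omega> * g (?x \<omega>) - u \<omega> * g (?y \<omega>)\<bar> \<le> L * e + 2 * C * indicator bad \<omega>" .
  qed
  also have "\<dots> = L * e + 2 * C * measure Q bad"
    using bad Q.prob_space
    by (subst Bochner_Integration.integral_add)
      (auto intro!: integrable_mult_right integrable_real_indicator simp: Q.emeasure_eq_measure)
  also have "\<dots> \<le> L * e + 2 * C * \<eta>" using close C by (intro add_left_mono mult_left_mono) (auto simp: bad_def)
  finally show ?thesis .
qed

section \<open>The discretization error on the grid\<close>

definition drift_remainder :: "real \<Rightarrow> real \<Rightarrow> real \<Rightarrow> real" where
  "drift_remainder r s t = integral {s..t} (\<lambda>u. exp (r * (u - s))) / (t - s) - 1 - r * (t - s) / 2"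

lemma drift_remainder_le:
  assumes st: "s < t"
  shows "\<bar>drift_remainder r s t\<bar> \<le> r\<^sup>2 * (t - s)\<^sup>2 * exp (\<bar>r\<bar> * (t - s))"
proof -
  have "((\<lambda>u. 1 + r * (u - s)) has_integral (t + r * (t - s)\<^sup>2 / 2) - (s + r * (s - s)\<^sup>2 / 2)) {s..t}"
    by (rule fundamental_theorem_of_calculus)
      (use st in \<open>auto intro!: derivative_eq_intros simp flip: has_real_derivative_iff_has_vector_derivative\<close>)
  then have I1: "integral {s..t} (\<lambda>u. 1 + r * (u - s)) = (t - s) + r * (t - s)\<^sup>2 / 2"
    by (simp add: integral_unique)
  have "integral {s..t} (\<lambda>u. exp (r * (u - s)) - (1 + r * (u - s))) =
      integral {s..t} (\<lambda>u. exp (r * (u - s))) - integral {s..t} (\<lambda>u. 1 + r * (u - s))"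
    by (intro Henstock_Kurzweil_Integration.integral_diff integrable_continuous_interval continuous_intros)
  moreover have "norm (integral {s..t} (\<lambda>u. exp (r * (u - s)) - (1 + r * (u - s)))) \<le> r\<^sup>2 * (t - s)\<^sup>2 * exp (\<bar>r\<bar> * (t - s)) * (t - s)"
  proof (rule integral_bound)
    fix u assume u: "u \<in> {s..t}"
    have "norm (exp (r * (u - s)) - (1 + r * (u - s))) = exp (r * (u - s)) - 1 - r * (u - s)"
      using exp_minus_one_minus_le(1)[of "r * (u - s)"] by simp
    also have "\<dots> \<le> (r * (u - s))\<^sup>2 * exp \<bar>r * (u - s)\<bar>" by (rule exp_minus_one_minus_le)
    also have "\<dots> \<le> (r\<^sup>2 * (t - s)\<^sup>2) * exp (\<bar>r\<bar> * (t - s))"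
    proof (rule mult_mono)
      show "(r * (u - s))\<^sup>2 \<le> r\<^sup>2 * (t - s)\<^sup>2" unfolding power_mult_distrib
        using u by (intro mult_left_mono power_mono) auto
      show "exp \<bar>r * (u - s)\<bar> \<le> exp (\<bar>r\<bar> * (t - s))"
        using u by (simp add: abs_mult mult_left_mono)
    qed simp_all
    finally show "norm (exp (r * (u - s)) - (1 + r * (u - s))) \<le> r\<^sup>2 * (t - s)\<^sup>2 * exp (\<bar>r\<bar> * (t - s))" .
  next
    show "continuous_on {s..t} (\<lambda>u. exp (r * (u - s)) - (1 + r * (u - s)))" by (intro continuous_intros)
  qed (use st in simp)
  moreover have "drift_remainder r s t = (integral {s..t} (\<lambda>u. exp (r * (u - s))) - ((t - s) + r * (t - s)\<^sup>2 / 2)) / (t - s)"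
  proof -
    have "r * d\<^sup>2 / 2 / d = r * d / 2" if "d \<noteq> 0" for d :: real using that by (simp add: power2_eq_square)
    from this[of "t - s"] have "r * (t - s)\<^sup>2 / 2 / (t - s) = r * (t - s) / 2" using st by simp
    then show ?thesis using st unfolding drift_remainder_def diff_divide_distrib[of "integral {s..t} _"] add_divide_distrib[of "t - s"]
      by simp
  qed
  ultimately have "\<bar>drift_remainder r s t\<bar> * (t - s) \<le> r\<^sup>2 * (t - s)\<^sup>2 * exp (\<bar>r\<bar> * (t - s)) * (t - s)"
    using st by (simp add: I1 abs_mult)
  then show ?thesis using st by simp
qed

context brownian
begin

lemma stock_cont:
  assumes "\<omega> \<in> space M"
  shows "continuous_on {0..T} (\<lambda>t. stock S0 r \<sigma> B t \<omega>)"
  unfolding stock_def by (intro continuous_intros B_cont assms)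

lemma stock_F:
  assumes "0 \<le> s" "s \<le> t" "s \<le> T"
  shows "stock S0 r \<sigma> B s \<in> borel_measurable (F t)"
proof -
  have [measurable]: "B s \<in> borel_measurable (F t)" using assms by (rule B_F)
  show ?thesis unfolding stock_def by measurable
qed

lemma stock_M: "0 \<le> s \<Longrightarrow> s \<le> T \<Longrightarrow> stock S0 r \<sigma> B s \<in> borel_measurable M"
  by (rule measurable_F[OF stock_F[of s s]]) auto

definition grid_error :: "real \<Rightarrow> real \<Rightarrow> real \<Rightarrow> nat \<Rightarrow> nat \<Rightarrow> 'a \<Rightarrow> real" where
  "grid_error S0 r \<sigma> n j \<omega> = (\<Sum>k<j. stock S0 r \<sigma> B (grid_point T n k) \<omega> * (\<sigma> * grid_bridge n k \<omega>
     + mean_remainder r \<sigma> (grid_point T n k) (grid_point T n (Suc k)) \<omega>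
     + drift_remainder r (grid_point T n k) (grid_point T n (Suc k))))"

lemma error_decomposition:
  assumes st: "0 \<le> s" "s < t" "t \<le> T" and \<omega>: "\<omega> \<in> space M"
  shows "integral {s..t} (\<lambda>u. stock S0 r \<sigma> B u \<omega>) / (t - s)
      - stock S0 r \<sigma> B s \<omega> * (1 + r * (t - s) / 2 + \<sigma> * ((B t \<omega> - B s \<omega>) / 2))
    = stock S0 r \<sigma> B s \<omega> * (\<sigma> * bridge s t \<omega> + mean_remainder r \<sigma> s t \<omega> + drift_remainder r s t)"
proof -
  define d where "d = t - s"
  have d: "d \<noteq> 0" using st by (simp add: d_def)
  have Bc: "continuous_on {s..t} (\<lambda>u. B u \<omega>)" by (rule continuous_on_subset[OF B_cont[OF \<omega>]]) (use st in auto)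
  have i1: "(\<lambda>u. exp_remainder r \<sigma> s u \<omega>) integrable_on {s..t}"
    by (intro integrable_continuous_interval exp_remainder_cont) (use st \<omega> in auto)
  have i2: "(\<lambda>u. exp (r * (u - s))) integrable_on {s..t}" by (intro integrable_continuous_interval continuous_intros)
  have i3: "(\<lambda>u. B u \<omega>) integrable_on {s..t}" by (intro integrable_continuous_interval Bc)
  have i4: "(\<lambda>u. \<sigma> * (B u \<omega> - B s \<omega>)) integrable_on {s..t}" by (intro integrable_continuous_interval continuous_intros Bc)
  have eq: "stock S0 r \<sigma> B u \<omega> = stock S0 r \<sigma> B s \<omega> * (exp_remainder r \<sigma> s u \<omega> + exp (r * (u - s)) + \<sigma> * (B u \<omega> - B s \<omega>))" for u
  proof -
    have "a * u + \<sigma> * B u \<omega> = (a * s + \<sigma> * B s \<omega>) + (a * (u - s) + \<sigma> * (B u \<omega> - B s \<omega>))" for a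
      by (simp add: algebra_simps)
    from this[of "r - \<sigma>\<^sup>2 / 2"]
    have "(r - \<sigma>\<^sup>2 / 2) * u + \<sigma> * B u \<omega> = ((r - \<sigma>\<^sup>2 / 2) * s + \<sigma> * B s \<omega>) + ((r - \<sigma>\<^sup>2 / 2) * (u - s) + \<sigma> * (B u \<omega> - B s \<omega>))" .
    then have "stock S0 r \<sigma> B u \<omega> = stock S0 r \<sigma> B s \<omega> * exp ((r - \<sigma>\<^sup>2 / 2) * (u - s) + \<sigma> * (B u \<omega> - B s \<omega>))"
      unfolding stock_def by (simp only: exp_add mult.assoc)
    then show ?thesis by (simp add: exp_remainder_def)
  qed
  have "integral {s..t} (\<lambda>u. stock S0 r \<sigma> B u \<omega>) =
    stock S0 r \<sigma> B s \<omega> * integral {s..t} (\<lambda>u. exp_remainder r \<sigma> s u \<omega> + exp (r * (u - s)) + \<sigma> * (B u \<omega> - B s \<omega>))"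
    by (subst eq) (rule integral_mult_right)
  also have "integral {s..t} (\<lambda>u. exp_remainder r \<sigma> s u \<omega> + exp (r * (u - s)) + \<sigma> * (B u \<omega> - B s \<omega>)) =
     integral {s..t} (\<lambda>u. exp_remainder r \<sigma> s u \<omega>) + integral {s..t} (\<lambda>u. exp (r * (u - s))) + integral {s..t} (\<lambda>u. \<sigma> * (B u \<omega> - B s \<omega>))"
    using i1 i2 i4 by (simp add: Henstock_Kurzweil_Integration.integral_add integrable_add)
  also have "integral {s..t} (\<lambda>u. \<sigma> * (B u \<omega> - B s \<omega>)) = \<sigma> * (integral {s..t} (\<lambda>u. B u \<omega>) - d * B s \<omega>)"
  proof -
    have "integral {s..t} (\<lambda>u. B u \<omega> - B s \<omega>) = integral {s..t} (\<lambda>u. B u \<omega>) - integral {s..t} (\<lambda>u. B s \<omega>)"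
      by (rule Henstock_Kurzweil_Integration.integral_diff[OF i3]) (rule integrable_const_ivl)
    then show ?thesis using st by (simp add: d_def)
  qed
  finally have total: "integral {s..t} (\<lambda>u. stock S0 r \<sigma> B u \<omega>) = stock S0 r \<sigma> B s \<omega> *
      (integral {s..t} (\<lambda>u. exp_remainder r \<sigma> s u \<omega>) + integral {s..t} (\<lambda>u. exp (r * (u - s)))
       + \<sigma> * (integral {s..t} (\<lambda>u. B u \<omega>) - d * B s \<omega>))" .
  then have "integral {s..t} (\<lambda>u. stock S0 r \<sigma> B u \<omega>) / d =
    stock S0 r \<sigma> B s \<omega> * (integral {s..t} (\<lambda>u. exp_remainder r \<sigma> s u \<omega>) / d + integral {s..t} (\<lambda>u. exp (r * (u - s))) / d
      + \<sigma> * (integral {s..t} (\<lambda>u. B u \<omega>) / d - B s \<omega>))"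
  proof -
    have "x * (p + q + y * (b - d * c)) / d = x * (p / d + q / d + y * (b / d - c))" for x p q y b c
      using d by (simp add: field_simps)
    then show ?thesis unfolding total by simp
  qed
  then have "integral {s..t} (\<lambda>u. stock S0 r \<sigma> B u \<omega>) / d =
    stock S0 r \<sigma> B s \<omega> * (mean_remainder r \<sigma> s t \<omega> + (drift_remainder r s t + 1 + r * d / 2)
      + \<sigma> * (bridge s t \<omega> + (B t \<omega> - B s \<omega>) / 2))"
  proof -
    have "integral {s..t} (\<lambda>u. B u \<omega>) / d - B s \<omega> = bridge s t \<omega> + (B t \<omega> - B s \<omega>) / 2"
      by (simp add: bridge_def d_def field_simps)
    moreover have "integral {s..t} (\<lambda>u. exp (r * (u - s))) / d = drift_remainder r s t + 1 + r * d / 2"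
      by (simp add: drift_remainder_def d_def)
    ultimately show ?thesis
      using \<open>integral {s..t} (\<lambda>u. stock S0 r \<sigma> B u \<omega>) / d = _\<close> by (simp only: mean_remainder_def d_def)
  qed
  then show ?thesis by (simp add: d_def[symmetric] algebra_simps)
qed

lemma error_at_grid:
  fixes S0 r \<sigma> :: real
  assumes n: "0 < n" and j: "j \<le> n" and \<omega>: "\<omega> \<in> space M"
  defines "S \<equiv> stock S0 r \<sigma> B"
  shows "real n * (average T S (grid_point T n j) \<omega> - trapezoidal_average T r \<sigma> B S n (grid_point T n j) \<omega>) = grid_error S0 r \<sigma> n j \<omega>"
proof -
  define p where "p = grid_point T n"
  define \<delta> where "\<delta> = T / real n"
  have \<delta>: "\<delta> > 0" using n T_pos by (simp add: \<delta>_def)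
  have pj: "0 \<le> p j" "p j \<le> T" using grid_point_mem[OF T_pos j] by (auto simp: p_def)
  have Sc: "continuous_on {0..p j} (\<lambda>u. S u \<omega>)"
    unfolding S_def by (rule continuous_on_subset[OF stock_cont[OF \<omega>]]) (use pj in auto)
  have "(LBINT u:{0..p j}. S u \<omega>) = integral {0..p j} (\<lambda>u. S u \<omega>)"
    by (rule set_borel_integral_eq_integral) (rule borel_integrable_atLeastAtMost'[OF Sc])
  also have "\<dots> = (\<Sum>k<j. integral {p k..p (Suc k)} (\<lambda>u. S u \<omega>))"
    using integral_partition[of j p "\<lambda>u. S u \<omega>"] Sc grid_point_mono[OF T_pos] by (simp add: p_def)
  finally have avg: "average T S (p j) \<omega> = (\<Sum>k<j. integral {p k..p (Suc k)} (\<lambda>u. S u \<omega>)) / T"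
    by (simp add: average_def)
  have "nat \<lfloor>p j / \<delta>\<rfloor> = j" using grid_index_grid_point[OF T_pos n, of j] by (simp add: grid_index_def p_def \<delta>_def)
  then have "trapezoidal_average T r \<sigma> B S n (p j) \<omega> = \<delta> / T * (\<Sum>k = 1..j. S (p (k - 1)) \<omega> *
          (1 + r * \<delta> / 2 + \<sigma> * ((B (p k) \<omega> - B (p (k - 1)) \<omega>) / 2)))"
    by (simp add: trapezoidal_average_def Let_def \<delta>_def p_def grid_point_def)
  also have "(\<Sum>k = 1..j. S (p (k - 1)) \<omega> * (1 + r * \<delta> / 2 + \<sigma> * ((B (p k) \<omega> - B (p (k - 1)) \<omega>) / 2)))
     = (\<Sum>k<j. S (p k) \<omega> * (1 + r * \<delta> / 2 + \<sigma> * ((B (p (Suc k)) \<omega> - B (p k) \<omega>) / 2)))"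
    by (rule sum.reindex_bij_witness[where i=Suc and j="\<lambda>k. k - 1"]) auto
  finally have tr: "trapezoidal_average T r \<sigma> B S n (p j) \<omega> =
    \<delta> / T * (\<Sum>k<j. S (p k) \<omega> * (1 + r * \<delta> / 2 + \<sigma> * ((B (p (Suc k)) \<omega> - B (p k) \<omega>) / 2)))" .
  have "real n * (average T S (p j) \<omega> - trapezoidal_average T r \<sigma> B S n (p j) \<omega>) =
    (\<Sum>k<j. integral {p k..p (Suc k)} (\<lambda>u. S u \<omega>) / \<delta> - S (p k) \<omega> * (1 + r * \<delta> / 2 + \<sigma> * ((B (p (Suc k)) \<omega> - B (p k) \<omega>) / 2)))"
  proof -
    have "real n * (x / T - \<delta> / T * y) = x / \<delta> - y" for x y using n T_pos by (simp add: \<delta>_def field_simps)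
    then show ?thesis unfolding avg tr by (simp only: sum_subtractf sum_divide_distrib[symmetric])
  qed
  also have "\<dots> = grid_error S0 r \<sigma> n j \<omega>"
    unfolding grid_error_def
  proof (intro sum.cong refl)
    fix k assume "k \<in> {..<j}"
    then have k: "k < n" using j by simp
    note gi = grid_interval[OF k]
    show "integral {p k..p (Suc k)} (\<lambda>u. S u \<omega>) / \<delta> - S (p k) \<omega> * (1 + r * \<delta> / 2 + \<sigma> * ((B (p (Suc k)) \<omega> - B (p k) \<omega>) / 2))
      = stock S0 r \<sigma> B (grid_point T n k) \<omega> * (\<sigma> * grid_bridge n k \<omega>
     + mean_remainder r \<sigma> (grid_point T n k) (grid_point T n (Suc k)) \<omega>
     + drift_remainder r (grid_point T n k) (grid_point T n (Suc k)))"
      using error_decomposition[OF gi(1-3) \<omega>, of S0 r \<sigma>] unfolding gi(4)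
      by (simp only: S_def p_def \<delta>_def grid_bridge_def)
  qed
  finally show ?thesis by (simp add: p_def)
qed

lemma path_tail:
  fixes H :: "real \<Rightarrow> 'a \<Rightarrow> real"
  assumes Hm: "\<And>t. t \<in> {0..T} \<Longrightarrow> H t \<in> borel_measurable M"
    and Hc: "\<And>\<omega>. \<omega> \<in> space M \<Longrightarrow> continuous_on {0..T} (\<lambda>t. H t \<omega>)" and \<eta>: "0 < \<eta>"
  shows "\<exists>K0\<ge>0. \<forall>K\<ge>K0. \<exists>E\<in>events. prob E \<le> \<eta> \<and> (\<forall>\<omega>\<in>space M - E. \<forall>n::nat. \<forall>k\<le>n. \<bar>H (grid_point T n k) \<omega>\<bar> \<le> K)"
proof -
  define A where "A K = (\<Union>n::nat. \<Union>k\<le>n. {\<omega> \<in> space M. K < \<bar>H (grid_point T n k) \<omega>\<bar>})" for K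
  have A: "A K \<in> events" for K
  proof -
    have "{\<omega> \<in> space M. K < \<bar>H (grid_point T n k) \<omega>\<bar>} \<in> events" if "k \<le> n" for n k
    proof -
      note [measurable] = Hm[OF grid_point_mem[OF T_pos that]]
      show ?thesis by measurable
    qed
    then have f: "(\<Union>k\<le>n. {\<omega> \<in> space M. K < \<bar>H (grid_point T n k) \<omega>\<bar>}) \<in> events" for n
      by (intro sets.finite_UN) simp_all
    show ?thesis unfolding A_def by (rule sets.countable_UN, rule image_subsetI, rule f)
  qed
  have mono: "A K' \<subseteq> A K" if "K \<le> K'" for K K' using that unfolding A_def by force
  have "decseq (\<lambda>m. A (real m))" unfolding decseq_def using mono by simp
  then have "(\<lambda>m. prob (A (real m))) \<longlonglongrightarrow> prob (\<Inter>m. A (real m))"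
    using A by (intro finite_Lim_measure_decseq) auto
  moreover have "(\<Inter>m. A (real m)) = {}"
  proof (rule ccontr)
    assume "(\<Inter>m. A (real m)) \<noteq> {}"
    then obtain \<omega> where \<omega>: "\<And>m. \<omega> \<in> A (real m)" by auto
    then have "\<omega> \<in> space M" by (auto simp: A_def)
    then have "compact ((\<lambda>t. H t \<omega>) ` {0..T})" by (intro compact_continuous_image Hc) auto
    then obtain C where "\<forall>x\<in>(\<lambda>t. H t \<omega>) ` {0..T}. norm x \<le> C"
      by (auto dest!: compact_imp_bounded simp only: bounded_iff)
    then have C: "\<And>t. t \<in> {0..T} \<Longrightarrow> \<bar>H t \<omega>\<bar> \<le> C" by (simp del: atLeastAtMost_iff)
    obtain m where m: "C \<le> real m" using real_arch_simple by blast
    obtain n k :: nat where "k \<le> n" "real m < \<bar>H (grid_point T n k) \<omega>\<bar>" using \<omega>[of m] by (auto simp: A_def)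
    then show False using C[OF grid_point_mem[OF T_pos, of k n]] m by simp
  qed
  ultimately have "\<forall>\<^sub>F m in sequentially. prob (A (real m)) < \<eta>" by (intro order_tendstoD(2)[of _ 0]) (simp_all add: \<eta>)
  then obtain m where m: "prob (A (real m)) < \<eta>" by (auto simp: eventually_sequentially)
  have "\<exists>E\<in>events. prob E \<le> \<eta> \<and> (\<forall>\<omega>\<in>space M - E. \<forall>n::nat. \<forall>k\<le>n. \<bar>H (grid_point T n k) \<omega>\<bar> \<le> K)" if "real m \<le> K" for K
  proof (intro bexI[of _ "A K"] conjI A)
    show "prob (A K) \<le> \<eta>" using finite_measure_mono[OF mono[OF that] A] m by simp
    show "\<forall>\<omega>\<in>space M - A K. \<forall>n::nat. \<forall>k\<le>n. \<bar>H (grid_point T n k) \<omega>\<bar> \<le> K" by (auto simp: A_def not_less)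
  qed
  then show ?thesis by (intro exI[of _ "real m"]) simp
qed

lemma grid_error_close:
  assumes e: "0 < e" and \<eta>: "0 < \<eta>"
  shows "\<exists>K0\<ge>0. \<forall>K\<ge>K0. \<forall>\<^sub>F n in sequentially.
    prob {\<omega> \<in> space M. \<exists>j\<le>n. e < \<bar>grid_error S0 r \<sigma> n j \<omega>
      - (\<Sum>k<j. clamp_abs K (stock S0 r \<sigma> B (grid_point T n k) \<omega>) * (\<sigma> * grid_bridge n k \<omega>))\<bar>} \<le> \<eta>"
proof -
  obtain K0 where K0: "0 \<le> K0" and tail: "\<And>K. K0 \<le> K \<Longrightarrow> \<exists>E\<in>events. prob E \<le> \<eta> / 2 \<and>
      (\<forall>\<omega>\<in>space M - E. \<forall>n::nat. \<forall>k\<le>n. \<bar>stock S0 r \<sigma> B (grid_point T n k) \<omega>\<bar> \<le> K)"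
    using path_tail[of "stock S0 r \<sigma> B" "\<eta> / 2"] \<eta> stock_M stock_cont by force
  have "\<forall>\<^sub>F n in sequentially.
    prob {\<omega> \<in> space M. \<exists>j\<le>n. e < \<bar>grid_error S0 r \<sigma> n j \<omega>
      - (\<Sum>k<j. clamp_abs K (stock S0 r \<sigma> B (grid_point T n k) \<omega>) * (\<sigma> * grid_bridge n k \<omega>))\<bar>} \<le> \<eta>"
    if KK: "K0 \<le> K" for K
  proof -
    have K: "0 \<le> K" using K0 KK by simp
    obtain E where E: "E \<in> events" "prob E \<le> \<eta> / 2"
      "\<And>\<omega> n k. \<omega> \<in> space M \<Longrightarrow> \<omega> \<notin> E \<Longrightarrow> k \<le> n \<Longrightarrow> \<bar>stock S0 r \<sigma> B (grid_point T n k) \<omega>\<bar> \<le> K"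
      using tail[OF KK] by blast
    define D where "D = K * r\<^sup>2 * T\<^sup>2 * exp (\<bar>r\<bar> * T)"
    define C where "C = K\<^sup>2 * exp_const r \<sigma> * T\<^sup>2 / (e / 2)\<^sup>2"
    have "(\<lambda>n. D * (1 / real n)) \<longlonglongrightarrow> D * 0" "(\<lambda>n. C * (1 / real n)) \<longlonglongrightarrow> C * 0" by (intro tendsto_intros lim_1_over_n)+
    then have "\<forall>\<^sub>F n in sequentially. D * (1 / real n) < e / 2" "\<forall>\<^sub>F n in sequentially. C * (1 / real n) < \<eta> / 2"
      using e \<eta> order_tendstoD(2)[of "\<lambda>n. D * (1 / real n)" 0 sequentially "e / 2"]
        order_tendstoD(2)[of "\<lambda>n. C * (1 / real n)" 0 sequentially "\<eta> / 2"] by simp_all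
    then show ?thesis using eventually_gt_at_top[of 0]
    proof eventually_elim
      case (elim n)
      define p where "p = grid_point T n"
      define S where "S k \<omega> = stock S0 r \<sigma> B (p k) \<omega>" for k \<omega>
      define R where "R k \<omega> = mean_remainder r \<sigma> (p k) (p (Suc k)) \<omega>" for k \<omega>
      define bad where "bad = {\<omega> \<in> space M. \<exists>j\<le>n. e / 2 < \<bar>\<Sum>k<j. clamp_abs K (S k \<omega>) * R k \<omega>\<bar>}"
      have SF: "S k \<in> borel_measurable (F (p k))" if "k < n" for k
        unfolding S_def p_def by (rule stock_F) (use grid_point_mem[OF T_pos, of k n] that in auto)
      have cF: "(\<lambda>\<omega>. clamp_abs K (S k \<omega>)) \<in> borel_measurable (F (p k))" if "k < n" for k
        using measurable_compose[OF SF[OF that] clamp_abs_measurable[of K]] .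
      have "prob bad \<le> K\<^sup>2 * exp_const r \<sigma> * T\<^sup>2 / (real n * (e / 2)\<^sup>2)"
        unfolding bad_def R_def p_def
        by (rule mean_remainder_maximal) (use elim e cF clamp_abs_le[OF K] in \<open>auto simp: p_def\<close>)
      also have "\<dots> = C * (1 / real n)" by (simp add: C_def)
      also have "\<dots> \<le> \<eta> / 2" using elim by linarith
      finally have pb: "prob bad \<le> \<eta> / 2" .
      have badm: "bad \<in> events"
      proof -
        have "{\<omega> \<in> space M. \<exists>j\<in>{..n}. e / 2 < \<bar>\<Sum>k<j. clamp_abs K (S k \<omega>) * R k \<omega>\<bar>} \<in> events"
        proof (rule sets.sets_Collect_finite_Ex[OF _ finite_atMost])
          fix j assume j: "j \<in> {..n}"
          have "(\<lambda>\<omega>. \<Sum>k<j. clamp_abs K (S k \<omega>) * R k \<omega>) \<in> borel_measurable M"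
          proof (intro borel_measurable_sum borel_measurable_times)
            fix k assume "k \<in> {..<j}"
            then have k: "k < n" using j by simp
            show "(\<lambda>\<omega>. clamp_abs K (S k \<omega>)) \<in> borel_measurable M" by (rule measurable_F[OF cF[OF k]])
            show "R k \<in> borel_measurable M" unfolding R_def mean_remainder_def p_def
            proof (intro borel_measurable_divide borel_measurable_const integral_measurable)
              fix u assume "u \<in> {grid_point T n k..grid_point T n (Suc k)}"
              then show "exp_remainder r \<sigma> (grid_point T n k) u \<in> borel_measurable M"
                using grid_interval[OF k] by (intro measurable_F[OF exp_remainder_moments(1)]) auto
            qed (use grid_interval[OF k] exp_remainder_cont in auto)
          qed
          note [measurable] = this
          show "{\<omega> \<in> space M. e / 2 < \<bar>\<Sum>k<j. clamp_abs K (S k \<omega>) * R k \<omega>\<bar>} \<in> events" by measurable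
        qed
        then show ?thesis unfolding bad_def Bex_def atMost_iff .
      qed
      have "{\<omega> \<in> space M. \<exists>j\<le>n. e < \<bar>grid_error S0 r \<sigma> n j \<omega>
        - (\<Sum>k<j. clamp_abs K (stock S0 r \<sigma> B (grid_point T n k) \<omega>) * (\<sigma> * grid_bridge n k \<omega>))\<bar>} \<subseteq> E \<union> bad"
      proof (rule subsetI, rule ccontr)
        fix \<omega> assume \<omega>: "\<omega> \<in> {\<omega> \<in> space M. \<exists>j\<le>n. e < \<bar>grid_error S0 r \<sigma> n j \<omega>
          - (\<Sum>k<j. clamp_abs K (stock S0 r \<sigma> B (grid_point T n k) \<omega>) * (\<sigma> * grid_bridge n k \<omega>))\<bar>}"
          and "\<omega> \<notin> E \<union> bad"
        then have nE: "\<omega> \<in> space M" "\<omega> \<notin> E" "\<omega> \<notin> bad" by auto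
        obtain j where j: "j \<le> n" "e < \<bar>grid_error S0 r \<sigma> n j \<omega>
          - (\<Sum>k<j. clamp_abs K (S k \<omega>) * (\<sigma> * grid_bridge n k \<omega>))\<bar>" using \<omega> by (auto simp: S_def p_def)
        have SK: "\<bar>S k \<omega>\<bar> \<le> K" if "k \<le> n" for k using E(3)[OF nE(1,2) that] by (simp add: S_def p_def)
        define d where "d k = drift_remainder r (p k) (p (Suc k))" for k
        have "grid_error S0 r \<sigma> n j \<omega> - (\<Sum>k<j. clamp_abs K (S k \<omega>) * (\<sigma> * grid_bridge n k \<omega>))
            = (\<Sum>k<j. clamp_abs K (S k \<omega>) * R k \<omega>) + (\<Sum>k<j. S k \<omega> * d k)"
        proof -
          have "grid_error S0 r \<sigma> n j \<omega> = (\<Sum>k<j. clamp_abs K (S k \<omega>) * (\<sigma> * grid_bridge n k \<omega>) + (clamp_abs K (S k \<omega>) * R k \<omega> + S k \<omega> * d k))"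
            unfolding grid_error_def
          proof (intro sum.cong refl)
            fix k assume "k \<in> {..<j}"
            then have "clamp_abs K (S k \<omega>) = S k \<omega>" using SK[of k] j by (intro clamp_abs_eq) simp
            then show "stock S0 r \<sigma> B (grid_point T n k) \<omega> * (\<sigma> * grid_bridge n k \<omega>
               + mean_remainder r \<sigma> (grid_point T n k) (grid_point T n (Suc k)) \<omega>
               + drift_remainder r (grid_point T n k) (grid_point T n (Suc k)))
              = clamp_abs K (S k \<omega>) * (\<sigma> * grid_bridge n k \<omega>) + (clamp_abs K (S k \<omega>) * R k \<omega> + S k \<omega> * d k)"
              by (simp add: S_def[symmetric] p_def[symmetric] R_def[symmetric] d_def[symmetric] distrib_left)
          qed
          then show ?thesis by (simp add: sum.distrib)
        qed
        moreover have "\<bar>\<Sum>k<j. clamp_abs K (S k \<omega>) * R k \<omega>\<bar> \<le> e / 2"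
          using nE j(1) by (auto simp: bad_def not_less)
        moreover have "\<bar>\<Sum>k<j. S k \<omega> * d k\<bar> \<le> D * (1 / real n)"
        proof -
          have "\<bar>\<Sum>k<j. S k \<omega> * d k\<bar> \<le> (\<Sum>k<j. K * (r\<^sup>2 * (T / real n)\<^sup>2 * exp (\<bar>r\<bar> * T)))"
          proof (rule order_trans[OF sum_abs], rule sum_mono)
            fix k assume "k \<in> {..<j}"
            then have k: "k < n" using j by simp
            have "\<bar>d k\<bar> \<le> r\<^sup>2 * (T / real n)\<^sup>2 * exp (\<bar>r\<bar> * (T / real n))"
              using drift_remainder_le[OF grid_interval(2)[OF k], of r] unfolding grid_interval(4)[OF k] by (simp add: d_def p_def)
            also have "\<dots> \<le> r\<^sup>2 * (T / real n)\<^sup>2 * exp (\<bar>r\<bar> * T)"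
            proof -
              have "T / real n \<le> T" using T_pos elim by (simp add: divide_le_eq)
              then have "\<bar>r\<bar> * (T / real n) \<le> \<bar>r\<bar> * T" by (rule mult_left_mono) simp
              then show ?thesis by (intro mult_left_mono) simp_all
            qed
            finally show "\<bar>S k \<omega> * d k\<bar> \<le> K * (r\<^sup>2 * (T / real n)\<^sup>2 * exp (\<bar>r\<bar> * T))"
              unfolding abs_mult using SK[of k] k K by (intro mult_mono) auto
          qed
          also have "\<dots> = real j * (K * (r\<^sup>2 * (T / real n)\<^sup>2 * exp (\<bar>r\<bar> * T)))" by simp
          also have "\<dots> \<le> real n * (K * (r\<^sup>2 * (T / real n)\<^sup>2 * exp (\<bar>r\<bar> * T)))"
            using j K by (intro mult_right_mono) auto
          also have "\<dots> = D * (1 / real n)" using elim by (simp add: D_def power2_eq_square)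
          finally show ?thesis .
        qed
        ultimately show False using j(2) elim by linarith
      qed
      then have "prob {\<omega> \<in> space M. \<exists>j\<le>n. e < \<bar>grid_error S0 r \<sigma> n j \<omega>
        - (\<Sum>k<j. clamp_abs K (stock S0 r \<sigma> B (grid_point T n k) \<omega>) * (\<sigma> * grid_bridge n k \<omega>))\<bar>} \<le> prob (E \<union> bad)"
        using E badm by (intro finite_measure_mono) auto
      also have "\<dots> \<le> prob E + prob bad" by (rule measure_Un_le) (use E badm in auto)
      finally show ?case using E pb by simp
    qed
  qed
  then show ?thesis using K0 by blast
qed

end

section \<open>Comparison of the two limits\<close>

definition vec_path :: "(nat + nat \<Rightarrow> real) \<Rightarrow> nat \<Rightarrow> real" where
  "vec_path z j = (\<Sum>k<j. z (Inl k))"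

definition vec_sum :: "real \<Rightarrow> real \<Rightarrow> real \<Rightarrow> real \<Rightarrow> nat \<Rightarrow> real \<Rightarrow> (nat + nat \<Rightarrow> real) \<Rightarrow> nat \<Rightarrow> real" where
  "vec_sum S0 r \<sigma> T n K z j =
     (\<Sum>k<j. clamp_abs K (S0 * exp ((r - \<sigma>\<^sup>2 / 2) * grid_point T n k + \<sigma> * vec_path z k)) * (\<sigma> / sqrt 12 * z (Inr k)))"

lemma vec_path_measurable:
  "j \<le> n \<Longrightarrow> (\<lambda>z. vec_path z j) \<in> borel_measurable (\<Pi>\<^sub>M i\<in>grid_labels n. borel)"
  unfolding vec_path_def by (intro borel_measurable_sum measurable_component_singleton) auto

lemma vec_sum_measurable:
  assumes "j \<le> n"
  shows "(\<lambda>z. vec_sum S0 r \<sigma> T n K z j) \<in> borel_measurable (\<Pi>\<^sub>M i\<in>grid_labels n. borel)"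
  unfolding vec_sum_def
proof (intro borel_measurable_sum)
  fix k assume "k \<in> {..<j}"
  then have "k < n" "k \<le> n" using assms by auto
  have [measurable]: "(\<lambda>z. vec_path z k) \<in> borel_measurable (\<Pi>\<^sub>M i\<in>grid_labels n. borel)"
    by (rule vec_path_measurable[OF \<open>k \<le> n\<close>])
  have [measurable]: "(\<lambda>z. z (Inr k)) \<in> borel_measurable (\<Pi>\<^sub>M i\<in>grid_labels n. borel :: real measure)"
    by (rule measurable_component_singleton) (use \<open>k < n\<close> in auto)
  show "(\<lambda>z. clamp_abs K (S0 * exp ((r - \<sigma>\<^sup>2 / 2) * grid_point T n k + \<sigma> * vec_path z k)) * (\<sigma> / sqrt 12 * z (Inr k)))
    \<in> borel_measurable (\<Pi>\<^sub>M i\<in>grid_labels n. borel)" by measurable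
qed

lemma (in brownian) prob_eq_value:
  assumes s: "0 < s" "s \<le> T"
  shows "AE \<omega> in M. B s \<omega> \<noteq> x"
proof -
  have [measurable]: "B 0 \<in> borel_measurable M" "B s \<in> borel_measurable M" using s T_pos by (auto intro!: B_M)
  have d: "distributed M lborel (\<lambda>\<omega>. B s \<omega> - B 0 \<omega>) (normal_density 0 (sqrt (s - 0)))"
    by (rule increment_distributed) (use s in auto)
  have "AE y in lborel. y \<noteq> x" by (rule AE_lborel_singleton)
  then have "AE y in density lborel (\<lambda>x. ennreal (normal_density 0 (sqrt (s - 0)) x)). y \<noteq> x"
    by (simp add: AE_density) (auto elim: eventually_mono)
  then have "AE y in distr M lborel (\<lambda>\<omega>. B s \<omega> - B 0 \<omega>). y \<noteq> x"
    unfolding distributed_distr_eq_density[OF d] .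
  then have "AE \<omega> in M. B s \<omega> - B 0 \<omega> \<noteq> x" by (subst (asm) AE_distr_iff) auto
  then show ?thesis using B_0 by eventually_elim simp
qed

locale stock_limit = W: brownian M F T W + Y: brownian N G T B
  for M :: "'a measure" and F :: "real \<Rightarrow> 'a measure" and T :: real and W :: "real \<Rightarrow> 'a \<Rightarrow> real"
    and N :: "'b measure" and G :: "real \<Rightarrow> 'b measure" and B :: "real \<Rightarrow> 'b \<Rightarrow> real" +
  fixes \<pi> :: "'b \<Rightarrow> 'a" and I :: "real \<Rightarrow> 'b \<Rightarrow> real" and S0 r \<sigma> :: real
  assumes pi_measurable: "\<pi> \<in> measurable N M"
    and distr_pi: "distr N M \<pi> = M"
    and independent: "independent_processes N T (\<lambda>t \<omega>. W t (\<pi> \<omega>)) B"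
    and ito: "ito_integral N G T B (\<lambda>t \<omega>. stock S0 r \<sigma> W t (\<pi> \<omega>)) I"
begin

text \<open>Left labels carry the increments of $W$. Right labels carry its rescaled bridge functionals for
  \<open>vec_M\<close> and the increments of $B$ for \<open>vec_N\<close>; the two vectors have the same law.\<close>

definition vec_M :: "nat \<Rightarrow> 'a \<Rightarrow> nat + nat \<Rightarrow> real" where
  "vec_M n \<omega> = (\<lambda>i\<in>grid_labels n. case_sum (\<lambda>k. W.grid_increment n k \<omega>) (\<lambda>k. sqrt 12 * W.grid_bridge n k \<omega>) i)"

definition vec_N :: "nat \<Rightarrow> 'b \<Rightarrow> nat + nat \<Rightarrow> real" where
  "vec_N n \<omega> = (\<lambda>i\<in>grid_labels n. case_sum (\<lambda>k. W.grid_increment n k (\<pi> \<omega>)) (\<lambda>k. Y.grid_increment n k \<omega>) i)"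

lemma vec_M_measurable: "vec_M n \<in> measurable M (\<Pi>\<^sub>M i\<in>grid_labels n. borel)"
  unfolding vec_M_def
proof (rule measurable_restrict)
  fix i assume "i \<in> grid_labels n"
  then show "(\<lambda>\<omega>. case_sum (\<lambda>k. W.grid_increment n k \<omega>) (\<lambda>k. sqrt 12 * W.grid_bridge n k \<omega>) i) \<in> borel_measurable M"
    by (cases i) (auto intro: W.grid_increment_M borel_measurable_times W.grid_bridge_M)
qed

lemma vec_N_measurable: "vec_N n \<in> measurable N (\<Pi>\<^sub>M i\<in>grid_labels n. borel)"
  unfolding vec_N_def
proof (rule measurable_restrict)
  fix i assume "i \<in> grid_labels n"
  then show "(\<lambda>\<omega>. case_sum (\<lambda>k. W.grid_increment n k (\<pi> \<omega>)) (\<lambda>k. Y.grid_increment n k \<omega>) i) \<in> borel_measurable N"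
    by (cases i) (auto intro: Y.grid_increment_M measurable_compose[OF pi_measurable W.grid_increment_M])
qed

lemma vec_law_eq:
  fixes \<phi> :: "(nat + nat \<Rightarrow> real) \<Rightarrow> real"
  assumes n: "0 < n" and \<phi>: "\<phi> \<in> borel_measurable (\<Pi>\<^sub>M i\<in>grid_labels n. borel)"
  shows "(\<integral>\<omega>. \<phi> (vec_M n \<omega>) \<partial>M) = (\<integral>\<omega>. \<phi> (vec_N n \<omega>) \<partial>N)"
proof -
  have "(\<integral>\<omega>. \<phi> (vec_M n \<omega>) \<partial>M) = (\<integral>z. \<phi> z \<partial>distr M (\<Pi>\<^sub>M i\<in>grid_labels n. borel) (vec_M n))"
    by (rule integral_distr[symmetric, OF vec_M_measurable \<phi>])
  also have "distr M (\<Pi>\<^sub>M i\<in>grid_labels n. borel) (vec_M n) = distr N (\<Pi>\<^sub>M i\<in>grid_labels n. borel) (vec_N n)"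
    using W.grid_law[OF n]
      grid_law_independent[OF W.brownian_axioms Y.brownian_axioms pi_measurable distr_pi independent n]
    by (simp add: vec_M_def[abs_def] vec_N_def[abs_def])
  also have "(\<integral>z. \<phi> z \<partial>\<dots>) = (\<integral>\<omega>. \<phi> (vec_N n \<omega>) \<partial>N)" by (rule integral_distr[OF vec_N_measurable \<phi>])
  finally show ?thesis .
qed

lemma integral_pi: 
  fixes f :: "'a \<Rightarrow> real"
  assumes "f \<in> borel_measurable M" shows "(\<integral>\<omega>. f (\<pi> \<omega>) \<partial>N) = (\<integral>\<omega>. f \<omega> \<partial>M)"
  using integral_distr[OF pi_measurable assms] by (simp add: distr_pi)

lemma AE_pi: "AE \<omega> in M. P \<omega> \<Longrightarrow> AE \<omega> in N. P (\<pi> \<omega>)"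
  by (rule AE_distrD[OF pi_measurable]) (unfold distr_pi)

lemma vec_path_M:
  assumes "W 0 \<omega> = 0" "j \<le> n"
  shows "vec_path (vec_M n \<omega>) j = W (grid_point T n j) \<omega>"
proof -
  have "vec_path (vec_M n \<omega>) j = (\<Sum>k<j. W (grid_point T n (Suc k)) \<omega> - W (grid_point T n k) \<omega>)"
    unfolding vec_path_def by (intro sum.cong refl) (use assms in \<open>auto simp: vec_M_def W.grid_increment_def\<close>)
  also have "\<dots> = W (grid_point T n j) \<omega> - W (grid_point T n 0) \<omega>" by (rule sum_lessThan_telescope)
  finally show ?thesis using assms by simp
qed

lemma vec_path_N:
  assumes "W 0 (\<pi> \<omega>) = 0" "j \<le> n"
  shows "vec_path (vec_N n \<omega>) j = W (grid_point T n j) (\<pi> \<omega>)"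
proof -
  have "vec_path (vec_N n \<omega>) j = (\<Sum>k<j. W (grid_point T n (Suc k)) (\<pi> \<omega>) - W (grid_point T n k) (\<pi> \<omega>))"
    unfolding vec_path_def by (intro sum.cong refl) (use assms in \<open>auto simp: vec_N_def W.grid_increment_def\<close>)
  also have "\<dots> = W (grid_point T n j) (\<pi> \<omega>) - W (grid_point T n 0) (\<pi> \<omega>)" by (rule sum_lessThan_telescope)
  finally show ?thesis using assms by simp
qed

definition main_sum :: "real \<Rightarrow> nat \<Rightarrow> nat \<Rightarrow> 'a \<Rightarrow> real" where
  "main_sum K n j \<omega> = (\<Sum>k<j. clamp_abs K (stock S0 r \<sigma> W (grid_point T n k) \<omega>) * (\<sigma> * W.grid_bridge n k \<omega>))"

definition ito_sum :: "real \<Rightarrow> nat \<Rightarrow> nat \<Rightarrow> 'b \<Rightarrow> real" where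
  "ito_sum K n j \<omega> = \<sigma> / (2 * sqrt 3) *
     (\<Sum>k<j. clamp_abs K (stock S0 r \<sigma> W (grid_point T n k) (\<pi> \<omega>)) * Y.grid_increment n k \<omega>)"

lemma sqrt_12: "sqrt 12 = 2 * sqrt (3::real)"
  using real_sqrt_mult[of 4 3] by simp

lemma vec_sum_M:
  assumes "W 0 \<omega> = 0" "j \<le> n"
  shows "vec_sum S0 r \<sigma> T n K (vec_M n \<omega>) j = main_sum K n j \<omega>"
  unfolding vec_sum_def main_sum_def
proof (intro sum.cong refl)
  fix k assume "k \<in> {..<j}"
  then have k: "k < n" "k \<le> n" using assms by auto
  then have "vec_M n \<omega> (Inr k) = sqrt 12 * W.grid_bridge n k \<omega>" by (auto simp: vec_M_def)
  then show "clamp_abs K (S0 * exp ((r - \<sigma>\<^sup>2 / 2) * grid_point T n k + \<sigma> * vec_path (vec_M n \<omega>) k)) * (\<sigma> / sqrt 12 * vec_M n \<omega> (Inr k))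
    = clamp_abs K (stock S0 r \<sigma> W (grid_point T n k) \<omega>) * (\<sigma> * W.grid_bridge n k \<omega>)"
    by (simp add: vec_path_M[OF assms(1) k(2)] stock_def)
qed

lemma vec_sum_N:
  assumes "W 0 (\<pi> \<omega>) = 0" "j \<le> n"
  shows "vec_sum S0 r \<sigma> T n K (vec_N n \<omega>) j = ito_sum K n j \<omega>"
  unfolding vec_sum_def ito_sum_def sum_distrib_left
proof (intro sum.cong refl)
  fix k assume "k \<in> {..<j}"
  then have k: "k < n" "k \<le> n" using assms by auto
  then have "vec_N n \<omega> (Inr k) = Y.grid_increment n k \<omega>" by (auto simp: vec_N_def)
  then show "clamp_abs K (S0 * exp ((r - \<sigma>\<^sup>2 / 2) * grid_point T n k + \<sigma> * vec_path (vec_N n \<omega>) k)) * (\<sigma> / sqrt 12 * vec_N n \<omega> (Inr k))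
    = \<sigma> / (2 * sqrt 3) * (clamp_abs K (stock S0 r \<sigma> W (grid_point T n k) (\<pi> \<omega>)) * Y.grid_increment n k \<omega>)"
    by (simp add: vec_path_N[OF assms(1) k(2)] stock_def sqrt_12)
qed

lemma ito_facts:
  shows "(\<lambda>(t, \<omega>). stock S0 r \<sigma> W t (\<pi> \<omega>)) \<in> borel_measurable (time_product N T)"
    and "t \<in> {0..T} \<Longrightarrow> (\<lambda>\<omega>. stock S0 r \<sigma> W t (\<pi> \<omega>)) \<in> borel_measurable (G t)"
    and "sq_norm N T (\<lambda>t \<omega>. stock S0 r \<sigma> W t (\<pi> \<omega>)) < \<infinity>"
    and "t \<in> {0..T} \<Longrightarrow> I t \<in> borel_measurable N"
    and "\<omega> \<in> space N \<Longrightarrow> continuous_on {0..T} (\<lambda>t. I t \<omega>)"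
  using ito unfolding ito_integral_def sq_norm_def by auto

lemma ito_sum_close:
  assumes e: "0 < e" and \<eta>: "0 < \<eta>"
  shows "\<exists>K0\<ge>0. \<forall>K\<ge>K0. \<forall>\<^sub>F n in sequentially.
    Y.prob {\<omega> \<in> space N. \<exists>j\<le>n. e < \<bar>ito_sum K n j \<omega> - \<sigma> / (2 * sqrt 3) * I (grid_point T n j) \<omega>\<bar>} \<le> \<eta>"
proof -
  define c where "c = \<sigma> / (2 * sqrt 3)"
  define l where "l = e / (2 * (\<bar>c\<bar> + 1))"
  have l: "0 < l" using e by (simp add: l_def)
  have "\<exists>K0\<ge>0. \<forall>K\<ge>K0. \<forall>\<^sub>F n in sequentially.
    sq_norm N T (\<lambda>t \<omega>. stock S0 r \<sigma> W t (\<pi> \<omega>) - Y.elem_val {..<n} (grid_point T n) (\<lambda>k. grid_point T n (Suc k))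
      (\<lambda>k \<omega>. clamp_abs K (stock S0 r \<sigma> W (grid_point T n k) (\<pi> \<omega>))) t \<omega>) < ennreal (\<eta> * l\<^sup>2 / 2)"
  proof (rule Y.clamp_grid_L2)
    show "continuous_on {0..T} (\<lambda>t. stock S0 r \<sigma> W t (\<pi> \<omega>))" if "\<omega> \<in> space N" for \<omega>
      by (rule W.stock_cont) (use measurable_space[OF pi_measurable that] in simp)
  qed (use ito_facts l \<eta> in auto)
  then obtain K0 where K0: "0 \<le> K0" and L2: "\<And>K. K0 \<le> K \<Longrightarrow> \<forall>\<^sub>F n in sequentially.
    sq_norm N T (\<lambda>t \<omega>. stock S0 r \<sigma> W t (\<pi> \<omega>) - Y.elem_val {..<n} (grid_point T n) (\<lambda>k. grid_point T n (Suc k))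
      (\<lambda>k \<omega>. clamp_abs K (stock S0 r \<sigma> W (grid_point T n k) (\<pi> \<omega>))) t \<omega>) < ennreal (\<eta> * l\<^sup>2 / 2)" by blast
  have "\<forall>\<^sub>F n in sequentially.
    Y.prob {\<omega> \<in> space N. \<exists>j\<le>n. e < \<bar>ito_sum K n j \<omega> - c * I (grid_point T n j) \<omega>\<bar>} \<le> \<eta>" if KK: "K0 \<le> K" for K
    using L2[OF KK] eventually_gt_at_top[of 0]
  proof eventually_elim
    case (elim n)
    have K: "0 \<le> K" using K0 KK by simp
    define R where "R j \<omega> = (\<Sum>k<j. clamp_abs K (stock S0 r \<sigma> W (grid_point T n k) (\<pi> \<omega>)) * Y.grid_increment n k \<omega>)" for j \<omega>
    have SG: "(\<lambda>\<omega>. clamp_abs K (stock S0 r \<sigma> W (grid_point T n k) (\<pi> \<omega>))) \<in> borel_measurable (G (grid_point T n k))" if "k < n" for k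
    proof -
      have "grid_point T n k \<in> {0..T}" by (rule grid_point_mem[OF Y.T_pos]) (use that in simp)
      note [measurable] = ito_facts(2)[OF this]
      show ?thesis by measurable
    qed
    have RM: "R j \<in> borel_measurable N" if "j \<le> n" for j
      unfolding R_def using that Y.measurable_F[OF SG] Y.grid_increment_M[of _ n]
      by (intro borel_measurable_sum borel_measurable_times) auto
    have "emeasure N {\<omega> \<in> space N. \<exists>j\<le>n. 2 * l \<le> \<bar>I (grid_point T n j) \<omega> - R j \<omega>\<bar>}
      \<le> ennreal (2 / l\<^sup>2) * sq_norm N T (\<lambda>t \<omega>. stock S0 r \<sigma> W t (\<pi> \<omega>) - Y.elem_val {..<n} (grid_point T n) (\<lambda>k. grid_point T n (Suc k))
      (\<lambda>k \<omega>. clamp_abs K (stock S0 r \<sigma> W (grid_point T n k) (\<pi> \<omega>))) t \<omega>)"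
      unfolding R_def
      by (rule Y.ito_grid_approx[OF ito elim(2) l SG]) (use clamp_abs_le[OF K] in \<open>auto simp: bounded_iff\<close>)
    also have "\<dots> \<le> ennreal (2 / l\<^sup>2) * ennreal (\<eta> * l\<^sup>2 / 2)" using elim by (intro mult_left_mono) auto
    also have "\<dots> = ennreal \<eta>" using l \<eta> by (subst ennreal_mult[symmetric]) (auto simp: field_simps)
    finally have 1: "Y.prob {\<omega> \<in> space N. \<exists>j\<le>n. 2 * l \<le> \<bar>I (grid_point T n j) \<omega> - R j \<omega>\<bar>} \<le> \<eta>"
      using \<eta> by (simp add: Y.emeasure_eq_measure)
    have "Y.prob {\<omega> \<in> space N. \<exists>j\<le>n. e < \<bar>ito_sum K n j \<omega> - c * I (grid_point T n j) \<omega>\<bar>}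
      \<le> Y.prob {\<omega> \<in> space N. \<exists>j\<le>n. 2 * l \<le> \<bar>I (grid_point T n j) \<omega> - R j \<omega>\<bar>}"
    proof (rule Y.finite_measure_mono)
      show "{\<omega> \<in> space N. \<exists>j\<le>n. e < \<bar>ito_sum K n j \<omega> - c * I (grid_point T n j) \<omega>\<bar>}
        \<subseteq> {\<omega> \<in> space N. \<exists>j\<le>n. 2 * l \<le> \<bar>I (grid_point T n j) \<omega> - R j \<omega>\<bar>}"
      proof
        fix \<omega> assume "\<omega> \<in> {\<omega> \<in> space N. \<exists>j\<le>n. e < \<bar>ito_sum K n j \<omega> - c * I (grid_point T n j) \<omega>\<bar>}"
        then obtain j where j: "\<omega> \<in> space N" "j \<le> n" "e < \<bar>ito_sum K n j \<omega> - c * I (grid_point T n j) \<omega>\<bar>" by auto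
        have "\<bar>ito_sum K n j \<omega> - c * I (grid_point T n j) \<omega>\<bar> = \<bar>c\<bar> * \<bar>I (grid_point T n j) \<omega> - R j \<omega>\<bar>"
          by (simp add: ito_sum_def c_def[symmetric] R_def right_diff_distrib[symmetric] abs_mult abs_minus_commute)
        also have "\<dots> \<le> (\<bar>c\<bar> + 1) * \<bar>I (grid_point T n j) \<omega> - R j \<omega>\<bar>" by (rule mult_right_mono) auto
        finally have "e \<le> (\<bar>c\<bar> + 1) * \<bar>I (grid_point T n j) \<omega> - R j \<omega>\<bar>" using j by simp
        then have "2 * l \<le> \<bar>I (grid_point T n j) \<omega> - R j \<omega>\<bar>" by (simp add: l_def field_simps)
        then show "\<omega> \<in> {\<omega> \<in> space N. \<exists>j\<le>n. 2 * l \<le> \<bar>I (grid_point T n j) \<omega> - R j \<omega>\<bar>}" using j by blast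
      qed
      have "{\<omega> \<in> space N. \<exists>j\<in>{..n}. 2 * l \<le> \<bar>I (grid_point T n j) \<omega> - R j \<omega>\<bar>} \<in> Y.events"
      proof (rule sets.sets_Collect_finite_Ex[OF _ finite_atMost])
        fix j assume "j \<in> {..n}"
        then have j: "j \<le> n" by simp
        note [measurable] = RM[OF j] ito_facts(4)[OF grid_point_mem[OF Y.T_pos j]]
        show "{\<omega> \<in> space N. 2 * l \<le> \<bar>I (grid_point T n j) \<omega> - R j \<omega>\<bar>} \<in> Y.events" by measurable
      qed
      then show "{\<omega> \<in> space N. \<exists>j\<le>n. 2 * l \<le> \<bar>I (grid_point T n j) \<omega> - R j \<omega>\<bar>} \<in> Y.events"
        unfolding Bex_def atMost_iff .
    qed
    with 1 show ?case by simp
  qed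
  then show ?thesis using K0 unfolding c_def by blast
qed

end

lemma (in prob_space) weighted_expectation_diff_le:
  fixes u v z :: "'a \<Rightarrow> real"
  assumes [measurable]: "u \<in> borel_measurable M" "v \<in> borel_measurable M" "z \<in> borel_measurable M"
    and u: "\<And>\<omega>. \<omega> \<in> space M \<Longrightarrow> \<bar>u \<omega>\<bar> \<le> 1" and v: "\<And>\<omega>. \<omega> \<in> space M \<Longrightarrow> \<bar>v \<omega>\<bar> \<le> 1"
    and z: "\<And>\<omega>. \<omega> \<in> space M \<Longrightarrow> \<bar>z \<omega>\<bar> \<le> C"
  shows "\<bar>(\<integral>\<omega>. u \<omega> * z \<omega> \<partial>M) - (\<integral>\<omega>. v \<omega> * z \<omega> \<partial>M)\<bar> \<le> C * (\<integral>\<omega>. \<bar>u \<omega> - v \<omega>\<bar> \<partial>M)"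
proof -
  have int: "integrable M (\<lambda>\<omega>. f \<omega> * z \<omega>)" if [measurable]: "f \<in> borel_measurable M" and f: "\<And>\<omega>. \<omega> \<in> space M \<Longrightarrow> \<bar>f \<omega>\<bar> \<le> 1" for f
  proof (rule integrable_const_bound[where B=C])
    show "AE \<omega> in M. norm (f \<omega> * z \<omega>) \<le> C"
    proof (rule AE_I2)
      fix \<omega> assume \<omega>: "\<omega> \<in> space M"
      have "\<bar>f \<omega>\<bar> * \<bar>z \<omega>\<bar> \<le> 1 * C" using f[OF \<omega>] z[OF \<omega>] by (intro mult_mono) auto
      then show "norm (f \<omega> * z \<omega>) \<le> C" by (simp add: abs_mult)
    qed
  qed measurable
  have i2: "integrable M (\<lambda>\<omega>. \<bar>u \<omega> - v \<omega>\<bar>)"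
  proof (rule integrable_const_bound[where B=2])
    show "AE \<omega> in M. norm \<bar>u \<omega> - v \<omega>\<bar> \<le> 2"
      by (rule AE_I2) (use u v abs_triangle_ineq4 in \<open>fastforce intro: order_trans\<close>)
  qed measurable
  have "\<bar>(\<integral>\<omega>. u \<omega> * z \<omega> \<partial>M) - (\<integral>\<omega>. v \<omega> * z \<omega> \<partial>M)\<bar> = \<bar>\<integral>\<omega>. u \<omega> * z \<omega> - v \<omega> * z \<omega> \<partial>M\<bar>"
    using int u v by simp
  also have "\<dots> \<le> (\<integral>\<omega>. \<bar>u \<omega> * z \<omega> - v \<omega> * z \<omega>\<bar> \<partial>M)" by (rule integral_abs_bound)
  also have "\<dots> \<le> (\<integral>\<omega>. C * \<bar>u \<omega> - v \<omega>\<bar> \<partial>M)"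
  proof (rule integral_mono)
    show "integrable M (\<lambda>\<omega>. \<bar>u \<omega> * z \<omega> - v \<omega> * z \<omega>\<bar>)" using int u v by simp
    show "integrable M (\<lambda>\<omega>. C * \<bar>u \<omega> - v \<omega>\<bar>)" using i2 by simp
    fix \<omega> assume \<omega>: "\<omega> \<in> space M"
    have "\<bar>u \<omega> * z \<omega> - v \<omega> * z \<omega>\<bar> = \<bar>z \<omega>\<bar> * \<bar>u \<omega> - v \<omega>\<bar>" by (simp add: left_diff_distrib[symmetric] abs_mult mult.commute)
    then show "\<bar>u \<omega> * z \<omega> - v \<omega> * z \<omega>\<bar> \<le> C * \<bar>u \<omega> - v \<omega>\<bar>" using z[OF \<omega>] by (simp add: mult_right_mono)
  qed
  finally show ?thesis by simp
qed

context stock_limit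
begin

text \<open>Finite sets $Q$ of pairs $(s, x)$ encode the constraints $W_s \<le> x$; the corresponding path
  events form an intersection stable generator of the Brownian filtration, up to null sets. On the
  grid, $s$ is replaced by the grid point to its left.\<close>

definition path_event :: "(real \<times> real) set \<Rightarrow> 'a set" where
  "path_event Q = {\<omega> \<in> space M. \<forall>(s, x)\<in>Q. W s \<omega> \<le> x}"

definition grid_event :: "(real \<times> real) set \<Rightarrow> nat \<Rightarrow> 'a set" where
  "grid_event Q n = {\<omega> \<in> space M. \<forall>(s, x)\<in>Q. W (grid_point T n (grid_index T n s)) \<omega> \<le> x}"

definition vec_event :: "(real \<times> real) set \<Rightarrow> nat \<Rightarrow> (nat + nat \<Rightarrow> real) set" where
  "vec_event Q n = {z \<in> space (\<Pi>\<^sub>M i\<in>grid_labels n. borel). \<forall>(s, x)\<in>Q. vec_path z (grid_index T n s) \<le> x}"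

lemma path_event_sets:
  assumes Q: "finite Q" "Q \<subseteq> {0..T} \<times> UNIV"
  shows "path_event Q \<in> sets M" "grid_event Q n \<in> sets M" "vec_event Q n \<in> sets (\<Pi>\<^sub>M i\<in>grid_labels n. borel)"
proof -
  have 1: "{\<omega> \<in> space M. case q of (s, x) \<Rightarrow> W s \<omega> \<le> x} \<in> sets M" if "q \<in> Q" for q
  proof -
    obtain s x where q: "q = (s, x)" by (cases q)
    then have "s \<in> {0..T}" using that Q by auto
    then have [measurable]: "W s \<in> borel_measurable M" by (intro W.B_M) auto
    show ?thesis unfolding q prod.case by measurable
  qed
  have 2: "{\<omega> \<in> space M. case q of (s, x) \<Rightarrow> W (grid_point T n (grid_index T n s)) \<omega> \<le> x} \<in> sets M" if "q \<in> Q" for q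
  proof -
    obtain s x where q: "q = (s, x)" by (cases q)
    then have "s \<in> {0..T}" using that Q by auto
    from W.grid_B_M[OF grid_index_le[OF W.T_pos this]]
    have [measurable]: "W (grid_point T n (grid_index T n s)) \<in> borel_measurable M" .
    show ?thesis unfolding q prod.case by measurable
  qed
  have 3: "{z \<in> space (\<Pi>\<^sub>M i\<in>grid_labels n. borel). case q of (s, x) \<Rightarrow> vec_path z (grid_index T n s) \<le> x} \<in> sets (\<Pi>\<^sub>M i\<in>grid_labels n. borel)" if "q \<in> Q" for q
  proof -
    obtain s x where q: "q = (s, x)" by (cases q)
    then have "s \<in> {0..T}" using that Q by auto
    from vec_path_measurable[OF grid_index_le[OF W.T_pos this]]
    have [measurable]: "(\<lambda>z. vec_path z (grid_index T n s)) \<in> borel_measurable (\<Pi>\<^sub>M i\<in>grid_labels n. borel)" .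
    show ?thesis unfolding q prod.case by measurable
  qed
  show "path_event Q \<in> sets M" unfolding path_event_def by (rule sets.sets_Collect_finite_All[OF 1 Q(1)])
  show "grid_event Q n \<in> sets M" unfolding grid_event_def by (rule sets.sets_Collect_finite_All[OF 2 Q(1)])
  show "vec_event Q n \<in> sets (\<Pi>\<^sub>M i\<in>grid_labels n. borel)" unfolding vec_event_def by (rule sets.sets_Collect_finite_All[OF 3 Q(1)])
qed

lemma grid_event_tendsto:
  assumes Q: "finite Q" "Q \<subseteq> {0..T} \<times> UNIV"
  shows "AE \<omega> in M. \<forall>\<^sub>F n in sequentially. \<omega> \<in> grid_event Q n \<longleftrightarrow> \<omega> \<in> path_event Q"
proof -
  have "AE \<omega> in M. \<forall>q\<in>Q. \<forall>\<^sub>F n in sequentially. (case q of (s, x) \<Rightarrow> W (grid_point T n (grid_index T n s)) \<omega> \<le> x \<longleftrightarrow> W s \<omega> \<le> x)"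
  proof (rule AE_finite_allI[OF Q(1)])
    fix q assume "q \<in> Q"
    obtain s x where q: "q = (s, x)" by (cases q)
    then have s: "0 \<le> s" "s \<le> T" using \<open>q \<in> Q\<close> Q by auto
    show "AE \<omega> in M. \<forall>\<^sub>F n in sequentially. (case q of (s, x) \<Rightarrow> W (grid_point T n (grid_index T n s)) \<omega> \<le> x \<longleftrightarrow> W s \<omega> \<le> x)"
    proof (cases "s = 0")
      case True
      then have "grid_index T n s = 0" for n by (simp add: grid_index_def)
      then show ?thesis using True by (simp add: q)
    next
      case False
      then have "AE \<omega> in M. W s \<omega> \<noteq> x" using s by (intro W.prob_eq_value) auto
      then show ?thesis using AE_space
      proof eventually_elim
        case (elim \<omega>)
        have "(\<lambda>n. W (grid_point T n (grid_index T n s)) \<omega>) \<longlonglongrightarrow> W s \<omega>"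
        proof (rule continuous_on_tendsto_compose[OF W.B_cont[OF elim(2)]])
          show "(\<lambda>n. grid_point T n (grid_index T n s)) \<longlonglongrightarrow> s"
            by (rule grid_point_index_tendsto[OF W.T_pos s(1)])
          show "\<forall>\<^sub>F n in sequentially. grid_point T n (grid_index T n s) \<in> {0..T}"
            using s by (intro always_eventually allI grid_point_mem W.T_pos grid_index_le) auto
        qed (use s in simp)
        note lim = this
        show ?case
        proof (cases "W s \<omega> < x")
          case True
          from order_tendstoD(2)[OF lim True] show ?thesis
            by eventually_elim (use True in \<open>simp add: q\<close>)
        next
          case False
          then have "x < W s \<omega>" using elim by simp
          from order_tendstoD(1)[OF lim this] show ?thesis
            by eventually_elim (use \<open>x < W s \<omega>\<close> in \<open>simp add: q\<close>)
        qed
      qed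
    qed
  qed
  then show ?thesis using AE_space
  proof eventually_elim
    case (elim \<omega>)
    have "\<forall>\<^sub>F n in sequentially. \<forall>q\<in>Q. (case q of (s, x) \<Rightarrow> W (grid_point T n (grid_index T n s)) \<omega> \<le> x \<longleftrightarrow> W s \<omega> \<le> x)"
      using elim by (intro eventually_ball_finite Q)
    then show ?case by eventually_elim (use elim in \<open>auto simp: grid_event_def path_event_def\<close>)
  qed
qed

lemma grid_event_L1:
  assumes Q: "finite Q" "Q \<subseteq> {0..T} \<times> UNIV"
  shows "(\<lambda>n. \<integral>\<omega>. \<bar>indicator (grid_event Q n) \<omega> - indicator (path_event Q) \<omega>\<bar> \<partial>M) \<longlonglongrightarrow> (0::real)"
proof -
  note [measurable] = path_event_sets[OF Q]
  have "(\<lambda>n. \<integral>\<omega>. \<bar>indicator (grid_event Q n) \<omega> - indicator (path_event Q) \<omega>\<bar> \<partial>M) \<longlonglongrightarrow> (\<integral>\<omega>. (0::real) \<partial>M)"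
  proof (rule integral_dominated_convergence[where w="\<lambda>_. 1"])
    show "AE \<omega> in M. (\<lambda>n. \<bar>indicator (grid_event Q n) \<omega> - indicator (path_event Q) \<omega>\<bar>) \<longlonglongrightarrow> (0::real)"
      using grid_event_tendsto[OF Q]
    proof eventually_elim
      case (elim \<omega>)
      show ?case by (rule tendsto_eventually, rule eventually_mono[OF elim]) (simp add: indicator_def)
    qed
    show "AE \<omega> in M. norm \<bar>indicator (grid_event Q n) \<omega> - indicator (path_event Q) \<omega> :: real\<bar> \<le> 1" for n
      by (rule AE_I2) (simp add: indicator_def)
  qed simp_all
  then show ?thesis by simp
qed

definition error_at :: "nat \<Rightarrow> nat \<Rightarrow> 'a \<Rightarrow> real" where
  "error_at n j \<omega> = real n * (average T (stock S0 r \<sigma> W) (grid_point T n j) \<omega>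
     - trapezoidal_average T r \<sigma> W (stock S0 r \<sigma> W) n (grid_point T n j) \<omega>)"

lemma error_at_measurable:
  assumes j: "j \<le> n"
  shows "error_at n j \<in> borel_measurable M"
proof (cases "n = 0")
  case True
  then show ?thesis by (simp add: error_at_def[abs_def])
next
  case False
  define S where "S = stock S0 r \<sigma> W"
  have p: "grid_point T n i \<in> {0..T}" if "i \<le> n" for i by (rule grid_point_mem[OF W.T_pos that])
  have av: "average T S (grid_point T n j) \<omega> = 1 / T * integral {0..grid_point T n j} (\<lambda>u. S u \<omega>)" if \<omega>: "\<omega> \<in> space M" for \<omega>
  proof -
    have "continuous_on {0..grid_point T n j} (\<lambda>u. S u \<omega>)"
      unfolding S_def by (rule continuous_on_subset[OF W.stock_cont[OF \<omega>]]) (use p[OF j] in auto)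
    then have "(LBINT u:{0..grid_point T n j}. S u \<omega>) = integral {0..grid_point T n j} (\<lambda>u. S u \<omega>)"
      by (intro set_borel_integral_eq_integral borel_integrable_atLeastAtMost')
    then show ?thesis by (simp add: average_def)
  qed
  have [measurable]: "(\<lambda>\<omega>. integral {0..grid_point T n j} (\<lambda>u. S u \<omega>)) \<in> borel_measurable M"
  proof (rule integral_measurable)
    show "continuous_on {0..grid_point T n j} (\<lambda>u. S u \<omega>)" if "\<omega> \<in> space M" for \<omega>
      unfolding S_def by (rule continuous_on_subset[OF W.stock_cont[OF that]]) (use p[OF j] in auto)
    show "S u \<in> borel_measurable M" if "u \<in> {0..grid_point T n j}" for u
      unfolding S_def by (rule W.stock_M) (use that p[OF j] in auto)
  qed (use p[OF j] in simp)
  have "(\<lambda>\<omega>. average T S (grid_point T n j) \<omega>) \<in> borel_measurable M"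
    by (subst measurable_cong[OF av]) measurable
  moreover have "(\<lambda>\<omega>. trapezoidal_average T r \<sigma> W S n (grid_point T n j) \<omega>) \<in> borel_measurable M"
    unfolding trapezoidal_average_def Let_def
  proof (intro borel_measurable_times borel_measurable_const borel_measurable_sum)
    have idx: "nat \<lfloor>grid_point T n j / (T / real n)\<rfloor> = j"
      using grid_index_grid_point[OF W.T_pos, of n j] False by (simp add: grid_index_def)
    fix k assume "k \<in> {1..nat \<lfloor>grid_point T n j / (T / real n)\<rfloor>}"
    then have k: "k \<le> n" "k - 1 \<le> n" using j unfolding idx by auto
    have [measurable]: "W (real k * (T / real n)) \<in> borel_measurable M" "W (real (k - 1) * (T / real n)) \<in> borel_measurable M"
      using W.grid_B_M[OF k(1)] W.grid_B_M[OF k(2)] unfolding grid_point_def .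
    show "S (real (k - 1) * (T / real n)) \<in> borel_measurable M"
      unfolding S_def stock_def by measurable
    show "(\<lambda>\<omega>. 1 + r * (T / real n) / 2 + \<sigma> * ((W (real k * (T / real n)) \<omega> - W (real (k - 1) * (T / real n)) \<omega>) / 2)) \<in> borel_measurable M"
      by measurable
  qed
  ultimately show ?thesis unfolding error_at_def S_def[symmetric] by measurable
qed

lemma main_sum_measurable:
  assumes "j \<le> n"
  shows "main_sum K n j \<in> borel_measurable M"
  unfolding main_sum_def
proof (intro borel_measurable_sum)
  fix k assume "k \<in> {..<j}"
  then have k: "k < n" using assms by simp
  have [measurable]: "stock S0 r \<sigma> W (grid_point T n k) \<in> borel_measurable M" "W.grid_bridge n k \<in> borel_measurable M"
    using grid_point_mem[OF W.T_pos, of k n] k by (auto intro!: W.stock_M W.grid_bridge_M)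
  show "(\<lambda>\<omega>. clamp_abs K (stock S0 r \<sigma> W (grid_point T n k) \<omega>) * (\<sigma> * W.grid_bridge n k \<omega>)) \<in> borel_measurable M" by measurable
qed

lemma ito_sum_measurable:
  assumes "j \<le> n"
  shows "ito_sum K n j \<in> borel_measurable N"
  unfolding ito_sum_def
proof (intro borel_measurable_times borel_measurable_const borel_measurable_sum)
  fix k assume "k \<in> {..<j}"
  then have k: "k < n" using assms by simp
  have [measurable]: "stock S0 r \<sigma> W (grid_point T n k) \<in> borel_measurable M"
    using grid_point_mem[OF W.T_pos, of k n] k by (auto intro!: W.stock_M)
  note [measurable] = pi_measurable
  show "(\<lambda>\<omega>. clamp_abs K (stock S0 r \<sigma> W (grid_point T n k) (\<pi> \<omega>))) \<in> borel_measurable N" by measurable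
  show "Y.grid_increment n k \<in> borel_measurable N" by (rule Y.grid_increment_M[OF k])
qed

lemma main_sum_transfer:
  fixes g :: "(real \<Rightarrow> real) \<Rightarrow> real"
  assumes n: "0 < n" and Q: "finite Q" "Q \<subseteq> {0..T} \<times> UNIV"
    and g: "g \<in> borel_measurable (borel_of_topology (skorokhod_topology T))"
  shows "(\<integral>\<omega>. indicator (grid_event Q n) \<omega> * g (step_path T n (\<lambda>j. main_sum K n j \<omega>)) \<partial>M)
    = (\<integral>\<omega>. indicator (grid_event Q n) (\<pi> \<omega>) * g (step_path T n (\<lambda>j. ito_sum K n j \<omega>)) \<partial>N)"
proof -
  define \<phi> where "\<phi> z = indicator (vec_event Q n) z * g (step_path T n (vec_sum S0 r \<sigma> T n K z))" for z
  have step: "step_path T n x = step_path T n y" if "\<And>j. j \<le> n \<Longrightarrow> x j = y j" for x y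
    unfolding step_path_def using that grid_index_le[OF W.T_pos] by (intro restrict_ext) blast
  have idx: "grid_index T n s \<le> n" if "(s, x) \<in> Q" for s x using that Q by (intro grid_index_le W.T_pos) auto
  have "(\<lambda>z. step_path T n (\<lambda>j. vec_sum S0 r \<sigma> T n K z j)) \<in> measurable (\<Pi>\<^sub>M i\<in>grid_labels n. borel) (borel_of_topology (skorokhod_topology T))"
    by (rule step_path_measurable[OF W.T_pos vec_sum_measurable])
  from measurable_compose[OF this g] path_event_sets(3)[OF Q]
  have \<phi>: "\<phi> \<in> borel_measurable (\<Pi>\<^sub>M i\<in>grid_labels n. borel)" unfolding \<phi>_def by measurable
  have W0: "AE \<omega> in M. W 0 \<omega> = 0" by (rule W.B_0)
  have "(\<integral>\<omega>. indicator (grid_event Q n) \<omega> * g (step_path T n (\<lambda>j. main_sum K n j \<omega>)) \<partial>M) = (\<integral>\<omega>. \<phi> (vec_M n \<omega>) \<partial>M)"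
  proof (rule integral_cong_AE)
    note [measurable] = path_event_sets(2)[OF Q] measurable_compose[OF step_path_measurable[where n=n, OF W.T_pos main_sum_measurable] g]
    show "(\<lambda>\<omega>. indicator (grid_event Q n) \<omega> * g (step_path T n (\<lambda>j. main_sum K n j \<omega>))) \<in> borel_measurable M" by measurable
    show "(\<lambda>\<omega>. \<phi> (vec_M n \<omega>)) \<in> borel_measurable M" by (rule measurable_compose[OF vec_M_measurable \<phi>])
    show "AE \<omega> in M. indicator (grid_event Q n) \<omega> * g (step_path T n (\<lambda>j. main_sum K n j \<omega>)) = \<phi> (vec_M n \<omega>)"
      using W0 AE_space
    proof eventually_elim
      case (elim \<omega>)
      have "vec_M n \<omega> \<in> space (\<Pi>\<^sub>M i\<in>grid_labels n. borel)" using measurable_space[OF vec_M_measurable elim(2)] .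
      then have "vec_M n \<omega> \<in> vec_event Q n \<longleftrightarrow> \<omega> \<in> grid_event Q n"
        using elim vec_path_M[OF elim(1) idx] unfolding vec_event_def grid_event_def by auto
      moreover have "step_path T n (vec_sum S0 r \<sigma> T n K (vec_M n \<omega>)) = step_path T n (\<lambda>j. main_sum K n j \<omega>)"
        by (rule step) (rule vec_sum_M[OF elim(1)])
      ultimately show ?case by (simp add: \<phi>_def indicator_def)
    qed
  qed
  also have "\<dots> = (\<integral>\<omega>. \<phi> (vec_N n \<omega>) \<partial>N)" by (rule vec_law_eq[OF n \<phi>])
  also have "\<dots> = (\<integral>\<omega>. indicator (grid_event Q n) (\<pi> \<omega>) * g (step_path T n (\<lambda>j. ito_sum K n j \<omega>)) \<partial>N)"
  proof (rule integral_cong_AE)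
    note [measurable] = path_event_sets(2)[OF Q] measurable_compose[OF step_path_measurable[where n=n, OF W.T_pos ito_sum_measurable] g] pi_measurable
    show "(\<lambda>\<omega>. indicator (grid_event Q n) (\<pi> \<omega>) * g (step_path T n (\<lambda>j. ito_sum K n j \<omega>))) \<in> borel_measurable N" by measurable
    show "(\<lambda>\<omega>. \<phi> (vec_N n \<omega>)) \<in> borel_measurable N" by (rule measurable_compose[OF vec_N_measurable \<phi>])
    show "AE \<omega> in N. \<phi> (vec_N n \<omega>) = indicator (grid_event Q n) (\<pi> \<omega>) * g (step_path T n (\<lambda>j. ito_sum K n j \<omega>))"
      using AE_pi[OF W0] AE_space
    proof eventually_elim
      case (elim \<omega>)
      have "vec_N n \<omega> \<in> space (\<Pi>\<^sub>M i\<in>grid_labels n. borel)" using measurable_space[OF vec_N_measurable elim(2)] .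
      then have "vec_N n \<omega> \<in> vec_event Q n \<longleftrightarrow> \<pi> \<omega> \<in> grid_event Q n"
        using elim vec_path_N[OF elim(1) idx] measurable_space[OF pi_measurable elim(2)]
        unfolding vec_event_def grid_event_def by auto
      moreover have "step_path T n (vec_sum S0 r \<sigma> T n K (vec_N n \<omega>)) = step_path T n (\<lambda>j. ito_sum K n j \<omega>)"
        by (rule step) (rule vec_sum_N[OF elim(1)])
      ultimately show ?case by (simp add: \<phi>_def indicator_def)
    qed
  qed
  finally show ?thesis .
qed

definition limit_path :: "'b \<Rightarrow> real \<Rightarrow> real" where
  "limit_path \<omega> = (\<lambda>t\<in>{0..T}. \<sigma> / (2 * sqrt 3) * I t \<omega>)"

lemma limit_path_cont: "\<omega> \<in> space N \<Longrightarrow> continuous_on {0..T} (\<lambda>t. \<sigma> / (2 * sqrt 3) * I t \<omega>)"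
  by (intro continuous_intros ito_facts)

lemma limit_path_measurable: "limit_path \<in> measurable N (borel_of_topology (skorokhod_topology T))"
  unfolding limit_path_def
  by (rule continuous_path_measurable[OF W.T_pos _ limit_path_cont]) (intro borel_measurable_times borel_measurable_const ito_facts)

lemma lipschitz_path_event:
  fixes g :: "(real \<Rightarrow> real) \<Rightarrow> real"
  assumes Q: "finite Q" "Q \<subseteq> {0..T} \<times> UNIV"
    and C: "\<And>x. x \<in> cadlag_paths T \<Longrightarrow> \<bar>g x\<bar> \<le> C"
    and lip: "\<And>x y. x \<in> cadlag_paths T \<Longrightarrow> y \<in> cadlag_paths T \<Longrightarrow> \<bar>g x - g y\<bar> \<le> L * skorokhod_dist T x y"
  shows "(\<lambda>n. \<integral>\<omega>. indicator (path_event Q) \<omega> * g (step_path T n (\<lambda>j. error_at n j \<omega>)) \<partial>M)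
    \<longlonglongrightarrow> (\<integral>\<omega>. indicator (path_event Q) (\<pi> \<omega>) * g (limit_path \<omega>) \<partial>N)"
proof -
  note T = W.T_pos
  have gm: "g \<in> borel_measurable (borel_of_topology (skorokhod_topology T))"
    by (rule measurable_lipschitz_skorokhod[OF T lip])
  interpret D: Metric_space "cadlag_paths T" "skorokhod_dist T" using T by (intro Metric_space_skorokhod) simp
  define L' where "L' = \<bar>L\<bar> + 1"
  have L': "0 < L'" by (simp add: L'_def)
  have lip': "\<bar>g x - g y\<bar> \<le> L' * skorokhod_dist T x y" if "x \<in> cadlag_paths T" "y \<in> cadlag_paths T" for x y
    by (rule order_trans[OF lip[OF that]]) (auto simp: L'_def intro!: mult_right_mono)
  have C0: "0 \<le> C" using C[OF step_path_cadlag[OF T, of 0 "\<lambda>_. 0"]] by simp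
  define A where "A n = (\<integral>\<omega>. indicator (path_event Q) \<omega> * g (step_path T n (\<lambda>j. error_at n j \<omega>)) \<partial>M)" for n
  define A1 where "A1 n = (\<integral>\<omega>. indicator (grid_event Q n) \<omega> * g (step_path T n (\<lambda>j. error_at n j \<omega>)) \<partial>M)" for n
  define A2 where "A2 K n = (\<integral>\<omega>. indicator (grid_event Q n) \<omega> * g (step_path T n (\<lambda>j. main_sum K n j \<omega>)) \<partial>M)" for K n
  define A4 where "A4 n = (\<integral>\<omega>. indicator (grid_event Q n) (\<pi> \<omega>) * g (step_path T n (\<lambda>j. \<sigma> / (2 * sqrt 3) * I (grid_point T n j) \<omega>)) \<partial>N)" for n
  define A5 where "A5 n = (\<integral>\<omega>. indicator (grid_event Q n) (\<pi> \<omega>) * g (limit_path \<omega>) \<partial>N)" for n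
  define A6 where "A6 = (\<integral>\<omega>. indicator (path_event Q) (\<pi> \<omega>) * g (limit_path \<omega>) \<partial>N)"
  define \<delta> :: "nat \<Rightarrow> real" where "\<delta> n = (\<integral>\<omega>. \<bar>indicator (grid_event Q n) \<omega> - indicator (path_event Q) \<omega>\<bar> \<partial>M)" for n
  have \<delta>: "(\<lambda>n. C * \<delta> n) \<longlonglongrightarrow> C * 0" unfolding \<delta>_def by (intro tendsto_intros grid_event_L1 Q)
  note [measurable] = path_event_sets[OF Q] pi_measurable
  have cIm: "(\<lambda>\<omega>. \<sigma> / (2 * sqrt 3) * I (grid_point T n j) \<omega>) \<in> borel_measurable N" if "j \<le> n" for n j
    by (intro borel_measurable_times borel_measurable_const ito_facts grid_point_mem T that)
  note [measurable] = measurable_compose[OF step_path_measurable[where x="error_at n" and n=n for n, OF T error_at_measurable] gm]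
    measurable_compose[OF step_path_measurable[where x="\<lambda>j \<omega>. \<sigma> / (2 * sqrt 3) * I (grid_point T n j) \<omega>" and n=n for n, OF T cIm] gm]
    measurable_compose[OF limit_path_measurable gm]
  have cadY: "limit_path \<omega> \<in> cadlag_paths T" if "\<omega> \<in> space N" for \<omega>
    unfolding limit_path_def by (rule continuous_cadlag[OF limit_path_cont[OF that]])
  have s1: "\<bar>A n - A1 n\<bar> \<le> C * \<delta> n" for n
    unfolding A_def A1_def \<delta>_def
    by (subst abs_minus_commute, rule W.weighted_expectation_diff_le) (use C[OF step_path_cadlag[OF T]] in \<open>simp_all add: indicator_def\<close>)
  have s6: "\<bar>A5 n - A6\<bar> \<le> C * \<delta> n" for n
  proof -
    have "\<bar>A5 n - A6\<bar> \<le> C * (\<integral>\<omega>. \<bar>indicator (grid_event Q n) (\<pi> \<omega>) - indicator (path_event Q) (\<pi> \<omega>)\<bar> \<partial>N)"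
      unfolding A5_def A6_def
      by (rule Y.weighted_expectation_diff_le) (use C cadY in \<open>simp_all add: indicator_def\<close>)
    also have "(\<integral>\<omega>. \<bar>indicator (grid_event Q n) (\<pi> \<omega>) - indicator (path_event Q) (\<pi> \<omega>)\<bar> \<partial>N) = \<delta> n"
      unfolding \<delta>_def by (rule integral_pi) measurable
    finally show ?thesis .
  qed
  have s5: "(\<lambda>n. \<bar>A4 n - A5 n\<bar>) \<longlonglongrightarrow> 0"
  proof -
    define w where "w n \<omega> = \<bar>g (step_path T n (\<lambda>j. \<sigma> / (2 * sqrt 3) * I (grid_point T n j) \<omega>)) - g (limit_path \<omega>)\<bar>" for n \<omega>
    have wm[measurable]: "w n \<in> borel_measurable N" for n unfolding w_def by measurable
    have wb: "w n \<omega> \<le> 2 * C" if "\<omega> \<in> space N" for n \<omega>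
      using C[OF step_path_cadlag[OF T], of n "\<lambda>j. \<sigma> / (2 * sqrt 3) * I (grid_point T n j) \<omega>"] C[OF cadY[OF that]]
      unfolding w_def by linarith
    have "(\<lambda>n. \<integral>\<omega>. w n \<omega> \<partial>N) \<longlonglongrightarrow> (\<integral>\<omega>. 0 \<partial>N)"
    proof (rule integral_dominated_convergence[where w="\<lambda>_. 2 * C"])
      show "AE \<omega> in N. (\<lambda>n. w n \<omega>) \<longlonglongrightarrow> 0"
      proof (rule AE_I2)
        fix \<omega> assume \<omega>: "\<omega> \<in> space N"
        show "(\<lambda>n. w n \<omega>) \<longlonglongrightarrow> 0"
        proof (rule LIMSEQ_I)
          fix e :: real assume e: "0 < e"
          have "\<forall>\<^sub>F n in sequentially. \<forall>t\<in>{0..T}. \<bar>\<sigma> / (2 * sqrt 3) * I t \<omega> - \<sigma> / (2 * sqrt 3) * I (grid_point T n (grid_index T n t)) \<omega>\<bar> < e / (2 * L')"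
            by (rule uniform_grid_approx[OF T limit_path_cont[OF \<omega>]]) (use e L' in simp)
          then have "\<forall>\<^sub>F n in sequentially. norm (w n \<omega> - 0) < e"
          proof eventually_elim
            case (elim n)
            have "w n \<omega> \<le> L' * skorokhod_dist T (step_path T n (\<lambda>j. \<sigma> / (2 * sqrt 3) * I (grid_point T n j) \<omega>)) (limit_path \<omega>)"
              unfolding w_def by (rule lip'[OF step_path_cadlag[OF T] cadY[OF \<omega>]])
            also have "\<dots> \<le> L' * (e / (2 * L'))"
            proof (intro mult_left_mono skorokhod_dist_le_sup step_path_cadlag[OF T] cadY[OF \<omega>])
              fix t assume t: "t \<in> {0..T}"
              show "\<bar>step_path T n (\<lambda>j. \<sigma> / (2 * sqrt 3) * I (grid_point T n j) \<omega>) t - limit_path \<omega> t\<bar> \<le> e / (2 * L')"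
                using bspec[OF elim t] t by (simp add: step_path_def limit_path_def abs_minus_commute)
            qed (use T L' e in auto)
            also have "\<dots> < e" using L' e by simp
            finally show ?case by (simp add: w_def)
          qed
          then show "\<exists>n0. \<forall>n\<ge>n0. norm (w n \<omega> - 0) < e" by (simp add: eventually_sequentially)
        qed
      qed
      show "AE \<omega> in N. norm (w n \<omega>) \<le> 2 * C" for n by (rule AE_I2) (use wb in \<open>simp add: w_def\<close>)
    qed auto
    then have lim: "(\<lambda>n. \<integral>\<omega>. w n \<omega> \<partial>N) \<longlonglongrightarrow> 0" by simp
    have "\<bar>A4 n - A5 n\<bar> \<le> (\<integral>\<omega>. w n \<omega> \<partial>N)" for n
    proof -
      let ?x = "\<lambda>\<omega>. indicator (grid_event Q n) (\<pi> \<omega>) * g (step_path T n (\<lambda>j. \<sigma> / (2 * sqrt 3) * I (grid_point T n j) \<omega>))"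
      let ?y = "\<lambda>\<omega>. indicator (grid_event Q n) (\<pi> \<omega>) * g (limit_path \<omega>)"
      have i: "integrable N ?x"
      proof (rule Y.integrable_const_bound[where B=C])
        show "AE \<omega> in N. norm (?x \<omega>) \<le> C"
          by (rule AE_I2) (simp add: indicator_def C[OF step_path_cadlag[OF T]] C0)
      qed measurable
      have i': "integrable N ?y"
      proof (rule Y.integrable_const_bound[where B=C])
        show "AE \<omega> in N. norm (?y \<omega>) \<le> C"
          by (rule AE_I2) (simp add: indicator_def C[OF cadY] C0)
      qed measurable
      have "\<bar>A4 n - A5 n\<bar> = \<bar>\<integral>\<omega>. ?x \<omega> - ?y \<omega> \<partial>N\<bar>" unfolding A4_def A5_def using i i' by simp
      also have "\<dots> \<le> (\<integral>\<omega>. \<bar>?x \<omega> - ?y \<omega>\<bar> \<partial>N)" by (rule integral_abs_bound)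
      also have "\<dots> \<le> (\<integral>\<omega>. w n \<omega> \<partial>N)"
      proof (rule integral_mono)
        show "integrable N (w n)"
          by (rule Y.integrable_const_bound[where B="2 * C", OF AE_I2 wm]) (use wb in \<open>simp add: w_def\<close>)
        show "\<bar>?x \<omega> - ?y \<omega>\<bar> \<le> w n \<omega>" for \<omega> by (simp add: w_def indicator_def)
        show "integrable N (\<lambda>\<omega>. \<bar>?x \<omega> - ?y \<omega>\<bar>)" using i i' by simp
      qed
      finally show ?thesis .
    qed
    then show ?thesis by (intro tendsto_sandwich[OF _ _ tendsto_const lim]) auto
  qed
  have "\<forall>\<^sub>F n in sequentially. norm (A n - A6) < e" if e: "0 < e" for e
  proof -
    define \<epsilon> where "\<epsilon> = e / (8 * L')"
    define \<eta> where "\<eta> = e / (16 * (C + 1))"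
    have \<epsilon>\<eta>: "0 < \<epsilon>" "0 < \<eta>" using e L' C0 by (auto simp: \<epsilon>_def \<eta>_def)
    have small: "L' * \<epsilon> + 2 * C * \<eta> \<le> e / 4"
    proof -
      have "2 * C * \<eta> \<le> 2 * (C + 1) * \<eta>" using \<epsilon>\<eta> by (intro mult_right_mono) auto
      also have "\<dots> = e / 8" using C0 by (simp add: \<eta>_def field_simps)
      finally show ?thesis using L' by (simp add: \<epsilon>_def)
    qed
    obtain K1 where K1: "0 \<le> K1" "\<And>K. K1 \<le> K \<Longrightarrow> \<forall>\<^sub>F n in sequentially.
        W.prob {\<omega> \<in> space M. \<exists>j\<le>n. \<epsilon> < \<bar>W.grid_error S0 r \<sigma> n j \<omega> - main_sum K n j \<omega>\<bar>} \<le> \<eta>"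
      using W.grid_error_close[OF \<epsilon>\<eta>, of S0 r \<sigma>] unfolding main_sum_def by blast
    obtain K2 where K2: "0 \<le> K2" "\<And>K. K2 \<le> K \<Longrightarrow> \<forall>\<^sub>F n in sequentially.
        Y.prob {\<omega> \<in> space N. \<exists>j\<le>n. \<epsilon> < \<bar>ito_sum K n j \<omega> - \<sigma> / (2 * sqrt 3) * I (grid_point T n j) \<omega>\<bar>} \<le> \<eta>"
      using ito_sum_close[OF \<epsilon>\<eta>] by blast
    define K where "K = max K1 K2"
    have ev1: "\<forall>\<^sub>F n in sequentially. W.prob {\<omega> \<in> space M. \<exists>j\<le>n. \<epsilon> < \<bar>W.grid_error S0 r \<sigma> n j \<omega> - main_sum K n j \<omega>\<bar>} \<le> \<eta>"
      by (rule K1(2)) (simp add: K_def)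
    have ev2: "\<forall>\<^sub>F n in sequentially. Y.prob {\<omega> \<in> space N. \<exists>j\<le>n. \<epsilon> < \<bar>ito_sum K n j \<omega> - \<sigma> / (2 * sqrt 3) * I (grid_point T n j) \<omega>\<bar>} \<le> \<eta>"
      by (rule K2(2)) (simp add: K_def)
    have ev3: "\<forall>\<^sub>F n in sequentially. C * \<delta> n < e / 8" by (rule order_tendstoD(2)[OF \<delta>]) (use e in simp)
    have ev4: "\<forall>\<^sub>F n in sequentially. \<bar>A4 n - A5 n\<bar> < e / 8" by (rule order_tendstoD(2)[OF s5]) (use e in simp)
    show ?thesis using ev1 ev2 ev3 ev4 eventually_gt_at_top[of 0]
    proof eventually_elim
      case (elim n)
      have "\<bar>A1 n - A2 K n\<bar> \<le> L' * \<epsilon> + 2 * C * \<eta>"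
        unfolding A1_def A2_def
      proof (rule step_path_expectation_close[OF T W.prob_space_axioms error_at_measurable main_sum_measurable _ _ C lip'])
        show "W.prob {\<omega> \<in> space M. \<exists>j\<le>n. \<epsilon> < \<bar>error_at n j \<omega> - main_sum K n j \<omega>\<bar>} \<le> \<eta>"
        proof -
          have "{\<omega> \<in> space M. \<exists>j\<le>n. \<epsilon> < \<bar>error_at n j \<omega> - main_sum K n j \<omega>\<bar>} = {\<omega> \<in> space M. \<exists>j\<le>n. \<epsilon> < \<bar>W.grid_error S0 r \<sigma> n j \<omega> - main_sum K n j \<omega>\<bar>}"
            using W.error_at_grid[OF elim(5)] unfolding error_at_def by (intro Collect_cong conj_cong refl ex_cong1) auto
          then show ?thesis using elim by simp
        qed
      qed (use L' \<epsilon>\<eta> in \<open>auto simp: indicator_def\<close>)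
      moreover have "A2 K n = (\<integral>\<omega>. indicator (grid_event Q n) (\<pi> \<omega>) * g (step_path T n (\<lambda>j. ito_sum K n j \<omega>)) \<partial>N)"
        unfolding A2_def by (rule main_sum_transfer[OF elim(5) Q gm])
      moreover have "\<bar>(\<integral>\<omega>. indicator (grid_event Q n) (\<pi> \<omega>) * g (step_path T n (\<lambda>j. ito_sum K n j \<omega>)) \<partial>N) - A4 n\<bar> \<le> L' * \<epsilon> + 2 * C * \<eta>"
        unfolding A4_def
        by (rule step_path_expectation_close[OF T Y.prob_space_axioms ito_sum_measurable cIm _ _ C lip' _ _ elim(2)])
          (use L' \<epsilon>\<eta> in \<open>auto simp: indicator_def\<close>)
      moreover note s1[of n] s6[of n] elim(3,4) small
      ultimately show ?case unfolding real_norm_def using e by linarith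
    qed
  qed
  then have "A \<longlonglongrightarrow> A6" by (intro LIMSEQ_I) (simp add: eventually_sequentially)
  then show ?thesis by (simp add: A_def[abs_def] A6_def)
qed

end

section \<open>From path events to all bounded weights\<close>

lemma sigma_sets_path_events:
  fixes W :: "real \<Rightarrow> 'a \<Rightarrow> real"
  assumes M: "sets M = sets (brownian_filtration M T W T)" and T: "0 < T"
  defines "P \<equiv> {{\<omega> \<in> space M. \<forall>(s, x)\<in>Q. W s \<omega> \<le> x} | Q. finite Q \<and> Q \<subseteq> {0..T} \<times> UNIV}"
  shows "sets M = sigma_sets (space M) (P \<union> null_sets M)" and "Int_stable (P \<union> null_sets M)"
    and "P \<union> null_sets M \<subseteq> Pow (space M)"
proof -
  define gen where "gen = {W s -` A \<inter> space M | s A. 0 \<le> s \<and> s \<le> T \<and> s \<le> T \<and> A \<in> sets borel} \<union> null_sets M"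
  have gen: "sets M = sigma_sets (space M) gen"
  proof -
    have "sets (brownian_filtration M T W T) = sigma_sets (space M) gen"
      unfolding brownian_filtration_def gen_def by (rule sets_measure_of) (auto dest: sets.sets_into_space)
    then show ?thesis using M by simp
  qed
  show sub: "P \<union> null_sets M \<subseteq> Pow (space M)" by (auto simp: P_def dest: sets.sets_into_space)
  have Wm: "W s \<in> borel_measurable M" if "s \<in> {0..T}" for s
  proof (rule measurableI)
    fix A :: "real set" assume "A \<in> sets borel"
    then have "W s -` A \<inter> space M \<in> gen" using that by (auto simp: gen_def)
    then show "W s -` A \<inter> space M \<in> sets M" unfolding gen by (rule sigma_sets.Basic)
  qed simp
  have PM: "P \<subseteq> sets M"
  proof
    fix A assume "A \<in> P"
    then obtain Q where Q: "finite Q" "Q \<subseteq> {0..T} \<times> UNIV" and A: "A = {\<omega> \<in> space M. \<forall>(s, x)\<in>Q. W s \<omega> \<le> x}" by (auto simp: P_def)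
    show "A \<in> sets M" unfolding A
    proof (rule sets.sets_Collect_finite_All[OF _ Q(1)])
      fix q assume "q \<in> Q"
      obtain s x where q: "q = (s, x)" by (cases q)
      then have [measurable]: "W s \<in> borel_measurable M" using \<open>q \<in> Q\<close> Q by (intro Wm) auto
      show "{\<omega> \<in> space M. case q of (s, x) \<Rightarrow> W s \<omega> \<le> x} \<in> sets M" unfolding q prod.case by measurable
    qed
  qed
  show "sets M = sigma_sets (space M) (P \<union> null_sets M)"
  proof
    show "sigma_sets (space M) (P \<union> null_sets M) \<subseteq> sets M"
      by (rule sets.sigma_sets_subset) (use PM in auto)
    define S where "S = sigma (space M) (P \<union> null_sets M)"
    have S: "sets S = sigma_sets (space M) (P \<union> null_sets M)" "space S = space M"
      unfolding S_def using sub by (simp_all add: sets_measure_of space_measure_of)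
    have "gen \<subseteq> sets S"
    proof
      fix A assume "A \<in> gen"
      then consider "A \<in> null_sets M" | s D where "A = W s -` D \<inter> space M" "0 \<le> s" "s \<le> T" "D \<in> sets borel"
        by (auto simp: gen_def)
      then show "A \<in> sets S"
      proof cases
        case 1
        then show ?thesis unfolding S by (intro sigma_sets.Basic) simp
      next
        case 2
        have "W s \<in> borel_measurable S"
        proof (rule borel_measurableI_le)
          fix x
          have "{\<omega> \<in> space S. W s \<omega> \<le> x} = {\<omega> \<in> space M. \<forall>(s, x)\<in>{(s, x)}. W s \<omega> \<le> x}" by (simp add: S)
          also have "\<dots> \<in> P" unfolding P_def using 2 by (intro CollectI exI[of _ "{(s, x)}"]) auto
          finally show "{\<omega> \<in> space S. W s \<omega> \<le> x} \<in> sets S" unfolding S(1) by (intro sigma_sets.Basic) simp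
        qed
        from measurable_sets[OF this 2(4)] show ?thesis by (simp add: 2(1) S(2))
      qed
    qed
    then show "sets M \<subseteq> sigma_sets (space M) (P \<union> null_sets M)"
      unfolding gen S(1)[symmetric] using sets.sigma_sets_subset[of gen S] by (simp add: S(2))
  qed
  show "Int_stable (P \<union> null_sets M)"
  proof (rule Int_stableI)
    fix A A' assume A: "A \<in> P \<union> null_sets M" "A' \<in> P \<union> null_sets M"
    have *: "D \<inter> E \<in> null_sets M" if "D \<in> null_sets M" "E \<in> P \<union> null_sets M" for D E
      using that PM by (intro null_set_Int2) auto
    show "A \<inter> A' \<in> P \<union> null_sets M"
    proof (cases "A \<in> P \<and> A' \<in> P")
      case True
      then obtain Q Q' where "finite Q" "Q \<subseteq> {0..T} \<times> UNIV" "A = {\<omega> \<in> space M. \<forall>(s, x)\<in>Q. W s \<omega> \<le> x}"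
        "finite Q'" "Q' \<subseteq> {0..T} \<times> UNIV" "A' = {\<omega> \<in> space M. \<forall>(s, x)\<in>Q'. W s \<omega> \<le> x}" by (auto simp: P_def)
      then have "A \<inter> A' \<in> P" unfolding P_def by (intro CollectI exI[of _ "Q \<union> Q'"]) auto
      then show ?thesis by simp
    next
      case False
      then show ?thesis using A *[of A A'] *[of A' A] by (auto simp: Int_commute)
    qed
  qed
qed

context stock_limit
begin

definition error_path :: "nat \<Rightarrow> 'a \<Rightarrow> real \<Rightarrow> real" where
  "error_path n \<omega> = step_path T n (\<lambda>j. error_at n j \<omega>)"

lemma error_path_measurable: "error_path n \<in> measurable M (borel_of_topology (skorokhod_topology T))"
  unfolding error_path_def by (rule step_path_measurable[OF W.T_pos error_at_measurable])

lemma error_path_cadlag: "error_path n \<omega> \<in> cadlag_paths T"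
  unfolding error_path_def by (rule step_path_cadlag[OF W.T_pos])

lemma limit_path_cadlag: "\<omega> \<in> space N \<Longrightarrow> limit_path \<omega> \<in> cadlag_paths T"
  unfolding limit_path_def by (rule continuous_cadlag[OF limit_path_cont])

lemma lipschitz_event:
  fixes g :: "(real \<Rightarrow> real) \<Rightarrow> real"
  assumes M: "sets M = sets (brownian_filtration M T W T)" and A: "A \<in> sets M"
    and C: "\<And>x. x \<in> cadlag_paths T \<Longrightarrow> \<bar>g x\<bar> \<le> C"
    and lip: "\<And>x y. x \<in> cadlag_paths T \<Longrightarrow> y \<in> cadlag_paths T \<Longrightarrow> \<bar>g x - g y\<bar> \<le> L * skorokhod_dist T x y"
  shows "(\<lambda>n. \<integral>\<omega>. indicator A \<omega> * g (error_path n \<omega>) \<partial>M) \<longlonglongrightarrow> (\<integral>\<omega>. indicator A (\<pi> \<omega>) * g (limit_path \<omega>) \<partial>N)"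
proof -
  define P where "P = {{\<omega> \<in> space M. \<forall>(s, x)\<in>Q. W s \<omega> \<le> x} | Q. finite Q \<and> Q \<subseteq> {0..T} \<times> UNIV}"
  note sg = sigma_sets_path_events[OF M W.T_pos, folded P_def]
  have gm: "g \<in> borel_measurable (borel_of_topology (skorokhod_topology T))"
    by (rule measurable_lipschitz_skorokhod[OF W.T_pos lip])
  have [measurable]: "(\<lambda>\<omega>. g (error_path n \<omega>)) \<in> borel_measurable M" for n by (rule measurable_compose[OF error_path_measurable gm])
  have [measurable]: "(\<lambda>\<omega>. g (limit_path \<omega>)) \<in> borel_measurable N" by (rule measurable_compose[OF limit_path_measurable gm])
  note [measurable] = pi_measurable
  have iM: "integrable M (\<lambda>\<omega>. g (error_path n \<omega>))" for n
    by (rule W.integrable_const_bound[where B=C]) (use C[OF error_path_cadlag] in auto)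
  have iN: "integrable N (\<lambda>\<omega>. g (limit_path \<omega>))"
    by (rule Y.integrable_const_bound[where B=C, OF AE_I2]) (use C[OF limit_path_cadlag] in auto)
  have iMA: "integrable M (\<lambda>\<omega>. indicator D \<omega> * g (error_path n \<omega>))" if "D \<in> sets M" for D n
    using integrable_mult_indicator[OF that iM[of n]] by simp
  have piD: "\<pi> -` D \<inter> space N \<in> sets N" if "D \<in> sets M" for D by (rule measurable_sets[OF pi_measurable that])
  have iNA: "integrable N (\<lambda>\<omega>. indicator D (\<pi> \<omega>) * g (limit_path \<omega>))" if "D \<in> sets M" for D
  proof -
    have "integrable N (\<lambda>\<omega>. indicator (\<pi> -` D \<inter> space N) \<omega> *\<^sub>R g (limit_path \<omega>))"
      by (rule integrable_mult_indicator[OF piD[OF that] iN])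
    then show ?thesis by (rule Bochner_Integration.integrable_cong[OF refl, THEN iffD1, rotated]) (simp add: indicator_def)
  qed
  have "A \<in> sigma_sets (space M) (P \<union> null_sets M)" using A sg(1) by simp
  from sg(2) sg(3) this show ?thesis
  proof (induction rule: sigma_sets_induct_disjoint)
    case (basic A)
    then show ?case
    proof
      assume "A \<in> P"
      then obtain Q where "finite Q" "Q \<subseteq> {0..T} \<times> UNIV" "A = path_event Q" by (auto simp: P_def path_event_def)
      then show ?thesis using lipschitz_path_event[OF _ _ C lip, of Q] by (simp add: error_path_def)
    next
      assume A0: "A \<in> null_sets M"
      then have [measurable]: "A \<in> sets M" by auto
      have AE: "AE \<omega> in M. \<omega> \<notin> A" by (rule AE_not_in[OF A0])
      have "(\<integral>\<omega>. indicator A \<omega> * g (error_path n \<omega>) \<partial>M) = (\<integral>\<omega>. 0 \<partial>M)" for n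
        by (rule integral_cong_AE) (use AE in \<open>auto elim: eventually_mono\<close>)
      moreover have "(\<integral>\<omega>. indicator A (\<pi> \<omega>) * g (limit_path \<omega>) \<partial>N) = (\<integral>\<omega>. 0 \<partial>N)"
        by (rule integral_cong_AE) (use AE_pi[OF AE] in \<open>auto elim: eventually_mono\<close>)
      ultimately show ?thesis by simp
    qed
  next
    case empty
    then show ?case by simp
  next
    case (compl A)
    then have A: "A \<in> sets M" using sg(1) by simp
    have top: "path_event {} = space M" by (simp add: path_event_def)
    have full: "(\<lambda>n. \<integral>\<omega>. indicator (space M) \<omega> * g (error_path n \<omega>) \<partial>M) \<longlonglongrightarrow> (\<integral>\<omega>. indicator (space M) (\<pi> \<omega>) * g (limit_path \<omega>) \<partial>N)"
      using lipschitz_path_event[OF _ _ C lip, of "{}"] by (simp add: error_path_def top)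
    have split: "indicator (space M - A) x = indicator (space M) x - (indicator A x :: real)" for x
      using sets.sets_into_space[OF A] by (auto simp: indicator_def)
    have "(\<lambda>n. (\<integral>\<omega>. indicator (space M) \<omega> * g (error_path n \<omega>) \<partial>M) - (\<integral>\<omega>. indicator A \<omega> * g (error_path n \<omega>) \<partial>M))
      \<longlonglongrightarrow> (\<integral>\<omega>. indicator (space M) (\<pi> \<omega>) * g (limit_path \<omega>) \<partial>N) - (\<integral>\<omega>. indicator A (\<pi> \<omega>) * g (limit_path \<omega>) \<partial>N)"
      by (intro tendsto_diff full compl)
    then show ?case
      unfolding split left_diff_distrib
      by (subst Bochner_Integration.integral_diff[OF iNA[OF sets.top] iNA[OF A]])
        (simp add: Bochner_Integration.integral_diff[OF iMA[OF sets.top] iMA[OF A]])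
  next
    case (union A)
    then have A: "A i \<in> sets M" for i using sg(1) by auto
    have disj: "A i \<inter> A j = {}" if "i \<noteq> j" for i j using union(1) that by (auto simp: disjoint_family_on_def)
    have sM: "(\<integral>\<omega>. indicator (\<Union>i. A i) \<omega> * g (error_path n \<omega>) \<partial>M) = (\<Sum>i. \<integral>\<omega>. indicator (A i) \<omega> * g (error_path n \<omega>) \<partial>M)" for n
    proof -
      have "set_integrable M (\<Union>i. A i) (\<lambda>\<omega>. g (error_path n \<omega>))"
        unfolding set_integrable_def by (rule integrable_mult_indicator[OF _ iM]) (use A in auto)
      from lebesgue_integral_countable_add[OF A disj this] show ?thesis by (simp add: set_lebesgue_integral_def)
    qed
    have ind: "indicator (\<pi> -` D \<inter> space N) \<omega> = (indicator D (\<pi> \<omega>) :: real)" if "\<omega> \<in> space N" for D \<omega>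
      using that by (simp add: indicator_def)
    have sN: "(\<integral>\<omega>. indicator (\<Union>i. A i) (\<pi> \<omega>) * g (limit_path \<omega>) \<partial>N) = (\<Sum>i. \<integral>\<omega>. indicator (A i) (\<pi> \<omega>) * g (limit_path \<omega>) \<partial>N)"
    proof -
      have U: "(\<Union>i. \<pi> -` A i \<inter> space N) = \<pi> -` (\<Union>i. A i) \<inter> space N" by auto
      have "set_integrable N (\<Union>i. \<pi> -` A i \<inter> space N) (\<lambda>\<omega>. g (limit_path \<omega>))"
        unfolding set_integrable_def
        by (rule integrable_mult_indicator[OF _ iN], rule sets.countable_UN, rule image_subsetI, rule piD[OF A])
      then have "(LINT \<omega>:(\<Union>i. \<pi> -` A i \<inter> space N)|N. g (limit_path \<omega>)) = (\<Sum>i. (LINT \<omega>:(\<pi> -` A i \<inter> space N)|N. g (limit_path \<omega>)))"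
        by (intro lebesgue_integral_countable_add piD A) (use disj in blast)
      then show ?thesis unfolding U set_lebesgue_integral_def by (simp add: ind cong: Bochner_Integration.integral_cong)
    qed
    have "(\<lambda>n. \<Sum>i. \<integral>\<omega>. indicator (A i) \<omega> * g (error_path n \<omega>) \<partial>M) \<longlonglongrightarrow> (\<Sum>i. \<integral>\<omega>. indicator (A i) (\<pi> \<omega>) * g (limit_path \<omega>) \<partial>N)"
    proof (rule tannerys_theorem[THEN conjunct2, THEN conjunct2])
      show "(\<lambda>n. \<integral>\<omega>. indicator (A i) \<omega> * g (error_path n \<omega>) \<partial>M) \<longlonglongrightarrow> (\<integral>\<omega>. indicator (A i) (\<pi> \<omega>) * g (limit_path \<omega>) \<partial>N)" for i
        by (rule union.IH)
      have C0: "0 \<le> C" using C[OF error_path_cadlag, of 0 undefined] by simp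
      have "norm (\<integral>\<omega>. indicator (A k) \<omega> * g (error_path n \<omega>) \<partial>M) \<le> C * W.prob (A k)" for k n
      proof -
        have "norm (\<integral>\<omega>. indicator (A k) \<omega> * g (error_path n \<omega>) \<partial>M) \<le> (\<integral>\<omega>. norm (indicator (A k) \<omega> * g (error_path n \<omega>)) \<partial>M)"
          by (rule integral_norm_bound)
        also have "\<dots> \<le> (\<integral>\<omega>. C * indicator (A k) \<omega> \<partial>M)"
        proof (rule integral_mono)
          show "integrable M (\<lambda>\<omega>. norm (indicator (A k) \<omega> * g (error_path n \<omega>)))" by (rule integrable_norm[OF iMA[OF A]])
          show "integrable M (\<lambda>\<omega>. C * indicator (A k) \<omega>)"
            by (intro integrable_mult_right integrable_real_indicator A) (simp add: W.emeasure_eq_measure)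
          show "norm (indicator (A k) \<omega> * g (error_path n \<omega>)) \<le> C * indicator (A k) \<omega>" for \<omega>
            using C[OF error_path_cadlag, of n \<omega>] by (simp add: indicator_def)
        qed
        also have "\<dots> = C * W.prob (A k)" using A by simp
        finally show ?thesis .
      qed
      then show "\<forall>\<^sub>F (k, n) in at_top \<times>\<^sub>F sequentially. norm (\<integral>\<omega>. indicator (A k) \<omega> * g (error_path n \<omega>) \<partial>M) \<le> C * W.prob (A k)"
        by (intro always_eventually) auto
      have "summable (\<lambda>k. W.prob (A k))"
        using W.finite_measure_UNION[of A] A union(1) by (auto simp: sums_iff)
      then show "summable (\<lambda>k. C * W.prob (A k))" by (rule summable_mult)
    qed simp
    then show ?case by (simp only: sM sN)
  qed
qed

lemma bounded_continuous_event:
  fixes h :: "(real \<Rightarrow> real) \<Rightarrow> real"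
  assumes M: "sets M = sets (brownian_filtration M T W T)" and A: "A \<in> sets M"
    and h: "continuous_map (skorokhod_topology T) euclideanreal h" "\<And>x. x \<in> cadlag_paths T \<Longrightarrow> \<bar>h x\<bar> \<le> C"
  shows "(\<lambda>n. \<integral>\<omega>. indicator A \<omega> * h (error_path n \<omega>) \<partial>M) \<longlonglongrightarrow> (\<integral>\<omega>. indicator A (\<pi> \<omega>) * h (limit_path \<omega>) \<partial>N)"
proof -
  interpret D: Metric_space "cadlag_paths T" "skorokhod_dist T" using W.T_pos by (intro Metric_space_skorokhod) simp
  note [measurable] = A pi_measurable
  show ?thesis
  proof (rule D.stable_limit_from_lipschitz[where C=C and u="indicator A" and v="\<lambda>\<omega>. indicator A (\<pi> \<omega>)"
        and X=error_path and Y=limit_path and h=h, unfolded skorokhod_topology_def[symmetric]])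
    show "error_path n \<in> M \<rightarrow>\<^sub>M borel_of_topology (skorokhod_topology T)" for n by (rule error_path_measurable)
    show "limit_path \<in> N \<rightarrow>\<^sub>M borel_of_topology (skorokhod_topology T)" by (rule limit_path_measurable)
    show "integrable M (indicator A :: _ \<Rightarrow> real)" by (rule W.integrable_const_bound[where B=1]) auto
    show "integrable N (\<lambda>\<omega>. indicator A (\<pi> \<omega>) :: real)" by (rule Y.integrable_const_bound[where B=1]) auto
    fix g :: "(real \<Rightarrow> real) \<Rightarrow> real" and C L
    assume "\<And>x. x \<in> cadlag_paths T \<Longrightarrow> \<bar>g x\<bar> \<le> C"
      and "\<And>x y. x \<in> cadlag_paths T \<Longrightarrow> y \<in> cadlag_paths T \<Longrightarrow> \<bar>g x - g y\<bar> \<le> L * skorokhod_dist T x y"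
    then show "(\<lambda>n. \<integral>\<omega>. indicator A \<omega> * g (error_path n \<omega>) \<partial>M) \<longlonglongrightarrow> (\<integral>\<omega>. indicator A (\<pi> \<omega>) * g (limit_path \<omega>) \<partial>N)"
      by (rule lipschitz_event[OF M A])
  qed (use h in auto)
qed

lemma bounded_continuous_weight:
  fixes h :: "(real \<Rightarrow> real) \<Rightarrow> real" and U :: "'a \<Rightarrow> real"
  assumes M: "sets M = sets (brownian_filtration M T W T)"
    and U: "U \<in> borel_measurable M" "\<And>\<omega>. \<omega> \<in> space M \<Longrightarrow> \<bar>U \<omega>\<bar> \<le> K"
    and h: "continuous_map (skorokhod_topology T) euclideanreal h" "\<And>x. x \<in> cadlag_paths T \<Longrightarrow> \<bar>h x\<bar> \<le> C"
  shows "(\<lambda>n. \<integral>\<omega>. U \<omega> * h (error_path n \<omega>) \<partial>M) \<longlonglongrightarrow> (\<integral>\<omega>. U (\<pi> \<omega>) * h (limit_path \<omega>) \<partial>N)"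
proof (rule LIMSEQ_I)
  fix e :: real assume e: "0 < e"
  have C0: "0 \<le> C" using h(2)[OF error_path_cadlag, of 0 undefined] by simp
  define m where "m = nat \<lceil>4 * (C + 1) / e\<rceil> + 1"
  have m: "0 < m" "4 * (C + 1) / e \<le> real m" by (auto simp: m_def) linarith
  have mC: "C / real m < e / 3"
  proof -
    have "4 * (C + 1) \<le> real m * e" using m e by (simp add: pos_divide_le_eq)
    moreover have "3 * C < 4 * (C + 1)" using C0 by simp
    ultimately have "3 * C < real m * e" by (rule less_le_trans[rotated])
    then show ?thesis using m by (simp add: divide_less_eq less_divide_eq mult.commute)
  qed
  define J where "J = {- \<lceil>real m * \<bar>K\<bar>\<rceil> - 1 .. \<lceil>real m * \<bar>K\<bar>\<rceil> + 1}"
  have J: "finite J" by (simp add: J_def)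
  define A where "A j = {\<omega> \<in> space M. \<lfloor>real m * U \<omega>\<rfloor> = j}" for j
  note [measurable] = U(1) pi_measurable
  have A: "A j \<in> sets M" for j unfolding A_def by measurable
  note [measurable] = A
  define V where "V \<omega> = (\<Sum>j\<in>J. of_int j / real m * indicator (A j) \<omega>)" for \<omega>
  have V: "V \<omega> = of_int \<lfloor>real m * U \<omega>\<rfloor> / real m" if \<omega>: "\<omega> \<in> space M" for \<omega>
  proof -
    have "\<bar>real m * U \<omega>\<bar> \<le> real m * \<bar>K\<bar>" using U(2)[OF \<omega>] by (simp add: abs_mult mult_left_mono)
    then have "\<lfloor>real m * U \<omega>\<rfloor> \<in> J" unfolding J_def by (simp add: abs_le_iff) linarith
    have "V \<omega> = (\<Sum>j\<in>{\<lfloor>real m * U \<omega>\<rfloor>}. of_int j / real m)"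
      unfolding V_def by (rule sum.mono_neutral_cong_right) (use J \<open>\<lfloor>real m * U \<omega>\<rfloor> \<in> J\<close> \<omega> in \<open>auto simp: A_def\<close>)
    then show ?thesis by simp
  qed
  have UV: "\<bar>U \<omega> - V \<omega>\<bar> \<le> 1 / real m" if \<omega>: "\<omega> \<in> space M" for \<omega>
  proof -
    have "\<bar>real m * U \<omega> - of_int \<lfloor>real m * U \<omega>\<rfloor>\<bar> \<le> 1" by linarith
    then have "\<bar>real m * U \<omega> - of_int \<lfloor>real m * U \<omega>\<rfloor>\<bar> / real m \<le> 1 / real m" by (rule divide_right_mono) simp
    moreover have "\<bar>U \<omega> - V \<omega>\<bar> = \<bar>real m * U \<omega> - of_int \<lfloor>real m * U \<omega>\<rfloor>\<bar> / real m"
    proof -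
      have "U \<omega> - of_int \<lfloor>real m * U \<omega>\<rfloor> / real m = (real m * U \<omega> - of_int \<lfloor>real m * U \<omega>\<rfloor>) / real m"
        using m(1) by (simp add: diff_divide_distrib)
      then show ?thesis unfolding V[OF \<omega>] by (simp only: abs_divide abs_of_nat)
    qed
    ultimately show ?thesis by simp
  qed
  have hm: "h \<in> borel_measurable (borel_of_topology (skorokhod_topology T))" by (rule continuous_map_measurable_borel_of_topology[OF h(1)])
  have [measurable]: "(\<lambda>\<omega>. h (error_path n \<omega>)) \<in> borel_measurable M" for n by (rule measurable_compose[OF error_path_measurable hm])
  have [measurable]: "(\<lambda>\<omega>. h (limit_path \<omega>)) \<in> borel_measurable N" by (rule measurable_compose[OF limit_path_measurable hm])
  have [measurable]: "V \<in> borel_measurable M" unfolding V_def by measurable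
  have piM: "\<pi> \<omega> \<in> space M" if "\<omega> \<in> space N" for \<omega> using measurable_space[OF pi_measurable that] .
  have bnd: "\<bar>x * y\<bar> \<le> k * C" if "\<bar>x\<bar> \<le> k" "\<bar>y\<bar> \<le> C" for x y k :: real
    unfolding abs_mult using that by (intro mult_mono) auto
  have VK: "\<bar>V \<omega>\<bar> \<le> \<bar>K\<bar> + 1" if "\<omega> \<in> space M" for \<omega>
  proof -
    have "1 / real m \<le> 1" using m by simp
    then show ?thesis using UV[OF that] U(2)[OF that] by linarith
  qed
  have iU: "integrable M (\<lambda>\<omega>. U \<omega> * h (error_path n \<omega>))" "integrable M (\<lambda>\<omega>. V \<omega> * h (error_path n \<omega>))" for n
    by (rule W.integrable_const_bound[where B="K * C", OF AE_I2], use bnd[OF U(2) h(2)[OF error_path_cadlag]] in simp, measurable)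
      (rule W.integrable_const_bound[where B="(\<bar>K\<bar> + 1) * C", OF AE_I2], use bnd[OF VK h(2)[OF error_path_cadlag]] in simp, measurable)
  have iN: "integrable N (\<lambda>\<omega>. U (\<pi> \<omega>) * h (limit_path \<omega>))" "integrable N (\<lambda>\<omega>. V (\<pi> \<omega>) * h (limit_path \<omega>))"
    by (rule Y.integrable_const_bound[where B="K * C", OF AE_I2], use bnd[OF U(2) h(2)[OF limit_path_cadlag]] piM in simp, measurable)
      (rule Y.integrable_const_bound[where B="(\<bar>K\<bar> + 1) * C", OF AE_I2], use bnd[OF VK h(2)[OF limit_path_cadlag]] piM in simp, measurable)
  have dM: "\<bar>(\<integral>\<omega>. U \<omega> * h (error_path n \<omega>) \<partial>M) - (\<integral>\<omega>. V \<omega> * h (error_path n \<omega>) \<partial>M)\<bar> < e / 3" for n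
  proof -
    have "\<bar>(\<integral>\<omega>. U \<omega> * h (error_path n \<omega>) \<partial>M) - (\<integral>\<omega>. V \<omega> * h (error_path n \<omega>) \<partial>M)\<bar> = \<bar>\<integral>\<omega>. U \<omega> * h (error_path n \<omega>) - V \<omega> * h (error_path n \<omega>) \<partial>M\<bar>"
      using iU by simp
    also have "\<dots> \<le> (\<integral>\<omega>. \<bar>U \<omega> * h (error_path n \<omega>) - V \<omega> * h (error_path n \<omega>)\<bar> \<partial>M)" by (rule integral_abs_bound)
    also have "\<dots> \<le> (\<integral>\<omega>. 1 / real m * C \<partial>M)"
    proof (rule integral_mono)
      show "\<bar>U \<omega> * h (error_path n \<omega>) - V \<omega> * h (error_path n \<omega>)\<bar> \<le> 1 / real m * C" if "\<omega> \<in> space M" for \<omega>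
        unfolding left_diff_distrib[symmetric] by (rule bnd[OF UV[OF that] h(2)[OF error_path_cadlag]])
    qed (use iU in auto)
    also have "\<dots> < e / 3" using mC W.prob_space by simp
    finally show ?thesis .
  qed
  have dN: "\<bar>(\<integral>\<omega>. U (\<pi> \<omega>) * h (limit_path \<omega>) \<partial>N) - (\<integral>\<omega>. V (\<pi> \<omega>) * h (limit_path \<omega>) \<partial>N)\<bar> < e / 3"
  proof -
    have "\<bar>(\<integral>\<omega>. U (\<pi> \<omega>) * h (limit_path \<omega>) \<partial>N) - (\<integral>\<omega>. V (\<pi> \<omega>) * h (limit_path \<omega>) \<partial>N)\<bar> = \<bar>\<integral>\<omega>. U (\<pi> \<omega>) * h (limit_path \<omega>) - V (\<pi> \<omega>) * h (limit_path \<omega>) \<partial>N\<bar>"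
      using iN by simp
    also have "\<dots> \<le> (\<integral>\<omega>. \<bar>U (\<pi> \<omega>) * h (limit_path \<omega>) - V (\<pi> \<omega>) * h (limit_path \<omega>)\<bar> \<partial>N)" by (rule integral_abs_bound)
    also have "\<dots> \<le> (\<integral>\<omega>. 1 / real m * C \<partial>N)"
    proof (rule integral_mono)
      show "\<bar>U (\<pi> \<omega>) * h (limit_path \<omega>) - V (\<pi> \<omega>) * h (limit_path \<omega>)\<bar> \<le> 1 / real m * C" if "\<omega> \<in> space N" for \<omega>
        unfolding left_diff_distrib[symmetric] by (rule bnd[OF UV[OF piM[OF that]] h(2)[OF limit_path_cadlag[OF that]]])
    qed (use iN in auto)
    also have "\<dots> < e / 3" using mC Y.prob_space by simp
    finally show ?thesis .
  qed
  have iA: "integrable M (\<lambda>\<omega>. of_int j / real m * (indicator (A j) \<omega> * h (error_path n \<omega>)))" for j n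
    by (intro integrable_mult_right W.integrable_const_bound[where B=C])
      (use h(2)[OF error_path_cadlag] C0 in \<open>auto simp: indicator_def\<close>)
  have iAN: "integrable N (\<lambda>\<omega>. of_int j / real m * (indicator (A j) (\<pi> \<omega>) * h (limit_path \<omega>)))" for j
    by (intro integrable_mult_right Y.integrable_const_bound[where B=C, OF AE_I2])
      (use h(2)[OF limit_path_cadlag] C0 in \<open>auto simp: indicator_def\<close>)
  have "(\<lambda>n. \<Sum>j\<in>J. of_int j / real m * (\<integral>\<omega>. indicator (A j) \<omega> * h (error_path n \<omega>) \<partial>M))
    \<longlonglongrightarrow> (\<Sum>j\<in>J. of_int j / real m * (\<integral>\<omega>. indicator (A j) (\<pi> \<omega>) * h (limit_path \<omega>) \<partial>N))"
    by (intro tendsto_sum tendsto_mult tendsto_const bounded_continuous_event[OF M A h])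
  moreover have "(\<integral>\<omega>. V \<omega> * h (error_path n \<omega>) \<partial>M) = (\<Sum>j\<in>J. of_int j / real m * (\<integral>\<omega>. indicator (A j) \<omega> * h (error_path n \<omega>) \<partial>M))" for n
    unfolding V_def sum_distrib_right mult.assoc using iA by (simp add: Bochner_Integration.integral_sum)
  moreover have "(\<integral>\<omega>. V (\<pi> \<omega>) * h (limit_path \<omega>) \<partial>N) = (\<Sum>j\<in>J. of_int j / real m * (\<integral>\<omega>. indicator (A j) (\<pi> \<omega>) * h (limit_path \<omega>) \<partial>N))"
    unfolding V_def sum_distrib_right mult.assoc using iAN by (simp add: Bochner_Integration.integral_sum)
  ultimately have lim: "(\<lambda>n. \<integral>\<omega>. V \<omega> * h (error_path n \<omega>) \<partial>M) \<longlonglongrightarrow> (\<integral>\<omega>. V (\<pi> \<omega>) * h (limit_path \<omega>) \<partial>N)" by simp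
  have "\<forall>\<^sub>F n in sequentially. \<bar>(\<integral>\<omega>. V \<omega> * h (error_path n \<omega>) \<partial>M) - (\<integral>\<omega>. V (\<pi> \<omega>) * h (limit_path \<omega>) \<partial>N)\<bar> < e / 3"
    using tendstoD[OF lim, of "e / 3"] e by (simp add: dist_real_def)
  then have "\<forall>\<^sub>F n in sequentially. norm ((\<integral>\<omega>. U \<omega> * h (error_path n \<omega>) \<partial>M) - (\<integral>\<omega>. U (\<pi> \<omega>) * h (limit_path \<omega>) \<partial>N)) < e"
  proof eventually_elim
    case (elim n)
    then show ?case unfolding real_norm_def using dM[of n] dN by linarith
  qed
  then show "\<exists>n0. \<forall>n\<ge>n0. norm ((\<integral>\<omega>. U \<omega> * h (error_path n \<omega>) \<partial>M) - (\<integral>\<omega>. U (\<pi> \<omega>) * h (limit_path \<omega>) \<partial>N)) < e"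
    by (simp add: eventually_sequentially)
qed

lemma error_path_converges_stably:
  assumes "sets M = sets (brownian_filtration M T W T)"
  shows "converges_stably M N \<pi> (skorokhod_topology T) error_path limit_path"
  unfolding converges_stably_def
proof (intro conjI allI impI)
  show "error_path n \<in> measurable M (borel_of_topology (skorokhod_topology T))" for n by (rule error_path_measurable)
  show "limit_path \<in> measurable N (borel_of_topology (skorokhod_topology T))" by (rule limit_path_measurable)
  fix h :: "(real \<Rightarrow> real) \<Rightarrow> real" and U :: "'a \<Rightarrow> real"
  assume *: "continuous_map (skorokhod_topology T) euclideanreal h \<and> bounded (h ` topspace (skorokhod_topology T)) \<and>
            U \<in> borel_measurable M \<and> bounded (U ` space M)"
  have T0: "0 \<le> T" using W.T_pos by simp
  obtain C where C: "\<And>x. x \<in> cadlag_paths T \<Longrightarrow> \<bar>h x\<bar> \<le> C" using * T0 by (auto simp: bounded_iff)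
  obtain K where K: "\<And>\<omega>. \<omega> \<in> space M \<Longrightarrow> \<bar>U \<omega>\<bar> \<le> K" using * by (auto simp: bounded_iff)
  show "(\<lambda>n. \<integral>\<omega>. U \<omega> * h (error_path n \<omega>) \<partial>M) \<longlonglongrightarrow> (\<integral>\<omega>. U (\<pi> \<omega>) * h (limit_path \<omega>) \<partial>N)"
    by (rule bounded_continuous_weight[OF assms _ K _ C]) (use * in auto)
qed

end

section \<open>Existence of the limiting process\<close>

lemma continuous_paths_jointly_measurable:
  fixes S :: "real \<Rightarrow> 'a \<Rightarrow> real"
  assumes T: "0 < T" and S: "\<And>t. t \<in> {0..T} \<Longrightarrow> S t \<in> borel_measurable M"
    and cont: "\<And>\<omega>. \<omega> \<in> space M \<Longrightarrow> continuous_on {0..T} (\<lambda>t. S t \<omega>)"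
  shows "(\<lambda>(t, \<omega>). S t \<omega>) \<in> borel_measurable (time_product M T)"
proof (rule borel_measurable_LIMSEQ_real)
  let ?g = "\<lambda>n t. grid_point T n (grid_index T n t)"
  show "(\<lambda>(t, \<omega>). \<Sum>j\<le>n. of_bool (grid_index T n t = j) * S (grid_point T n j) \<omega>) \<in> borel_measurable (time_product M T)" for n
    unfolding split_beta
  proof (intro borel_measurable_sum borel_measurable_times)
    fix j assume "j \<in> {..n}"
    then have *: "S (grid_point T n j) \<in> borel_measurable M" using grid_point_mem[OF T] by (intro S) simp
    show "(\<lambda>p. S (grid_point T n j) (snd p)) \<in> borel_measurable (time_product M T)"
      by (rule measurable_compose[OF measurable_snd *])
    have "(\<lambda>t. of_bool (grid_index T n t = j) :: real) \<in> borel_measurable borel"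
      unfolding grid_index_def by measurable
    then have "(\<lambda>t. of_bool (grid_index T n t = j) :: real) \<in> borel_measurable (restrict_space lborel {0..T})"
      by (intro measurable_restrict_space1) simp
    then show "(\<lambda>p. of_bool (grid_index T n (fst p) = j) :: real) \<in> borel_measurable (time_product M T)"
      by (rule measurable_compose[OF measurable_fst])
  qed
  fix p assume "p \<in> space (time_product M T)"
  then obtain t \<omega> where p: "p = (t, \<omega>)" and t: "t \<in> {0..T}" and \<omega>: "\<omega> \<in> space M"
    by (auto simp: space_pair_measure space_restrict_space)
  have "(\<Sum>j\<le>n. of_bool (grid_index T n t = j) * S (grid_point T n j) \<omega>) = S (?g n t) \<omega>" for n
    using grid_index_le[OF T t, of n] by (simp add: of_bool_def if_distrib[of "\<lambda>x. x * _"] cong: if_cong)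
  moreover have "(\<lambda>n. S (?g n t) \<omega>) \<longlonglongrightarrow> S t \<omega>"
  proof (rule continuous_on_tendsto_compose[OF cont[OF \<omega>]])
    show "(\<lambda>n. ?g n t) \<longlonglongrightarrow> t" using t by (intro grid_point_index_tendsto T) simp
    show "\<forall>\<^sub>F n in sequentially. ?g n t \<in> {0..T}"
      using grid_point_mem[OF T grid_index_le[OF T t]] by simp
  qed (rule t)
  ultimately show "(\<lambda>n. case p of (t, \<omega>) \<Rightarrow> \<Sum>j\<le>n. of_bool (grid_index T n t = j) * S (grid_point T n j) \<omega>)
    \<longlonglongrightarrow> (case p of (t, \<omega>) \<Rightarrow> S t \<omega>)" by (simp add: p)
qed

context brownian
begin

lemma elem_sup_tail:
  assumes el: "elementary I a b \<xi>" and l: "0 < l"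
  shows "{\<omega> \<in> space M. \<exists>t\<in>{0..T}. l < \<bar>elem_int I a b \<xi> t \<omega>\<bar>} \<in> sets M"
    and "emeasure M {\<omega> \<in> space M. \<exists>t\<in>{0..T}. l < \<bar>elem_int I a b \<xi> t \<omega>\<bar>} \<le> ennreal (1 / l\<^sup>2) * sq_norm M T (elem_val I a b \<xi>)"
proof -
  define Z where "Z = elem_int I a b \<xi>"
  define E where "E q = {\<omega> \<in> space M. \<exists>j\<le>2 ^ q. l < \<bar>Z (grid_point T (2 ^ q) j) \<omega>\<bar>}" for q :: nat
  have E: "E q \<in> sets M" for q
  proof -
    have "{\<omega> \<in> space M. \<exists>j\<in>{..2 ^ q}. l < \<bar>Z (grid_point T (2 ^ q) j) \<omega>\<bar>} \<in> sets M"
    proof (rule sets.sets_Collect_finite_Ex[OF _ finite_atMost])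
      fix j :: nat
      have "0 \<le> grid_point T (2 ^ q) j" using grid_point_mono[OF T_pos, of 0 j "2 ^ q"] by simp
      note [measurable] = elem_int_M[OF el this, folded Z_def]
      show "{\<omega> \<in> space M. l < \<bar>Z (grid_point T (2 ^ q) j) \<omega>\<bar>} \<in> sets M" by measurable
    qed
    then show ?thesis unfolding E_def Bex_def atMost_iff .
  qed
  have inc: "incseq E"
  proof (rule incseq_SucI, rule subsetI)
    fix q \<omega> assume "\<omega> \<in> E q"
    then obtain j where j: "\<omega> \<in> space M" "j \<le> 2 ^ q" "l < \<bar>Z (grid_point T (2 ^ q) j) \<omega>\<bar>" by (auto simp: E_def)
    have "grid_point T (2 ^ Suc q) (2 * j) = grid_point T (2 ^ q) j" by (simp add: grid_point_def)
    then show "\<omega> \<in> E (Suc q)" using j unfolding E_def by (intro CollectI conjI exI[of _ "2 * j"]) auto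
  qed
  have eq: "{\<omega> \<in> space M. \<exists>t\<in>{0..T}. l < \<bar>Z t \<omega>\<bar>} = (\<Union>q. E q)"
  proof (intro equalityI subsetI)
    fix \<omega> assume "\<omega> \<in> {\<omega> \<in> space M. \<exists>t\<in>{0..T}. l < \<bar>Z t \<omega>\<bar>}"
    then obtain t where \<omega>: "\<omega> \<in> space M" and t: "t \<in> {0..T}" "l < \<bar>Z t \<omega>\<bar>" by blast
    have "\<forall>\<^sub>F n in sequentially. \<forall>s\<in>{0..T}. \<bar>Z s \<omega> - Z (grid_point T n (grid_index T n s)) \<omega>\<bar> < \<bar>Z t \<omega>\<bar> - l"
      unfolding Z_def by (rule uniform_grid_approx[OF T_pos elem_int_cont[OF el \<omega>]]) (use t in \<open>simp add: Z_def\<close>)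
    then obtain n0 where n0: "\<And>n. n0 \<le> n \<Longrightarrow> \<bar>Z t \<omega> - Z (grid_point T n (grid_index T n t)) \<omega>\<bar> < \<bar>Z t \<omega>\<bar> - l"
      using t(1) unfolding eventually_sequentially by blast
    have "n0 \<le> 2 ^ n0" by (simp add: less_imp_le)
    from n0[OF this] have "l < \<bar>Z (grid_point T (2 ^ n0) (grid_index T (2 ^ n0) t)) \<omega>\<bar>" by linarith
    then have "\<omega> \<in> E n0" unfolding E_def using \<omega> grid_index_le[OF T_pos t(1)]
      by (intro CollectI conjI exI[of _ "grid_index T (2 ^ n0) t"])
    then show "\<omega> \<in> (\<Union>q. E q)" by blast
  next
    fix \<omega> assume "\<omega> \<in> (\<Union>q. E q)"
    then obtain q j where "\<omega> \<in> space M" "j \<le> 2 ^ q" "l < \<bar>Z (grid_point T (2 ^ q) j) \<omega>\<bar>" by (auto simp: E_def)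
    then show "\<omega> \<in> {\<omega> \<in> space M. \<exists>t\<in>{0..T}. l < \<bar>Z t \<omega>\<bar>}" using grid_point_mem[OF T_pos] by blast
  qed
  show "{\<omega> \<in> space M. \<exists>t\<in>{0..T}. l < \<bar>elem_int I a b \<xi> t \<omega>\<bar>} \<in> sets M"
    unfolding Z_def[symmetric] eq by (intro sets.countable_UN) (use E in auto)
  have "emeasure M (\<Union>q. E q) = (SUP q. emeasure M (E q))"
    by (rule SUP_emeasure_incseq[symmetric]) (use E inc in auto)
  also have "\<dots> \<le> ennreal (1 / l\<^sup>2) * sq_norm M T (elem_val I a b \<xi>)"
  proof (rule SUP_least)
    fix q
    have "emeasure M (E q) \<le> emeasure M {\<omega> \<in> space M. \<exists>j\<le>2 ^ q. l \<le> \<bar>elem_int I a b \<xi> (grid_point T (2 ^ q) j) \<omega>\<bar>}"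
    proof (rule emeasure_mono)
      have "{\<omega> \<in> space M. \<exists>j\<in>{..2 ^ q}. l \<le> \<bar>Z (grid_point T (2 ^ q) j) \<omega>\<bar>} \<in> sets M"
      proof (rule sets.sets_Collect_finite_Ex[OF _ finite_atMost])
        fix j :: nat
        have "0 \<le> grid_point T (2 ^ q) j" using grid_point_mono[OF T_pos, of 0 j "2 ^ q"] by simp
        note [measurable] = elem_int_M[OF el this, folded Z_def]
        show "{\<omega> \<in> space M. l \<le> \<bar>Z (grid_point T (2 ^ q) j) \<omega>\<bar>} \<in> sets M" by measurable
      qed
      then show "{\<omega> \<in> space M. \<exists>j\<le>2 ^ q. l \<le> \<bar>elem_int I a b \<xi> (grid_point T (2 ^ q) j) \<omega>\<bar>} \<in> sets M"
        unfolding Bex_def atMost_iff Z_def .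
    qed (auto simp: E_def Z_def intro: less_imp_le)
    also have "\<dots> \<le> ennreal (1 / l\<^sup>2) * sq_norm M T (elem_val I a b \<xi>)"
      by (rule elem_maximal[OF el _ _ _ l]) (auto intro: grid_point_mono T_pos simp: grid_point_n)
    finally show "emeasure M (E q) \<le> ennreal (1 / l\<^sup>2) * sq_norm M T (elem_val I a b \<xi>)" .
  qed
  finally show "emeasure M {\<omega> \<in> space M. \<exists>t\<in>{0..T}. l < \<bar>elem_int I a b \<xi> t \<omega>\<bar>} \<le> ennreal (1 / l\<^sup>2) * sq_norm M T (elem_val I a b \<xi>)"
    unfolding Z_def[symmetric] eq .
qed

text \<open>A subsequence of grid approximations converges so fast that, by Borel-Cantelli, its integrals
  converge uniformly on \<^term>\<open>{0..T}\<close> for almost every path.\<close>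

lemma ito_integral_exists:
  assumes Hm: "(\<lambda>(t, \<omega>). H t \<omega>) \<in> borel_measurable (time_product M T)"
    and HF: "\<And>t. t \<in> {0..T} \<Longrightarrow> H t \<in> borel_measurable (F t)"
    and Hfin: "sq_norm M T H < \<infinity>"
    and Hcont: "\<And>\<omega>. \<omega> \<in> space M \<Longrightarrow> continuous_on {0..T} (\<lambda>t. H t \<omega>)"
  shows "\<exists>I. ito_integral M F T B H I"
proof -
  define cl where "cl K n k \<omega> = clamp_abs K (H (grid_point T n k) \<omega>)" for K n k \<omega>
  define ev where "ev K n = elem_val {..<n} (grid_point T n) (\<lambda>k. grid_point T n (Suc k)) (cl K n)" for K n
  have "\<exists>K n. 0 \<le> K \<and> 0 < n \<and> sq_norm M T (\<lambda>t \<omega>. H t \<omega> - ev K n t \<omega>) < ennreal ((1 / 8) ^ j)" for j :: nat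
  proof -
    have "\<exists>K\<ge>0. \<forall>K'\<ge>K. \<forall>\<^sub>F n in sequentially. sq_norm M T (\<lambda>t \<omega>. H t \<omega> - ev K' n t \<omega>) < ennreal ((1 / 8) ^ j)"
      unfolding ev_def cl_def[abs_def] by (rule clamp_grid_L2[OF Hm HF Hfin Hcont]) simp_all
    then obtain K where K: "0 \<le> K"
      "\<forall>K'\<ge>K. \<forall>\<^sub>F n in sequentially. sq_norm M T (\<lambda>t \<omega>. H t \<omega> - ev K' n t \<omega>) < ennreal ((1 / 8) ^ j)"
      by (elim exE conjE)
    have "\<exists>n. 0 < n \<and> sq_norm M T (\<lambda>t \<omega>. H t \<omega> - ev K n t \<omega>) < ennreal ((1 / 8) ^ j)"
      by (rule eventually_happens'[OF sequentially_bot eventually_conj[OF eventually_gt_at_top[of 0] K(2)[rule_format, OF order_refl]]])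
    then show ?thesis using K(1) by (elim exE) (rule exI, rule exI, rule conjI)
  qed
  then obtain K n where Kn: "\<And>j. 0 \<le> K j" "\<And>j::nat. 0 < n j"
    and close: "\<And>j. sq_norm M T (\<lambda>t \<omega>. H t \<omega> - ev (K j) (n j) t \<omega>) < ennreal ((1 / 8) ^ j)" by metis
  define s where "s j = grid_point T (n j)" for j
  define \<xi> where "\<xi> j = cl (K j) (n j)" for j
  define h where "h j = elem_val {..<n j} (s j) (\<lambda>k. s j (Suc k)) (\<xi> j)" for j
  define Z where "Z j = elem_int {..<n j} (s j) (\<lambda>k. s j (Suc k)) (\<xi> j)" for j
  have \<xi>F: "\<xi> j k \<in> borel_measurable (F (s j k))" if "k < n j" for j k
  proof -
    have "H (s j k) \<in> borel_measurable (F (s j k))"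
      unfolding s_def by (rule HF[OF grid_point_mem[OF T_pos]]) (use that in simp)
    then show ?thesis unfolding \<xi>_def cl_def s_def[symmetric] by measurable
  qed
  have \<xi>B: "bounded (\<xi> j k ` space M)" for j k
    using clamp_abs_le[OF Kn(1)[of j]] by (auto simp: \<xi>_def cl_def bounded_iff)
  have el: "elementary {..<n j} (s j) (\<lambda>k. s j (Suc k)) (\<xi> j)" for j
    unfolding s_def by (rule grid_elementary) (use \<xi>F \<xi>B in \<open>auto simp: s_def\<close>)
  have hm: "(\<lambda>(t, \<omega>). h j t \<omega>) \<in> borel_measurable (time_product M T)" for j
    unfolding h_def by (rule elem_val_measurable[OF el])
  have Hhm: "(\<lambda>(t, \<omega>). H t \<omega> - h j t \<omega>) \<in> borel_measurable (time_product M T)" for j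
    using borel_measurable_diff[OF Hm hm[of j]] by (simp add: split_beta)
  have Hh: "sq_norm M T (\<lambda>t \<omega>. H t \<omega> - h j t \<omega>) < ennreal ((1 / 8) ^ j)" for j
    using close[of j] by (simp add: ev_def h_def s_def \<xi>_def)
  have hh: "sq_norm M T (\<lambda>t \<omega>. h i t \<omega> - h j t \<omega>) \<le> ennreal (4 * (1 / 8) ^ j)" if "j \<le> i" for i j
  proof -
    have "sq_norm M T (\<lambda>t \<omega>. h i t \<omega> - h j t \<omega>) = sq_norm M T (\<lambda>t \<omega>. (H t \<omega> - h j t \<omega>) - (H t \<omega> - h i t \<omega>))" by simp
    also have "\<dots> \<le> 2 * sq_norm M T (\<lambda>t \<omega>. H t \<omega> - h j t \<omega>) + 2 * sq_norm M T (\<lambda>t \<omega>. H t \<omega> - h i t \<omega>)"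
      by (rule sq_norm_diff_le[OF Hhm Hhm])
    also have "\<dots> \<le> 2 * ennreal ((1 / 8) ^ j) + 2 * ennreal ((1 / 8) ^ j)"
    proof (intro add_mono mult_left_mono)
      show "sq_norm M T (\<lambda>t \<omega>. H t \<omega> - h j t \<omega>) \<le> ennreal ((1 / 8) ^ j)" using Hh by (simp add: less_imp_le)
      have "sq_norm M T (\<lambda>t \<omega>. H t \<omega> - h i t \<omega>) \<le> ennreal ((1 / 8) ^ i)" using Hh by (simp add: less_imp_le)
      also have "\<dots> \<le> ennreal ((1 / 8) ^ j)" using that by (intro ennreal_leI power_decreasing) auto
      finally show "sq_norm M T (\<lambda>t \<omega>. H t \<omega> - h i t \<omega>) \<le> ennreal ((1 / 8) ^ j)" .
    qed simp_all
    also have "\<dots> = ennreal (4 * (1 / 8) ^ j)"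
    proof -
      have "2 * ennreal ((1 / 8) ^ j) = ennreal (2 * (1 / 8) ^ j)" by (simp add: ennreal_mult)
      then show ?thesis by (simp add: ennreal_plus[symmetric] del: ennreal_plus)
    qed
    finally show ?thesis .
  qed
  define E where "E j = {\<omega> \<in> space M. \<exists>t\<in>{0..T}. (1 / 2) ^ j < \<bar>Z (Suc j) t \<omega> - Z j t \<omega>\<bar>}" for j
  note ed = elementary_diff[OF el el]
  have ZZ: "{\<omega> \<in> space M. \<exists>t\<in>{0..T}. l < \<bar>Z i t \<omega> - Z j t \<omega>\<bar>} \<in> sets M"
    "emeasure M {\<omega> \<in> space M. \<exists>t\<in>{0..T}. l < \<bar>Z i t \<omega> - Z j t \<omega>\<bar>} \<le> ennreal (1 / l\<^sup>2) * sq_norm M T (\<lambda>t \<omega>. h i t \<omega> - h j t \<omega>)"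
    if "0 < l" for l i j
  proof -
    from elem_sup_tail[OF ed(1)[of i j] that]
    show "{\<omega> \<in> space M. \<exists>t\<in>{0..T}. l < \<bar>Z i t \<omega> - Z j t \<omega>\<bar>} \<in> sets M"
      "emeasure M {\<omega> \<in> space M. \<exists>t\<in>{0..T}. l < \<bar>Z i t \<omega> - Z j t \<omega>\<bar>} \<le> ennreal (1 / l\<^sup>2) * sq_norm M T (\<lambda>t \<omega>. h i t \<omega> - h j t \<omega>)"
      by (simp_all only: ed(2) Z_def ed(3)[abs_def] h_def)
  qed
  have EM: "E j \<in> sets M" for j unfolding E_def by (rule ZZ(1)) simp
  have Eprob: "prob (E j) \<le> 4 * (1 / 2) ^ j" for j
  proof -
    have "emeasure M (E j) \<le> ennreal (1 / ((1 / 2) ^ j)\<^sup>2) * sq_norm M T (\<lambda>t \<omega>. h (Suc j) t \<omega> - h j t \<omega>)"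
      unfolding E_def by (rule ZZ(2)) simp
    also have "\<dots> \<le> ennreal (1 / ((1 / 2) ^ j)\<^sup>2) * ennreal (4 * (1 / 8) ^ j)" by (intro mult_left_mono hh) auto
    also have "\<dots> = ennreal (1 / ((1 / 2) ^ j)\<^sup>2 * (4 * (1 / 8) ^ j))" by (rule ennreal_mult[symmetric]) auto
    also have "1 / ((1 / 2) ^ j)\<^sup>2 * (4 * (1 / 8) ^ j) = 4 * (1 / 2 :: real) ^ j"
    proof -
      have "1 / ((1 / 2 :: real) ^ j)\<^sup>2 = 4 ^ j" by (simp add: power_divide power2_eq_square flip: power_mult_distrib)
      moreover have "4 ^ j * (1 / 8 :: real) ^ j = (1 / 2) ^ j" by (simp flip: power_mult_distrib)
      ultimately show ?thesis by (simp add: mult.left_commute)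
    qed
    finally show ?thesis by (simp add: emeasure_eq_measure)
  qed
  define Good where "Good = {\<omega> \<in> space M. \<forall>\<^sub>F j in sequentially. \<omega> \<in> space M - E j}"
  have GM: "Good \<in> sets M"
  proof -
    note [measurable] = EM
    show ?thesis unfolding Good_def eventually_sequentially by measurable
  qed
  have AEG: "AE \<omega> in M. \<omega> \<in> Good"
  proof -
    have "summable (\<lambda>j. prob (E j))"
    proof (rule summable_comparison_test)
      show "\<exists>N. \<forall>j\<ge>N. norm (prob (E j)) \<le> 4 * (1 / 2) ^ j" using Eprob by simp
      show "summable (\<lambda>j. 4 * (1 / 2 :: real) ^ j)" by (intro summable_mult summable_geometric) simp
    qed
    then have "AE \<omega> in M. \<forall>\<^sub>F j in sequentially. \<omega> \<in> space M - E j"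
      by (intro borel_cantelli_AE1 EM) (auto simp: emeasure_eq_measure)
    then show ?thesis using AE_space by eventually_elim (simp add: Good_def)
  qed
  define I where "I t \<omega> = (if \<omega> \<in> Good then lim (\<lambda>j. Z j t \<omega>) else 0)" for t \<omega>
  have Zcont: "continuous_on {0..T} (\<lambda>t. Z j t \<omega>)" if "\<omega> \<in> space M" for j \<omega>
    unfolding Z_def by (rule elem_int_cont[OF el that])
  have ul: "uniform_limit {0..T} (\<lambda>j t. Z j t \<omega>) (\<lambda>t. I t \<omega>) sequentially" if \<omega>: "\<omega> \<in> Good" for \<omega>
  proof -
    let ?f = "\<lambda>j t. Z (Suc j) t \<omega> - Z j t \<omega>"
    have "\<forall>\<^sub>F j in sequentially. \<forall>t\<in>{0..T}. norm (?f j t) \<le> (1 / 2) ^ j"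
      using \<omega> unfolding Good_def mem_Collect_eq
      by (elim conjE eventually_mono) (auto simp: E_def not_less)
    then have ul0: "uniform_limit {0..T} (\<lambda>j t. \<Sum>i<j. ?f i t) (\<lambda>t. \<Sum>i. ?f i t) sequentially"
      by (rule Weierstrass_m_test_ev) simp
    have tele: "(\<Sum>i<j. ?f i t) + Z 0 t \<omega> = Z j t \<omega>" for j t
      using sum_lessThan_telescope[of "\<lambda>i. Z i t \<omega>" j] by simp
    from uniform_limit_add[OF ul0 uniform_limit_const[where c="\<lambda>t. Z 0 t \<omega>"]]
    have *: "uniform_limit {0..T} (\<lambda>j t. Z j t \<omega>) (\<lambda>t. (\<Sum>i. ?f i t) + Z 0 t \<omega>) sequentially"
      by (simp only: tele)
    have "I t \<omega> = (\<Sum>i. ?f i t) + Z 0 t \<omega>" if "t \<in> {0..T}" for t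
      using limI[OF tendsto_uniform_limitI[OF * that]] \<omega> by (simp add: I_def)
    then show ?thesis by (rule uniform_limit_cong'[THEN iffD2, OF refl _ *])
  qed
  have Zlim: "(\<lambda>j. Z j t \<omega>) \<longlonglongrightarrow> I t \<omega>" if "\<omega> \<in> Good" "t \<in> {0..T}" for t \<omega>
    by (rule tendsto_uniform_limitI[OF ul[OF that(1)] that(2)])
  have ZM: "Z j t \<in> borel_measurable M" if "t \<in> {0..T}" for j t
    unfolding Z_def by (rule elem_int_M[OF el]) (use that in simp)
  have IM: "I t \<in> borel_measurable M" if "t \<in> {0..T}" for t
  proof -
    note [measurable] = ZM[OF that] GM
    show ?thesis unfolding I_def by measurable
  qed
  have Icont: "continuous_on {0..T} (\<lambda>t. I t \<omega>)" if "\<omega> \<in> space M" for \<omega>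
  proof (cases "\<omega> \<in> Good")
    case True
    show ?thesis
      by (rule uniform_limit_theorem[OF always_eventually ul[OF True]]) (use Zcont[OF that] in auto)
  qed (simp add: I_def)
  have ZL2: "(\<integral>\<^sup>+\<omega>. ennreal ((Z i t \<omega> - Z j t \<omega>)\<^sup>2) \<partial>M) \<le> ennreal (4 * (1 / 8) ^ j)" if "j \<le> i" "t \<in> {0..T}" for i j t
  proof -
    have "(\<integral>\<^sup>+\<omega>. ennreal ((Z i t \<omega> - Z j t \<omega>)\<^sup>2) \<partial>M) \<le> sq_norm M T (\<lambda>t \<omega>. h i t \<omega> - h j t \<omega>)"
      using elem_int_L2_le[OF ed(1)[of i j], of t] that(2)
      by (simp only: ed(2) Z_def ed(3)[abs_def] h_def atLeastAtMost_iff)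
    also have "\<dots> \<le> ennreal (4 * (1 / 8) ^ j)" by (rule hh[OF that(1)])
    finally show ?thesis .
  qed
  have IL2: "(\<integral>\<^sup>+\<omega>. ennreal ((I t \<omega> - Z j t \<omega>)\<^sup>2) \<partial>M) \<le> ennreal (4 * (1 / 8) ^ j)" if t: "t \<in> {0..T}" for j t
  proof -
    have "(\<integral>\<^sup>+\<omega>. ennreal ((I t \<omega> - Z j t \<omega>)\<^sup>2) \<partial>M) = (\<integral>\<^sup>+\<omega>. liminf (\<lambda>i. ennreal ((Z i t \<omega> - Z j t \<omega>)\<^sup>2)) \<partial>M)"
    proof (rule nn_integral_cong_AE)
      show "AE \<omega> in M. ennreal ((I t \<omega> - Z j t \<omega>)\<^sup>2) = liminf (\<lambda>i. ennreal ((Z i t \<omega> - Z j t \<omega>)\<^sup>2))"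
        using AEG
      proof eventually_elim
        case (elim \<omega>)
        have "(\<lambda>i. ennreal ((Z i t \<omega> - Z j t \<omega>)\<^sup>2)) \<longlonglongrightarrow> ennreal ((I t \<omega> - Z j t \<omega>)\<^sup>2)"
          by (intro tendsto_ennrealI tendsto_power tendsto_diff tendsto_const Zlim elim t)
        then show ?case by (rule lim_imp_Liminf[OF sequentially_bot, symmetric])
      qed
    qed
    also have "\<dots> \<le> liminf (\<lambda>i. \<integral>\<^sup>+\<omega>. ennreal ((Z i t \<omega> - Z j t \<omega>)\<^sup>2) \<partial>M)"
    proof (rule nn_integral_liminf)
      fix i
      note [measurable] = ZM[OF t]
      show "(\<lambda>\<omega>. ennreal ((Z i t \<omega> - Z j t \<omega>)\<^sup>2)) \<in> borel_measurable M" by measurable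
    qed
    also have "\<dots> \<le> limsup (\<lambda>i. \<integral>\<^sup>+\<omega>. ennreal ((Z i t \<omega> - Z j t \<omega>)\<^sup>2) \<partial>M)"
      by (rule Liminf_le_Limsup) simp
    also have "\<dots> \<le> ennreal (4 * (1 / 8) ^ j)"
      by (rule Limsup_bounded) (use ZL2[OF _ t] in \<open>auto simp: eventually_sequentially\<close>)
    finally show ?thesis .
  qed
  have geo: "(\<lambda>j. ennreal (4 * (1 / 8) ^ j)) \<longlonglongrightarrow> 0"
  proof -
    have "(\<lambda>j. ennreal (4 * (1 / 8) ^ j)) \<longlonglongrightarrow> ennreal (4 * 0)"
      by (intro tendsto_ennrealI tendsto_mult tendsto_const LIMSEQ_power_zero) simp
    then show ?thesis by simp
  qed
  have sp: "simple_process M F T (n j) (s j) (\<xi> j)" for j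
    unfolding simple_process_def using \<xi>F \<xi>B Kn(2)[of j] grid_point_mono[OF T_pos]
    by (simp add: s_def grid_point_n)
  have sv: "simple_value (n j) (s j) (\<xi> j) t \<omega> = h j t \<omega>" for j t \<omega> by (simp only: simple_value_def h_def elem_val_def)
  have si: "simple_integral B (n j) (s j) (\<xi> j) t \<omega> = Z j t \<omega>" for j t \<omega> by (simp only: simple_integral_def Z_def elem_int_def)
  have c1: "(\<lambda>j. sq_norm M T (\<lambda>t \<omega>. H t \<omega> - h j t \<omega>)) \<longlonglongrightarrow> 0"
  proof (rule tendsto_sandwich[OF _ _ tendsto_const geo])
    have "sq_norm M T (\<lambda>t \<omega>. H t \<omega> - h j t \<omega>) \<le> ennreal (4 * (1 / 8) ^ j)" for j
      by (rule order_trans[OF less_imp_le[OF Hh] ennreal_leI]) simp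
    then show "\<forall>\<^sub>F j in sequentially. sq_norm M T (\<lambda>t \<omega>. H t \<omega> - h j t \<omega>) \<le> ennreal (4 * (1 / 8) ^ j)" by simp
  qed simp
  have c2: "(\<lambda>j. \<integral>\<^sup>+\<omega>. ennreal ((I t \<omega> - Z j t \<omega>)\<^sup>2) \<partial>M) \<longlonglongrightarrow> 0" if "t \<in> {0..T}" for t
    by (rule tendsto_sandwich[OF _ _ tendsto_const geo]) (use IL2[OF that] in auto)
  have "ito_integral M F T B H I"
    unfolding ito_integral_def
  proof (intro conjI)
    show "\<exists>k s \<xi>. (\<forall>m. simple_process M F T (k m) (s m) (\<xi> m)) \<and>
        (\<lambda>m. \<integral>\<^sup>+\<omega>. (\<integral>\<^sup>+t\<in>{0..T}. ennreal ((H t \<omega> - simple_value (k m) (s m) (\<xi> m) t \<omega>)\<^sup>2) \<partial>lborel) \<partial>M) \<longlonglongrightarrow> 0 \<and>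
        (\<forall>t\<in>{0..T}. (\<lambda>m. \<integral>\<^sup>+\<omega>. ennreal ((I t \<omega> - simple_integral B (k m) (s m) (\<xi> m) t \<omega>)\<^sup>2) \<partial>M) \<longlonglongrightarrow> 0)"
      by (rule exI[of _ n], rule exI[of _ s], rule exI[of _ \<xi>])
        (use sp c1 c2 in \<open>simp add: sv si sq_norm_def\<close>)
    show "(\<integral>\<^sup>+\<omega>. (\<integral>\<^sup>+t\<in>{0..T}. ennreal ((H t \<omega>)\<^sup>2) \<partial>lborel) \<partial>M) < \<infinity>" using Hfin by (simp only: sq_norm_def)
  qed (use Hm HF IM Icont in auto)
  then show ?thesis by blast
qed

lemma stock_sq_norm_finite: "sq_norm M T (stock S0 r \<sigma> B) < \<infinity>"
proof -
  define c where "c = S0\<^sup>2 * exp (2 * \<bar>r - \<sigma>\<^sup>2 / 2\<bar> * T) * exp ((2 * \<sigma>)\<^sup>2 * T / 2)"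
  have c0: "0 \<le> c" by (simp add: c_def)
  have jm: "(\<lambda>(t, \<omega>). stock S0 r \<sigma> B t \<omega>) \<in> borel_measurable (time_product M T)"
    by (rule continuous_paths_jointly_measurable[OF T_pos stock_M stock_cont]) auto
  interpret L: sigma_finite_measure "restrict_space lborel {0..T::real}"
    by (rule sigma_finite_measure_restrict_space) (auto intro: sigma_finite_lborel)
  interpret P: pair_sigma_finite "restrict_space lborel {0..T::real}" M ..
  have m: "(\<lambda>(t, \<omega>). ennreal ((stock S0 r \<sigma> B t \<omega>)\<^sup>2)) \<in> borel_measurable (time_product M T)"
    using jm by (simp add: split_beta)
  have "sq_norm M T (stock S0 r \<sigma> B) = (\<integral>\<^sup>+\<omega>. (\<integral>\<^sup>+t. ennreal ((stock S0 r \<sigma> B t \<omega>)\<^sup>2) \<partial>restrict_space lborel {0..T}) \<partial>M)"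
    by (simp add: sq_norm_def nn_integral_restrict_space)
  also have "\<dots> = (\<integral>\<^sup>+t. (\<integral>\<^sup>+\<omega>. ennreal ((stock S0 r \<sigma> B t \<omega>)\<^sup>2) \<partial>M) \<partial>restrict_space lborel {0..T})"
    by (rule P.Fubini'[OF m])
  also have "\<dots> \<le> (\<integral>\<^sup>+t. ennreal c \<partial>restrict_space lborel {0..T})"
  proof (rule nn_integral_mono)
    fix t assume "t \<in> space (restrict_space lborel {0..T})"
    then have t: "0 \<le> t" "t \<le> T" by (auto simp: space_restrict_space)
    define D where "D \<omega> = B t \<omega> - B 0 \<omega>" for \<omega>
    have D: "integrable M (\<lambda>\<omega>. exp ((2 * \<sigma>) * D \<omega>))" "expectation (\<lambda>\<omega>. exp ((2 * \<sigma>) * D \<omega>)) = exp ((2 * \<sigma>)\<^sup>2 * t / 2)"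
      using increment_moments(5,6)[of 0 t "2 * \<sigma>"] t by (simp_all add: D_def)
    define a where "a = S0\<^sup>2 * exp (2 * \<bar>r - \<sigma>\<^sup>2 / 2\<bar> * T)"
    have a0: "0 \<le> a" by (simp add: a_def)
    have "(\<integral>\<^sup>+\<omega>. ennreal ((stock S0 r \<sigma> B t \<omega>)\<^sup>2) \<partial>M) \<le> (\<integral>\<^sup>+\<omega>. ennreal (a * exp ((2 * \<sigma>) * D \<omega>)) \<partial>M)"
    proof (rule nn_integral_mono_AE)
      show "AE \<omega> in M. ennreal ((stock S0 r \<sigma> B t \<omega>)\<^sup>2) \<le> ennreal (a * exp ((2 * \<sigma>) * D \<omega>))"
        using B_0
      proof eventually_elim
        case (elim \<omega>)
        have "(stock S0 r \<sigma> B t \<omega>)\<^sup>2 = S0\<^sup>2 * exp (2 * (r - \<sigma>\<^sup>2 / 2) * t) * exp ((2 * \<sigma>) * D \<omega>)"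
          using elim unfolding stock_def D_def power_mult_distrib exp_double[symmetric] mult.assoc exp_add[symmetric]
          by (simp add: distrib_left)
        also have "\<dots> \<le> a * exp ((2 * \<sigma>) * D \<omega>)"
          unfolding a_def
        proof (intro mult_right_mono mult_left_mono)
          have "2 * (r - \<sigma>\<^sup>2 / 2) * t \<le> 2 * \<bar>r - \<sigma>\<^sup>2 / 2\<bar> * T" using t
            by (intro mult_mono mult_left_mono abs_ge_self) simp_all
          then show "exp (2 * (r - \<sigma>\<^sup>2 / 2) * t) \<le> exp (2 * \<bar>r - \<sigma>\<^sup>2 / 2\<bar> * T)" by simp
        qed simp_all
        finally show ?case by (rule ennreal_leI)
      qed
    qed
    also have "\<dots> = ennreal (a * exp ((2 * \<sigma>)\<^sup>2 * t / 2))"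
      using D a0 by (subst nn_integral_eq_integral) auto
    also have "\<dots> \<le> ennreal c"
    proof (rule ennreal_leI)
      have "(2 * \<sigma>)\<^sup>2 * t / 2 \<le> (2 * \<sigma>)\<^sup>2 * T / 2" using t by (intro divide_right_mono mult_left_mono) auto
      then show "a * exp ((2 * \<sigma>)\<^sup>2 * t / 2) \<le> c" unfolding c_def a_def[symmetric] using a0 by (intro mult_left_mono) auto
    qed
    finally show "(\<integral>\<^sup>+\<omega>. ennreal ((stock S0 r \<sigma> B t \<omega>)\<^sup>2) \<partial>M) \<le> ennreal c" .
  qed
  also have "\<dots> = ennreal c * ennreal T" using T_pos by (simp add: emeasure_restrict_space)
  also have "\<dots> < \<infinity>" by (simp add: ennreal_mult_less_top)
  finally show ?thesis .
qed

end

lemma sets_pair_measure_mono: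
  assumes "space A = space A'" "sets A \<subseteq> sets A'" "space C = space C'" "sets C \<subseteq> sets C'"
  shows "sets (A \<Otimes>\<^sub>M C) \<subseteq> sets (A' \<Otimes>\<^sub>M C')"
  unfolding sets_pair_measure assms(1,3) by (intro sigma_sets_subseteq) (use assms in blast)

lemma distr_pair_snd:
  assumes "prob_space M" "prob_space N"
  shows "distr (M \<Otimes>\<^sub>M N) N snd = N"
proof (rule measure_eqI)
  interpret M: prob_space M by fact
  interpret N: prob_space N by fact
  fix A assume "A \<in> sets (distr (M \<Otimes>\<^sub>M N) N snd)"
  then have A: "A \<in> sets N" by simp
  have "snd -` A \<inter> space (M \<Otimes>\<^sub>M N) = space M \<times> A"
    using sets.sets_into_space[OF A] by (auto simp: space_pair_measure)
  then show "emeasure (distr (M \<Otimes>\<^sub>M N) N snd) A = emeasure N A"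
    using A by (simp add: emeasure_distr N.emeasure_pair_measure_Times M.emeasure_space_1)
qed simp

context brownian
begin

lemma product_extension:
  fixes S0 r \<sigma> :: real
  defines "N \<equiv> M \<Otimes>\<^sub>M M" and "G \<equiv> \<lambda>t. F t \<Otimes>\<^sub>M F t" and "B' \<equiv> \<lambda>t \<omega>. B t (snd \<omega>)"
  shows "basis_extension M F N G fst" "brownian_motion N G T B'" "independent_processes N T (\<lambda>t \<omega>. B t (fst \<omega>)) B'"
proof -
  interpret P: pair_prob_space M M ..
  interpret N: prob_space N unfolding N_def by (rule P.prob_space_axioms)
  have fst: "fst \<in> measurable N M" and snd: "snd \<in> measurable N M" by (simp_all add: N_def)
  have dfst: "distr N M fst = M" unfolding N_def by (rule distr_pair_fst)
  have dsnd: "distr N M snd = M" unfolding N_def by (intro distr_pair_snd prob_space_axioms)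
  have spG: "space (G t) = space N" for t by (simp add: G_def N_def space_pair_measure space_F)
  have GN: "sets (G t) \<subseteq> sets N" for t
    unfolding G_def N_def using sets_F by (intro sets_pair_measure_mono) (auto simp: space_F)
  have Gmono: "sets (G s) \<subseteq> sets (G t)" if "s \<le> t" for s t
    unfolding G_def using sets_F_mono[OF that] by (intro sets_pair_measure_mono) (auto simp: space_F)
  have basis: "stochastic_basis N G"
    unfolding stochastic_basis_def subalgebra_def filtration_def
    using spG GN Gmono N.prob_space_axioms by auto
  show "basis_extension M F N G fst"
    unfolding basis_extension_def
  proof (intro conjI allI impI basis fst dfst)
    show "stochastic_basis M F" using bm by (simp add: brownian_motion_def)
    show "fst \<in> measurable (G t) (F t)" for t by (simp add: G_def)
  qed
  show "brownian_motion N G T B'"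
    unfolding brownian_motion_def
  proof (intro conjI allI impI ballI basis)
    show "AE \<omega> in N. B' 0 \<omega> = 0"
      unfolding B'_def by (rule AE_distrD[OF snd]) (simp only: dsnd B_0)
    show "continuous_on {0..T} (\<lambda>t. B' t \<omega>)" if "\<omega> \<in> space N" for \<omega>
      unfolding B'_def using that by (intro B_cont) (auto simp: N_def space_pair_measure)
    show "B' t \<in> borel_measurable (G t)" if "t \<in> {0..T}" for t
      unfolding B'_def G_def by (rule measurable_compose[OF measurable_snd B_F]) (use that in auto)
    fix s t assume st: "0 \<le> s \<and> s < t \<and> t \<le> T"
    define X where "X \<omega> = B t \<omega> - B s \<omega>" for \<omega>
    have X: "distributed M lborel X (normal_density 0 (sqrt (t - s)))"
      unfolding X_def using st by (intro increment_distributed) auto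
    have Xm: "X \<in> measurable M lborel" using X by (simp add: distributed_def)
    have BX: "(\<lambda>\<omega>. B' t \<omega> - B' s \<omega>) = (\<lambda>\<omega>. X (snd \<omega>))" by (simp add: B'_def X_def)
    have "distr N lborel (\<lambda>\<omega>. X (snd \<omega>)) = distr (distr N M snd) lborel X"
      by (subst distr_distr[OF Xm snd]) (simp add: comp_def)
    then show "distributed N lborel (\<lambda>\<omega>. B' t \<omega> - B' s \<omega>) (normal_density 0 (sqrt (t - s)))"
      using X measurable_compose[OF snd Xm] unfolding distributed_def BX dsnd by simp
    have XI: "prob (A \<inter> (X -` C \<inter> space M)) = prob A * prob (X -` C \<inter> space M)"
      if A: "A \<in> sets (F s)" and C: "C \<in> sets borel" for A C
    proof -
      have "indep_set (sets (F s)) (sets (vimage_algebra (space M) X borel))"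
        using bm st by (simp add: brownian_motion_def X_def[abs_def])
      moreover have "X -` C \<inter> space M \<in> sets (vimage_algebra (space M) X borel)"
        unfolding sets_vimage_algebra using C by (intro sigma_sets.Basic) blast
      ultimately show ?thesis using A unfolding indep_sets2_eq by blast
    qed
    have XC: "X -` C \<inter> space M \<in> sets M" if "C \<in> sets borel" for C
      using measurable_sets[OF Xm, of C] that by simp
    have "N.indep_set (sigma_sets (space N) {A \<times> A' | A A'. A \<in> sets (F s) \<and> A' \<in> sets (F s)})
      (sigma_sets (space N) {(\<lambda>\<omega>. X (snd \<omega>)) -` C \<inter> space N | C. C \<in> sets borel})"
    proof (rule N.indep_set_sigma_sets)
      show "Int_stable {A \<times> A' | A A'. A \<in> sets (F s) \<and> A' \<in> sets (F s)}"
        by (rule Int_stable_pair_measure_generator)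
      show "Int_stable {(\<lambda>\<omega>. X (snd \<omega>)) -` C \<inter> space N | C. C \<in> sets borel}"
      proof (rule Int_stableI)
        fix a b assume "a \<in> {(\<lambda>\<omega>. X (snd \<omega>)) -` C \<inter> space N | C. C \<in> sets borel}"
          "b \<in> {(\<lambda>\<omega>. X (snd \<omega>)) -` C \<inter> space N | C. C \<in> sets borel}"
        then obtain C D where "C \<in> sets borel" "D \<in> sets borel" "a = (\<lambda>\<omega>. X (snd \<omega>)) -` C \<inter> space N"
          "b = (\<lambda>\<omega>. X (snd \<omega>)) -` D \<inter> space N" by blast
        then have "a \<inter> b = (\<lambda>\<omega>. X (snd \<omega>)) -` (C \<inter> D) \<inter> space N" "C \<inter> D \<in> sets borel" by auto
        then show "a \<inter> b \<in> {(\<lambda>\<omega>. X (snd \<omega>)) -` C \<inter> space N | C. C \<in> sets borel}" by blast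
      qed
      have eq: "(\<lambda>\<omega>. X (snd \<omega>)) -` C \<inter> space N = space M \<times> (X -` C \<inter> space M)" for C
        by (auto simp: N_def space_pair_measure)
      show "N.indep_set {A \<times> A' | A A'. A \<in> sets (F s) \<and> A' \<in> sets (F s)} {(\<lambda>\<omega>. X (snd \<omega>)) -` C \<inter> space N | C. C \<in> sets borel}"
        unfolding N.indep_sets2_eq
      proof (intro conjI ballI subsetI)
        show "a \<in> sets N" if "a \<in> {A \<times> A' | A A'. A \<in> sets (F s) \<and> A' \<in> sets (F s)}" for a
          using that sets_F unfolding N_def by blast
        show "a \<in> sets N" if "a \<in> {(\<lambda>\<omega>. X (snd \<omega>)) -` C \<inter> space N | C. C \<in> sets borel}" for a
        proof -
          from that obtain C where "a = (\<lambda>\<omega>. X (snd \<omega>)) -` C \<inter> space N" "C \<in> sets borel"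
            unfolding mem_Collect_eq by (elim exE conjE)
          then show ?thesis using XC unfolding eq by (simp add: N_def)
        qed
        fix a b assume "a \<in> {A \<times> A' | A A'. A \<in> sets (F s) \<and> A' \<in> sets (F s)}"
          "b \<in> {(\<lambda>\<omega>. X (snd \<omega>)) -` C \<inter> space N | C. C \<in> sets borel}"
        then obtain A A' C where a: "a = A \<times> A'" and A: "A \<in> sets (F s)" "A' \<in> sets (F s)"
          and b: "b = (\<lambda>\<omega>. X (snd \<omega>)) -` C \<inter> space N" and C: "C \<in> sets borel"
          unfolding mem_Collect_eq by (elim exE conjE)
        note ab = a b[unfolded eq]
        have AM: "A \<in> sets M" "A' \<in> sets M" using A sets_F by auto
        have Np: "N.prob (D \<times> D') = prob D * prob D'" if "D \<in> sets M" "D' \<in> sets M" for D D'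
          unfolding N_def using emeasure_pair_measure_Times[OF that]
          by (simp add: measure_def enn2real_mult)
        have "a \<inter> b = A \<times> (A' \<inter> (X -` C \<inter> space M))" using sets.sets_into_space[OF AM(1)] by (auto simp: ab)
        then have "N.prob (a \<inter> b) = prob A * prob (A' \<inter> (X -` C \<inter> space M))"
          using AM XC[OF C] by (simp add: Np)
        also have "\<dots> = N.prob a * N.prob b"
          using AM XC[OF C] by (simp add: Np ab XI A C prob_space)
        finally show "N.prob (a \<inter> b) = N.prob a * N.prob b" .
      qed
    qed
    moreover have "sets (G s) = sigma_sets (space N) {A \<times> A' | A A'. A \<in> sets (F s) \<and> A' \<in> sets (F s)}"
      by (simp add: G_def N_def sets_pair_measure space_F space_pair_measure)
    ultimately show "N.indep_set (sets (G s)) (sets (vimage_algebra (space N) (\<lambda>\<omega>. B' t \<omega> - B' s \<omega>) borel))"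
      by (simp add: sets_vimage_algebra BX)
  qed
  let ?L = "Pi\<^sub>M {0..T} (\<lambda>_. borel :: real measure)"
  define X where "X \<omega> = (\<lambda>t\<in>{0..T}. B t \<omega>)" for \<omega>
  have X: "X \<in> measurable M ?L"
    unfolding X_def by (intro measurable_restrict B_M) auto
  have Xd: "prob_space (distr M ?L X)" by (rule prob_space_distr[OF X])
  then have sf: "sigma_finite_measure (distr M ?L X)" by (rule prob_space_imp_sigma_finite)
  have "N.indep_var ?L (\<lambda>\<omega>. X (fst \<omega>)) ?L (\<lambda>\<omega>. X (snd \<omega>))"
    unfolding N.indep_var_distribution_eq
  proof (intro conjI)
    show "(\<lambda>\<omega>. X (fst \<omega>)) \<in> measurable N ?L" "(\<lambda>\<omega>. X (snd \<omega>)) \<in> measurable N ?L"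
      by (rule measurable_compose[OF fst X], rule measurable_compose[OF snd X])
    have "distr N ?L (\<lambda>\<omega>. X (fst \<omega>)) = distr (distr N M fst) ?L X" by (subst distr_distr[OF X fst]) (simp add: comp_def)
    moreover have "distr N ?L (\<lambda>\<omega>. X (snd \<omega>)) = distr (distr N M snd) ?L X" by (subst distr_distr[OF X snd]) (simp add: comp_def)
    moreover have "distr M ?L X \<Otimes>\<^sub>M distr M ?L X = distr N (?L \<Otimes>\<^sub>M ?L) (\<lambda>\<omega>. (X (fst \<omega>), X (snd \<omega>)))"
      using pair_measure_distr[OF X X sf] by (simp only: N_def case_prod_beta')
    ultimately show "distr N ?L (\<lambda>\<omega>. X (fst \<omega>)) \<Otimes>\<^sub>M distr N ?L (\<lambda>\<omega>. X (snd \<omega>)) = distr N (?L \<Otimes>\<^sub>M ?L) (\<lambda>\<omega>. (X (fst \<omega>), X (snd \<omega>)))"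
      by (simp add: dfst dsnd)
  qed
  then show "independent_processes N T (\<lambda>t \<omega>. B t (fst \<omega>)) B'"
    by (simp add: independent_processes_def X_def B'_def)
qed

lemma limit_data_exists:
  assumes "F = brownian_filtration M T B"
  shows "\<exists>(N::('a \<times> 'a) measure) G \<pi> Y I. limit_data M T B (stock S0 r \<sigma> B) N G \<pi> Y I"
proof -
  define N where "N = M \<Otimes>\<^sub>M M"
  define G where "G = (\<lambda>t. F t \<Otimes>\<^sub>M F t)"
  define Y where "Y = (\<lambda>t (\<omega>::'a \<times> 'a). B t (snd \<omega>))"
  note ext = product_extension[folded N_def G_def Y_def]
  interpret N: brownian N G T Y using ext(2) T_pos by unfold_locales
  have fst: "fst \<in> measurable N M" and dfst: "distr N M fst = M"
    and fstG: "\<And>t. 0 \<le> t \<Longrightarrow> fst \<in> measurable (G t) (F t)" using ext(1) by (auto simp: basis_extension_def)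
  let ?H = "\<lambda>t \<omega>. stock S0 r \<sigma> B t (fst \<omega>)"
  have cont: "continuous_on {0..T} (\<lambda>t. ?H t \<omega>)" if "\<omega> \<in> space N" for \<omega>
    by (rule stock_cont) (rule measurable_space[OF fst that])
  have jm: "(\<lambda>(t, \<omega>). ?H t \<omega>) \<in> borel_measurable (time_product N T)"
    by (rule continuous_paths_jointly_measurable[OF T_pos _ cont])
      (auto intro: measurable_compose[OF fst stock_M])
  have jM: "(\<lambda>(t, \<omega>). stock S0 r \<sigma> B t \<omega>) \<in> borel_measurable (time_product M T)"
    by (rule continuous_paths_jointly_measurable[OF T_pos stock_M stock_cont]) auto
  have "sq_norm N T ?H = sq_norm (distr N M fst) T (stock S0 r \<sigma> B)"
    unfolding sq_norm_def by (subst nn_integral_distr[OF fst]) (use sq_norm_inner(1)[OF jM] in simp_all)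
  then have "sq_norm N T ?H < \<infinity>" using stock_sq_norm_finite by (simp add: dfst)
  then obtain I where "ito_integral N G T Y ?H I"
    using N.ito_integral_exists[OF jm _ _ cont] measurable_compose[OF fstG stock_F] by force
  then have "limit_data M T B (stock S0 r \<sigma> B) N G fst Y I"
    unfolding limit_data_def using ext assms by simp
  then show ?thesis by blast
qed

end

theorem theorem4p1:
  fixes M :: "'a measure" and W S J :: "real \<Rightarrow> 'a \<Rightarrow> real"
    and Jn :: "nat \<Rightarrow> real \<Rightarrow> 'a \<Rightarrow> real" and T S0 r \<sigma> :: real
  assumes "0 < T" and "0 < \<sigma>"
    and "brownian_motion M (brownian_filtration M T W) T W"
    and "sets M = sets (brownian_filtration M T W T)"
    and "S = stock S0 r \<sigma> W"
    and "J = average T S"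
    and "Jn = trapezoidal_average T r \<sigma> W S"
  shows "(\<exists>(N :: ('a \<times> 'a) measure) G \<pi> B I. limit_data M T W S N G \<pi> B I) \<and>
    (\<forall>(N :: 'b measure) G \<pi> B I. limit_data M T W S N G \<pi> B I \<longrightarrow>
       converges_stably M N \<pi> (skorokhod_topology T)
         (\<lambda>n \<omega>. \<lambda>t\<in>{0..T}. grid_sampled T n (\<lambda>t \<omega>. real n * (J t \<omega> - Jn n t \<omega>)) t \<omega>)
         (\<lambda>\<omega>. \<lambda>t\<in>{0..T}. \<sigma> / (2 * sqrt 3) * I t \<omega>))"
proof (intro conjI allI impI)
  interpret W: brownian M "brownian_filtration M T W" T W using assms by unfold_locales
  show "\<exists>(N :: ('a \<times> 'a) measure) G \<pi> B I. limit_data M T W S N G \<pi> B I"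
    unfolding assms(5) by (rule W.limit_data_exists[OF refl])
  fix N :: "'b measure" and G \<pi> B I
  assume L: "limit_data M T W S N G \<pi> B I"
  interpret stock_limit M "brownian_filtration M T W" T W N G B \<pi> I S0 r \<sigma>
    using L assms by unfold_locales (auto simp: limit_data_def basis_extension_def)
  have "(\<lambda>t\<in>{0..T}. grid_sampled T n (\<lambda>t \<omega>. real n * (J t \<omega> - Jn n t \<omega>)) t \<omega>) = error_path n \<omega>" for n \<omega>
  proof
    fix t
    have "of_int \<lfloor>t / (T / real n)\<rfloor> * (T / real n) = grid_point T n (grid_index T n t)" if "0 \<le> t"
      using grid_point_index[OF assms(1) that, of n] by simp
    then show "(\<lambda>t\<in>{0..T}. grid_sampled T n (\<lambda>t \<omega>. real n * (J t \<omega> - Jn n t \<omega>)) t \<omega>) t = error_path n \<omega> t"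
      by (simp add: restrict_def grid_sampled_def Let_def error_path_def step_path_def error_at_def assms(5-7))
  qed
  then show "converges_stably M N \<pi> (skorokhod_topology T)
         (\<lambda>n \<omega>. \<lambda>t\<in>{0..T}. grid_sampled T n (\<lambda>t \<omega>. real n * (J t \<omega> - Jn n t \<omega>)) t \<omega>)
         (\<lambda>\<omega>. \<lambda>t\<in>{0..T}. \<sigma> / (2 * sqrt 3) * I t \<omega>)"
    using error_path_converges_stably[OF assms(4)] by (simp only: limit_path_def[abs_def])
qed

end
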